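(* Let $I\subset\mathbb{R}$ be an interval and let $\mathbb{B}(x;\lambda)$, $x\in(0,1)$, $\lambda\in I$, satisfy Assumptions (A) (stated in the context). Let $\alpha,\beta\in\mathbb{C}^{n\times 2n}$ satisfy $\operatorname{rank}\alpha=\operatorname{rank}\beta=n$, $\alpha J\alpha^*=0$, $\beta J\beta^*=0$. Fix $\lambda_1,\lambda_2\in I$, $\lambda_1<\lambda_2$. Let $\mathbf{X}_1(x;\lambda)\in\mathbb{C}^{2n\times n}$ be the solution of $J\mathbf{X}_1'=\mathbb{B}(x;\lambda)\mathbf{X}_1$, $\mathbf{X}_1(0;\lambda)=J\alpha^*$, and let $\mathbf{X}_2(x;\lambda_2)\in\mathbb{C}^{2n\times n}$ be the solution of $J\mathbf{X}_2'=\mathbb{B}(x;\lambda_2)\mathbf{X}_2$, $\mathbf{X}_2(1;\lambda_2)=J\beta^*$. Let $\ell_1(x;\lambda)$ and $\ell_2(x;\lambda_2)$ denote the Lagrangian subspaces of $\mathbb{C}^{2n}$ with respective frames $\mathbf{X}_1(x;\lambda)$ and $\mathbf{X}_2(x;\lambda_2)$. Assume that for any $\lambda\in I$ the matrix $\int_0^1\mathbf{X}_1(x;\lambda)^*\,\mathbb{B}_\lambda(x;\lambda)\,\mathbf{X}_1(x;\lambda)\,dx$ is positive definite. Let $\mathcal{N}([\lambda_1,\lambda_2))$ be the spectral count (number of eigenvalues in $[\lambda_1,\lambda_2)$, counted with geometric multiplicity) of $Jy'=\mathbb{B}(x;\lambda)y$ with boundary conditions $\alpha y(0;\lambda)=0$,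 $\beta y(1;\lambda)=0$. Then $$\mathcal{N}([\lambda_1,\lambda_2))=\operatorname{Mas}(\ell_1(\cdot;\lambda_1),\ell_2(\cdot;\lambda_2);[0,1]).$$ Moreover, suppose additionally that $\mathbb{B}(x;\lambda_2)-\mathbb{B}(x;\lambda_1)$ is non-negative for a.e. $x\in(0,1)$, and that there is no interval $[a,b]\subset[0,1]$, $a<b$, such that $\dim(\ell_1(x;\lambda_1)\cap\ell_2(x;\lambda_2))\ne 0$ for all $x\in[a,b]$. Then $$\mathcal{N}([\lambda_1,\lambda_2))=\sum_{x\in(0,1]}\dim\ker\big(\mathbf{X}_1(x;\lambda_1)^*J\,\mathbf{X}_2(x;\lambda_2)\big).$$
   Context: $n\in\{1,2,\dots\}$, $J=\begin{pmatrix}0_n&-I_n\\ I_n&0_n\end{pmatrix}$, and $*$ denotes adjoint (conjugate transpose). The system is $Jy'=\mathbb{B}(x;\lambda)y$, $x\in(0,1)$, $y(x;\lambda)\in\mathbb{C}^{2n}$; solutions are absolutely continuous on $[0,1]$ and satisfy the equation a.e. "Non-negative" means positive semidefinite. $\mathbb{B}_\lambda=\partial_\lambda\mathbb{B}$. Assumptions (A): for each $\lambda\in I$, $\mathbb{B}(x;\lambda)\in\mathbb{C}^{2n\times2n}$ is a measurable function of $x$, self-adjoint for a.e. $x\in(0,1)$, and there is $b_0\in L^1((0,1),\mathbb{R})$ such that for each $\lambda\in I$, $\|\mathbb{B}(x;\lambda)\|\le b_0(x)$ for a.e. $x\in(0,1)$; moreover $\mathbb{B}$ is differentiable in $\lambda$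 and there is $b_1\in L^1((0,1),\mathbb{R})$ such that for each $\lambda\in I$, $\|\mathbb{B}_\lambda(x;\lambda)\|\le b_1(x)$ for a.e. $x\in(0,1)$. Eigenvalues and spectral count: $\lambda\in I$ is an eigenvalue if there is a nonzero $y(\cdot;\lambda)\in AC([0,1],\mathbb{C}^{2n})$ solving the system and the boundary conditions. $\mathbb{E}(\lambda)$ is the linear space of all such solutions (together with $0$), and $\mathcal{N}([\lambda_1,\lambda_2))=\sum_{\lambda\in[\lambda_1,\lambda_2)}\dim\mathbb{E}(\lambda)$. Lagrangian subspaces: $\ell\subset\mathbb{C}^{2n}$ is Lagrangian if $\dim\ell=n$ and $(Ju,v)=0$ for all $u,v\in\ell$; $\Lambda(n)$ is the set of all Lagrangian subspaces, with metric $d(\ell,\ell')=\|\mathcal{P}-\mathcal{P}'\|$, where $\mathcal{P},\mathcal{P}'$ are the orthogonal projections onto $\ell,\ell'$. A frame for $\ell$ is a $2n\times n$ matrix $\mathbf{X}=\binom{X}{Y}$ ($X,Y\in\mathbb{C}^{n\times n}$) whose columns form a basis of $\ell$. (The matrices $\mathbf{X}_1(x;\lambda)$, $\mathbf{X}_2(x;\lambda_2)$ in the claim are frames for Lagrangian subspaces for every $x\in[0,1]$.) Maslov index: let $\ell_1,\ell_2:[a,b]\to\Lambda(n)$ be continuous with frames $\binom{X_i(t)}{Y_i(t)}$, and set $$\tilde W(t)=-(X_1+iY_1)(X_1-iY_1)^{-1}(X_2-iY_2)(X_2+iY_2)^{-1},$$ a continuous path of unitary $n\times n$ matrices. Choose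 a partition $a=t_0<t_1<\dots<t_N=b$ and numbers $\epsilon_j\in(0,\pi)$, $j=1,\dots,N$, so that $e^{i(\pi\pm\epsilon_j)}\notin\sigma(\tilde W(t))$ for $t_{j-1}\le t\le t_j$. Put $k(t,\epsilon_j)=\sum_{0\le\theta<\epsilon_j}\dim\ker(\tilde W(t)-e^{i(\pi+\theta)}I)$. Then $\operatorname{Mas}(\ell_1,\ell_2;[a,b])=\sum_{j=1}^N\big(k(t_j,\epsilon_j)-k(t_{j-1},\epsilon_j)\big)$, which does not depend on the choices made. *)

theory Defs
  imports "HOL-Analysis.Analysis" "HOL-Library.Function_Algebras"
begin

text \<open>
  The space of complex vectors of size \<open>2n\<close> is \<open>complex ^ ('n + 'n)\<close>: the index
  \<open>Inl i\<close> addresses the upper and \<open>Inr i\<close> the lower block of size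
  \<open>n = CARD('n) \<ge> 1\<close>.
\<close>

definition cinner :: "complex ^ 'm \<Rightarrow> complex ^ 'm \<Rightarrow> complex" where
  "cinner u v = (\<Sum>i\<in>UNIV. u $ i * cnj (v $ i))"

definition adj :: "complex ^ 'k ^ 'm \<Rightarrow> complex ^ 'm ^ 'k" where
  "adj A = (\<chi> i j. cnj (A $ j $ i))"

definition mker :: "complex ^ 'k ^ 'm \<Rightarrow> (complex ^ 'k) set" where
  "mker A = {v. A *v v = 0}"

definition mspectrum :: "complex ^ 'm ^ 'm \<Rightarrow> complex set" where
  "mspectrum A = {z. \<exists>v. v \<noteq> 0 \<and> A *v v = z *s v}"

definition nonneg_mat :: "complex ^ 'm ^ 'm \<Rightarrow> bool" where
  "nonneg_mat A \<longleftrightarrow> adj A = A \<and> (\<forall>v. 0 \<le> Re (cinner (A *v v) v))"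

definition posdef_mat :: "complex ^ 'm ^ 'm \<Rightarrow> bool" where
  "posdef_mat A \<longleftrightarrow> adj A = A \<and> (\<forall>v. v \<noteq> 0 \<longrightarrow> 0 < Re (cinner (A *v v) v))"

definition Jmat :: "complex ^ ('n::finite + 'n) ^ ('n + 'n)" where
  "Jmat = (\<chi> r c. case (r, c) of
      (Inl i, Inr j) \<Rightarrow> (if i = j then -1 else 0)
    | (Inr i, Inl j) \<Rightarrow> (if i = j then 1 else 0)
    | _ \<Rightarrow> 0)"


subsection \<open>The differential system\<close>

definition abs_continuous_on :: "real \<Rightarrow> real \<Rightarrow> (real \<Rightarrow> 'b::real_normed_vector) \<Rightarrow> bool" where
  "abs_continuous_on a b f \<longleftrightarrow>
    (\<forall>\<epsilon>>0. \<exists>\<delta>>0. \<forall>(N::nat) c d.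
       (\<forall>i<N. a \<le> c i \<and> c i \<le> d i \<and> d i \<le> b) \<longrightarrow>
       disjoint_family_on (\<lambda>i. {c i<..<d i}) {..<N} \<longrightarrow>
       (\<Sum>i<N. d i - c i) < \<delta> \<longrightarrow>
       (\<Sum>i<N. norm (f (d i) - f (c i))) < \<epsilon>)"

abbreviation leb01 :: "real measure" where
  "leb01 \<equiv> lebesgue_on {0<..<1}"

definition lam_deriv ::
  "real set \<Rightarrow> (real \<Rightarrow> real \<Rightarrow> complex ^ 'm ^ 'm) \<Rightarrow> real \<Rightarrow> real \<Rightarrow> complex ^ 'm ^ 'm" where
  "lam_deriv I B x \<mu> = vector_derivative (B x) (at \<mu> within I)"

text \<open>
  The spectral parameter is called \<open>\<mu>\<close>.  The operator norm of a matrix \<open>A\<close> is \<^term>\<open>onorm ((*v) A)\<close>.  At an endpoint belonging to \<open>I\<close>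
  the derivative in \<open>\<mu>\<close> is one-sided.  The null set off which \<open>B x\<close> is differentiable does not
  depend on \<open>\<mu>\<close>; the null sets in all other conditions may depend on \<open>\<mu>\<close>.
\<close>

definition assumptions_A ::
  "real set \<Rightarrow> (real \<Rightarrow> real \<Rightarrow> complex ^ 'm ^ 'm) \<Rightarrow> bool" where
  "assumptions_A I B \<longleftrightarrow>
    (\<forall>\<mu>\<in>I. (\<lambda>x. B x \<mu>) \<in> borel_measurable leb01) \<and>
    (\<forall>\<mu>\<in>I. AE x in leb01. adj (B x \<mu>) = B x \<mu>) \<and>
    (\<exists>b0. integrable leb01 b0 \<and> (\<forall>\<mu>\<in>I. AE x in leb01. onorm ((*v) (B x \<mu>)) \<le> b0 x)) \<and>
    (AE x in leb01. \<forall>\<mu>\<in>I. B x differentiable (at \<mu> within I)) \<and>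
    (\<exists>b1. integrable leb01 b1 \<and>
       (\<forall>\<mu>\<in>I. AE x in leb01. onorm ((*v) (lam_deriv I B x \<mu>)) \<le> b1 x))"

definition solves_system ::
  "(real \<Rightarrow> complex ^ ('n::finite + 'n) ^ ('n + 'n)) \<Rightarrow> (real \<Rightarrow> complex ^ ('n + 'n)) \<Rightarrow> bool" where
  "solves_system A y \<longleftrightarrow> abs_continuous_on 0 1 y \<and>
    (AE x in leb01. \<exists>y'. (y has_vector_derivative y') (at x) \<and> Jmat *v y' = A x *v y x)"

definition solves_matrix_system ::
  "(real \<Rightarrow> complex ^ ('n::finite + 'n) ^ ('n + 'n)) \<Rightarrow> (real \<Rightarrow> complex ^ 'n ^ ('n + 'n)) \<Rightarrow> bool" where
  "solves_matrix_system A X \<longleftrightarrow> abs_continuous_on 0 1 X \<and>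
    (AE x in leb01. \<exists>X'. (X has_vector_derivative X') (at x) \<and> Jmat ** X' = A x ** X x)"


subsection \<open>Eigenvalues and spectral count\<close>

text \<open>
  A function on \<open>[0,1]\<close> is represented by its extension by zero to all reals, so that distinct
  elements of the eigenspace are distinct functions on \<open>[0,1]\<close> and its dimension is the right one.
\<close>

definition eigenspace ::
  "(real \<Rightarrow> real \<Rightarrow> complex ^ ('n::finite + 'n) ^ ('n + 'n)) \<Rightarrow> complex ^ ('n + 'n) ^ 'n \<Rightarrow>
   complex ^ ('n + 'n) ^ 'n \<Rightarrow> real \<Rightarrow> (real \<Rightarrow> complex ^ ('n + 'n)) set" where
  "eigenspace B \<alpha> \<beta> \<mu> =
    {y. (\<forall>x. x \<notin> {0..1} \<longrightarrow> y x = 0) \<and> solves_system (\<lambda>x. B x \<mu>) y \<and> \<alpha> *v y 0 = 0 \<and> \<beta> *v y 1 = 0}"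

definition fscale :: "complex \<Rightarrow> (real \<Rightarrow> complex ^ 'm) \<Rightarrow> real \<Rightarrow> complex ^ 'm" where
  "fscale c f = (\<lambda>x. c *s f x)"

lemma vector_space_fscale: "vector_space fscale"
  by unfold_locales
    (auto simp: fscale_def fun_eq_iff vec_eq_iff plus_fun_def distrib_left distrib_right)

definition eigenvalues_in ::
  "real set \<Rightarrow> (real \<Rightarrow> real \<Rightarrow> complex ^ ('n::finite + 'n) ^ ('n + 'n)) \<Rightarrow> complex ^ ('n + 'n) ^ 'n \<Rightarrow>
   complex ^ ('n + 'n) ^ 'n \<Rightarrow> real set" where
  "eigenvalues_in S B \<alpha> \<beta> = {\<mu>\<in>S. \<exists>y\<in>eigenspace B \<alpha> \<beta> \<mu>. y \<noteq> 0}"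

text \<open>
  All terms of the sum over \<open>[\<mu>1, \<mu>2)\<close> that are omitted here vanish.  The value is meaningful only
  if the index set is finite, so finiteness has to be stated along with it.
\<close>

definition spectral_count ::
  "real \<Rightarrow> real \<Rightarrow> (real \<Rightarrow> real \<Rightarrow> complex ^ ('n::finite + 'n) ^ ('n + 'n)) \<Rightarrow> complex ^ ('n + 'n) ^ 'n \<Rightarrow>
   complex ^ ('n + 'n) ^ 'n \<Rightarrow> nat" where
  "spectral_count \<mu>1 \<mu>2 B \<alpha> \<beta> =
    (\<Sum>\<mu>\<in>eigenvalues_in {\<mu>1..<\<mu>2} B \<alpha> \<beta>. vector_space.dim fscale (eigenspace B \<alpha> \<beta> \<mu>))"


subsection \<open>Lagrangian subspaces\<close>

definition lagrangian :: "(complex ^ ('n::finite + 'n)) set \<Rightarrow> bool" where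
  "lagrangian L \<longleftrightarrow> vec.subspace L \<and> vec.dim L = CARD('n) \<and>
    (\<forall>u\<in>L. \<forall>v\<in>L. cinner (Jmat *v u) v = 0)"

definition orth_proj :: "(complex ^ 'm) set \<Rightarrow> complex ^ 'm \<Rightarrow> complex ^ 'm" where
  "orth_proj L v = (THE p. p \<in> L \<and> (\<forall>w\<in>L. cinner (v - p) w = 0))"

definition lag_dist :: "(complex ^ ('n::finite + 'n)) set \<Rightarrow> (complex ^ ('n + 'n)) set \<Rightarrow> real" where
  "lag_dist L L' = onorm (\<lambda>v. orth_proj L v - orth_proj L' v)"

definition lagrangian_path ::
  "real \<Rightarrow> real \<Rightarrow> (real \<Rightarrow> (complex ^ ('n::finite + 'n)) set) \<Rightarrow> bool" where
  "lagrangian_path a b L \<longleftrightarrow> (\<forall>t\<in>{a..b}. lagrangian (L t)) \<and>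
    (\<forall>t\<in>{a..b}. ((\<lambda>s. lag_dist (L s) (L t)) \<longlongrightarrow> 0) (at t within {a..b}))"

definition colspace :: "complex ^ 'k ^ 'm \<Rightarrow> (complex ^ 'm) set" where
  "colspace F = vec.span (columns F)"

text \<open>The rank condition says that the columns are linearly independent.\<close>

definition is_frame :: "complex ^ 'n ^ ('n::finite + 'n) \<Rightarrow> (complex ^ ('n + 'n)) set \<Rightarrow> bool" where
  "is_frame F L \<longleftrightarrow> colspace F = L \<and> rank F = CARD('n)"


subsection \<open>The Maslov index\<close>

text \<open>The combinations \<open>X + z Y\<close> of the two square blocks of a frame, used with \<open>z = \<plusminus>i\<close>.\<close>

definition frame_comb :: "complex \<Rightarrow> complex ^ 'n ^ ('n::finite + 'n) \<Rightarrow> complex ^ 'n ^ 'n" where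
  "frame_comb z F = (\<chi> i j. F $ Inl i $ j + z * F $ Inr i $ j)"

definition Wtilde ::
  "complex ^ 'n ^ ('n::finite + 'n) \<Rightarrow> complex ^ 'n ^ ('n + 'n) \<Rightarrow> complex ^ 'n ^ 'n" where
  "Wtilde F1 F2 = - (frame_comb \<i> F1 ** matrix_inv (frame_comb (-\<i>) F1)
                      ** frame_comb (-\<i>) F2 ** matrix_inv (frame_comb \<i> F2))"

text \<open>The sum runs over the finitely many angles whose term is nonzero.\<close>

definition kcount :: "complex ^ 'n ^ 'n \<Rightarrow> real \<Rightarrow> nat" where
  "kcount W \<epsilon> = (\<Sum>\<theta>\<in>{\<theta>. 0 \<le> \<theta> \<and> \<theta> < \<epsilon> \<and> cis (pi + \<theta>) \<in> mspectrum W}.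
                    vec.dim (mker (W - mat (cis (pi + \<theta>)))))"

text \<open>
  \<open>has_maslov_index L1 L2 a b m\<close>: some admissible choice of frames, partition and angles yields the
  value \<open>m\<close>.  The index \<open>j\<close> of the subintervals is shifted by one: \<open>\<epsilon> j\<close> belongs to
  \<open>[p j, p (Suc j)]\<close>.
\<close>

definition has_maslov_index ::
  "(real \<Rightarrow> (complex ^ ('n::finite + 'n)) set) \<Rightarrow> (real \<Rightarrow> (complex ^ ('n + 'n)) set) \<Rightarrow>
   real \<Rightarrow> real \<Rightarrow> int \<Rightarrow> bool" where
  "has_maslov_index L1 L2 a b m \<longleftrightarrow>
    lagrangian_path a b L1 \<and> lagrangian_path a b L2 \<and>
    (\<exists>F1 F2 (N::nat) p \<epsilon>.
       (\<forall>t\<in>{a..b}. is_frame (F1 t) (L1 t) \<and> is_frame (F2 t) (L2 t)) \<and>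
       p 0 = a \<and> p N = b \<and> (\<forall>j<N. p j < p (Suc j)) \<and>
       (\<forall>j<N. 0 < \<epsilon> j \<and> \<epsilon> j < pi \<and>
          (\<forall>t\<in>{p j..p (Suc j)}. cis (pi + \<epsilon> j) \<notin> mspectrum (Wtilde (F1 t) (F2 t)) \<and>
                                 cis (pi - \<epsilon> j) \<notin> mspectrum (Wtilde (F1 t) (F2 t)))) \<and>
       m = (\<Sum>j<N. int (kcount (Wtilde (F1 (p (Suc j))) (F2 (p (Suc j)))) (\<epsilon> j))
                  - int (kcount (Wtilde (F1 (p j)) (F2 (p j))) (\<epsilon> j))))"

definition Mas ::
  "(real \<Rightarrow> (complex ^ ('n::finite + 'n)) set) \<Rightarrow> (real \<Rightarrow> (complex ^ ('n + 'n)) set) \<Rightarrow>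
   real \<Rightarrow> real \<Rightarrow> int" where
  "Mas L1 L2 a b = (THE m. has_maslov_index L1 L2 a b m)"

end

theory Submission
  imports Defs
begin

text \<open>
  Two Lagrangian planes meet in a subspace whose dimension is the multiplicity of the eigenvalue \<open>-1\<close>
  of the unitary matrix \<open>Wtilde\<close> of their frames (\<open>crossing_Wtilde\<close>).  Attach to \<open>(x, \<mu>)\<close> in the
  rectangle \<open>[0,1] \<times> [\<mu>1,\<mu>2]\<close> the matrix \<open>W(x, \<mu>)\<close> of the planes of \<open>X1 x \<mu>\<close> and \<open>X2 x\<close>.
  The rectangle is convex, so there is one integer function \<open>m\<close> on it whose increments along every path
  are the spectral flow of \<open>W\<close> through \<open>-1\<close> (\<open>flow_function_exists\<close>): up to the factor \<open>2\<pi>\<close>, it is the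
  difference of a continuous argument of \<open>det (-W)\<close> and the sum of the angles of the eigenvalues of
  \<open>W\<close>, measured in \<open>[0, 2\<pi>)\<close> from \<open>-1\<close>.  The Maslov index of a path is the increment of \<open>m\<close>
  (\<open>Mas_flow\<close>), and the first claim follows by going round the rectangle.

  \<^item> The side \<open>\<mu> = \<mu>1\<close> contributes the Maslov index.
  \<^item> On the side \<open>x = 0\<close> the matrix \<open>W\<close> is constant, because \<open>X1 0 \<mu>\<close> is.
  \<^item> On the side \<open>\<mu> = \<mu>2\<close> both frames solve the same equation, so \<open>X1\<^sup>* J X2\<close> and with it the
    multiplicity of \<open>-1\<close> are constant; an eigenvalue that never leaves \<open>-1\<close> gives no flow
    (\<open>flow_constant\<close>).
  \<^item> On the side \<open>x = 1\<close> the multiplicity of \<open>-1\<close> is the geometric multiplicity of \<open>\<mu>\<close> as an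
    eigenvalue of the boundary value problem (\<open>eigenspace_image\<close>), and every crossing has the same
    direction.  Hence the increment of \<open>m\<close> is the number of eigenvalues; the half-open
    interval \<open>[\<mu>1, \<mu>2)\<close> appears because an eigenvalue of \<open>W\<close> is counted when it arrives at \<open>-1\<close>.

  Directions of crossing are controlled by the Cayley transform of \<open>W\<close> with pole at a point
  \<open>cis (pi + \<epsilon>)\<close> off the spectrum: it is Hermitian, and \<open>gform\<close> is its quadratic form, shifted so that
  its signature counts the eigenvalues of \<open>W\<close> between \<open>-1\<close> and the pole.  By a dimension count, monotonicity
  of the form makes the flow monotone (\<open>index_comparison\<close>, \<open>flow_monotone\<close>), and strict monotonicity
  makes the crossings isolated.  A monotone flow whose crossings are isolated is the sum of their
  multiplicities (\<open>jump_count\<close>).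

  The increment of \<open>gform\<close> under a motion of the first plane \<open>Z\<close> is \<open>4 (J Z c, Z' c')\<close> with nonzero
  coefficient vectors \<open>c\<close> and \<open>c'\<close> (\<open>gform_frames\<close>).  In the direction of \<open>\<mu>\<close> the derivative of
  \<open>X1\<^sup>* J X1\<close> at \<open>x = 1\<close>, with one factor kept fixed, is minus the matrix
  \<open>\<integral> X1\<^sup>* \<partial>\<^sub>\<mu>B X1\<close>, by the Lagrange identity (\<open>symplectic_derivative\<close>); so its positivity
  makes the form strictly decreasing (\<open>gform_decreasing\<close>).  In the direction of \<open>x\<close> both planes move.  Locally
  a symplectic change of coordinates freezes the second one, and then the increment is an integral over
  the form of \<open>B x \<mu>2 - B x \<mu>1\<close> (\<open>space_monotone\<close>).  This gives the second claim, where the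
  hypothesis that the planes do not meet throughout an interval takes the place of strict
  monotonicity.

  Solutions are treated through the integrated equation (\<open>integral_solution\<close>), since the coefficients are
  merely integrable.  The bound on the derivative of \<open>B\<close> turns into a Lipschitz bound in \<open>\<mu>\<close> for almost
  every \<open>x\<close> by Fubini's theorem (\<open>parameter_lipschitz\<close>), which yields joint continuity of \<open>X1\<close>.
\<close>

section \<open>Complex matrices\<close>

lemma Re_cinner: "Re (cinner u v) = u \<bullet> v"
  by (simp add: cinner_def inner_vec_def inner_complex_def)

lemma cinner_self: "cinner v v = complex_of_real (norm v ^ 2)"
proof (rule complex_eqI)
  show "Re (cinner v v) = Re (complex_of_real (norm v ^ 2))"
    by (simp add: Re_cinner power2_norm_eq_inner)
  show "Im (cinner v v) = Im (complex_of_real (norm v ^ 2))"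
    by (simp add: cinner_def)
qed

lemma cinner_add_left: "cinner (u + v) w = cinner u w + cinner v w"
  and cinner_diff_left: "cinner (u - v) w = cinner u w - cinner v w"
  and cinner_add_right: "cinner w (u + v) = cinner w u + cinner w v"
  and cinner_diff_right: "cinner w (u - v) = cinner w u - cinner w v"
  and cinner_scale_left: "cinner (c *s u) w = c * cinner u w"
  and cinner_scale_right: "cinner w (c *s u) = cnj c * cinner w u"
  and cinner_zero_left [simp]: "cinner 0 w = 0"
  and cinner_zero_right [simp]: "cinner w 0 = 0"
  by (simp_all add: cinner_def algebra_simps sum.distrib sum_subtractf sum_distrib_left)

lemmas cinner_simps = cinner_add_left cinner_diff_left cinner_add_right cinner_diff_right
  cinner_scale_left cinner_scale_right

lemma cnj_cinner: "cnj (cinner u v) = cinner v u"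
  by (simp add: cinner_def mult.commute)

lemma cinner_eq_0I:
  assumes "\<And>v. cinner u v = 0" shows "u = 0"
  using assms[of u] by (simp add: cinner_self)

lemma adj_adj [simp]: "adj (adj A) = A"
  by (simp add: adj_def vec_eq_iff)

lemma adj_mult: "adj (A ** B) = adj B ** adj A"
  by (simp add: adj_def vec_eq_iff matrix_matrix_mult_def mult.commute)

lemma adj_add: "adj (A + B) = adj A + adj B"
  and adj_diff: "adj (A - B) = adj A - adj B"
  and adj_minus: "adj (- A) = - adj A"
  and adj_zero [simp]: "adj 0 = 0"
  and adj_scaleR: "adj (r *\<^sub>R A) = r *\<^sub>R adj A"
  by (simp_all add: adj_def vec_eq_iff)

lemma adj_mat [simp]: "adj (mat z :: complex ^ 'm ^ 'm) = mat (cnj z)"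
  by (simp add: adj_def mat_def vec_eq_iff)

lemma cinner_mult_left: "cinner (A *v u) v = cinner u (adj A *v v)"
proof -
  have "cinner (A *v u) v = (\<Sum>i\<in>UNIV. \<Sum>j\<in>UNIV. A $ i $ j * u $ j * cnj (v $ i))"
    by (simp add: cinner_def matrix_vector_mult_def sum_distrib_right)
  also have "\<dots> = (\<Sum>j\<in>UNIV. \<Sum>i\<in>UNIV. A $ i $ j * u $ j * cnj (v $ i))"
    by (rule sum.swap)
  also have "\<dots> = cinner u (adj A *v v)"
    by (simp add: cinner_def matrix_vector_mult_def sum_distrib_left adj_def mult_ac)
  finally show ?thesis .
qed

lemma cinner_mult_right: "cinner u (A *v v) = cinner (adj A *v u) v"
  by (simp add: cinner_mult_left)

lemma inner_adj: "(A *v u) \<bullet> v = u \<bullet> (adj A *v v)" for A :: "complex ^ 'k ^ 'm"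
  by (simp add: Re_cinner[symmetric] cinner_mult_left)

lemma matrix_vector_mult_minus_left: "(- A) *v v = - (A *v v)" for A :: "complex ^ 'k ^ 'm"
  by (simp add: vec_eq_iff matrix_vector_mult_def sum_negf)

lemma matrix_mult_minus_left: "(- A) ** B = - (A ** B)"
  and matrix_mult_minus_right: "A ** (- B) = - (A ** B)" for A :: "complex ^ 'k ^ 'm"
  by (simp_all add: vec_eq_iff matrix_matrix_mult_def sum_negf)

lemma matrix_diff_ldistrib: "A ** (B - C) = A ** B - A ** C"
  and matrix_diff_rdistrib: "(D - E) ** B = D ** B - E ** B" for A :: "complex ^ 'k ^ 'm"
  by (simp_all add: vec_eq_iff matrix_matrix_mult_def sum_subtractf algebra_simps)

lemma mat_vector [simp]: "mat z *v v = z *s v" for v :: "complex ^ 'm"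
  by (simp add: vec_eq_iff matrix_vector_mult_def mat_def if_distrib if_distribR cong: if_cong)

lemma matrix_eqI: "(\<And>v. A *v v = B *v v) \<Longrightarrow> A = B" for A :: "complex ^ 'k ^ 'm"
  by (simp add: matrix_eq)

subsection \<open>Continuity of the matrix operations\<close>

lemma bounded_linear_adj: "bounded_linear (adj :: complex ^ 'k ^ 'm \<Rightarrow> complex ^ 'm ^ 'k)"
  unfolding linear_conv_bounded_linear[symmetric]
  by (rule linearI) (simp_all add: adj_add adj_scaleR)

lemma bounded_bilinear_mm:
  "bounded_bilinear ((**) :: complex ^ 'k ^ 'm \<Rightarrow> complex ^ 'l ^ 'k \<Rightarrow> complex ^ 'l ^ 'm)"
  unfolding bilinear_conv_bounded_bilinear[symmetric] bilinear_def
  by (auto intro!: linearI simp: vec_eq_iff matrix_matrix_mult_def sum.distrib algebra_simps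
      scaleR_sum_right)

lemma bounded_bilinear_mv:
  "bounded_bilinear ((*v) :: complex ^ 'k ^ 'm \<Rightarrow> complex ^ 'k \<Rightarrow> complex ^ 'm)"
  unfolding bilinear_conv_bounded_bilinear[symmetric] bilinear_def
  by (auto intro!: linearI simp: vec_eq_iff matrix_vector_mult_def sum.distrib algebra_simps
      scaleR_sum_right)

lemmas tendsto_adj [tendsto_intros] = bounded_linear.tendsto[OF bounded_linear_adj]
lemmas continuous_on_adj [continuous_intros] = bounded_linear.continuous_on[OF bounded_linear_adj]
lemmas tendsto_mm [tendsto_intros] = bounded_bilinear.tendsto[OF bounded_bilinear_mm]
lemmas continuous_on_mm [continuous_intros] = bounded_bilinear.continuous_on[OF bounded_bilinear_mm]
lemmas tendsto_mv [tendsto_intros] = bounded_bilinear.tendsto[OF bounded_bilinear_mv]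
lemmas continuous_on_mv [continuous_intros] = bounded_bilinear.continuous_on[OF bounded_bilinear_mv]

lemma continuous_on_det:
  fixes A :: "'t::topological_space \<Rightarrow> complex ^ 'm ^ 'm"
  assumes "continuous_on S A"
  shows "continuous_on S (\<lambda>t. det (A t))"
  unfolding det_def by (intro continuous_intros assms)

lemma matrix_inv_mult:
  fixes A :: "complex ^ 'm ^ 'm"
  assumes "invertible A"
  shows "A ** matrix_inv A = mat 1" "matrix_inv A ** A = mat 1"
  using someI_ex[OF assms[unfolded invertible_def]] by (auto simp: matrix_inv_def)

text \<open>Cramer's rule expresses the entries of the inverse as quotients of determinants.\<close>
lemma continuous_on_matrix_inv:
  fixes A :: "'t::topological_space \<Rightarrow> complex ^ 'm ^ 'm"
  assumes A: "continuous_on S A" and inv: "\<And>t. t \<in> S \<Longrightarrow> invertible (A t)"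
  shows "continuous_on S (\<lambda>t. matrix_inv (A t))"
proof -
  define D where "D t k l = (\<chi> i j. if j = k then (axis l 1 :: complex ^ 'm) $ i else A t $ i $ j)" for t k l
  have entry: "matrix_inv (A t) $ k $ l = det (D t k l) / det (A t)" if "t \<in> S" for t k l
  proof -
    have d0: "det (A t) \<noteq> 0" using inv[OF that] by (simp add: invertible_det_nz)
    have "A t *v (matrix_inv (A t) *v axis l 1) = axis l 1"
      by (simp add: matrix_vector_mul_assoc matrix_inv_mult(1)[OF inv[OF that]])
    then have "matrix_inv (A t) *v axis l 1 = (\<chi> k. det (D t k l) / det (A t))"
      unfolding D_def by (subst (asm) cramer[OF d0]) simp
    then have "(matrix_inv (A t) *v axis l 1) $ k = det (D t k l) / det (A t)"
      by simp
    then show ?thesis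
      by (simp add: matrix_vector_mult_def axis_def if_distrib if_distribR cong: if_cong)
  qed
  have Dc: "continuous_on S (\<lambda>t. D t k l)" for k l
    unfolding D_def
  proof (intro continuous_on_vec_lambda)
    fix i j
    show "continuous_on S (\<lambda>t. if j = k then (axis l 1 :: complex ^ 'm) $ i else A t $ i $ j)"
      by (cases "j = k") (auto intro!: continuous_intros A)
  qed
  have "continuous_on S (\<lambda>t. \<chi> k l. det (D t k l) / det (A t))"
    by (intro continuous_on_vec_lambda continuous_on_divide continuous_on_det Dc A)
       (use inv in \<open>auto simp: invertible_det_nz\<close>)
  also have "?this \<longleftrightarrow> ?thesis"
    by (intro continuous_on_cong) (auto simp: vec_eq_iff entry)
  finally show ?thesis .
qed

section \<open>Unitary matrices\<close>

definition unitary :: "complex ^ 'm ^ 'm \<Rightarrow> bool" where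
  "unitary W \<longleftrightarrow> adj W ** W = mat 1"

lemma unitary_right: "unitary W \<Longrightarrow> W ** adj W = mat 1"
  unfolding unitary_def using matrix_left_right_inverse by blast

lemma unitary_adj: "unitary W \<Longrightarrow> unitary (adj W)"
  by (simp add: unitary_def unitary_right)

lemma unitary_cinner: "unitary W \<Longrightarrow> cinner (W *v u) (W *v v) = cinner u v"
  by (simp add: cinner_mult_left unitary_def matrix_vector_mul_assoc)

lemma unitary_norm: "unitary W \<Longrightarrow> norm (W *v u) = norm u"
  using unitary_cinner[of W u u] unfolding cinner_self of_real_eq_iff
  by (simp add: power2_eq_iff_nonneg)

lemma unitary_eigen_adj:
  assumes W: "unitary W" and e: "W *v v = z *s v" and n: "norm z = 1"
  shows "adj W *v v = cnj z *s v"
proof -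
  have "v = adj W *v (z *s v)"
    using W by (simp add: e[symmetric] matrix_vector_mul_assoc unitary_def)
  then have "cnj z *s v = cnj z *s (adj W *v (z *s v))" by simp
  also have "\<dots> = (cnj z * z) *s (adj W *v v)"
    by (simp add: vec.scale)
  also have "cnj z * z = 1" using n by (metis complex_norm_square mult.commute of_real_1 one_power2)
  finally show ?thesis by simp
qed

lemma unitary_eigen_norm:
  assumes W: "unitary W" and e: "W *v v = z *s v" and v: "v \<noteq> 0"
  shows "norm z = 1"
proof -
  have "norm (z *s v) = norm v" using unitary_norm[OF W, of v] e by simp
  moreover have "norm (z *s v) = norm z * norm v"
  proof -
    have "(norm (z *s v))\<^sup>2 = (norm z * norm v)\<^sup>2"
    proof -
      have "complex_of_real ((norm (z *s v))\<^sup>2) = z * cnj z * complex_of_real ((norm v)\<^sup>2)"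
        by (simp only: cinner_self[symmetric] cinner_simps mult_ac)
      also have "\<dots> = complex_of_real ((norm z * norm v)\<^sup>2)"
        by (simp add: complex_norm_square[symmetric] power_mult_distrib)
      finally show ?thesis by (simp only: of_real_eq_iff)
    qed
    then show ?thesis by (simp add: power2_eq_iff_nonneg)
  qed
  ultimately show ?thesis using v by simp
qed

text \<open>
  Fewer than \<open>n\<close> linear equations in \<open>n\<close> unknowns become a square system with a vanishing row, whose
  determinant is zero.
\<close>
lemma zero_row_kernel:
  fixes M :: "complex ^ 'm ^ 'm"
  assumes "\<And>j. M $ k $ j = 0"
  shows "\<exists>v. v \<noteq> 0 \<and> M *v v = 0"
proof (rule ccontr)
  assume "\<not> ?thesis"
  then have "\<exists>B. B ** M = mat 1"
    by (subst matrix_left_invertible_ker) blast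
  then obtain B where "M ** B = mat 1" using matrix_left_right_inverse by blast
  then have "(M ** B) $ k $ k = 1" by (simp add: mat_def)
  then show False using assms by (simp add: matrix_matrix_mult_def)
qed

text \<open>
  The maximiser \<open>v\<close> of \<open>Re (W v, v)\<close> on the unit sphere of \<open>S\<close> satisfies \<open>W v + W\<^sup>* v = 2 c v\<close>,
  hence \<open>(W - r) (W - cnj r) v = 0\<close> with \<open>r\<close> the unimodular number of real part \<open>c\<close>.
\<close>
lemma unitary_eigenvector_in:
  assumes W: "unitary W" and S: "vec.subspace S" and clS: "closed S"
    and inv: "\<And>v. v \<in> S \<Longrightarrow> W *v v \<in> S" "\<And>v. v \<in> S \<Longrightarrow> adj W *v v \<in> S"
    and nz: "w \<in> S" "w \<noteq> 0"
  shows "\<exists>v z. v \<in> S \<and> norm v = 1 \<and> W *v v = z *s v"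
proof -
  have sc: "r *\<^sub>R v = complex_of_real r *s v" for r and v :: "complex ^ 'a"
    by (simp add: vec_eq_iff complex_eq_iff)
  have RS: "r *\<^sub>R v \<in> S" if "v \<in> S" for r v
    unfolding sc using S that by (rule vec.subspace_scale)
  define f where "f v = (W *v v) \<bullet> v" for v
  let ?K = "S \<inter> sphere 0 1"
  have "compact ?K" using clS by (simp add: closed_Int_compact)
  moreover have "?K \<noteq> {}"
    using RS[OF nz(1), of "1 / norm w"] nz(2) by (auto intro!: exI[of _ "(1 / norm w) *\<^sub>R w"])
  moreover have "continuous_on ?K f"
    unfolding f_def by (intro continuous_intros)
  ultimately obtain v where v: "v \<in> S" "norm v = 1" and mx: "\<And>u. u \<in> S \<Longrightarrow> norm u = 1 \<Longrightarrow> f u \<le> f v"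
    using continuous_attains_sup[of ?K f] by (metis IntE IntI mem_sphere_0)
  have vv: "v \<bullet> v = 1" using v by (simp add: dot_square_norm)
  define c where "c = f v"
  have mx': "f u \<le> c * (u \<bullet> u)" if "u \<in> S" for u
  proof (cases "u = 0")
    case False
    have "f ((1 / norm u) *\<^sub>R u) \<le> c"
      unfolding c_def using False RS[OF that] by (intro mx) auto
    moreover have "f ((1 / norm u) *\<^sub>R u) = f u / (u \<bullet> u)"
      by (simp add: f_def bounded_bilinear.scaleR_right[OF bounded_bilinear_mv] dot_square_norm power2_eq_square)
    ultimately show ?thesis using False by (simp add: divide_simps)
  qed (simp add: f_def)
  \<comment> \<open>The gradient at \<open>v\<close> of \<open>f u - c (u, u)\<close>, which has its maximum \<open>0\<close> there.\<close>
  define g where "g = W *v v + adj W *v v - (2 * c) *\<^sub>R v"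
  have gS: "g \<in> S"
    unfolding g_def by (intro vec.subspace_add[OF S] vec.subspace_diff[OF S] inv v RS)
  have "g = 0"
  proof (rule ccontr)
    assume g0: "g \<noteq> 0"
    have key: "t * (g \<bullet> g) \<le> t\<^sup>2 * (c * (g \<bullet> g) - f g)" for t :: real
    proof -
      have "v + t *\<^sub>R g \<in> S" by (intro vec.subspace_add[OF S] v RS gS)
      from mx'[OF this] have le: "f (v + t *\<^sub>R g) \<le> c * ((v + t *\<^sub>R g) \<bullet> (v + t *\<^sub>R g))" .
      have e1: "f (v + t *\<^sub>R g) = c + t * ((W *v v) \<bullet> g + (adj W *v v) \<bullet> g) + t\<^sup>2 * f g"
        unfolding c_def f_def
        by (simp add: matrix_vector_right_distrib bounded_bilinear.scaleR_right[OF bounded_bilinear_mv]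
            inner_add_left inner_add_right power2_eq_square algebra_simps)
           (metis inner_commute inner_adj)
      have e2: "(v + t *\<^sub>R g) \<bullet> (v + t *\<^sub>R g) = 1 + 2 * t * (v \<bullet> g) + t\<^sup>2 * (g \<bullet> g)"
        using vv by (simp add: inner_add_left inner_add_right power2_eq_square algebra_simps inner_commute[of g v])
      have "t * ((W *v v) \<bullet> g + (adj W *v v) \<bullet> g - 2 * c * (v \<bullet> g)) \<le> t\<^sup>2 * (c * (g \<bullet> g) - f g)"
        using le unfolding e1 e2 by (simp add: algebra_simps)
      moreover have "(W *v v) \<bullet> g + (adj W *v v) \<bullet> g - 2 * c * (v \<bullet> g) = g \<bullet> g"
        by (simp add: g_def inner_add_left inner_diff_left)
      ultimately show ?thesis by simp
    qed
    define a where "a = g \<bullet> g"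
    define b where "b = c * a - f g"
    have a: "a > 0" using g0 by (simp add: a_def)
    have k: "t * a \<le> t\<^sup>2 * b" for t using key[of t] by (simp add: a_def b_def)
    \<comment> \<open>For small \<open>t > 0\<close> the linear term of \<open>key\<close> dominates the quadratic one.\<close>
    define t where "t = a / (2 * (\<bar>b\<bar> + 1))"
    have t: "t > 0" using a by (simp add: t_def)
    then have "a \<le> t * b" using k[of t] by (simp add: power2_eq_square)
    also have "\<dots> \<le> t * \<bar>b\<bar>" using t by (intro mult_left_mono) auto
    also have "\<dots> < a" using a unfolding t_def by (simp add: divide_simps)
    finally show False by simp
  qed
  have c1: "\<bar>c\<bar> \<le> 1"
    unfolding c_def f_def using Cauchy_Schwarz_ineq2[of "W *v v" v] by (simp add: unitary_norm[OF W] v)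
  define r where "r = Complex c (sqrt (1 - c\<^sup>2))"
  have sq: "0 \<le> 1 - c\<^sup>2" using c1 by (simp add: abs_square_le_1)
  have r: "r + cnj r = complex_of_real (2 * c)" "r * cnj r = 1"
    using sq by (auto simp: r_def complex_eq_iff power2_eq_square)
  \<comment> \<open>As \<open>(W - r) (W - cnj r) v = 0\<close>, either \<open>v\<close> or this vector is an eigenvector.\<close>
  define u where "u = W *v v - cnj r *s v"
  have uS: "u \<in> S" unfolding u_def by (intro vec.subspace_diff[OF S] inv v vec.subspace_scale[OF S])
  show ?thesis
  proof (cases "u = 0")
    case True
    then show ?thesis using v by (auto simp: u_def)
  next
    case False
    have "W *v (adj W *v v) = v" using W by (simp add: matrix_vector_mul_assoc unitary_right)
    moreover have "W *v (adj W *v v) = (2 * c) *\<^sub>R (W *v v) - W *v (W *v v)"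
    proof -
      have "adj W *v v = (2 * c) *\<^sub>R v - W *v v" using \<open>g = 0\<close> by (simp add: g_def algebra_simps)
      then show ?thesis
        by (simp add: matrix_vector_mult_diff_distrib bounded_bilinear.scaleR_right[OF bounded_bilinear_mv])
    qed
    ultimately have "W *v (W *v v) = complex_of_real (2 * c) *s (W *v v) - v"
      by (simp add: sc algebra_simps)
    also have "\<dots> = (r + cnj r) *s (W *v v) - (r * cnj r) *s v"
      by (simp add: r)
    finally have "W *v u = r *s u"
      by (simp add: u_def matrix_vector_mult_diff_distrib vec.scale vec.scale_right_diff_distrib
          vec.scale_left_distrib algebra_simps)
    then have "W *v ((1 / norm u) *\<^sub>R u) = r *s ((1 / norm u) *\<^sub>R u)"
      by (simp add: bounded_bilinear.scaleR_right[OF bounded_bilinear_mv] vec_eq_iff)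
    then show ?thesis using False RS[OF uS]
      by (intro exI[of _ "(1 / norm u) *\<^sub>R u"] exI[of _ r]) auto
  qed
qed

definition diagm :: "('m \<Rightarrow> complex) \<Rightarrow> complex ^ 'm ^ 'm" where
  "diagm d = (\<chi> i j. if i = j then d i else 0)"

lemma diagm_vector [simp]: "diagm d *v v = (\<chi> i. d i * v $ i)"
  by (simp add: diagm_def vec_eq_iff matrix_vector_mult_def if_distrib if_distribR cong: if_cong)

text \<open>The columns of \<open>P\<close> are chosen one after the other in the orthogonal complement of the
  previous ones, which \<open>W\<close> and \<open>W\<^sup>*\<close> leave invariant.\<close>
lemma unitary_diagonal:
  fixes W :: "complex ^ 'm ^ 'm"
  assumes W: "unitary W"
  shows "\<exists>P d. unitary P \<and> W = P ** diagm d ** adj P \<and> (\<forall>i. norm (d i) = 1)"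
proof -
  have "\<exists>e z. (\<forall>i\<in>A. \<forall>j\<in>A. cinner (e i) (e j) = (if i = j then 1 else 0)) \<and>
      (\<forall>i\<in>A. W *v e i = z i *s e i)" for A :: "'m set"
  proof -
    have "finite A" by simp
    then show ?thesis
    proof (induction A rule: finite_induct)
      case (insert k A)
      then obtain e z where e: "\<And>i j. i \<in> A \<Longrightarrow> j \<in> A \<Longrightarrow> cinner (e i) (e j) = (if i = j then 1 else 0)"
        and z: "\<And>i. i \<in> A \<Longrightarrow> W *v e i = z i *s e i" by blast
      have nz: "e i \<noteq> 0" if "i \<in> A" for i using e[OF that that] by auto
      have n1: "norm (z i) = 1" if "i \<in> A" for i
        by (rule unitary_eigen_norm[OF W z[OF that] nz[OF that]])
      define S where "S = {v. \<forall>i\<in>A. cinner v (e i) = 0}"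
      have S: "vec.subspace S"
        by (auto simp: S_def vec.subspace_def cinner_simps)
      have "S = (\<Inter>i\<in>A. {v. cinner v (e i) = 0})" by (auto simp: S_def)
      moreover have "closed {v. cinner v (e i) = 0}" for i
        unfolding cinner_def by (intro closed_Collect_eq continuous_intros)
      ultimately have clS: "closed S" by auto
      have inv1: "W *v v \<in> S" if "v \<in> S" for v
        using that unitary_eigen_adj[OF W z n1]
        by (simp add: S_def cinner_mult_left cinner_simps)
      have inv2: "adj W *v v \<in> S" if "v \<in> S" for v
        using that by (simp add: S_def cinner_mult_left cinner_simps z)
      define M where "M = (\<chi> i j. if i \<in> A then cnj (e i $ j) else 0)"
      have "M $ k $ j = 0" for j using insert.hyps by (simp add: M_def)
      then obtain w where w: "w \<noteq> 0" "M *v w = 0" using zero_row_kernel by blast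
      have "w \<in> S"
      proof -
        have "cinner w (e i) = 0" if "i \<in> A" for i
        proof -
          have "(M *v w) $ i = cinner w (e i)"
            using that by (simp add: M_def matrix_vector_mult_def cinner_def mult.commute)
          then show ?thesis using w by simp
        qed
        then show ?thesis by (simp add: S_def)
      qed
      from unitary_eigenvector_in[OF W S clS inv1 inv2 this w(1)]
      obtain v y where v: "v \<in> S" "norm v = 1" "W *v v = y *s v" by blast
      have vv: "cinner v v = 1" using v by (simp add: cinner_self)
      have ve: "cinner v (e i) = 0" "cinner (e i) v = 0" if "i \<in> A" for i
        using v that by (auto simp: S_def) (metis cnj_cinner complex_cnj_zero)
      show ?case
        using insert.hyps e z vv ve v(3)
        by (intro exI[of _ "e(k := v)"] exI[of _ "z(k := y)"]) auto
    qed auto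
  qed
  from this[of UNIV] have "\<exists>(e :: 'm \<Rightarrow> _) z. (\<forall>i j. cinner (e i) (e j) = (if i = j then 1 else 0)) \<and> (\<forall>i. W *v e i = z i *s e i)"
    by simp
  then obtain e :: "'m \<Rightarrow> _" and z where e: "\<And>i j. cinner (e i) (e j) = (if i = j then 1 else 0)"
    and z: "\<And>i. W *v e i = z i *s e i" by blast
  have nz: "e i \<noteq> 0" for i using e[of i i] by auto
  define P where "P = (\<chi> i j. e j $ i)"
  have uP: "unitary P"
    using e by (simp add: unitary_def vec_eq_iff P_def adj_def matrix_matrix_mult_def mat_def cinner_def mult.commute)
      
  have WP: "W ** P = P ** diagm z"
  proof -
    have "(W ** P) $ i $ j = (P ** diagm z) $ i $ j" for i j
    proof -
      have "(W ** P) $ i $ j = (W *v e j) $ i"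
        by (simp add: P_def matrix_matrix_mult_def matrix_vector_mult_def)
      then show ?thesis
        by (simp add: z P_def matrix_matrix_mult_def diagm_def if_distrib if_distribR mult.commute cong: if_cong)
    qed
    then show ?thesis by (simp add: vec_eq_iff)
  qed
  have "W = (W ** P) ** adj P"
    using unitary_right[OF uP] by (simp add: matrix_mul_assoc[symmetric])
  then show ?thesis
    using uP WP unitary_eigen_norm[OF W z nz] by metis
qed

section \<open>Counting eigenvalues of unitary matrices\<close>

lemma mspectrum_iff_det: "z \<in> mspectrum W \<longleftrightarrow> det (mat z - W) = 0" for W :: "complex ^ 'm ^ 'm"
proof -
  have "z \<in> mspectrum W \<longleftrightarrow> (\<exists>v. v \<noteq> 0 \<and> (mat z - W) *v v = 0)"
    by (auto simp: mspectrum_def matrix_vector_mult_diff_rdistrib)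
  also have "\<dots> \<longleftrightarrow> \<not> (\<exists>B. B ** (mat z - W) = mat 1)"
    unfolding matrix_left_invertible_ker by blast
  also have "\<dots> \<longleftrightarrow> \<not> invertible (mat z - W)"
    by (simp add: invertible_left_inverse)
  finally show ?thesis by (simp add: invertible_det_nz)
qed

text \<open>
  The eigenvalues listed with multiplicity; their order is arbitrary and in general not continuous in \<open>W\<close>.
  Only symmetric functions of the list enter below.
\<close>
definition evals :: "complex ^ 'm ^ 'm \<Rightarrow> 'm \<Rightarrow> complex" where
  "evals W = (SOME d. \<exists>P. unitary P \<and> W = P ** diagm d ** adj P \<and> (\<forall>i. norm (d i) = 1))"

lemma evals:
  assumes "unitary W"
  obtains P where "unitary P" "W = P ** diagm (evals W) ** adj P"
  using someI_ex[of "\<lambda>d. \<exists>P. unitary P \<and> W = P ** diagm d ** adj P \<and> (\<forall>i. norm (d i) = 1)"]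
    unitary_diagonal[OF assms] unfolding evals_def by blast

lemma norm_evals: "unitary W \<Longrightarrow> norm (evals W i) = 1"
  using someI_ex[of "\<lambda>d. \<exists>P. unitary P \<and> W = P ** diagm d ** adj P \<and> (\<forall>i. norm (d i) = 1)"]
    unitary_diagonal[of W] unfolding evals_def by blast

text \<open>
  In the basis of eigenvectors \<open>W\<close> and the scalar matrices are diagonal simultaneously.
\<close>
lemma det_evals:
  fixes W :: "complex ^ 'm ^ 'm"
  assumes "unitary W"
  shows "det (mat a + mat b ** W) = (\<Prod>i\<in>UNIV. a + b * evals W i)"
proof -
  obtain P where P: "unitary P" "W = P ** diagm (evals W) ** adj P" using evals[OF assms] .
  have "mat a + mat b ** W = P ** (mat a + mat b ** diagm (evals W)) ** adj P"
  proof (rule matrix_eqI)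
    fix v
    have "W *v v = P *v (diagm (evals W) *v (adj P *v v))"
      by (subst P(2)) (simp only: matrix_vector_mul_assoc matrix_mul_assoc)
    moreover have "P *v (adj P *v v) = v"
      using unitary_right[OF P(1)] by (simp add: matrix_vector_mul_assoc)
    ultimately show "(mat a + mat b ** W) *v v = (P ** (mat a + mat b ** diagm (evals W)) ** adj P) *v v"
      by (simp add: matrix_vector_mul_assoc[symmetric] matrix_vector_mult_add_rdistrib
          matrix_vector_right_distrib vec.scale del: diagm_vector)
  qed
  then have "det (mat a + mat b ** W) = det P * det (mat a + mat b ** diagm (evals W)) * det (adj P)"
    by (simp add: det_mul)
  moreover have "det P * det (adj P) = 1"
    using arg_cong[OF unitary_right[OF P(1)], of det] by (simp add: det_mul)
  moreover have "det (mat a + mat b ** diagm (evals W)) = (\<Prod>i\<in>UNIV. a + b * evals W i)"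
  proof -
    have eq: "(mat a + mat b ** diagm (evals W)) $ i $ j = (if i = j then a + b * evals W i else 0)" for i j
    proof -
      have "(mat b ** diagm (evals W)) $ i $ j = (\<Sum>k\<in>UNIV. (if i = k then b else 0) * (if k = j then evals W k else 0))"
        by (simp add: matrix_matrix_mult_def mat_def diagm_def)
      also have "\<dots> = (\<Sum>k\<in>UNIV. if i = k then b * (if k = j then evals W k else 0) else 0)"
        by (intro sum.cong) auto
      finally show ?thesis by (simp add: mat_def)
    qed
    have "mat a + mat b ** diagm (evals W) = diagm (\<lambda>i. a + b * evals W i)"
      by (rule vec_eq_iff[THEN iffD2], rule allI, rule vec_eq_iff[THEN iffD2], rule allI,
          unfold eq) (simp add: diagm_def)
    then show ?thesis by (simp add: det_diagonal diagm_def)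
  qed
  ultimately show ?thesis by (simp add: mult_ac)
qed

lemma mspectrum_evals: "unitary W \<Longrightarrow> mspectrum W = range (evals W)"
proof -
  assume W: "unitary W"
  have "mat z - W = mat z + mat (-1) ** W" for z
    by (rule matrix_eqI) (simp add: matrix_vector_mul_assoc[symmetric] matrix_vector_mult_add_rdistrib matrix_vector_mult_diff_rdistrib)
  then have "det (mat z - W) = (\<Prod>i\<in>UNIV. z + -1 * evals W i)" for z
    by (simp only: det_evals[OF W])
  then show ?thesis
    by (auto simp: mspectrum_iff_det)
qed

lemma dim_mker_evals:
  fixes W :: "complex ^ 'm ^ 'm"
  assumes "unitary W"
  shows "vec.dim (mker (W - mat z)) = card {i. evals W i = z}"
proof -
  obtain P where P: "unitary P" "W = P ** diagm (evals W) ** adj P" using evals[OF assms] .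
  let ?d = "evals W"
  let ?S = "{x :: complex ^ 'm. \<forall>i. i \<notin> {i. ?d i = z} \<longrightarrow> x $ i = 0}"
  have PP: "adj P *v (P *v x) = x" "P *v (adj P *v x) = x" for x
    using P(1) unitary_right[OF P(1)] by (auto simp: matrix_vector_mul_assoc unitary_def)
  have WP: "W *v (P *v x) = P *v (diagm ?d *v x)" for x
    by (subst P(2)) (simp add: matrix_vector_mul_assoc[symmetric] PP del: diagm_vector)
  have mem: "(P *v x \<in> mker (W - mat z)) \<longleftrightarrow> x \<in> ?S" for x
  proof -
    have "P *v x \<in> mker (W - mat z) \<longleftrightarrow> P *v (diagm ?d *v x - z *s x) = 0"
      by (simp add: mker_def matrix_vector_mult_diff_rdistrib matrix_vector_mult_diff_distrib WP vec.scale del: diagm_vector)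
    also have "\<dots> \<longleftrightarrow> diagm ?d *v x - z *s x = 0"
      by (metis PP(1) matrix_vector_mult_0_right)
    also have "\<dots> \<longleftrightarrow> x \<in> ?S" by (auto simp: vec_eq_iff)
    finally show ?thesis .
  qed
  have "mker (W - mat z) = (*v) P ` ?S"
  proof (intro equalityI subsetI)
    fix v assume "v \<in> mker (W - mat z)"
    then have "P *v (adj P *v v) \<in> mker (W - mat z)" by (simp add: PP)
    then have "adj P *v v \<in> ?S" unfolding mem .
    then show "v \<in> (*v) P ` ?S" using PP(2)[of v, symmetric] by (rule image_eqI[rotated])
  next
    fix v assume "v \<in> (*v) P ` ?S"
    then obtain x where x: "v = P *v x" "x \<in> ?S" by (rule imageE)
    show "v \<in> mker (W - mat z)" unfolding x(1) mem by (rule x(2))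
  qed
  moreover have "inj_on ((*v) P) (vec.span ?S)"
    by (rule inj_on_inverseI[of _ "(*v) (adj P)"]) (rule PP(1))
  ultimately show ?thesis
    using vec.dim_image_eq[OF matrix_vector_mul_linear_gen, of P ?S]
      dim_substandard_cart[of "{i. ?d i = z}"] by simp
qed

text \<open>The angle of a unimodular number is measured counterclockwise from \<open>-1\<close>, the point at
  which crossings are counted.\<close>

definition ang :: "complex \<Rightarrow> real" where "ang d = Arg2pi (- d)"

lemma ang_bounds: "0 \<le> ang d" "ang d < 2 * pi"
  using Arg2pi[of "-d"] by (auto simp: ang_def)

lemma cis_pi_add: "cis (pi + a) = - cis a"
  by (simp add: cis_mult[symmetric])

lemma cis_ang:
  assumes "norm d = 1" shows "cis (pi + ang d) = d" and "- cis (ang d) = d"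
proof -
  have "- d = cis (ang d)"
    using Arg2pi_eq[of "-d"] assms by (simp add: ang_def cis_conv_exp)
  then show m: "- cis (ang d) = d" by (metis minus_minus)
  show "cis (pi + ang d) = d" by (simp add: cis_pi_add m)
qed

lemma ang_unique: "0 \<le> \<theta> \<Longrightarrow> \<theta> < 2 * pi \<Longrightarrow> ang (cis (pi + \<theta>)) = \<theta>"
  unfolding ang_def by (rule Arg2pi_unique[of 1]) (simp_all add: cis_pi_add cis_conv_exp[symmetric])

lemma ang_eq_iff:
  assumes "norm d = 1" "0 \<le> \<theta>" "\<theta> < 2 * pi"
  shows "ang d = \<theta> \<longleftrightarrow> d = cis (pi + \<theta>)"
  using cis_ang[OF assms(1)] ang_unique assms(2,3) by auto

lemma kcount_evals:
  fixes W :: "complex ^ 'm ^ 'm"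
  assumes W: "unitary W" and \<epsilon>: "\<epsilon> < 2 * pi"
  shows "kcount W \<epsilon> = card {i. ang (evals W i) < \<epsilon>}"
proof -
  let ?d = "evals W" and ?S = "{i. ang (evals W i) < \<epsilon>}"
  note n = norm_evals[OF W]
  have "{\<theta>. 0 \<le> \<theta> \<and> \<theta> < \<epsilon> \<and> cis (pi + \<theta>) \<in> mspectrum W} = (\<lambda>i. ang (?d i)) ` ?S" (is "?L = ?R")
  proof
    show "?L \<subseteq> ?R"
    proof
      fix \<theta> assume t: "\<theta> \<in> ?L"
      then obtain i where "cis (pi + \<theta>) = ?d i" by (auto simp: mspectrum_evals[OF W])
      moreover have "ang (cis (pi + \<theta>)) = \<theta>" using t \<epsilon> by (intro ang_unique) auto
      ultimately show "\<theta> \<in> ?R" using t by auto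
    qed
  next
    show "?R \<subseteq> ?L"
      using ang_bounds by (auto simp: mspectrum_evals[OF W] cis_ang(1)[OF n])
  qed
  then have "kcount W \<epsilon> = (\<Sum>\<theta>\<in>(\<lambda>i. ang (?d i)) ` ?S. card {i. ?d i = cis (pi + \<theta>)})"
    unfolding kcount_def by (simp add: dim_mker_evals[OF W])
  also have "\<dots> = (\<Sum>\<theta>\<in>(\<lambda>i. ang (?d i)) ` ?S. \<Sum>i\<in>{x \<in> ?S. ang (?d x) = \<theta>}. 1)"
  proof (rule sum.cong[OF refl])
    fix \<theta> assume t: "\<theta> \<in> (\<lambda>i. ang (?d i)) ` ?S"
    then have "0 \<le> \<theta>" "\<theta> < \<epsilon>" using ang_bounds by auto
    then have "{x \<in> ?S. ang (?d x) = \<theta>} = {i. ?d i = cis (pi + \<theta>)}"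
      using \<epsilon> ang_eq_iff[OF n, of \<theta>] by (auto simp: ang_unique)
    then show "card {i. ?d i = cis (pi + \<theta>)} = (\<Sum>i\<in>{x \<in> ?S. ang (?d x) = \<theta>}. 1)" by simp
  qed
  also have "\<dots> = (\<Sum>i\<in>?S. 1)" by (rule sum.image_gen[symmetric]) simp
  finally show ?thesis by simp
qed

definition crossing :: "complex ^ 'm ^ 'm \<Rightarrow> nat" where
  "crossing W = vec.dim (mker (W + mat 1))"

lemma crossing_evals:
  assumes W: "unitary W" shows "crossing W = card {i. ang (evals W i) = 0}"
proof -
  have "W + mat 1 = W - mat (-1)"
    by (rule matrix_eqI) (simp add: matrix_vector_mult_add_rdistrib matrix_vector_mult_diff_rdistrib)
  then have "crossing W = card {i. evals W i = -1}"
    by (simp add: crossing_def dim_mker_evals[OF W])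
  also have "{i. evals W i = -1} = {i. ang (evals W i) = 0}"
    using ang_eq_iff[OF norm_evals[OF W], of 0] by auto
  finally show ?thesis .
qed

lemma mspectrum_locally_avoided:
  fixes W :: "'t::metric_space \<Rightarrow> complex ^ 'm ^ 'm"
  assumes W: "continuous_on D W" and t: "t \<in> D" and z: "z \<notin> mspectrum (W t)"
  shows "\<exists>\<delta>>0. \<forall>s\<in>D. dist s t < \<delta> \<longrightarrow> z \<notin> mspectrum (W s)"
proof -
  have "continuous_on D (\<lambda>s. det (mat z - W s))"
    by (intro continuous_on_det continuous_intros W)
  then have "((\<lambda>s. det (mat z - W s)) \<longlongrightarrow> det (mat z - W t)) (at t within D)"
    using t by (auto simp: continuous_on_def)
  then have "\<forall>\<^sub>F s in at t within D. det (mat z - W s) \<noteq> 0"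
    using z by (intro tendsto_imp_eventually_ne) (auto simp: mspectrum_iff_det)
  then show ?thesis
    using z by (auto simp: mspectrum_iff_det eventually_at)
qed

text \<open>
  The spectrum is finite, so all small angles other than zero avoid it on both sides of \<open>-1\<close>.
\<close>
lemma avoiding_angle:
  assumes W: "unitary W"
  obtains \<epsilon> where "0 < \<epsilon>" "\<epsilon> < pi" "cis (pi + \<epsilon>) \<notin> mspectrum W" "cis (pi - \<epsilon>) \<notin> mspectrum W"
proof -
  let ?F = "(\<lambda>d. ang d) ` mspectrum W \<union> (\<lambda>d. 2 * pi - ang d) ` mspectrum W"
  have "finite ?F" by (simp add: mspectrum_evals[OF W])
  moreover have "infinite {0<..<pi}" by simp
  ultimately obtain \<epsilon> where e: "\<epsilon> \<in> {0<..<pi} - ?F"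
    by (metis Diff_infinite_finite equals0I finite.emptyI)
  have "cis (pi - \<epsilon>) = cis (pi + (2 * pi - \<epsilon>))"
    by (simp add: complex_eq_iff cos_diff sin_diff cos_add sin_add)
  moreover have "ang (cis (pi + \<epsilon>)) = \<epsilon>"
    by (rule ang_unique) (use e in auto)
  moreover have "ang (cis (pi + (2 * pi - \<epsilon>))) = 2 * pi - \<epsilon>"
    by (rule ang_unique) (use e in auto)
  ultimately have "ang (cis (pi + \<epsilon>)) = \<epsilon>" "ang (cis (pi - \<epsilon>)) = 2 * pi - \<epsilon>"
    by simp_all
  then have "cis (pi + \<epsilon>) \<notin> mspectrum W" "cis (pi - \<epsilon>) \<notin> mspectrum W"
    using e by (force simp: image_iff)+
  then show ?thesis using that e by auto
qed

section \<open>The spectral flow through \<open>-1\<close>\<close>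

lemma continuous_integer_multiple_constant:
  fixes f :: "'t::topological_space \<Rightarrow> real"
  assumes S: "connected S" and f: "continuous_on S f" and c: "c > 0"
    and int: "\<And>t. t \<in> S \<Longrightarrow> \<exists>k::int. f t = c * k"
  shows "\<exists>k::int. \<forall>t\<in>S. f t = c * k"
proof (cases "S = {}")
  case False
  have "f constant_on S"
  proof (rule continuous_discrete_range_constant[OF S f])
    fix x assume x: "x \<in> S"
    have "c \<le> norm (f y - f x)" if "y \<in> S" "f y \<noteq> f x" for y
    proof -
      obtain k l :: int where kl: "f x = c * k" "f y = c * l" using int x \<open>y \<in> S\<close> by blast
      then have "k \<noteq> l" using that by auto
      then have "1 \<le> \<bar>real_of_int (l - k)\<bar>" by linarith
      then have "c * 1 \<le> c * \<bar>real_of_int (l - k)\<bar>" using c by (intro mult_left_mono) auto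
      moreover have "f y - f x = c * real_of_int (l - k)" by (simp add: kl algebra_simps)
      ultimately show ?thesis using c by (simp add: abs_mult)
    qed
    then show "\<exists>e>0. \<forall>y. y \<in> S \<and> f y \<noteq> f x \<longrightarrow> e \<le> norm (f y - f x)" using c by blast
  qed
  then show ?thesis using False int by (metis constant_on_def ex_in_conv)
qed auto

text \<open>
  The sum of the principal arguments of the eigenvalues \<open>v\<close> of \<open>V = cis (-\<epsilon>) W\<close> is the increment
  over \<open>s \<in> [0,1]\<close> of a continuous logarithm of \<open>det (1 + s (V - 1)) = \<Prod>(1 + s (v - 1))\<close>, whose
  factors avoid the negative reals.  A logarithm that is jointly continuous in \<open>s\<close> and the parameter
  exists because the domain is convex.
\<close>
lemma continuous_sum_arguments:
  fixes W :: "'t::real_normed_vector \<Rightarrow> complex ^ 'm ^ 'm"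
  assumes T: "convex T" and Wc: "continuous_on T W" and W: "\<And>t. t \<in> T \<Longrightarrow> unitary (W t)"
    and av: "\<And>t. t \<in> T \<Longrightarrow> cis (pi + \<epsilon>) \<notin> mspectrum (W t)"
  shows "continuous_on T (\<lambda>t. \<Sum>i\<in>UNIV. Im (Ln (cis (-\<epsilon>) * evals (W t) i)))"
proof -
  define v where "v t i = cis (-\<epsilon>) * evals (W t) i" for t i
  \<comment> \<open>The value at \<open>(t, s)\<close> is \<open>det (1 + s (V - 1))\<close>.\<close>
  define f where "f = (\<lambda>p. det (mat (complex_of_real (1 - snd p)) + mat (complex_of_real (snd p) * cis (-\<epsilon>)) ** W (fst p)))"
  let ?D = "T \<times> {0..1::real}"
  have matc: "continuous_on S (\<lambda>p. mat (g p) :: complex ^ 'm ^ 'm)" if "continuous_on S g" for S and g :: "'t \<times> real \<Rightarrow> complex"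
  proof -
    show ?thesis
      unfolding mat_def
    proof (intro continuous_on_vec_lambda)
      fix i j :: 'm
      show "continuous_on S (\<lambda>p. if i = j then g p else 0)"
        using that by (cases "i = j") auto
    qed
  qed
  have fc: "continuous_on ?D f"
    unfolding f_def
    by (intro continuous_on_det continuous_on_add continuous_on_mm matc continuous_intros
        continuous_on_compose2[OF Wc]) auto
  have factor: "1 + complex_of_real s * (v t i - 1) \<notin> \<real>\<^sub>\<le>\<^sub>0" if t: "t \<in> T" and s: "0 \<le> s" "s \<le> 1" for t s i
  proof
    assume "1 + complex_of_real s * (v t i - 1) \<in> \<real>\<^sub>\<le>\<^sub>0"
    then have im: "s * Im (v t i) = 0" and re: "1 + s * (Re (v t i) - 1) \<le> 0"
      by (auto simp: complex_nonpos_Reals_iff)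
    have n: "norm (v t i) = 1" using norm_evals[OF W[OF t]] by (simp add: v_def norm_mult)
    have "s \<noteq> 0" using re by auto
    then have "Im (v t i) = 0" using im by simp
    moreover from this n have "\<bar>Re (v t i)\<bar> = 1" by (simp add: cmod_def)
    moreover have "Re (v t i) \<noteq> 1" using re by auto
    ultimately have "v t i = -1" by (auto simp: complex_eq_iff)
    moreover have "evals (W t) i = cis \<epsilon> * v t i"
      by (simp add: v_def mult.assoc[symmetric] cis_mult)
    ultimately have "evals (W t) i = cis (pi + \<epsilon>)" by (simp add: cis_mult[symmetric])
    then show False using av[OF t] by (simp add: mspectrum_evals[OF W[OF t]] image_iff) metis
  qed
  have f_eq: "f (t, s) = (\<Prod>i\<in>UNIV. 1 + complex_of_real s * (v t i - 1))" if "t \<in> T" for t s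
    unfolding f_def v_def by (simp add: det_evals[OF W[OF that]] algebra_simps)
  have nz: "f p \<noteq> 0" if pD: "p \<in> ?D" for p
  proof -
    obtain t s where p: "p = (t, s)" "t \<in> T" "0 \<le> s" "s \<le> 1" using pD by (cases p) auto
    have "1 + complex_of_real s * (v t i - 1) \<noteq> 0" for i using factor[OF p(2-4), of i] by auto
    then show ?thesis using p by (simp add: f_eq)
  qed
  obtain g where g: "continuous_on ?D g" "\<And>p. p \<in> ?D \<Longrightarrow> f p = exp (g p)"
    using continuous_logarithm_on_contractible[OF fc convex_imp_contractible nz] T
    by (auto simp: convex_Times)
  \<comment> \<open>The sum of the principal logarithms of the factors is a second logarithm along the segment, and it vanishes at \<open>s = 0\<close>.\<close>
  have eq: "(\<Sum>i\<in>UNIV. Im (Ln (v t i))) = Im (g (t, 1)) - Im (g (t, 0))" if t: "t \<in> T" for t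
  proof -
    define h where "h s = (\<Sum>i\<in>UNIV. Ln (1 + complex_of_real s * (v t i - 1)))" for s
    have hc: "continuous_on {0..1} h"
      unfolding h_def using factor[OF t] by (intro continuous_intros) auto
    have eh: "exp (h s) = f (t, s)" if "s \<in> {0..1}" for s
    proof -
      have "1 + complex_of_real s * (v t i - 1) \<noteq> 0" for i using factor[OF t, of s i] that by auto
      then show ?thesis by (simp add: h_def exp_sum f_eq[OF t])
    qed
    have gt: "continuous_on {0..1} (\<lambda>s. g (t, s))"
      using t by (intro continuous_on_compose2[OF g(1)] continuous_intros) auto
    have "\<exists>k::int. \<forall>s\<in>{0..1}. Im (g (t, s)) - Im (h s) = 2 * pi * k"
    proof (rule continuous_integer_multiple_constant)
      show "continuous_on {0..1} (\<lambda>s. Im (g (t, s)) - Im (h s))"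
        by (intro continuous_intros gt hc)
      fix s :: real assume s: "s \<in> {0..1}"
      have "exp (g (t, s)) = exp (h s)" using eh[OF s] g(2)[of "(t, s)"] s t by simp
      then obtain k :: int where "g (t, s) = h s + (of_int (2 * k) * pi) * \<i>"
        by (auto simp: exp_eq)
      then show "\<exists>k::int. Im (g (t, s)) - Im (h s) = 2 * pi * k" by auto
    qed auto
    then obtain k :: int where "\<forall>s\<in>{0..1}. Im (g (t, s)) - Im (h s) = 2 * pi * k" by blast
    then have "Im (g (t, 0)) - Im (h 0) = Im (g (t, 1)) - Im (h 1)" by simp
    moreover have "Im (h 0) = 0" "Im (h 1) = (\<Sum>i\<in>UNIV. Im (Ln (v t i)))" by (simp_all add: h_def)
    ultimately show ?thesis by simp
  qed
  have "continuous_on T (\<lambda>t. Im (g (t, 1)) - Im (g (t, 0)))"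
    by (intro continuous_intros continuous_on_compose2[OF g(1)]) auto
  then show ?thesis
    using eq unfolding v_def by (simp cong: continuous_on_cong)
qed

text \<open>
  The principal logarithm of \<open>cis (-\<epsilon>) d\<close> has its cut at \<open>d = cis (pi + \<epsilon>)\<close>.  Its argument therefore varies
  continuously where \<open>ang\<close> jumps from \<open>2\<pi>\<close> to \<open>0\<close>; the last summand records that jump.
\<close>
lemma ang_shifted:
  assumes d: "norm d = 1" and \<epsilon>: "0 < \<epsilon>" "\<epsilon> < 2 * pi" and ne: "ang d \<noteq> \<epsilon>"
  shows "ang d = Im (Ln (cis (-\<epsilon>) * d)) + \<epsilon> - pi + (if ang d < \<epsilon> then 0 else 2 * pi)"
proof (cases "ang d < \<epsilon>")
  case True
  have "cis (-\<epsilon>) * d = exp (\<i> * complex_of_real (ang d - \<epsilon> + pi))"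
    using cis_ang(1)[OF d] by (simp add: cis_conv_exp[symmetric] cis_mult algebra_simps del: of_real_add of_real_diff)
      (metis cis_mult add.commute add_diff_eq minus_diff_eq uminus_add_conv_diff)
  then have "Ln (cis (-\<epsilon>) * d) = \<i> * complex_of_real (ang d - \<epsilon> + pi)"
    using True \<epsilon> ang_bounds[of d] by (intro Ln_unique) auto
  then show ?thesis using True by simp
next
  case False
  have "cis (-\<epsilon>) * d = exp (\<i> * complex_of_real (ang d - \<epsilon> - pi))"
  proof -
    have "cis (-\<epsilon>) * d = cis (-\<epsilon>) * cis (pi + ang d)" using cis_ang(1)[OF d] by simp
    also have "\<dots> = cis (ang d - \<epsilon> - pi)"
      by (simp add: cis_mult) (simp add: complex_eq_iff cos_diff sin_diff cos_add sin_add algebra_simps)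
    finally show ?thesis by (simp add: cis_conv_exp)
  qed
  then have "Ln (cis (-\<epsilon>) * d) = \<i> * complex_of_real (ang d - \<epsilon> - pi)"
    using False ne \<epsilon> ang_bounds[of d] by (intro Ln_unique) auto
  then show ?thesis using False by simp
qed

text \<open>
  An integer function whose increments are the spectral flow of \<open>W\<close> through \<open>-1\<close>: wherever some
  \<open>cis (pi + \<epsilon>)\<close> stays off the spectrum, its increments are those of the number of eigenvalues on
  the half-open arc from \<open>-1\<close> to that point.
\<close>
definition flow_function :: "'t::real_normed_vector set \<Rightarrow> ('t \<Rightarrow> complex ^ 'm ^ 'm) \<Rightarrow> ('t \<Rightarrow> int) \<Rightarrow> bool" where
  "flow_function D W m \<longleftrightarrow> (\<forall>T \<epsilon>. convex T \<longrightarrow> T \<subseteq> D \<longrightarrow> 0 < \<epsilon> \<longrightarrow> \<epsilon> < 2 * pi \<longrightarrow>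
     (\<forall>t\<in>T. cis (pi + \<epsilon>) \<notin> mspectrum (W t)) \<longrightarrow> (\<exists>c. \<forall>t\<in>T. m t = c + int (kcount (W t) \<epsilon>)))"

lemma flow_functionD:
  assumes "flow_function D W m" "convex T" "T \<subseteq> D" "0 < \<epsilon>" "\<epsilon> < 2 * pi"
    "\<And>t. t \<in> T \<Longrightarrow> cis (pi + \<epsilon>) \<notin> mspectrum (W t)"
  obtains c where "\<And>t. t \<in> T \<Longrightarrow> m t = c + int (kcount (W t) \<epsilon>)"
  using assms unfolding flow_function_def by meson

text \<open>
  Let \<open>\<phi>\<close> be the sum of the angles of the eigenvalues, measured from \<open>-1\<close>, and \<open>g\<close> a continuous
  logarithm of \<open>det (-W)\<close>.  The difference of \<open>Im g\<close> and \<open>\<phi>\<close> is an integer multiple of \<open>2\<pi>\<close>, and this integer is the flow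
  function: where \<open>cis (pi + \<epsilon>)\<close> is avoided, \<open>\<phi> + 2\<pi> kcount W \<epsilon>\<close> is continuous, because each angle is
  compared with the argument whose cut is at \<open>cis (pi + \<epsilon>)\<close>.
\<close>
lemma flow_function_exists:
  fixes W :: "'t::real_normed_vector \<Rightarrow> complex ^ 'm ^ 'm"
  assumes D: "convex D" and Wc: "continuous_on D W" and W: "\<And>t. t \<in> D \<Longrightarrow> unitary (W t)"
  shows "\<exists>m. flow_function D W m"
proof -
  have "continuous_on D (\<lambda>t. det (mat (-1) ** W t))"
    by (intro continuous_on_det continuous_intros Wc)
  moreover have det: "det (mat (-1) ** W t) = (\<Prod>i\<in>UNIV. - evals (W t) i)" if "t \<in> D" for t
    using det_evals[OF W[OF that], of 0 "-1"] by simp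
  have "det (mat (-1) ** W t) \<noteq> 0" if "t \<in> D" for t
  proof -
    have "evals (W t) i \<noteq> 0" for i using norm_evals[OF W[OF that], of i] by auto
    then show ?thesis by (simp add: det[OF that])
  qed
  ultimately obtain g where g: "continuous_on D g" "\<And>t. t \<in> D \<Longrightarrow> det (mat (-1) ** W t) = exp (g t)"
    using continuous_logarithm_on_contractible[OF _ convex_imp_contractible[OF D], of "\<lambda>t. det (mat (-1) ** W t)"] by blast
  define \<phi> where "\<phi> t = (\<Sum>i\<in>UNIV. ang (evals (W t) i))" for t
  have g_\<phi>: "\<exists>k::int. Im (g t) - \<phi> t = 2 * pi * k" if t: "t \<in> D" for t
  proof -
    have "exp (\<i> * complex_of_real (\<phi> t)) = (\<Prod>i\<in>UNIV. cis (ang (evals (W t) i)))"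
      by (simp add: \<phi>_def sum_distrib_left exp_sum cis_conv_exp)
    also have "\<dots> = (\<Prod>i\<in>UNIV. - evals (W t) i)"
      using cis_ang(2)[OF norm_evals[OF W[OF t]]] by (intro prod.cong) (auto simp: minus_equation_iff[of "cis _"])
    also have "\<dots> = exp (g t)" using g(2)[OF t] det[OF t] by simp
    finally obtain k :: int where "g t = \<i> * complex_of_real (\<phi> t) + (of_int (2 * k) * pi) * \<i>"
      by (metis exp_eq)
    then show ?thesis by auto
  qed
  define m where "m t = \<lfloor>(Im (g t) - \<phi> t) / (2 * pi)\<rfloor>" for t
  have m: "Im (g t) - \<phi> t = 2 * pi * m t" if "t \<in> D" for t
    using g_\<phi>[OF that] by (auto simp: m_def)
  have "flow_function D W m"
    unfolding flow_function_def
  proof (intro allI impI)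
    fix T \<epsilon> assume T: "convex T" "T \<subseteq> D" and \<epsilon>: "0 < \<epsilon>" "\<epsilon> < 2 * pi"
      and av: "\<forall>t\<in>T. cis (pi + \<epsilon>) \<notin> mspectrum (W t)"
    define \<psi> where "\<psi> t = (\<Sum>i\<in>UNIV. Im (Ln (cis (-\<epsilon>) * evals (W t) i)))" for t
    have \<psi>: "continuous_on T \<psi>"
      unfolding \<psi>_def using T av W
      by (intro continuous_sum_arguments continuous_on_subset[OF Wc]) auto
    have \<phi>: "\<phi> t = \<psi> t + real CARD('m) * (\<epsilon> + pi) - 2 * pi * kcount (W t) \<epsilon>" if t: "t \<in> T" for t
    proof -
      have U: "unitary (W t)" using t T W by auto
      have "ang (evals (W t) i) \<noteq> \<epsilon>" for i
        using av t \<epsilon> ang_eq_iff[OF norm_evals[OF U], of \<epsilon> i] by (auto simp: mspectrum_evals[OF U])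
      from ang_shifted[OF norm_evals[OF U] \<epsilon> this]
      have "\<phi> t = (\<Sum>i\<in>UNIV. Im (Ln (cis (-\<epsilon>) * evals (W t) i)) + (\<epsilon> + pi) - (if ang (evals (W t) i) < \<epsilon> then 2 * pi else 0))"
        unfolding \<phi>_def by (intro sum.cong[OF refl]) (smt (verit, best))
      also have "\<dots> = \<psi> t + real CARD('m) * (\<epsilon> + pi) - (\<Sum>i\<in>UNIV. if ang (evals (W t) i) < \<epsilon> then 2 * pi else 0)"
        by (simp add: sum.distrib sum_subtractf \<psi>_def)
      also have "(\<Sum>i\<in>UNIV. if ang (evals (W t) i) < \<epsilon> then 2 * pi else 0) = 2 * pi * kcount (W t) \<epsilon>"
        by (simp add: kcount_evals[OF U \<epsilon>(2)] sum.If_cases)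
      finally show ?thesis .
    qed
    have "\<exists>k::int. \<forall>t\<in>T. Im (g t) - \<psi> t - real CARD('m) * (\<epsilon> + pi) = 2 * pi * k"
    proof (rule continuous_integer_multiple_constant)
      show "connected T" using T by (simp add: convex_connected)
      show "continuous_on T (\<lambda>t. Im (g t) - \<psi> t - real CARD('m) * (\<epsilon> + pi))"
        using T by (intro continuous_intros \<psi> continuous_on_subset[OF g(1)])
      fix t assume t: "t \<in> T"
      then have "t \<in> D" using T by auto
      have "Im (g t) - \<psi> t - real CARD('m) * (\<epsilon> + pi) = 2 * pi * (m t - int (kcount (W t) \<epsilon>))"
        using m[OF \<open>t \<in> D\<close>] \<phi>[OF t] by (simp add: algebra_simps)
      then show "\<exists>k::int. Im (g t) - \<psi> t - real CARD('m) * (\<epsilon> + pi) = 2 * pi * k" by blast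
    qed auto
    then obtain k :: int where k: "\<And>t. t \<in> T \<Longrightarrow> Im (g t) - \<psi> t - real CARD('m) * (\<epsilon> + pi) = 2 * pi * k" by blast
    have "m t = k + int (kcount (W t) \<epsilon>)" if t: "t \<in> T" for t
    proof -
      have "t \<in> D" using t T by auto
      have "2 * pi * real_of_int (m t) = 2 * pi * real_of_int (k + int (kcount (W t) \<epsilon>))"
        using m[OF \<open>t \<in> D\<close>] \<phi>[OF t] k[OF t] by (simp add: algebra_simps)
      then show ?thesis by (simp only: mult_cancel_left of_int_eq_iff) simp
    qed
    then show "\<exists>c. \<forall>t\<in>T. m t = c + int (kcount (W t) \<epsilon>)" by blast
  qed
  then show ?thesis by blast
qed

section \<open>Index comparison by the Cayley transform\<close>

text \<open>
  For unimodular \<open>z\<close> off the spectrum of a unitary \<open>W\<close> this is a Hermitian matrix.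
\<close>
definition cayley :: "complex \<Rightarrow> complex ^ 'm ^ 'm \<Rightarrow> complex ^ 'm ^ 'm" where
  "cayley z W = mat \<i> ** (mat z + W) ** matrix_inv (mat z - W)"

text \<open>
  The subtracted multiple of \<open>(v, v)\<close> is the value of the transform at the eigenvalue \<open>-1\<close>; with
  this shift the kernel of the form is the eigenspace of \<open>-1\<close>.
\<close>
definition gform :: "real \<Rightarrow> complex ^ 'm ^ 'm \<Rightarrow> complex ^ 'm \<Rightarrow> real" where
  "gform \<epsilon> W v = (cayley (cis (pi + \<epsilon>)) W *v v) \<bullet> v - sin \<epsilon> / (1 - cos \<epsilon>) * (v \<bullet> v)"

lemma cayley_vector:
  "cayley z W *v v = \<i> *s (z *s (matrix_inv (mat z - W) *v v) + W *v (matrix_inv (mat z - W) *v v))"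
  by (simp add: cayley_def matrix_vector_mul_assoc[symmetric] matrix_vector_mult_add_rdistrib)

lemma resolvent:
  assumes "z \<notin> mspectrum W"
  shows "(mat z - W) *v (matrix_inv (mat z - W) *v v) = v"
    and "matrix_inv (mat z - W) *v ((mat z - W) *v v) = v"
  using matrix_inv_mult[of "mat z - W"] assms
  by (simp_all add: mspectrum_iff_det invertible_det_nz matrix_vector_mul_assoc)

text \<open>
  Written with the resolvent vectors \<open>u = (z - W)\<^sup>-\<^sup>1 v\<close> and \<open>u' = (z - W')\<^sup>-\<^sup>1 v\<close>, one factor \<open>v\<close> of each form
  is expressed by the resolvent vector of the other matrix; the mixed terms then cancel.
\<close>
lemma gform_diff:
  assumes W: "unitary W" "unitary W'" and z: "cis (pi + \<epsilon>) \<notin> mspectrum W" "cis (pi + \<epsilon>) \<notin> mspectrum W'"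
    and u: "u = matrix_inv (mat (cis (pi + \<epsilon>)) - W) *v v" "u' = matrix_inv (mat (cis (pi + \<epsilon>)) - W') *v v"
  shows "gform \<epsilon> W' v - gform \<epsilon> W v = Re (- 2 * \<i> * (cinner u u' - cinner (W *v u) (W' *v u')))"
proof -
  let ?z = "cis (pi + \<epsilon>)"
  have v: "v = ?z *s u - W *v u" "v = ?z *s u' - W' *v u'"
    using resolvent(1)[OF z(1), of v] resolvent(1)[OF z(2), of v]
    by (simp_all add: u matrix_vector_mult_diff_rdistrib)
  have zz: "?z * cnj ?z = 1" by (simp add: cis_cnj cis_mult)
  have "gform \<epsilon> W' v - gform \<epsilon> W v = Re (cinner v (cayley ?z W' *v v)) - Re (cinner (cayley ?z W *v v) v)"
    by (simp add: gform_def Re_cinner inner_commute)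
  also have "cinner v (cayley ?z W' *v v) = cinner (?z *s u - W *v u) (\<i> *s (?z *s u' + W' *v u'))"
    unfolding cayley_vector u(2)[symmetric] by (subst v(1)) simp
  also have "cinner (cayley ?z W *v v) v = cinner (\<i> *s (?z *s u + W *v u)) (?z *s u' - W' *v u')"
    unfolding cayley_vector u(1)[symmetric] by (subst v(2)) simp
  also have "Re (cinner (?z *s u - W *v u) (\<i> *s (?z *s u' + W' *v u')))
      - Re (cinner (\<i> *s (?z *s u + W *v u)) (?z *s u' - W' *v u'))
     = Re (- 2 * \<i> * ((?z * cnj ?z) * cinner u u' - cinner (W *v u) (W' *v u')))"
    by (simp add: cinner_simps algebra_simps)
  finally show ?thesis unfolding zz by simp
qed

text \<open>With \<open>z = - cis \<epsilon>\<close> and \<open>d = - cis \<theta>\<close> the number \<open>\<i> (z + d) / (z - d)\<close> is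
  \<open>cot ((\<epsilon> - \<theta>) / 2)\<close>; the form \<open>gform\<close> subtracts its value \<open>cot (\<epsilon> / 2)\<close> at \<open>d = -1\<close>, so that
  its sign tells on which side of \<open>-1\<close> an eigenvalue lies.\<close>
lemma cayley_scalar_sign:
  assumes d: "norm d = 1" and \<epsilon>: "0 < \<epsilon>" "\<epsilon> < 2 * pi" and ne: "cis (pi + \<epsilon>) \<noteq> d"
  defines "g \<equiv> Re (\<i> * (cis (pi + \<epsilon>) + d) / (cis (pi + \<epsilon>) - d)) - sin \<epsilon> / (1 - cos \<epsilon>)"
  shows "0 \<le> g \<longleftrightarrow> ang d < \<epsilon>" "0 < g \<longleftrightarrow> 0 < ang d \<and> ang d < \<epsilon>"
proof -
  define \<theta> where "\<theta> = ang d"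
  have dd: "d = - cis \<theta>" using cis_ang(2)[OF d] by (simp add: \<theta>_def)
  have \<theta>: "0 \<le> \<theta>" "\<theta> < 2 * pi" "\<theta> \<noteq> \<epsilon>"
    using ang_bounds[of d] ne cis_ang(1)[OF d] by (auto simp: \<theta>_def)
  have c1: "cos x < 1" if "\<bar>x\<bar> < 2 * pi" "x \<noteq> 0" for x :: real
  proof -
    have "sin (\<bar>x\<bar> / 2) > 0" using that by (intro sin_gt_zero) auto
    then have "cos (2 * (\<bar>x\<bar> / 2)) < 1" unfolding cos_double_sin by simp
    then show ?thesis by simp
  qed
  have c: "cos (\<epsilon> - \<theta>) < 1" "cos \<epsilon> < 1" using c1 \<epsilon> \<theta> by auto
  have "\<i> * (cis (pi + \<epsilon>) + d) / (cis (pi + \<epsilon>) - d) = complex_of_real (sin (\<epsilon> - \<theta>) / (1 - cos (\<epsilon> - \<theta>)))"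
  proof -
    have n0: "cis (pi + \<epsilon>) - d \<noteq> 0" using ne by simp
    have eq: "\<i> * (cis (pi + \<epsilon>) + d) * complex_of_real (1 - cos (\<epsilon> - \<theta>)) = complex_of_real (sin (\<epsilon> - \<theta>)) * (cis (pi + \<epsilon>) - d)"
    proof -
      have p: "(cos \<epsilon>)\<^sup>2 = 1 - (sin \<epsilon>)\<^sup>2" "(cos \<theta>)\<^sup>2 = 1 - (sin \<theta>)\<^sup>2"
        by (simp_all add: cos_squared_eq)
      show ?thesis
        unfolding dd cis_pi_add complex_eq_iff
        by (simp add: cos_diff sin_diff) (use p in algebra)
    qed
    show ?thesis using eq n0 c by (simp add: divide_simps)
  qed
  then have g: "g = sin (\<epsilon> - \<theta>) / (1 - cos (\<epsilon> - \<theta>)) - sin \<epsilon> / (1 - cos \<epsilon>)"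
    by (simp only: g_def Re_complex_of_real)
  define D where "D = (1 - cos (\<epsilon> - \<theta>)) * (1 - cos \<epsilon>)"
  have D: "D > 0" using c by (simp add: D_def)
  have "g * D = sin (\<epsilon> - \<theta>) * (1 - cos \<epsilon>) - sin \<epsilon> * (1 - cos (\<epsilon> - \<theta>))"
  proof -
    have "(x / a - y / b) * (a * b) = x * b - y * a" if "a \<noteq> 0" "b \<noteq> 0" for a b x y :: real
      using that by (simp add: field_simps)
    then show ?thesis unfolding g D_def using c by simp
  qed
  also have "\<dots> = 4 * sin ((\<epsilon> - \<theta>) / 2) * sin (\<theta> / 2) * sin (\<epsilon> / 2)"
  proof -
    have id: "sin (2 * a) * (1 - cos (2 * (a + b))) - sin (2 * (a + b)) * (1 - cos (2 * a)) = 4 * sin a * sin b * sin (a + b)" for a b :: real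
    proof -
      have p: "(cos a)\<^sup>2 = 1 - (sin a)\<^sup>2" "(cos b)\<^sup>2 = 1 - (sin b)\<^sup>2"
        by (simp_all add: cos_squared_eq)
      show ?thesis
        unfolding sin_double cos_double_sin sin_add cos_add
        using p by algebra
    qed
    have e: "2 * ((\<epsilon> - \<theta>) / 2) = \<epsilon> - \<theta>" "(\<epsilon> - \<theta>) / 2 + \<theta> / 2 = \<epsilon> / 2" "2 * (\<epsilon> / 2) = \<epsilon>"
      by (simp_all add: field_simps)
    show ?thesis
      using id[of "(\<epsilon> - \<theta>) / 2" "\<theta> / 2"] unfolding e .
  qed
  finally have gD: "g * D = 4 * sin ((\<epsilon> - \<theta>) / 2) * sin (\<theta> / 2) * sin (\<epsilon> / 2)" .
  have se: "sin (\<epsilon> / 2) > 0" using \<epsilon> by (intro sin_gt_zero) auto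
  have g0: "0 \<le> g \<longleftrightarrow> 0 \<le> g * D" "0 < g \<longleftrightarrow> 0 < g * D"
    using D by (simp_all add: zero_le_mult_iff zero_less_mult_iff)
  consider "\<theta> = 0" | "0 < \<theta>" "\<theta> < \<epsilon>" | "\<epsilon> < \<theta>" using \<theta> by linarith
  then have "(0 \<le> g * D \<longleftrightarrow> \<theta> < \<epsilon>) \<and> (0 < g * D \<longleftrightarrow> 0 < \<theta> \<and> \<theta> < \<epsilon>)"
  proof cases
    case 1 then show ?thesis using \<epsilon> by (simp add: gD)
  next
    case 2
    have "sin ((\<epsilon> - \<theta>) / 2) > 0" "sin (\<theta> / 2) > 0" using 2 \<epsilon> \<theta> by (auto intro!: sin_gt_zero)
    then have "g * D > 0" unfolding gD using se by simp
    then show ?thesis using 2 by simp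
  next
    case 3
    have "sin ((\<theta> - \<epsilon>) / 2) > 0" "sin (\<theta> / 2) > 0" using 3 \<epsilon> \<theta> by (auto intro!: sin_gt_zero)
    then have "- (g * D) > 0" unfolding gD
      using se sin_minus[of "(\<epsilon> - \<theta>) / 2"] by (simp add: minus_divide_left mult_less_0_iff)
    then show ?thesis using 3 by simp
  qed
  then show "0 \<le> g \<longleftrightarrow> ang d < \<epsilon>" "0 < g \<longleftrightarrow> 0 < ang d \<and> ang d < \<epsilon>"
    unfolding g0 \<theta>_def by auto
qed

text \<open>
  In a basis of eigenvectors of \<open>W\<close> the form is diagonal, with a nonnegative weight exactly for the
  eigenvalues on the half-open arc and weight zero for the eigenvalue \<open>-1\<close>.
\<close>
lemma gform_diagonal:
  fixes W :: "complex ^ 'm ^ 'm"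
  assumes W: "unitary W" and \<epsilon>: "0 < \<epsilon>" "\<epsilon> < 2 * pi" and z: "cis (pi + \<epsilon>) \<notin> mspectrum W"
  obtains P and \<gamma> :: "'m \<Rightarrow> real" where "unitary P"
    "\<And>v. gform \<epsilon> W v = (\<Sum>i\<in>UNIV. \<gamma> i * (norm ((P *v v) $ i))\<^sup>2)"
    "card {i. 0 \<le> \<gamma> i} = kcount W \<epsilon>"
    "card {i. 0 < \<gamma> i} + crossing W = kcount W \<epsilon>"
proof -
  let ?z = "cis (pi + \<epsilon>)"
  obtain P where P: "unitary P" "W = P ** diagm (evals W) ** adj P" using evals[OF W] .
  let ?d = "evals W"
  note n = norm_evals[OF W]
  have ne: "?z \<noteq> ?d i" for i using z by (auto simp: mspectrum_evals[OF W])
  define \<gamma> where "\<gamma> i = Re (\<i> * (?z + ?d i) / (?z - ?d i)) - sin \<epsilon> / (1 - cos \<epsilon>)" for i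
  have PP: "adj P *v (P *v x) = x" "P *v (adj P *v x) = x" for x
    using P(1) unitary_right[OF P(1)] by (auto simp: matrix_vector_mul_assoc unitary_def)
  have WP: "W *v (P *v x) = P *v (\<chi> i. ?d i * x $ i)" for x
    by (subst P(2)) (simp add: matrix_vector_mul_assoc[symmetric] PP)
  have form: "gform \<epsilon> W v = (\<Sum>i\<in>UNIV. \<gamma> i * (norm ((adj P *v v) $ i))\<^sup>2)" for v
  proof -
    define c where "c = adj P *v v"
    have v: "v = P *v c" by (simp add: c_def PP)
    define r where "r = (\<chi> i. c $ i / (?z - ?d i))"
    have "(mat ?z - W) *v (P *v r) = P *v (?z *s r - (\<chi> i. ?d i * r $ i))"
      by (simp add: matrix_vector_mult_diff_rdistrib WP matrix_vector_mult_diff_distrib vec.scale)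
    also have "?z *s r - (\<chi> i. ?d i * r $ i) = c"
      using ne by (simp add: vec_eq_iff r_def left_diff_distrib[symmetric] diff_divide_distrib[symmetric])
    finally have "matrix_inv (mat ?z - W) *v v = P *v r"
      using resolvent(2)[OF z, of "P *v r"] by (simp add: v)
    then have "cayley ?z W *v v = P *v (\<i> *s (?z *s r + (\<chi> i. ?d i * r $ i)))"
      by (simp add: cayley_vector WP matrix_vector_right_distrib vec.scale)
    also have "\<i> *s (?z *s r + (\<chi> i. ?d i * r $ i)) = (\<chi> i. (\<i> * (?z + ?d i) / (?z - ?d i)) * c $ i)"
      by (simp add: vec_eq_iff r_def add_divide_distrib ring_distribs mult_ac)
    finally have C: "cayley ?z W *v v = P *v (\<chi> i. (\<i> * (?z + ?d i) / (?z - ?d i)) * c $ i)" .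
    have sq: "(a * x) \<bullet> x = Re a * (norm x)\<^sup>2" for a x :: complex
      unfolding cmod_power2 by (simp add: inner_complex_def power2_eq_square algebra_simps)
    have "(cayley ?z W *v v) \<bullet> v = (\<chi> i. (\<i> * (?z + ?d i) / (?z - ?d i)) * c $ i) \<bullet> c"
      unfolding C inner_adj by (simp add: c_def)
    also have "\<dots> = (\<Sum>i\<in>UNIV. Re (\<i> * (?z + ?d i) / (?z - ?d i)) * (norm (c $ i))\<^sup>2)"
      unfolding inner_vec_def vec_lambda_beta sq by simp
    finally have 1: "(cayley ?z W *v v) \<bullet> v = (\<Sum>i\<in>UNIV. Re (\<i> * (?z + ?d i) / (?z - ?d i)) * (norm (c $ i))\<^sup>2)" .
    have "v \<bullet> v = c \<bullet> c" by (simp add: v inner_adj PP)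
    also have "\<dots> = (\<Sum>i\<in>UNIV. (norm (c $ i))\<^sup>2)"
      by (simp add: inner_vec_def power2_norm_eq_inner)
    finally have 2: "v \<bullet> v = (\<Sum>i\<in>UNIV. (norm (c $ i))\<^sup>2)" .
    show ?thesis
      unfolding gform_def 1 2 c_def[symmetric] \<gamma>_def
      by (simp only: sum_distrib_left sum_subtractf[symmetric] left_diff_distrib)
  qed
  have s: "0 \<le> \<gamma> i \<longleftrightarrow> ang (?d i) < \<epsilon>" "0 < \<gamma> i \<longleftrightarrow> 0 < ang (?d i) \<and> ang (?d i) < \<epsilon>" for i
    using cayley_scalar_sign[OF n \<epsilon> ne] by (simp_all add: \<gamma>_def)
  have k: "card {i. 0 \<le> \<gamma> i} = kcount W \<epsilon>"
    by (simp add: s kcount_evals[OF W \<epsilon>(2)])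
  have "{i. 0 \<le> \<gamma> i} = {i. 0 < \<gamma> i} \<union> {i. ang (?d i) = 0}"
    using s \<epsilon> ang_bounds by (auto simp: order.order_iff_strict)
  moreover have "{i. 0 < \<gamma> i} \<inter> {i. ang (?d i) = 0} = {}" by (auto simp: s)
  ultimately have "card {i. 0 \<le> \<gamma> i} = card {i. 0 < \<gamma> i} + crossing W"
    by (simp add: card_Un_disjoint crossing_evals[OF W])
  then show ?thesis using that[OF unitary_adj[OF P(1)] form k] k by simp
qed

text \<open>
  The conditions are fewer linear equations than there are unknowns.
\<close>
lemma common_zero_vector:
  fixes P Q :: "complex ^ 'm ^ 'm"
  assumes "card A + card B < CARD('m)"
  obtains v where "v \<noteq> 0" "\<And>i. i \<in> A \<Longrightarrow> (P *v v) $ i = 0" "\<And>i. i \<in> B \<Longrightarrow> (Q *v v) $ i = 0"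
proof -
  have "card B < card (- A)"
    using assms by (simp add: Compl_eq_Diff_UNIV card_Diff_subset)
  then obtain Y where Y: "Y \<subseteq> - A" "card Y = card B"
    by (meson less_imp_le obtain_subset_with_card_n)
  then obtain g where g: "bij_betw g Y B"
    by (metis finite_same_card_bij finite)
  have "Y \<noteq> - A" using Y \<open>card B < card (- A)\<close> by auto
  then obtain k where k: "k \<notin> A" "k \<notin> Y" using Y by auto
  define M where "M = (\<chi> i j. if i \<in> A then P $ i $ j else if i \<in> Y then Q $ g i $ j else 0)"
  have "M $ k $ j = 0" for j using k by (simp add: M_def)
  then obtain v where v: "v \<noteq> 0" "M *v v = 0" using zero_row_kernel by blast
  have "(P *v v) $ i = 0" if "i \<in> A" for i
  proof -
    have "(M *v v) $ i = (P *v v) $ i" using that by (simp add: matrix_vector_mult_def M_def)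
    then show ?thesis using v by simp
  qed
  moreover have "(Q *v v) $ i = 0" if "i \<in> B" for i
  proof -
    have "i \<in> g ` Y" using g that by (simp add: bij_betw_def)
    then obtain y where y: "y \<in> Y" "g y = i" by blast
    then have "(M *v v) $ y = (Q *v v) $ i" using Y by (auto simp: matrix_vector_mult_def M_def)
    then show ?thesis using v by simp
  qed
  ultimately show ?thesis using that v by blast
qed

lemma sum_sq_unitary:
  assumes "unitary P" shows "(\<Sum>i\<in>UNIV. (norm ((P *v v) $ i))\<^sup>2) = (norm v)\<^sup>2"
proof -
  have "(\<Sum>i\<in>UNIV. (norm ((P *v v) $ i))\<^sup>2) = (P *v v) \<bullet> (P *v v)"
    by (simp add: inner_vec_def power2_norm_eq_inner)
  then show ?thesis by (simp add: dot_square_norm unitary_norm[OF assms])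
qed

lemma weighted_sum_bounds:
  fixes P :: "complex ^ 'm ^ 'm" and \<gamma> :: "'m \<Rightarrow> real"
  assumes P: "unitary P" and v: "\<And>i. i \<in> A \<Longrightarrow> (P *v v) $ i = 0"
  shows "(\<And>i. i \<notin> A \<Longrightarrow> c \<le> \<gamma> i) \<Longrightarrow> c * (norm v)\<^sup>2 \<le> (\<Sum>i\<in>UNIV. \<gamma> i * (norm ((P *v v) $ i))\<^sup>2)"
    and "(\<And>i. i \<notin> A \<Longrightarrow> \<gamma> i \<le> c) \<Longrightarrow> (\<Sum>i\<in>UNIV. \<gamma> i * (norm ((P *v v) $ i))\<^sup>2) \<le> c * (norm v)\<^sup>2"
proof -
  assume "\<And>i. i \<notin> A \<Longrightarrow> c \<le> \<gamma> i"
  then show "c * (norm v)\<^sup>2 \<le> (\<Sum>i\<in>UNIV. \<gamma> i * (norm ((P *v v) $ i))\<^sup>2)"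
    unfolding sum_sq_unitary[OF P, symmetric] sum_distrib_left
    by (intro sum_mono) (metis mult_right_mono norm_zero v zero_le_power2 mult_zero_right power_zero_numeral order_refl)
next
  assume "\<And>i. i \<notin> A \<Longrightarrow> \<gamma> i \<le> c"
  then show "(\<Sum>i\<in>UNIV. \<gamma> i * (norm ((P *v v) $ i))\<^sup>2) \<le> c * (norm v)\<^sup>2"
    unfolding sum_sq_unitary[OF P, symmetric] sum_distrib_left
    by (intro sum_mono) (metis mult_right_mono norm_zero v zero_le_power2 mult_zero_right power_zero_numeral order_refl)
qed

text \<open>
  Comparison of the numbers of nonnegative and of positive weights of two forms.  A nonzero vector in the
  intersection of a space on which one form is nonnegative and a space on which the other one is negative
  contradicts the assumed inequality, so the dimensions of two such spaces add up to at most \<open>n\<close>.  The constant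
  \<open>c\<close> is a gap between \<open>0\<close> and the nonzero weights of \<open>W\<close>, so that inequalities up to a multiple of it
  suffice; this covers both nearby matrices and weak monotonicity.
\<close>
lemma index_comparison:
  fixes W :: "complex ^ 'm ^ 'm"
  assumes W: "unitary W" and \<epsilon>: "0 < \<epsilon>" "\<epsilon> < 2 * pi" and z: "cis (pi + \<epsilon>) \<notin> mspectrum W"
  shows "\<exists>c>0. \<forall>W'. unitary W' \<longrightarrow> cis (pi + \<epsilon>) \<notin> mspectrum W' \<longrightarrow>
       ((\<forall>v. v \<noteq> 0 \<longrightarrow> gform \<epsilon> W' v < gform \<epsilon> W v + c * (norm v)\<^sup>2) \<longrightarrow> kcount W' \<epsilon> \<le> kcount W \<epsilon>) \<and>
       ((\<forall>v. v \<noteq> 0 \<longrightarrow> gform \<epsilon> W v < gform \<epsilon> W' v + c * (norm v)\<^sup>2) \<longrightarrow>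
         kcount W \<epsilon> + crossing W' \<le> kcount W' \<epsilon> + crossing W) \<and>
       ((\<forall>v. v \<noteq> 0 \<longrightarrow> gform \<epsilon> W v < gform \<epsilon> W' v) \<longrightarrow> kcount W \<epsilon> + crossing W' \<le> kcount W' \<epsilon>)"
proof -
  obtain P \<gamma> where P: "unitary P" and g: "\<And>v. gform \<epsilon> W v = (\<Sum>i\<in>UNIV. \<gamma> i * (norm ((P *v v) $ i))\<^sup>2)"
    and k: "card {i. 0 \<le> \<gamma> i} = kcount W \<epsilon>" "card {i. 0 < \<gamma> i} + crossing W = kcount W \<epsilon>"
    using gform_diagonal[OF W \<epsilon> z] by blast
  define c where "c = Min (insert 1 ((\<lambda>i. \<bar>\<gamma> i\<bar>) ` {i. \<gamma> i \<noteq> 0}))"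
  have c: "c > 0" unfolding c_def by (subst Min_gr_iff) auto
  have cm: "c \<le> \<bar>\<gamma> i\<bar>" if "\<gamma> i \<noteq> 0" for i unfolding c_def using that by (intro Min_le) auto
  have compl: "card {i. \<not> Q i} + card {i. Q i} = CARD('m)" for Q :: "'m \<Rightarrow> bool"
  proof -
    have "card ({i. \<not> Q i} \<union> {i. Q i}) = card {i. \<not> Q i} + card {i. Q i}"
      by (intro card_Un_disjoint) auto
    moreover have "{i. \<not> Q i} \<union> {i. Q i} = UNIV" by auto
    ultimately show ?thesis by simp
  qed
  show ?thesis
  proof (intro exI[of _ c] conjI allI impI c)
    fix W' :: "complex ^ 'm ^ 'm" assume W': "unitary W'" "cis (pi + \<epsilon>) \<notin> mspectrum W'"
      and "\<forall>v. v \<noteq> 0 \<longrightarrow> gform \<epsilon> W' v < gform \<epsilon> W v + c * (norm v)\<^sup>2"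
    then have le: "\<And>v. v \<noteq> 0 \<Longrightarrow> gform \<epsilon> W' v < gform \<epsilon> W v + c * (norm v)\<^sup>2" by blast
    obtain P' \<gamma>' where P': "unitary P'" and g': "\<And>v. gform \<epsilon> W' v = (\<Sum>i\<in>UNIV. \<gamma>' i * (norm ((P' *v v) $ i))\<^sup>2)"
      and k': "card {i. 0 \<le> \<gamma>' i} = kcount W' \<epsilon>" "card {i. 0 < \<gamma>' i} + crossing W' = kcount W' \<epsilon>"
      using gform_diagonal[OF W'(1) \<epsilon> W'(2)] by blast
    show "kcount W' \<epsilon> \<le> kcount W \<epsilon>"
    proof (rule ccontr)
      assume "\<not> ?thesis"
      then have "card {i. 0 \<le> \<gamma> i} + card {i. \<not> 0 \<le> \<gamma>' i} < CARD('m)"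
        using k k' compl[of "\<lambda>i. 0 \<le> \<gamma>' i"] by linarith
      then obtain v where v: "v \<noteq> 0" "\<And>i. i \<in> {i. 0 \<le> \<gamma> i} \<Longrightarrow> (P *v v) $ i = 0"
        "\<And>i. i \<in> {i. \<not> 0 \<le> \<gamma>' i} \<Longrightarrow> (P' *v v) $ i = 0" using common_zero_vector by blast
      have "0 * (norm v)\<^sup>2 \<le> gform \<epsilon> W' v"
        unfolding g' by (rule weighted_sum_bounds(1)[where A = "{i. \<not> 0 \<le> \<gamma>' i}", OF P' v(3)]) auto
      moreover have "gform \<epsilon> W v \<le> (- c) * (norm v)\<^sup>2"
      proof -
        have neg: "\<gamma> i \<le> - c" if "\<not> 0 \<le> \<gamma> i" for i using cm[of i] that by auto
        show ?thesis
          unfolding g by (rule weighted_sum_bounds(2)[where A = "{i. 0 \<le> \<gamma> i}", OF P v(2)]) (use neg in auto)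
      qed
      ultimately show False using le[OF v(1)] by simp
    qed
  next
    fix W' :: "complex ^ 'm ^ 'm" assume W': "unitary W'" "cis (pi + \<epsilon>) \<notin> mspectrum W'"
      and "\<forall>v. v \<noteq> 0 \<longrightarrow> gform \<epsilon> W v < gform \<epsilon> W' v + c * (norm v)\<^sup>2"
    then have le: "\<And>v. v \<noteq> 0 \<Longrightarrow> gform \<epsilon> W v < gform \<epsilon> W' v + c * (norm v)\<^sup>2" by blast
    obtain P' \<gamma>' where P': "unitary P'" and g': "\<And>v. gform \<epsilon> W' v = (\<Sum>i\<in>UNIV. \<gamma>' i * (norm ((P' *v v) $ i))\<^sup>2)"
      and k': "card {i. 0 \<le> \<gamma>' i} = kcount W' \<epsilon>" "card {i. 0 < \<gamma>' i} + crossing W' = kcount W' \<epsilon>"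
      using gform_diagonal[OF W'(1) \<epsilon> W'(2)] by blast
    show "kcount W \<epsilon> + crossing W' \<le> kcount W' \<epsilon> + crossing W"
    proof (rule ccontr)
      assume "\<not> ?thesis"
      then have "card {i. \<not> 0 < \<gamma> i} + card {i. 0 < \<gamma>' i} < CARD('m)"
        using k k' compl[of "\<lambda>i. 0 < \<gamma> i"] by linarith
      then obtain v where v: "v \<noteq> 0" "\<And>i. i \<in> {i. \<not> 0 < \<gamma> i} \<Longrightarrow> (P *v v) $ i = 0"
        "\<And>i. i \<in> {i. 0 < \<gamma>' i} \<Longrightarrow> (P' *v v) $ i = 0" using common_zero_vector by blast
      have "gform \<epsilon> W' v \<le> 0 * (norm v)\<^sup>2"
        unfolding g' by (rule weighted_sum_bounds(2)[where A = "{i. 0 < \<gamma>' i}", OF P' v(3)]) auto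
      moreover have "c * (norm v)\<^sup>2 \<le> gform \<epsilon> W v"
      proof -
        have pos: "c \<le> \<gamma> i" if "0 < \<gamma> i" for i using cm[of i] that by auto
        show ?thesis
          unfolding g by (rule weighted_sum_bounds(1)[where A = "{i. \<not> 0 < \<gamma> i}", OF P v(2)]) (use pos in auto)
      qed
      ultimately show False using le[OF v(1)] by simp
    qed
  next
    fix W' :: "complex ^ 'm ^ 'm" assume W': "unitary W'" "cis (pi + \<epsilon>) \<notin> mspectrum W'"
      and "\<forall>v. v \<noteq> 0 \<longrightarrow> gform \<epsilon> W v < gform \<epsilon> W' v"
    then have le: "\<And>v. v \<noteq> 0 \<Longrightarrow> gform \<epsilon> W v < gform \<epsilon> W' v" by blast
    obtain P' \<gamma>' where P': "unitary P'" and g': "\<And>v. gform \<epsilon> W' v = (\<Sum>i\<in>UNIV. \<gamma>' i * (norm ((P' *v v) $ i))\<^sup>2)"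
      and k': "card {i. 0 \<le> \<gamma>' i} = kcount W' \<epsilon>" "card {i. 0 < \<gamma>' i} + crossing W' = kcount W' \<epsilon>"
      using gform_diagonal[OF W'(1) \<epsilon> W'(2)] by blast
    show "kcount W \<epsilon> + crossing W' \<le> kcount W' \<epsilon>"
    proof (rule ccontr)
      assume "\<not> ?thesis"
      then have "card {i. \<not> 0 \<le> \<gamma> i} + card {i. 0 < \<gamma>' i} < CARD('m)"
        using k k' compl[of "\<lambda>i. 0 \<le> \<gamma> i"] by linarith
      then obtain v where v: "v \<noteq> 0" "\<And>i. i \<in> {i. \<not> 0 \<le> \<gamma> i} \<Longrightarrow> (P *v v) $ i = 0"
        "\<And>i. i \<in> {i. 0 < \<gamma>' i} \<Longrightarrow> (P' *v v) $ i = 0" using common_zero_vector by blast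
      have "gform \<epsilon> W' v \<le> 0 * (norm v)\<^sup>2"
        unfolding g' by (rule weighted_sum_bounds(2)[where A = "{i. 0 < \<gamma>' i}", OF P' v(3)]) auto
      moreover have "0 * (norm v)\<^sup>2 \<le> gform \<epsilon> W v"
        unfolding g by (rule weighted_sum_bounds(1)[where A = "{i. \<not> 0 \<le> \<gamma> i}", OF P v(2)]) auto
      ultimately show False using le[OF v(1)] by simp
    qed
  qed
qed

text \<open>
  Eigenvalues can enter or leave the arc only through its end \<open>-1\<close>: near \<open>W t\<close> the form changes by less
  than the gap in the comparison of indices.
\<close>
lemma kcount_semicontinuous:
  fixes W :: "'t::metric_space \<Rightarrow> complex ^ 'm ^ 'm"
  assumes Wc: "continuous_on D W" and W: "\<And>t. t \<in> D \<Longrightarrow> unitary (W t)" and t: "t \<in> D"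
    and \<epsilon>: "0 < \<epsilon>" "\<epsilon> < 2 * pi" and z: "cis (pi + \<epsilon>) \<notin> mspectrum (W t)"
  shows "\<exists>\<delta>>0. \<forall>s\<in>D. dist s t < \<delta> \<longrightarrow> cis (pi + \<epsilon>) \<notin> mspectrum (W s) \<and> kcount (W s) \<epsilon> \<le> kcount (W t) \<epsilon>
     \<and> kcount (W t) \<epsilon> + crossing (W s) \<le> kcount (W s) \<epsilon> + crossing (W t)"
proof -
  let ?z = "cis (pi + \<epsilon>)"
  obtain c where c: "c > 0"
    and k: "\<And>W'. unitary W' \<Longrightarrow> ?z \<notin> mspectrum W' \<Longrightarrow>
       \<forall>v. v \<noteq> 0 \<longrightarrow> gform \<epsilon> W' v < gform \<epsilon> (W t) v + c * (norm v)\<^sup>2 \<Longrightarrow> kcount W' \<epsilon> \<le> kcount (W t) \<epsilon>"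
    "\<And>W'. unitary W' \<Longrightarrow> ?z \<notin> mspectrum W' \<Longrightarrow>
       \<forall>v. v \<noteq> 0 \<longrightarrow> gform \<epsilon> (W t) v < gform \<epsilon> W' v + c * (norm v)\<^sup>2 \<Longrightarrow>
       kcount (W t) \<epsilon> + crossing W' \<le> kcount W' \<epsilon> + crossing (W t)"
    using index_comparison[OF W[OF t] \<epsilon> z] by blast
  obtain \<delta>1 where \<delta>1: "\<delta>1 > 0" "\<And>s. s \<in> D \<Longrightarrow> dist s t < \<delta>1 \<Longrightarrow> ?z \<notin> mspectrum (W s)"
    using mspectrum_locally_avoided[OF Wc t z] by blast
  obtain K where K: "K > 0" "\<And>(A :: complex ^ 'm ^ 'm) v. norm (A *v v) \<le> norm A * norm v * K"
    using bounded_bilinear.pos_bounded[OF bounded_bilinear_mv] by blast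
  let ?E = "D \<inter> ball t \<delta>1"
  have "continuous_on ?E (\<lambda>s. cayley ?z (W s))"
    unfolding cayley_def
    by (intro continuous_intros continuous_on_matrix_inv continuous_on_subset[OF Wc])
      (use \<delta>1 in \<open>auto simp: invertible_det_nz mspectrum_iff_det dist_commute\<close>)
  moreover have "t \<in> ?E" "c / K > 0" using t \<delta>1 c K by auto
  ultimately obtain \<delta>2 where \<delta>2: "\<delta>2 > 0" "\<And>s. s \<in> ?E \<Longrightarrow> dist s t < \<delta>2 \<Longrightarrow> norm (cayley ?z (W s) - cayley ?z (W t)) < c / K"
    unfolding continuous_on_iff dist_norm by blast
  show ?thesis
  proof (intro exI[of _ "min \<delta>1 \<delta>2"] conjI ballI impI)
    show "min \<delta>1 \<delta>2 > 0" using \<delta>1 \<delta>2 by simp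
    fix s assume s: "s \<in> D" "dist s t < min \<delta>1 \<delta>2"
    show av: "?z \<notin> mspectrum (W s)" using s \<delta>1 by auto
    have close: "\<bar>gform \<epsilon> (W s) v - gform \<epsilon> (W t) v\<bar> < c * (norm v)\<^sup>2" if "v \<noteq> 0" for v
    proof -
      let ?C = "cayley ?z (W s) - cayley ?z (W t)"
      have "gform \<epsilon> (W s) v - gform \<epsilon> (W t) v = (?C *v v) \<bullet> v"
        by (simp add: gform_def matrix_vector_mult_diff_rdistrib inner_diff_left)
      also have "\<bar>\<dots>\<bar> \<le> norm (?C *v v) * norm v" by (rule Cauchy_Schwarz_ineq2)
      also have "\<dots> \<le> (norm ?C * norm v * K) * norm v" using K by (intro mult_right_mono) auto
      also have "\<dots> = norm ?C * (K * (norm v)\<^sup>2)" by (simp add: power2_eq_square)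
      also have "\<dots> < c / K * (K * (norm v)\<^sup>2)"
        using \<delta>2(2)[of s] s K that by (intro mult_strict_right_mono) (auto simp: dist_commute)
      finally show ?thesis using K by simp
    qed
    show "kcount (W s) \<epsilon> \<le> kcount (W t) \<epsilon>"
      by (rule k(1)[OF W[OF s(1)] av]) (use close in \<open>fastforce simp: abs_less_iff\<close>)
    show "kcount (W t) \<epsilon> + crossing (W s) \<le> kcount (W s) \<epsilon> + crossing (W t)"
      by (rule k(2)[OF W[OF s(1)] av]) (use close in \<open>fastforce simp: abs_less_iff\<close>)
  qed
qed

section \<open>Local behaviour of the flow\<close>

text \<open>
  The semicontinuity of the eigenvalue count on an arc, restated for the flow function: \<open>m\<close> is upper
  semicontinuous, and \<open>m\<close> minus the crossing number is lower semicontinuous.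
\<close>
lemma flow_local:
  fixes W :: "'t::real_normed_vector \<Rightarrow> complex ^ 'm ^ 'm"
  assumes m: "flow_function D W m" and D: "convex D" and Wc: "continuous_on D W"
    and W: "\<And>t. t \<in> D \<Longrightarrow> unitary (W t)" and t: "t \<in> D"
  obtains \<epsilon> \<delta> c where "0 < \<epsilon>" "\<epsilon> < 2 * pi" "\<delta> > 0"
    "\<And>s. s \<in> D \<Longrightarrow> dist s t < \<delta> \<Longrightarrow> cis (pi + \<epsilon>) \<notin> mspectrum (W s)"
    "\<And>s. s \<in> D \<Longrightarrow> dist s t < \<delta> \<Longrightarrow> m s = c + int (kcount (W s) \<epsilon>)"
    "\<And>s. s \<in> D \<Longrightarrow> dist s t < \<delta> \<Longrightarrow> m s \<le> m t"
    "\<And>s. s \<in> D \<Longrightarrow> dist s t < \<delta> \<Longrightarrow> m t - int (crossing (W t)) \<le> m s - int (crossing (W s))"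
proof -
  obtain \<epsilon> where \<epsilon>: "0 < \<epsilon>" "\<epsilon> < pi" "cis (pi + \<epsilon>) \<notin> mspectrum (W t)"
    using avoiding_angle[OF W[OF t]] by blast
  then have \<epsilon>2: "\<epsilon> < 2 * pi" by simp
  obtain \<delta> where \<delta>: "\<delta> > 0" and loc: "\<And>s. s \<in> D \<Longrightarrow> dist s t < \<delta> \<Longrightarrow> cis (pi + \<epsilon>) \<notin> mspectrum (W s)
     \<and> kcount (W s) \<epsilon> \<le> kcount (W t) \<epsilon> \<and> kcount (W t) \<epsilon> + crossing (W s) \<le> kcount (W s) \<epsilon> + crossing (W t)"
    using kcount_semicontinuous[OF Wc W t \<epsilon>(1) \<epsilon>2 \<epsilon>(3)] by blast
  obtain c where c: "\<And>s. s \<in> D \<inter> ball t \<delta> \<Longrightarrow> m s = c + int (kcount (W s) \<epsilon>)"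
  proof (rule flow_functionD[OF m, of "D \<inter> ball t \<delta>" \<epsilon>])
    show "convex (D \<inter> ball t \<delta>)" using D by (simp add: convex_Int)
    show "cis (pi + \<epsilon>) \<notin> mspectrum (W s)" if "s \<in> D \<inter> ball t \<delta>" for s
      using loc that by (simp add: dist_commute)
  qed (use \<epsilon> \<epsilon>2 in auto)
  have mt: "m t = c + int (kcount (W t) \<epsilon>)" using c t \<delta> by simp
  have ms: "m s = c + int (kcount (W s) \<epsilon>)" if "s \<in> D" "dist s t < \<delta>" for s
    using c that by (simp add: dist_commute)
  show ?thesis
  proof (rule that[OF \<epsilon>(1) \<epsilon>2 \<delta>])
    fix s assume s: "s \<in> D" "dist s t < \<delta>"
    note l = loc[OF s] and k = ms[OF s]
    show "cis (pi + \<epsilon>) \<notin> mspectrum (W s)" using l by blast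
    show "m s = c + int (kcount (W s) \<epsilon>)" by (rule k)
    show "m s \<le> m t" using l k mt by linarith
    show "m t - int (crossing (W t)) \<le> m s - int (crossing (W s))" using l k mt by linarith
  qed
qed

text \<open>
  With a constant crossing number the two semicontinuity properties make the flow locally constant.
\<close>
lemma flow_constant:
  fixes W :: "'t::real_normed_vector \<Rightarrow> complex ^ 'm ^ 'm"
  assumes m: "flow_function D W m" and D: "convex D" and Wc: "continuous_on D W"
    and W: "\<And>t. t \<in> D \<Longrightarrow> unitary (W t)"
    and k: "\<And>t. t \<in> D \<Longrightarrow> crossing (W t) = k" and st: "s \<in> D" "t \<in> D"
  shows "m s = m t"
proof (rule connected_local_const[OF convex_connected[OF D] st], rule ballI)
  fix u assume u: "u \<in> D"
  obtain \<epsilon> \<delta> c where \<delta>: "\<delta> > 0" "\<And>s. s \<in> D \<Longrightarrow> dist s u < \<delta> \<Longrightarrow> m s \<le> m u"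
    "\<And>s. s \<in> D \<Longrightarrow> dist s u < \<delta> \<Longrightarrow> m u - int (crossing (W u)) \<le> m s - int (crossing (W s))"
    using flow_local[OF m D Wc W u] by metis
  show "\<forall>\<^sub>F b in at u within D. m u = m b"
    unfolding eventually_at using \<delta> k u by (intro exI[of _ \<delta>]) (auto intro!: antisym)
qed

text \<open>
  Near each point both functions differ from the same eigenvalue count by a constant.
\<close>
lemma flow_function_unique:
  fixes W :: "'t::real_normed_vector \<Rightarrow> complex ^ 'm ^ 'm"
  assumes m: "flow_function D W m" "flow_function D W m'" and D: "convex D" and Wc: "continuous_on D W"
    and W: "\<And>t. t \<in> D \<Longrightarrow> unitary (W t)" and st: "s \<in> D" "t \<in> D"
  shows "m s - m' s = m t - m' t"
proof (rule connected_local_const[OF convex_connected[OF D] st], rule ballI)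
  fix u assume u: "u \<in> D"
  obtain \<epsilon> \<delta> c where \<delta>: "0 < \<epsilon>" "\<epsilon> < 2 * pi" "\<delta> > 0" "\<And>s. s \<in> D \<Longrightarrow> dist s u < \<delta> \<Longrightarrow> cis (pi + \<epsilon>) \<notin> mspectrum (W s)"
    "\<And>s. s \<in> D \<Longrightarrow> dist s u < \<delta> \<Longrightarrow> m s = c + int (kcount (W s) \<epsilon>)"
    using flow_local[OF m(1) D Wc W u] by metis
  obtain c' where c': "\<And>s. s \<in> D \<inter> ball u \<delta> \<Longrightarrow> m' s = c' + int (kcount (W s) \<epsilon>)"
    using flow_functionD[OF m(2), of "D \<inter> ball u \<delta>" \<epsilon>] \<delta> D
    by (metis IntE convex_Int convex_ball dist_commute inf_le1 mem_ball)
  show "\<forall>\<^sub>F b in at u within D. m u - m' u = m b - m' b"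
    unfolding eventually_at
  proof (intro exI[of _ \<delta>] conjI ballI impI)
    fix b assume b: "b \<in> D" "b \<noteq> u \<and> dist b u < \<delta>"
    have "m u = c + int (kcount (W u) \<epsilon>)" "m b = c + int (kcount (W b) \<epsilon>)"
      "m' u = c' + int (kcount (W u) \<epsilon>)" "m' b = c' + int (kcount (W b) \<epsilon>)"
      using \<delta>(5)[OF u] \<delta>(5)[OF b(1)] c'[of u] c'[of b] u b \<delta>(3) by (auto simp: dist_commute)
    then show "m u - m' u = m b - m' b" by simp
  qed (rule \<delta>)
qed

lemma flow_function_compose:
  assumes m: "flow_function D W m" and f: "\<And>T. convex T \<Longrightarrow> T \<subseteq> D' \<Longrightarrow> convex (f ` T)" "f ` D' \<subseteq> D"
  shows "flow_function D' (\<lambda>t. W (f t)) (\<lambda>t. m (f t))"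
  unfolding flow_function_def
proof (intro allI impI)
  fix T \<epsilon> assume T: "convex T" "T \<subseteq> D'" and \<epsilon>: "0 < \<epsilon>" "\<epsilon> < 2 * pi"
    and av: "\<forall>t\<in>T. cis (pi + \<epsilon>) \<notin> mspectrum (W (f t))"
  obtain c where "\<And>t. t \<in> f ` T \<Longrightarrow> m t = c + int (kcount (W t) \<epsilon>)"
  proof (rule flow_functionD[OF m, of "f ` T" \<epsilon>])
    show "convex (f ` T)" by (rule f(1)[OF T])
    show "f ` T \<subseteq> D" using f(2) T by blast
  qed (use av \<epsilon> in auto)
  then show "\<exists>c. \<forall>t\<in>T. m (f t) = c + int (kcount (W (f t)) \<epsilon>)" by blast
qed

section \<open>Monotone paths\<close>

text \<open>
  Both monotonicity claims compose, so by the Bolzano principle they only have to be proved on short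
  intervals, on which one point \<open>cis (pi + \<epsilon>)\<close> is avoided and the indices of the form can be compared.
\<close>
lemma flow_monotone:
  fixes W :: "real \<Rightarrow> complex ^ 'm ^ 'm"
  assumes m: "flow_function {a..b} W m" and Wc: "continuous_on {a..b} W"
    and W: "\<And>t. t \<in> {a..b} \<Longrightarrow> unitary (W t)"
    and mono: "\<And>\<epsilon> s t v. 0 < \<epsilon> \<Longrightarrow> \<epsilon> < 2 * pi \<Longrightarrow> a \<le> s \<Longrightarrow> s \<le> t \<Longrightarrow> t \<le> b \<Longrightarrow>
       (\<And>u. u \<in> {s..t} \<Longrightarrow> cis (pi + \<epsilon>) \<notin> mspectrum (W u)) \<Longrightarrow> gform \<epsilon> (W s) v \<le> gform \<epsilon> (W t) v"
    and st: "a \<le> s" "s \<le> t" "t \<le> b"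
  shows "m s \<le> m t \<and> m s - int (crossing (W s)) \<le> m t - int (crossing (W t))"
proof -
  define P where "P s t \<longleftrightarrow> (a \<le> s \<longrightarrow> s \<le> t \<longrightarrow> t \<le> b \<longrightarrow> m s \<le> m t \<and> m s - int (crossing (W s)) \<le> m t - int (crossing (W t)))" for s t
  have "P s t" using st(2)
  proof (induction rule: Bolzano)
    case (trans x y z) then show ?case unfolding P_def by force
  next
    case (local x)
    show ?case
    proof (cases "x \<in> {a..b}")
      case False
      then show ?thesis using st local by auto
    next
      case True
      obtain \<epsilon> \<delta> c where \<epsilon>: "0 < \<epsilon>" "\<epsilon> < 2 * pi" and \<delta>: "\<delta> > 0" "\<And>s. s \<in> {a..b} \<Longrightarrow> dist s x < \<delta> \<Longrightarrow> cis (pi + \<epsilon>) \<notin> mspectrum (W s)"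
        "\<And>s. s \<in> {a..b} \<Longrightarrow> dist s x < \<delta> \<Longrightarrow> m s = c + int (kcount (W s) \<epsilon>)"
        using flow_local[OF m convex_real_interval(5) Wc W True] by metis
      have "P p q" if pq: "p \<le> x \<and> x \<le> q \<and> q - p < \<delta>" for p q
        unfolding P_def
      proof (intro impI)
        assume r: "a \<le> p" "p \<le> q" "q \<le> b"
        have near: "u \<in> {a..b}" "dist u x < \<delta>" if "u \<in> {p..q}" for u
          using that pq r by (auto simp: dist_real_def)
        have pq': "p \<in> {p..q}" "q \<in> {p..q}" using r by auto
        note Wp = W[OF near(1)[OF pq'(1)]] and Wq = W[OF near(1)[OF pq'(2)]]
        note zp = \<delta>(2)[OF near[OF pq'(1)]] and zq = \<delta>(2)[OF near[OF pq'(2)]]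
        have le: "gform \<epsilon> (W p) v \<le> gform \<epsilon> (W q) v" for v
          using mono[OF \<epsilon> r(1-3)] \<delta>(2) near by blast
        have less: "gform \<epsilon> (W p) v < gform \<epsilon> (W q) v + d * (norm v)\<^sup>2" if "d > 0" "v \<noteq> 0" for d v
        proof -
          have "d * (norm v)\<^sup>2 > 0" using that by simp
          then show ?thesis using le[of v] by linarith
        qed
        obtain d where d: "d > 0" "(\<forall>v. v \<noteq> 0 \<longrightarrow> gform \<epsilon> (W p) v < gform \<epsilon> (W q) v + d * (norm v)\<^sup>2) \<Longrightarrow> kcount (W p) \<epsilon> \<le> kcount (W q) \<epsilon>"
          using index_comparison[OF Wq \<epsilon> zq] Wp zp by blast
        obtain d' where d': "d' > 0" "(\<forall>v. v \<noteq> 0 \<longrightarrow> gform \<epsilon> (W p) v < gform \<epsilon> (W q) v + d' * (norm v)\<^sup>2)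
            \<Longrightarrow> kcount (W p) \<epsilon> + crossing (W q) \<le> kcount (W q) \<epsilon> + crossing (W p)"
          using index_comparison[OF Wp \<epsilon> zp] Wq zq by blast
        have "kcount (W p) \<epsilon> \<le> kcount (W q) \<epsilon>" using d less[OF d(1)] by blast
        moreover have "kcount (W p) \<epsilon> + crossing (W q) \<le> kcount (W q) \<epsilon> + crossing (W p)" using d' less[OF d'(1)] by blast
        ultimately show "m p \<le> m q \<and> m p - int (crossing (W p)) \<le> m q - int (crossing (W q))"
          using \<delta>(3)[OF near[OF pq'(1)]] \<delta>(3)[OF near[OF pq'(2)]] by linarith
      qed
      then show ?thesis using \<delta>(1) by blast
    qed
  qed
  then show ?thesis using st by (simp add: P_def)
qed

text \<open>
  If the form increases strictly, every crossing present at the right end of a short interval is a jump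
  of \<open>m\<close>; but \<open>m\<close> is upper semicontinuous at the left end, which leaves no room for a jump.
\<close>
lemma flow_strictly_monotone:
  fixes W :: "real \<Rightarrow> complex ^ 'm ^ 'm"
  assumes m: "flow_function {a..b} W m" and Wc: "continuous_on {a..b} W"
    and W: "\<And>t. t \<in> {a..b} \<Longrightarrow> unitary (W t)"
    and mono: "\<And>\<epsilon> s t v. 0 < \<epsilon> \<Longrightarrow> \<epsilon> < 2 * pi \<Longrightarrow> a \<le> s \<Longrightarrow> s < t \<Longrightarrow> t \<le> b \<Longrightarrow> v \<noteq> 0 \<Longrightarrow>
       (\<And>u. u \<in> {s..t} \<Longrightarrow> cis (pi + \<epsilon>) \<notin> mspectrum (W u)) \<Longrightarrow> gform \<epsilon> (W s) v < gform \<epsilon> (W t) v"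
  shows "a \<le> s \<Longrightarrow> s \<le> t \<Longrightarrow> t \<le> b \<Longrightarrow> m s \<le> m t \<and> m s - int (crossing (W s)) \<le> m t - int (crossing (W t))"
    and "a \<le> s \<Longrightarrow> s < t \<Longrightarrow> t \<le> b \<Longrightarrow> \<exists>x\<in>{s..t}. crossing (W x) = 0"
proof -
  have weak: "gform \<epsilon> (W s) v \<le> gform \<epsilon> (W t) v" if "0 < \<epsilon>" "\<epsilon> < 2 * pi" "a \<le> s" "s \<le> t" "t \<le> b"
      "\<And>u. u \<in> {s..t} \<Longrightarrow> cis (pi + \<epsilon>) \<notin> mspectrum (W u)" for \<epsilon> s t v
  proof (cases "s = t \<or> v = 0")
    case False
    then show ?thesis using mono[OF that(1,2,3) _ that(5) _ that(6)] that(4) by (simp add: less_imp_le)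
  qed (auto simp: gform_def)
  show "m s \<le> m t \<and> m s - int (crossing (W s)) \<le> m t - int (crossing (W t))" if "a \<le> s" "s \<le> t" "t \<le> b"
  proof (rule flow_monotone[OF m Wc W _ that])
    fix \<epsilon> s t v
    assume p: "0 < \<epsilon>" "\<epsilon> < 2 * pi" "a \<le> s" "s \<le> t" "t \<le> b"
      "\<And>u. u \<in> {s..t} \<Longrightarrow> cis (pi + \<epsilon>) \<notin> mspectrum (W u)"
    show "gform \<epsilon> (W s) v \<le> gform \<epsilon> (W t) v" by (rule weak[OF p])
  qed
  assume st: "a \<le> s" "s < t" "t \<le> b"
  have sD: "s \<in> {a..b}" using st by auto
  obtain \<epsilon> \<delta> c where \<epsilon>: "0 < \<epsilon>" "\<epsilon> < 2 * pi" and \<delta>: "\<delta> > 0" "\<And>u. u \<in> {a..b} \<Longrightarrow> dist u s < \<delta> \<Longrightarrow> cis (pi + \<epsilon>) \<notin> mspectrum (W u)"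
    "\<And>u. u \<in> {a..b} \<Longrightarrow> dist u s < \<delta> \<Longrightarrow> m u = c + int (kcount (W u) \<epsilon>)"
    "\<And>u. u \<in> {a..b} \<Longrightarrow> dist u s < \<delta> \<Longrightarrow> m u \<le> m s"
    using flow_local[OF m convex_real_interval(5) Wc W sD] by metis
  define u where "u = min t (s + \<delta> / 2)"
  have u: "s < u" "u \<le> t" "u - s < \<delta>" using st \<delta> by (auto simp: u_def)
  have near: "x \<in> {a..b}" "dist x s < \<delta>" if "x \<in> {s..u}" for x
    using that u st by (auto simp: dist_real_def)
  have su: "s \<in> {s..u}" "u \<in> {s..u}" using u by auto
  have "gform \<epsilon> (W s) v < gform \<epsilon> (W u) v" if "v \<noteq> 0" for v
    using mono[OF \<epsilon> st(1) u(1) _ that] u st near \<delta>(2) by (meson order_trans)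
  then have "kcount (W s) \<epsilon> + crossing (W u) \<le> kcount (W u) \<epsilon>"
    using index_comparison[OF W[OF near(1)[OF su(1)]] \<epsilon> \<delta>(2)[OF near[OF su(1)]]]
      W[OF near(1)[OF su(2)]] \<delta>(2)[OF near[OF su(2)]] by blast
  then have "m s + int (crossing (W u)) \<le> m u"
    using \<delta>(3)[OF near[OF su(1)]] \<delta>(3)[OF near[OF su(2)]] by linarith
  then have "crossing (W u) = 0" using \<delta>(4)[OF near[OF su(2)]] by simp
  then show "\<exists>x\<in>{s..t}. crossing (W x) = 0" using u by auto
qed

text \<open>
  At each point \<open>m\<close> is continuous from the right, and \<open>m - \<kappa>\<close> from the left, by monotonicity and
  semicontinuity.  Since \<open>\<kappa>\<close> vanishes on a dense set and is monotone on either side of a point, it vanishes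
  near that point, except at it.  So \<open>m\<close> is a step function whose jump on arrival at \<open>x\<close> is \<open>\<kappa> x\<close>.
\<close>
lemma jump_count:
  fixes m :: "real \<Rightarrow> int" and \<kappa> :: "real \<Rightarrow> nat"
  assumes ab: "a \<le> b"
    and mono: "\<And>s t. a \<le> s \<Longrightarrow> s \<le> t \<Longrightarrow> t \<le> b \<Longrightarrow> m s \<le> m t \<and> m s - int (\<kappa> s) \<le> m t - int (\<kappa> t)"
    and semi: "\<And>t. t \<in> {a..b} \<Longrightarrow> \<exists>\<delta>>0. \<forall>s\<in>{a..b}. dist s t < \<delta> \<longrightarrow> m s \<le> m t \<and> m t - int (\<kappa> t) \<le> m s - int (\<kappa> s)"
    and dense: "\<And>s t. a \<le> s \<Longrightarrow> s < t \<Longrightarrow> t \<le> b \<Longrightarrow> \<exists>x\<in>{s..t}. \<kappa> x = 0"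
  shows "finite {x \<in> {a<..b}. \<kappa> x \<noteq> 0} \<and> m b - m a = int (\<Sum>x\<in>{x \<in> {a<..b}. \<kappa> x \<noteq> 0}. \<kappa> x)"
proof -
  define Z where "Z s t = {x \<in> {s<..t}. \<kappa> x \<noteq> 0}" for s t
  define P where "P s t \<longleftrightarrow> (a \<le> s \<longrightarrow> s \<le> t \<longrightarrow> t \<le> b \<longrightarrow> finite (Z s t) \<and> m t - m s = int (\<Sum>x\<in>Z s t. \<kappa> x))" for s t
  \<comment> \<open>Right of \<open>t\<close> the function \<open>m\<close> is constant, so \<open>\<kappa>\<close> decreases there and is zero right of each of its zeros.\<close>
  have right: "m s = m t \<and> \<kappa> s = 0" if ts: "a \<le> t" "t < s" "s \<le> b"
    and usc: "\<And>u. t \<le> u \<Longrightarrow> u \<le> s \<Longrightarrow> m u \<le> m t" for s t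
  proof -
    have eq: "m u = m t" if "t \<le> u" "u \<le> s" for u
      using mono[of t u] usc[OF that] that ts by (intro antisym) auto
    obtain x where x: "x \<in> {(t + s) / 2..s}" "\<kappa> x = 0" using dense[of "(t + s) / 2" s] ts by auto
    have "m x - int (\<kappa> x) \<le> m s - int (\<kappa> s)" using mono[of x s] x ts by auto
    moreover have "m x = m t" "m s = m t" using eq[of x] eq[of s] x ts by auto
    ultimately show ?thesis using x by simp
  qed
  \<comment> \<open>Left of \<open>t\<close> it is \<open>m - \<kappa>\<close> that is constant, so \<open>\<kappa>\<close> increases there and is zero left of each of its zeros.\<close>
  have left: "m s = m t - int (\<kappa> t) \<and> \<kappa> s = 0" if ts: "a \<le> s" "s < t" "t \<le> b"
    and lsc: "\<And>u. s \<le> u \<Longrightarrow> u \<le> t \<Longrightarrow> m t - int (\<kappa> t) \<le> m u - int (\<kappa> u)" for s t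
  proof -
    have eq: "m u - int (\<kappa> u) = m t - int (\<kappa> t)" if "s \<le> u" "u \<le> t" for u
      using mono[of u t] lsc[OF that] that ts by (intro antisym) auto
    obtain x where x: "x \<in> {s..(s + t) / 2}" "\<kappa> x = 0" using dense[of s "(s + t) / 2"] ts by auto
    have "m s \<le> m x" using mono[of s x] x ts by auto
    moreover have "m x - int (\<kappa> x) = m t - int (\<kappa> t)" "m s - int (\<kappa> s) = m t - int (\<kappa> t)" using eq[of x] eq[of s] x ts by auto
    ultimately show ?thesis using x by simp
  qed
  have "P a b" using ab
  proof (induction rule: Bolzano)
    case (trans x y z)
    show ?case unfolding P_def
    proof (intro impI)
      assume r: "a \<le> x" "x \<le> z" "z \<le> b"
      have "finite (Z x y)" "m y - m x = int (\<Sum>x\<in>Z x y. \<kappa> x)" "finite (Z y z)" "m z - m y = int (\<Sum>x\<in>Z y z. \<kappa> x)"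
        using trans r unfolding P_def by auto
      moreover have "Z x z = Z x y \<union> Z y z" "Z x y \<inter> Z y z = {}" using trans by (auto simp: Z_def)
      ultimately show "finite (Z x z) \<and> m z - m x = int (\<Sum>x\<in>Z x z. \<kappa> x)"
        by (simp add: sum.union_disjoint)
    qed
  next
    case (local x)
    then obtain \<delta> where \<delta>: "\<delta> > 0" "\<And>s. s \<in> {a..b} \<Longrightarrow> dist s x < \<delta> \<Longrightarrow> m s \<le> m x \<and> m x - int (\<kappa> x) \<le> m s - int (\<kappa> s)"
      using semi[of x] by auto
    have R: "m s = m x \<and> \<kappa> s = 0" if "x < s" "s \<le> b" "s - x < \<delta>" for s
      using \<delta>(2) that local by (intro right) (auto simp: dist_real_def)
    have L: "m s = m x - int (\<kappa> x) \<and> \<kappa> s = 0" if "s < x" "a \<le> s" "x - s < \<delta>" for s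
      using \<delta>(2) that local by (intro left) (auto simp: dist_real_def)
    have "P s t" if st: "s \<le> x \<and> x \<le> t \<and> t - s < \<delta>" for s t
      unfolding P_def
    proof (intro impI)
      assume r: "a \<le> s" "s \<le> t" "t \<le> b"
      have k0: "\<kappa> y = 0" if "y \<in> {s..t}" "y \<noteq> x" for y
        using L[of y] R[of y] that st r by (cases "y < x") auto
      have "y \<in> Z s t \<longleftrightarrow> y = x \<and> s < x \<and> \<kappa> x \<noteq> 0" for y
        using k0[of y] st by (cases "y = x") (auto simp: Z_def)
      then have Z: "Z s t = (if s < x \<and> \<kappa> x \<noteq> 0 then {x} else {})" by auto
      have "m t = m x" using R[of t] st r by (cases "x = t") auto
      moreover have "s < x \<Longrightarrow> m s = m x - int (\<kappa> x)" using L[of s] st r by auto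
      moreover have "\<not> s < x \<Longrightarrow> m s = m x" using st by (simp add: order.order_iff_strict)
      ultimately show "finite (Z s t) \<and> m t - m s = int (\<Sum>x\<in>Z s t. \<kappa> x)"
        by (cases "s < x") (auto simp: Z)
    qed
    then show ?case using \<delta>(1) by blast
  qed
  then show ?thesis using ab by (simp add: P_def Z_def)
qed

section \<open>The Maslov index as a flow increment\<close>

text \<open>
  Each point of the interval has a neighbourhood on which one pair of angles works; a Lebesgue number of
  this cover is a mesh size.
\<close>
lemma maslov_partition:
  fixes W :: "real \<Rightarrow> complex ^ 'm ^ 'm"
  assumes ab: "a < b" and Wc: "continuous_on {a..b} W" and W: "\<And>t. t \<in> {a..b} \<Longrightarrow> unitary (W t)"
  shows "\<exists>(N :: nat) p \<epsilon>. p 0 = a \<and> p N = b \<and> (\<forall>j<N. p j < p (Suc j)) \<and>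
    (\<forall>j<N. 0 < \<epsilon> j \<and> \<epsilon> j < pi \<and>
      (\<forall>t\<in>{p j..p (Suc j)}. cis (pi + \<epsilon> j) \<notin> mspectrum (W t) \<and> cis (pi - \<epsilon> j) \<notin> mspectrum (W t)))"
proof -
  have "\<exists>\<epsilon> \<delta>. 0 < \<epsilon> \<and> \<epsilon> < pi \<and> \<delta> > 0 \<and> (\<forall>s\<in>{a..b}. dist s t < \<delta> \<longrightarrow> cis (pi + \<epsilon>) \<notin> mspectrum (W s) \<and> cis (pi - \<epsilon>) \<notin> mspectrum (W s))"
    if t: "t \<in> {a..b}" for t
  proof -
    obtain \<epsilon> where \<epsilon>: "0 < \<epsilon>" "\<epsilon> < pi" "cis (pi + \<epsilon>) \<notin> mspectrum (W t)" "cis (pi - \<epsilon>) \<notin> mspectrum (W t)"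
      using avoiding_angle[OF W[OF t]] by blast
    obtain \<delta> \<delta>' where "\<delta> > 0" "\<forall>s\<in>{a..b}. dist s t < \<delta> \<longrightarrow> cis (pi + \<epsilon>) \<notin> mspectrum (W s)"
      "\<delta>' > 0" "\<forall>s\<in>{a..b}. dist s t < \<delta>' \<longrightarrow> cis (pi - \<epsilon>) \<notin> mspectrum (W s)"
      using mspectrum_locally_avoided[OF Wc t \<epsilon>(3)] mspectrum_locally_avoided[OF Wc t \<epsilon>(4)] by blast
    then show ?thesis using \<epsilon> by (intro exI[of _ \<epsilon>] exI[of _ "min \<delta> \<delta>'"]) auto
  qed
  then obtain e d where ed: "\<And>t. t \<in> {a..b} \<Longrightarrow> 0 < e t \<and> e t < pi \<and> d t > 0 \<and>
      (\<forall>s\<in>{a..b}. dist s t < d t \<longrightarrow> cis (pi + e t) \<notin> mspectrum (W s) \<and> cis (pi - e t) \<notin> mspectrum (W s))"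
    by metis
  have cover: "{a..b} \<subseteq> \<Union> ((\<lambda>t. ball t (d t)) ` {a..b})" using ed by fastforce
  obtain r where r: "r > 0" "\<forall>x\<in>{a..b}. \<exists>G\<in>(\<lambda>t. ball t (d t)) ` {a..b}. ball x r \<subseteq> G"
  proof (rule Heine_Borel_lemma[OF compact_Icc cover])
    show "open G" if "G \<in> (\<lambda>t. ball t (d t)) ` {a..b}" for G using that by auto
  qed (use that in blast)
  obtain N where N: "(b - a) / r < real N" using reals_Archimedean2 by blast
  have N0: "real N > 0" using N ab r by (smt (verit) divide_pos_pos)
  define p where "p j = a + (b - a) * real j / real N" for j
  have step: "p (Suc j) - p j = (b - a) / real N" for j
    using N0 by (simp add: p_def field_simps)
  have small: "(b - a) / real N < r" using N N0 r by (simp add: divide_simps mult.commute)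
  have inI: "p j \<in> {a..b}" if "j \<le> N" for j
  proof -
    have "(b - a) * real j \<le> (b - a) * real N" using that ab by (intro mult_left_mono) auto
    then have "(b - a) * real j / real N \<le> b - a" using N0 by (simp add: divide_simps)
    then show ?thesis using ab by (auto simp: p_def)
  qed
  have "\<exists>t\<in>{a..b}. {p j..p (Suc j)} \<subseteq> ball t (d t)" if "j < N" for j
  proof -
    have "p j \<in> {a..b}" using inI[of j] that by simp
    then obtain t where t: "t \<in> {a..b}" "ball (p j) r \<subseteq> ball t (d t)" using r(2) by blast
    have "{p j..p (Suc j)} \<subseteq> ball (p j) r"
      using step[of j] small by (auto simp: dist_real_def)
    then show ?thesis using t by blast
  qed
  then obtain \<tau> where \<tau>: "\<And>j. j < N \<Longrightarrow> \<tau> j \<in> {a..b} \<and> {p j..p (Suc j)} \<subseteq> ball (\<tau> j) (d (\<tau> j))"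
    by metis
  have A: "p 0 = a" "p N = b" using N0 by (auto simp: p_def)
  have B: "\<forall>j<N. p j < p (Suc j)"
  proof (intro allI impI)
    fix j
    have "(b - a) / real N > 0" using ab N0 by simp
    then show "p j < p (Suc j)" using step[of j] by linarith
  qed
  have C: "\<forall>j<N. 0 < e (\<tau> j) \<and> e (\<tau> j) < pi \<and> (\<forall>t\<in>{p j..p (Suc j)}. cis (pi + e (\<tau> j)) \<notin> mspectrum (W t) \<and> cis (pi - e (\<tau> j)) \<notin> mspectrum (W t))"
  proof (intro allI impI)
    fix j assume j: "j < N"
    have "t \<in> {a..b} \<and> dist t (\<tau> j) < d (\<tau> j)" if "t \<in> {p j..p (Suc j)}" for t
      using that inI[of j] inI[of "Suc j"] j \<tau>[OF j] by (auto simp: dist_commute subset_iff)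
    then show "0 < e (\<tau> j) \<and> e (\<tau> j) < pi \<and> (\<forall>t\<in>{p j..p (Suc j)}. cis (pi + e (\<tau> j)) \<notin> mspectrum (W t) \<and> cis (pi - e (\<tau> j)) \<notin> mspectrum (W t))"
      using ed[of "\<tau> j"] \<tau>[OF j] by blast
  qed
  show ?thesis
    by (intro exI[of _ N] exI[of _ p] exI[of _ "\<lambda>j. e (\<tau> j)"] conjI A B C)
qed

text \<open>
  On each interval of an admissible partition the increments of the flow function and of the eigenvalue
  count agree, and the sum telescopes.  As this holds for every admissible choice, the value is unique, and
  \<open>maslov_partition\<close> provides a choice.
\<close>
lemma Mas_flow:
  fixes W :: "real \<Rightarrow> complex ^ 'n ^ 'n::finite"
  assumes ab: "a < b" and m: "flow_function {a..b} W m"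
    and Wc: "continuous_on {a..b} W" and W: "\<And>t. t \<in> {a..b} \<Longrightarrow> unitary (W t)"
    and L: "lagrangian_path a b L1" "lagrangian_path a b L2"
    and frame: "\<And>t. t \<in> {a..b} \<Longrightarrow> is_frame (F1 t) (L1 t) \<and> is_frame (F2 t) (L2 t)"
    and WF: "\<And>t G1 G2. t \<in> {a..b} \<Longrightarrow> is_frame G1 (L1 t) \<Longrightarrow> is_frame G2 (L2 t) \<Longrightarrow> Wtilde G1 G2 = W t"
  shows "Mas L1 L2 a b = m b - m a"
  unfolding Mas_def
proof (rule the_equality)
  obtain N :: nat and p \<epsilon> where p: "p 0 = a" "p N = b" "\<forall>j<N. p j < p (Suc j)"
    and e: "\<forall>j<N. 0 < \<epsilon> j \<and> \<epsilon> j < pi \<and> (\<forall>t\<in>{p j..p (Suc j)}. cis (pi + \<epsilon> j) \<notin> mspectrum (W t) \<and> cis (pi - \<epsilon> j) \<notin> mspectrum (W t))"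
    using maslov_partition[OF ab Wc W] by blast
  have sum: "(\<Sum>j<N. int (kcount (W (p (Suc j))) (\<epsilon> j)) - int (kcount (W (p j)) (\<epsilon> j))) = m b - m a
      \<and> (\<forall>j\<le>N. p j \<in> {a..b})"
    if p: "p 0 = a" "p N = b" "\<forall>j<N. p j < p (Suc j)"
    and e: "\<forall>j<N. 0 < \<epsilon> j \<and> \<epsilon> j < pi" and z: "\<And>j t. \<forall>j\<le>N. p j \<in> {a..b} \<Longrightarrow> j < N \<Longrightarrow> t \<in> {p j..p (Suc j)} \<Longrightarrow> cis (pi + \<epsilon> j) \<notin> mspectrum (W t)"
    for N :: nat and p \<epsilon>
  proof -
    have mp: "p i \<le> p j" if "i \<le> j" "j \<le> N" for i j
      using that
    proof (induction j)
      case (Suc j)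
      then show ?case using p(3)[rule_format, of j] by (cases "i = Suc j") auto
    qed auto
    have inI: "p j \<in> {a..b}" if "j \<le> N" for j
      using mp[of 0 j] mp[of j N] that p by auto
    have "int (kcount (W (p (Suc j))) (\<epsilon> j)) - int (kcount (W (p j)) (\<epsilon> j)) = m (p (Suc j)) - m (p j)" if j: "j < N" for j
    proof -
      obtain c where c: "\<And>t. t \<in> {p j..p (Suc j)} \<Longrightarrow> m t = c + int (kcount (W t) (\<epsilon> j))"
      proof (rule flow_functionD[OF m, of "{p j..p (Suc j)}" "\<epsilon> j"])
        show "{p j..p (Suc j)} \<subseteq> {a..b}" using inI[of j] inI[of "Suc j"] j by auto
        show "0 < \<epsilon> j" "\<epsilon> j < 2 * pi" using e[rule_format, OF j] by auto
        show "cis (pi + \<epsilon> j) \<notin> mspectrum (W t)" if "t \<in> {p j..p (Suc j)}" for t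
          using z j that inI by blast
      qed auto
      then show ?thesis using p(3)[rule_format, OF j] by (simp add: c)
    qed
    then have "(\<Sum>j<N. int (kcount (W (p (Suc j))) (\<epsilon> j)) - int (kcount (W (p j)) (\<epsilon> j))) = (\<Sum>j<N. m (p (Suc j)) - m (p j))"
      by (intro sum.cong) auto
    also have "\<dots> = m b - m a" using p sum_lessThan_telescope[of "\<lambda>j. m (p j)" N] by simp
    finally show ?thesis using inI by auto
  qed
  show "has_maslov_index L1 L2 a b (m b - m a)"
  proof -
    have s: "(\<Sum>j<N. int (kcount (W (p (Suc j))) (\<epsilon> j)) - int (kcount (W (p j)) (\<epsilon> j))) = m b - m a"
      and inI: "\<And>j. j \<le> N \<Longrightarrow> p j \<in> {a..b}"
      using sum[of p N \<epsilon>, OF p] e by (simp_all add: atLeastAtMost_iff)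
    have WW: "Wtilde (F1 t) (F2 t) = W t" if "t \<in> {a..b}" for t using WF frame that by blast
    have S1: "\<forall>j<N. 0 < \<epsilon> j \<and> \<epsilon> j < pi \<and> (\<forall>t\<in>{p j..p (Suc j)}. cis (pi + \<epsilon> j) \<notin> mspectrum (Wtilde (F1 t) (F2 t)) \<and> cis (pi - \<epsilon> j) \<notin> mspectrum (Wtilde (F1 t) (F2 t)))"
    proof (intro allI impI)
      fix j assume j: "j < N"
      have "t \<in> {a..b}" if "t \<in> {p j..p (Suc j)}" for t
        using that inI[of j] inI[of "Suc j"] j by auto
      then show "0 < \<epsilon> j \<and> \<epsilon> j < pi \<and> (\<forall>t\<in>{p j..p (Suc j)}. cis (pi + \<epsilon> j) \<notin> mspectrum (Wtilde (F1 t) (F2 t)) \<and> cis (pi - \<epsilon> j) \<notin> mspectrum (Wtilde (F1 t) (F2 t)))"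
        using e[rule_format, OF j] by (simp add: WW)
    qed
    have S2: "m b - m a = (\<Sum>j<N. int (kcount (Wtilde (F1 (p (Suc j))) (F2 (p (Suc j)))) (\<epsilon> j)) - int (kcount (Wtilde (F1 (p j)) (F2 (p j))) (\<epsilon> j)))"
    proof -
      have "Wtilde (F1 (p j)) (F2 (p j)) = W (p j)" if "j \<le> N" for j using WW inI that by blast
      then show ?thesis unfolding s[symmetric] by (intro sum.cong refl) simp
    qed
    have S0: "\<forall>t\<in>{a..b}. is_frame (F1 t) (L1 t) \<and> is_frame (F2 t) (L2 t)" using frame by blast
    show ?thesis
      unfolding has_maslov_index_def
      by (intro conjI L exI[of _ F1] exI[of _ F2] exI[of _ N] exI[of _ p] exI[of _ \<epsilon>] S0 p S1 S2)
  qed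
  fix k assume "has_maslov_index L1 L2 a b k"
  then obtain G1 G2 N q \<eta> where G: "\<And>t. t \<in> {a..b} \<Longrightarrow> is_frame (G1 t) (L1 t) \<and> is_frame (G2 t) (L2 t)"
    and q: "q 0 = a" "q N = b" "\<forall>j<N. q j < q (Suc j)"
    and \<eta>: "\<forall>j<N. 0 < \<eta> j \<and> \<eta> j < pi \<and>
          (\<forall>t\<in>{q j..q (Suc j)}. cis (pi + \<eta> j) \<notin> mspectrum (Wtilde (G1 t) (G2 t)) \<and>
                                 cis (pi - \<eta> j) \<notin> mspectrum (Wtilde (G1 t) (G2 t)))"
    and k: "k = (\<Sum>j<N. int (kcount (Wtilde (G1 (q (Suc j))) (G2 (q (Suc j)))) (\<eta> j))
                  - int (kcount (Wtilde (G1 (q j)) (G2 (q j))) (\<eta> j)))"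
    unfolding has_maslov_index_def by blast
  have WW: "Wtilde (G1 t) (G2 t) = W t" if "t \<in> {a..b}" for t using WF G that by blast
  have "(\<Sum>j<N. int (kcount (W (q (Suc j))) (\<eta> j)) - int (kcount (W (q j)) (\<eta> j))) = m b - m a
      \<and> (\<forall>j\<le>N. q j \<in> {a..b})"
  proof (rule sum)
    fix j t assume inI: "\<forall>j\<le>N. q j \<in> {a..b}" and j: "j < N" and t: "t \<in> {q j..q (Suc j)}"
    have "t \<in> {a..b}" using t inI[rule_format, of j] inI[rule_format, of "Suc j"] j by auto
    then show "cis (pi + \<eta> j) \<notin> mspectrum (W t)" using \<eta> j t WW[of t] by metis
  qed (use q \<eta> in auto)
  moreover have "k = (\<Sum>j<N. int (kcount (W (q (Suc j))) (\<eta> j)) - int (kcount (W (q j)) (\<eta> j)))"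
  proof -
    have "Wtilde (G1 (q j)) (G2 (q j)) = W (q j)" if "j \<le> N" for j using WW calculation that by blast
    then show ?thesis unfolding k by (intro sum.cong refl) simp
  qed
  ultimately show "k = m b - m a" by simp
qed

section \<open>Lagrangian frames\<close>

lemma sum_UNIV_Plus: "(\<Sum>r\<in>UNIV. f r) = (\<Sum>i\<in>UNIV. f (Inl i)) + (\<Sum>i\<in>UNIV. f (Inr i))"
  for f :: "'a::finite + 'b::finite \<Rightarrow> 'c::comm_monoid_add"
  by (simp add: UNIV_Plus_UNIV[symmetric] sum.Plus del: UNIV_Plus_UNIV)

lemma Jmat_vector:
  "(Jmat *v v) $ Inl i = - v $ Inr i" "(Jmat *v v) $ Inr i = v $ Inl i"
  by (simp_all add: Jmat_def matrix_vector_mult_def sum_UNIV_Plus if_distrib if_distribR cong: if_cong)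

lemma plus_index_cases: "(\<And>i. P (Inl i)) \<Longrightarrow> (\<And>i. P (Inr i)) \<Longrightarrow> \<forall>r. P r"
  by (metis sum.exhaust)

lemma Jmat_Jmat: "Jmat ** Jmat = - mat 1"
  by (rule matrix_eqI, rule vec_eq_iff[THEN iffD2], rule plus_index_cases)
    (simp_all add: matrix_vector_mul_assoc[symmetric] Jmat_vector matrix_vector_mult_minus_left)

lemma Jmat_Jmat_vector [simp]: "Jmat *v (Jmat *v v) = - v"
  by (simp add: matrix_vector_mul_assoc Jmat_Jmat matrix_vector_mult_minus_left)

lemma adj_Jmat: "adj Jmat = - Jmat"
  by (auto simp: vec_eq_iff adj_def Jmat_def split: sum.split)

text \<open>
  The map \<open>x + z y\<close> of the two blocks of a vector, so that \<open>frame_comb\<close> acts by it on columns.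
\<close>
definition comb :: "complex \<Rightarrow> complex ^ ('n::finite + 'n) \<Rightarrow> complex ^ 'n" where
  "comb z x = (\<chi> i. x $ Inl i + z * x $ Inr i)"

lemma frame_comb_vector: "frame_comb z F *v v = comb z (F *v v)"
  by (simp add: frame_comb_def comb_def vec_eq_iff matrix_vector_mult_def sum.distrib
      sum_distrib_left algebra_simps)

lemma frame_comb_mult: "frame_comb z (F ** C) = frame_comb z F ** C"
  by (rule matrix_eqI) (simp add: matrix_vector_mul_assoc[symmetric] frame_comb_vector)

text \<open>
  The form \<open>(J x, y)\<close> is the difference of the two norms of \<open>x + i y\<close> and \<open>x - i y\<close>, polarised and up to a factor.
  On an isotropic plane the two maps therefore have the same inner products, and this is what makes \<open>Wtilde\<close> unitary.
\<close>
lemma cinner_comb: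
  "cinner (comb \<i> x) (comb \<i> y) - cinner (comb (-\<i>) x) (comb (-\<i>) y) = - 2 * \<i> * cinner (Jmat *v x) y"
  by (simp add: cinner_def comb_def sum_UNIV_Plus Jmat_vector sum_subtractf[symmetric]
      sum.distrib[symmetric] sum_distrib_left algebra_simps)

lemma comb_eqI:
  assumes "comb \<i> x = comb \<i> y" "comb (-\<i>) x = comb (-\<i>) y"
  shows "x = y"
proof -
  have eq: "x $ Inl i + \<i> * x $ Inr i = y $ Inl i + \<i> * y $ Inr i"
    "x $ Inl i - \<i> * x $ Inr i = y $ Inl i - \<i> * y $ Inr i" for i
    using assms by (auto simp: comb_def vec_eq_iff)
  have "2 * x $ Inl i = 2 * y $ Inl i" for i using arg_cong2[OF eq(1)[of i] eq(2)[of i], of "(+)"] by simp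
  moreover have "2 * \<i> * x $ Inr i = 2 * \<i> * y $ Inr i" for i using arg_cong2[OF eq(1)[of i] eq(2)[of i], of "(-)"] by simp
  ultimately show ?thesis
    by (intro vec_eq_iff[THEN iffD2] plus_index_cases) auto
qed

text \<open>
  A frame is handled through its isotropy and injectivity; together they say that its columns span a
  Lagrangian plane.
\<close>
definition lag_frame :: "complex ^ 'n ^ ('n::finite + 'n) \<Rightarrow> bool" where
  "lag_frame F \<longleftrightarrow> adj F ** Jmat ** F = 0 \<and> (\<forall>v. F *v v = 0 \<longrightarrow> v = 0)"

lemma cinner_J_frame: "cinner (Jmat *v (G *v w)) (F *v u) = cinner ((adj F ** Jmat ** G) *v w) u"
  by (simp add: cinner_mult_right matrix_vector_mul_assoc matrix_mul_assoc)

lemma lag_frame_isotropic: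
  assumes "lag_frame F" shows "cinner (Jmat *v (F *v u)) (F *v v) = 0"
  using assms by (simp add: cinner_J_frame lag_frame_def)

lemma lag_frame_cinner:
  assumes "lag_frame F"
  shows "cinner (frame_comb \<i> F *v u) (frame_comb \<i> F *v v) = cinner (frame_comb (-\<i>) F *v u) (frame_comb (-\<i>) F *v v)"
  using cinner_comb[of "F *v u" "F *v v"] lag_frame_isotropic[OF assms, of u v]
  by (simp add: frame_comb_vector)

lemma invertible_kernelI:
  fixes A :: "complex ^ 'm ^ 'm"
  assumes "\<And>v. A *v v = 0 \<Longrightarrow> v = 0" shows "invertible A"
  using assms matrix_left_invertible_ker[of A] invertible_left_inverse by blast

lemma lag_frame_invertible:
  assumes F: "lag_frame F"
  shows "invertible (frame_comb \<i> F)" "invertible (frame_comb (-\<i>) F)"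
proof -
  have *: "v = 0" if "frame_comb \<i> F *v v = 0 \<or> frame_comb (-\<i>) F *v v = 0" for v
  proof -
    have "cinner (frame_comb \<i> F *v v) (frame_comb \<i> F *v v) = 0"
      using that lag_frame_cinner[OF F, of v v] by auto
    moreover have "cinner (frame_comb (-\<i>) F *v v) (frame_comb (-\<i>) F *v v) = 0"
      using that lag_frame_cinner[OF F, of v v] by auto
    ultimately have "comb \<i> (F *v v) = 0" "comb (-\<i>) (F *v v) = 0"
      by (simp_all add: cinner_self frame_comb_vector)
    then have "F *v v = 0"
      by (intro comb_eqI) (simp_all add: comb_def vec_eq_iff)
    then show "v = 0" using F by (simp add: lag_frame_def)
  qed
  show "invertible (frame_comb \<i> F)" "invertible (frame_comb (-\<i>) F)"
    by (rule invertible_kernelI, use * in blast)+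
qed

lemma inv_vector:
  fixes A :: "complex ^ 'm ^ 'm"
  assumes "invertible A"
  shows "A *v (matrix_inv A *v v) = v" "matrix_inv A *v (A *v v) = v"
  using matrix_inv_mult[OF assms] by (simp_all add: matrix_vector_mul_assoc)

text \<open>A Lagrangian plane is maximal isotropic: it equals its own orthogonal complement with respect
  to the form \<open>(J x, y)\<close>.\<close>
lemma lag_frame_maximal:
  assumes F: "lag_frame F"
  shows "(adj F ** Jmat) *v y = 0 \<longleftrightarrow> (\<exists>c. y = F *v c)"
proof
  assume 0: "(adj F ** Jmat) *v y = 0"
  have eq: "cinner (comb \<i> y) (frame_comb \<i> F *v u) = cinner (comb (-\<i>) y) (frame_comb (-\<i>) F *v u)" for u
  proof -
    have "cinner (Jmat *v y) (F *v u) = 0"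
      using 0 by (simp add: cinner_mult_right matrix_vector_mul_assoc)
    then show ?thesis using cinner_comb[of y "F *v u"] by (simp add: frame_comb_vector)
  qed
  define c where "c = matrix_inv (frame_comb (-\<i>) F) *v comb (-\<i>) y"
  have c: "frame_comb (-\<i>) F *v c = comb (-\<i>) y"
    by (simp add: c_def inv_vector lag_frame_invertible[OF F])
  have "comb \<i> y - frame_comb \<i> F *v c = 0"
  proof (rule cinner_eq_0I)
    fix v
    define u where "u = matrix_inv (frame_comb \<i> F) *v v"
    have v: "v = frame_comb \<i> F *v u" by (simp add: u_def inv_vector lag_frame_invertible[OF F])
    show "cinner (comb \<i> y - frame_comb \<i> F *v c) v = 0"
      by (simp only: v cinner_diff_left eq lag_frame_cinner[OF F] c) simp
  qed
  then have "y = F *v c"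
    using c by (intro comb_eqI) (simp_all add: frame_comb_vector)
  then show "\<exists>c. y = F *v c" ..
next
  assume "\<exists>c. y = F *v c"
  then show "(adj F ** Jmat) *v y = 0"
    using F by (auto simp: lag_frame_def matrix_vector_mul_assoc)
qed

lemma colspace_range: "colspace F = range ((*v) F)" for F :: "complex ^ 'k ^ 'm"
proof
  have "vec.subspace (range ((*v) F))"
  proof (rule vec.subspaceI)
    show "0 \<in> range ((*v) F)" by (rule image_eqI[of _ _ 0]) auto
  qed (auto simp: matrix_vector_right_distrib[symmetric] vec.scale[symmetric])
  moreover have "columns F \<subseteq> range ((*v) F)"
  proof -
    have "column i F = F *v axis i 1" for i
      by (simp add: vec_eq_iff column_def matrix_vector_mult_def axis_def if_distrib if_distribR cong: if_cong)
    then show ?thesis by (auto simp: columns_def)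
  qed
  ultimately show "colspace F \<subseteq> range ((*v) F)"
    unfolding colspace_def by (intro vec.span_minimal)
  show "range ((*v) F) \<subseteq> colspace F"
    unfolding colspace_def using matrix_vector_mult_in_columnspace_gen by blast
qed

lemma rank_injective:
  fixes F :: "complex ^ 'n ^ 'm"
  shows "rank F = CARD('n) \<longleftrightarrow> (\<forall>v. F *v v = 0 \<longrightarrow> v = 0)"
proof -
  have "(\<forall>v. F *v v = 0 \<longrightarrow> v = 0) \<longleftrightarrow> vec.span (rows F) = UNIV"
    using matrix_left_invertible_ker[of F] matrix_left_invertible_span_rows_gen[of F] by blast
  also have "\<dots> \<longleftrightarrow> rank F = CARD('n)"
    unfolding row_rank_def_gen using vec.dim_eq_full[of "rows F"]
    by (simp add: vec.dimension_def card_cart_basis)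
  finally show ?thesis by blast
qed

lemma lag_frame_is_frame: "lag_frame F \<Longrightarrow> is_frame F (colspace F)"
  by (simp add: is_frame_def rank_injective lag_frame_def)

lemma lag_frame_lagrangian:
  fixes F :: "complex ^ 'n ^ ('n::finite + 'n)"
  assumes F: "lag_frame F" shows "lagrangian (colspace F)"
  unfolding lagrangian_def
proof (intro conjI ballI)
  show "vec.subspace (colspace F)" by (simp add: colspace_def)
  have "inj_on ((*v) F) (vec.span UNIV)"
  proof (rule inj_onI)
    fix u v assume "F *v u = F *v v"
    then have "F *v (u - v) = 0" by (simp add: matrix_vector_mult_diff_distrib)
    then have "u - v = 0" using F unfolding lag_frame_def by blast
    then show "u = v" by simp
  qed
  then show "vec.dim (colspace F) = CARD('n)"
    unfolding colspace_range using vec.dim_image_eq[OF matrix_vector_mul_linear_gen, of F UNIV] by (simp add: card_cart_basis)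
  show "cinner (Jmat *v u) v = 0" if "u \<in> colspace F" "v \<in> colspace F" for u v
    using that lag_frame_isotropic[OF F] by (auto simp: colspace_range)
qed

text \<open>
  The Gram matrix of an injective frame is invertible, and \<open>F (F\<^sup>* F)\<^sup>-\<^sup>1 F\<^sup>*\<close> satisfies the conditions that
  characterise the orthogonal projection.
\<close>
lemma orth_proj_frame:
  fixes F :: "complex ^ 'k ^ 'm"
  assumes F: "\<And>v. F *v v = 0 \<Longrightarrow> v = 0"
  shows "invertible (adj F ** F)"
    and "orth_proj (colspace F) v = (F ** matrix_inv (adj F ** F) ** adj F) *v v"
proof -
  show inv: "invertible (adj F ** F)"
  proof (rule invertible_kernelI)
    fix v assume "(adj F ** F) *v v = 0"
    then have "cinner (F *v v) (F *v v) = 0"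
      by (simp add: cinner_mult_right matrix_vector_mul_assoc)
    then show "v = 0" using F by (simp add: cinner_self)
  qed
  let ?p = "(F ** matrix_inv (adj F ** F) ** adj F) *v v"
  have p: "?p = F *v (matrix_inv (adj F ** F) *v (adj F *v v))"
    by (simp add: matrix_vector_mul_assoc matrix_mul_assoc)
  have orth: "adj F *v (v - ?p) = 0"
  proof -
    have "adj F *v ?p = (adj F ** F) *v (matrix_inv (adj F ** F) *v (adj F *v v))"
      unfolding p by (simp only: matrix_vector_mul_assoc matrix_mul_assoc)
    then show ?thesis by (simp add: inv_vector[OF inv] matrix_vector_mult_diff_distrib)
  qed
  show "orth_proj (colspace F) v = ?p"
    unfolding orth_proj_def
  proof (rule the_equality)
    show "?p \<in> colspace F \<and> (\<forall>w\<in>colspace F. cinner (v - ?p) w = 0)"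
      using orth by (auto simp: p colspace_range cinner_mult_right)
    fix q assume q: "q \<in> colspace F \<and> (\<forall>w\<in>colspace F. cinner (v - q) w = 0)"
    then obtain c where c: "q = F *v c" by (auto simp: colspace_range)
    have "cinner (adj F *v (v - q)) u = 0" for u
      using q by (auto simp: colspace_range cinner_mult_right)
    then have "adj F *v (v - q) = 0" by (rule cinner_eq_0I)
    then have "adj F *v v = (adj F ** F) *v c"
      by (simp add: matrix_vector_mult_diff_distrib c matrix_vector_mul_assoc)
    then show "q = ?p" by (simp add: p c inv_vector[OF inv])
  qed
qed

text \<open>
  By the explicit formula for the projections, a continuous frame moves its plane continuously.
\<close>
lemma lagrangian_path_frames:
  fixes F :: "real \<Rightarrow> complex ^ 'n ^ ('n::finite + 'n)"
  assumes F: "\<And>t. t \<in> {a..b} \<Longrightarrow> lag_frame (F t)" and Fc: "continuous_on {a..b} F"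
  shows "lagrangian_path a b (\<lambda>t. colspace (F t))"
  unfolding lagrangian_path_def
proof (intro conjI ballI)
  fix t assume t: "t \<in> {a..b}"
  show "lagrangian (colspace (F t))" by (rule lag_frame_lagrangian[OF F[OF t]])
  define P where "P s = F s ** matrix_inv (adj (F s) ** F s) ** adj (F s)" for s
  have inj: "F s *v v = 0 \<Longrightarrow> v = 0" if "s \<in> {a..b}" for s v
    using F[OF that] by (simp add: lag_frame_def)
  have P: "orth_proj (colspace (F s)) v = P s *v v" if "s \<in> {a..b}" for s v
    unfolding P_def by (rule orth_proj_frame(2)) (rule inj[OF that])
  have "continuous_on {a..b} P"
    unfolding P_def
    by (intro continuous_intros continuous_on_matrix_inv Fc orth_proj_frame(1)) (rule inj)
  then have Pt: "((\<lambda>s. P s - P t) \<longlongrightarrow> P t - P t) (at t within {a..b})"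
    using t by (intro tendsto_intros) (auto simp: continuous_on_def)
  obtain K where K: "K > 0" "\<And>(A :: complex ^ ('n + 'n) ^ ('n + 'n)) v. norm (A *v v) \<le> norm A * norm v * K"
    using bounded_bilinear.pos_bounded[OF bounded_bilinear_mv] by blast
  have le: "lag_dist (colspace (F s)) (colspace (F t)) \<le> norm (P s - P t) * K" if s: "s \<in> {a..b}" for s
  proof -
    have "(\<lambda>v. orth_proj (colspace (F s)) v - orth_proj (colspace (F t)) v) = (*v) (P s - P t)"
      by (simp add: P[OF s] P[OF t] fun_eq_iff matrix_vector_mult_diff_rdistrib)
    then show ?thesis
      unfolding lag_dist_def using K by (auto intro!: onorm_le simp: mult_ac)
  qed
  have ge: "0 \<le> lag_dist (colspace (F s)) (colspace (F t))" if s: "s \<in> {a..b}" for s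
  proof -
    have "(\<lambda>v. orth_proj (colspace (F s)) v - orth_proj (colspace (F t)) v) = (*v) (P s - P t)"
      by (simp add: P[OF s] P[OF t] fun_eq_iff matrix_vector_mult_diff_rdistrib)
    then show ?thesis
      unfolding lag_dist_def by (simp add: onorm_pos_le bounded_bilinear.bounded_linear_right[OF bounded_bilinear_mv])
  qed
  have "((\<lambda>s. norm (P s - P t) * K) \<longlongrightarrow> norm (P t - P t) * K) (at t within {a..b})"
    by (intro tendsto_intros Pt)
  then have "((\<lambda>s. norm (P s - P t) * K) \<longlongrightarrow> 0) (at t within {a..b})" by simp
  then show "((\<lambda>s. lag_dist (colspace (F s)) (colspace (F t))) \<longlongrightarrow> 0) (at t within {a..b})"
    by (rule Lim_null_comparison[rotated]) (auto simp: eventually_at_filter le ge)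
qed

section \<open>The unitary matrix of a pair of Lagrangian planes\<close>

lemma unitaryI:
  assumes "\<And>u v. cinner (W *v u) (W *v v) = cinner u v" shows "unitary W"
  unfolding unitary_def
proof (rule matrix_eqI)
  fix v
  have "(adj W ** W) *v v - v = 0"
    by (rule cinner_eq_0I)
      (simp add: cinner_diff_left matrix_vector_mul_assoc[symmetric] assms cinner_mult_left[of "adj W"])
  then show "(adj W ** W) *v v = mat 1 *v v" by simp
qed

lemma Wtilde_vector:
  "Wtilde F G *v v = - (frame_comb \<i> F *v (matrix_inv (frame_comb (-\<i>) F) *v
     (frame_comb (-\<i>) G *v (matrix_inv (frame_comb \<i> G) *v v))))"
  by (simp add: Wtilde_def matrix_vector_mult_minus_left matrix_vector_mul_assoc matrix_mul_assoc)

lemma cinner_minus: "cinner (- u) v = - cinner u v" "cinner u (- v) = - cinner u v"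
  by (simp_all add: cinner_def sum_negf)

lemma unitary_Wtilde:
  assumes F: "lag_frame F" and G: "lag_frame G"
  shows "unitary (Wtilde F G)"
  by (rule unitaryI)
    (simp add: Wtilde_vector cinner_minus lag_frame_cinner[OF F] lag_frame_cinner[OF G, symmetric]
      inv_vector lag_frame_invertible[OF F] lag_frame_invertible[OF G])

text \<open>
  A vector \<open>v\<close> is written as \<open>x + i y\<close> for a point of the plane of \<open>G\<close>, and the matrix sends it to minus
  the corresponding expression for the point \<open>F c\<close> with the same \<open>x - i y\<close>.  If the result is \<open>- v\<close>, both points have the same \<open>x + i y\<close> as well,
  hence coincide.
\<close>
lemma mker_Wtilde:
  assumes F: "lag_frame F" and G: "lag_frame G"
  shows "mker (Wtilde F G + mat 1) = {v. \<exists>w c. G *v w = F *v c \<and> v = frame_comb \<i> G *v w}"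
proof (intro equalityI subsetI)
  note inv = lag_frame_invertible[OF F] lag_frame_invertible[OF G]
  fix v assume "v \<in> mker (Wtilde F G + mat 1)"
  then have v: "v = - (Wtilde F G *v v)"
    by (simp add: mker_def matrix_vector_mult_add_rdistrib add_eq_0_iff2)
  define w where "w = matrix_inv (frame_comb \<i> G) *v v"
  define c where "c = matrix_inv (frame_comb (-\<i>) F) *v (frame_comb (-\<i>) G *v w)"
  have 1: "frame_comb \<i> G *v w = v" by (simp add: w_def inv_vector inv)
  have 2: "frame_comb (-\<i>) F *v c = frame_comb (-\<i>) G *v w" by (simp add: c_def inv_vector inv)
  have 3: "frame_comb \<i> F *v c = v"
    using v unfolding Wtilde_vector w_def[symmetric] c_def[symmetric] by simp
  have "G *v w = F *v c"
    using 1 2 3 by (intro comb_eqI) (simp_all add: frame_comb_vector)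
  then show "v \<in> {v. \<exists>w c. G *v w = F *v c \<and> v = frame_comb \<i> G *v w}" using 1 by auto
next
  note inv = lag_frame_invertible[OF F] lag_frame_invertible[OF G]
  fix v assume "v \<in> {v. \<exists>w c. G *v w = F *v c \<and> v = frame_comb \<i> G *v w}"
  then obtain w c where wc: "G *v w = F *v c" "v = frame_comb \<i> G *v w" by blast
  have "matrix_inv (frame_comb (-\<i>) F) *v (frame_comb (-\<i>) G *v w) = c"
  proof -
    have "frame_comb (-\<i>) G *v w = frame_comb (-\<i>) F *v c" by (simp add: frame_comb_vector wc)
    then show ?thesis by (simp add: inv_vector inv)
  qed
  then have "Wtilde F G *v v = - (frame_comb \<i> F *v c)"
    by (simp add: Wtilde_vector wc(2) inv_vector inv)
  also have "frame_comb \<i> F *v c = v" by (simp add: wc frame_comb_vector)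
  finally show "v \<in> mker (Wtilde F G + mat 1)"
    by (simp add: mker_def matrix_vector_mult_add_rdistrib)
qed

lemma dim_image_invertible:
  fixes A :: "complex ^ 'm ^ 'm"
  assumes "invertible A" shows "vec.dim ((*v) A ` S) = vec.dim S"
proof -
  have "inj_on ((*v) A) (vec.span S)"
    by (rule inj_on_inverseI[of _ "(*v) (matrix_inv A)"]) (rule inv_vector(2)[OF assms])
  then show ?thesis by (rule vec.dim_image_eq[OF matrix_vector_mul_linear_gen])
qed

lemma crossing_Wtilde:
  assumes F: "lag_frame F" and G: "lag_frame G"
  shows "crossing (Wtilde F G) = vec.dim (mker (adj F ** Jmat ** G))"
    and "crossing (Wtilde F G) = vec.dim (mker (adj G ** Jmat ** F))"
proof -
  have 1: "mker (adj F ** Jmat ** G) = {w. \<exists>c. G *v w = F *v c}"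
    using lag_frame_maximal[OF F] by (simp add: mker_def matrix_vector_mul_assoc[symmetric])
  have "mker (Wtilde F G + mat 1) = (*v) (frame_comb \<i> G) ` mker (adj F ** Jmat ** G)"
    unfolding mker_Wtilde[OF F G] 1 by auto
  then show "crossing (Wtilde F G) = vec.dim (mker (adj F ** Jmat ** G))"
    by (simp add: crossing_def dim_image_invertible lag_frame_invertible[OF G])
  have 2: "mker (adj G ** Jmat ** F) = {c. \<exists>w. F *v c = G *v w}"
    using lag_frame_maximal[OF G] by (simp add: mker_def matrix_vector_mul_assoc[symmetric])
  have "frame_comb \<i> G *v w = frame_comb \<i> F *v c" if "G *v w = F *v c" for w c
    using that by (simp add: frame_comb_vector)
  then have "mker (Wtilde F G + mat 1) = (*v) (frame_comb \<i> F) ` mker (adj G ** Jmat ** F)"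
    unfolding mker_Wtilde[OF F G] 2 image_def by (auto; metis)
  then show "crossing (Wtilde F G) = vec.dim (mker (adj G ** Jmat ** F))"
    by (simp add: crossing_def dim_image_invertible lag_frame_invertible[OF F])
qed

lemma crossing_intersection:
  assumes F: "lag_frame F" and G: "lag_frame G" and "crossing (Wtilde F G) \<noteq> 0"
  shows "vec.dim (colspace F \<inter> colspace G) \<noteq> 0"
proof -
  have "\<not> mker (Wtilde F G + mat 1) \<subseteq> {0}"
    using assms(3) unfolding crossing_def using vec.dim_eq_0 by metis
  then obtain w c where wc: "G *v w = F *v c" "frame_comb \<i> G *v w \<noteq> 0"
    unfolding mker_Wtilde[OF F G] by blast
  have "comb \<i> 0 = 0" by (simp add: comb_def vec_eq_iff)
  then have "G *v w \<noteq> 0" using wc(2) by (auto simp: frame_comb_vector)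
  moreover have "G *v w \<in> range ((*v) F)" unfolding wc(1) by (rule rangeI)
  moreover have "G *v w \<in> range ((*v) G)" by (rule rangeI)
  ultimately show ?thesis unfolding vec.dim_eq_0 colspace_range by blast
qed

text \<open>Another frame of the same plane is \<open>F C\<close> with \<open>C\<close> invertible, and \<open>C\<close> cancels.\<close>
lemma frame_change:
  assumes F: "lag_frame F" and H: "is_frame H (colspace F)"
  shows "lag_frame H" and "frame_comb \<i> H ** matrix_inv (frame_comb (-\<i>) H) = frame_comb \<i> F ** matrix_inv (frame_comb (-\<i>) F)"
    and "frame_comb (-\<i>) H ** matrix_inv (frame_comb \<i> H) = frame_comb (-\<i>) F ** matrix_inv (frame_comb \<i> F)"
proof -
  have cs: "colspace H = colspace F" and inj: "\<And>v. H *v v = 0 \<Longrightarrow> v = 0"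
    using H by (auto simp: is_frame_def rank_injective)
  have "\<exists>c. H *v axis j 1 = F *v c" for j
  proof -
    have "H *v axis j 1 \<in> colspace F" unfolding cs[symmetric] by (auto simp: colspace_range)
    then show ?thesis by (auto simp: colspace_range)
  qed
  then obtain c where c: "\<And>j. H *v axis j 1 = F *v c j" by metis
  define C where "C = (\<chi> i j. c j $ i)"
  have HC: "H = F ** C"
  proof -
    have "H $ i $ j = (F ** C) $ i $ j" for i j
      using arg_cong[OF c[of j], of "\<lambda>x. x $ i"]
      by (simp add: matrix_vector_mult_basis column_def matrix_matrix_mult_def matrix_vector_mult_def C_def
          axis_def if_distrib if_distribR cong: if_cong)
    then show ?thesis by (simp add: vec_eq_iff)
  qed
  have "invertible C"
  proof (rule invertible_kernelI)
    fix v assume "C *v v = 0"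
    then have "H *v v = 0" by (simp add: HC matrix_vector_mul_assoc[symmetric])
    then show "v = 0" by (rule inj)
  qed
  then obtain C' where C': "C ** C' = mat 1" by (auto simp: invertible_def)
  show lH: "lag_frame H"
    unfolding lag_frame_def
  proof (intro conjI allI impI)
    have "adj H ** Jmat ** H = adj C ** (adj F ** Jmat ** F) ** C"
      by (simp add: HC adj_mult matrix_mul_assoc)
    then show "adj H ** Jmat ** H = 0" using F by (simp add: lag_frame_def)
  qed (rule inj)
  have *: "frame_comb z H ** matrix_inv (frame_comb y H) = frame_comb z F ** matrix_inv (frame_comb y F)"
    if "invertible (frame_comb y H)" "invertible (frame_comb y F)" for y z
  proof -
    let ?X = "frame_comb z H ** matrix_inv (frame_comb y H)"
    have "?X ** frame_comb y F = ?X ** (frame_comb y H ** C')"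
      by (simp add: HC frame_comb_mult matrix_mul_assoc[symmetric] C')
    also have "\<dots> = frame_comb z H ** (matrix_inv (frame_comb y H) ** frame_comb y H) ** C'"
      by (simp add: matrix_mul_assoc)
    also have "\<dots> = frame_comb z F"
      by (simp add: matrix_inv_mult that) (simp add: HC frame_comb_mult matrix_mul_assoc[symmetric] C')
    finally have "?X ** (frame_comb y F ** matrix_inv (frame_comb y F)) = frame_comb z F ** matrix_inv (frame_comb y F)"
      by (simp add: matrix_mul_assoc)
    then show ?thesis by (simp add: matrix_inv_mult that)
  qed
  show "frame_comb \<i> H ** matrix_inv (frame_comb (-\<i>) H) = frame_comb \<i> F ** matrix_inv (frame_comb (-\<i>) F)"
    "frame_comb (-\<i>) H ** matrix_inv (frame_comb \<i> H) = frame_comb (-\<i>) F ** matrix_inv (frame_comb \<i> F)"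
    by (rule *; rule lag_frame_invertible; fact)+
qed

lemma Wtilde_frame_change:
  assumes "lag_frame F" "lag_frame G" "is_frame F' (colspace F)" "is_frame G' (colspace G)"
  shows "Wtilde F' G' = Wtilde F G"
  unfolding Wtilde_def
  using frame_change(2)[OF assms(1,3)] frame_change(3)[OF assms(2,4)]
  by (metis matrix_mul_assoc)

lemma continuous_on_frame_comb [continuous_intros]:
  assumes "continuous_on S F"
  shows "continuous_on S (\<lambda>t. frame_comb z (F t))"
  unfolding frame_comb_def
  by (intro continuous_on_vec_lambda continuous_intros assms)

lemma continuous_on_Wtilde:
  assumes "continuous_on S F" "continuous_on S G" "\<And>t. t \<in> S \<Longrightarrow> lag_frame (F t)" "\<And>t. t \<in> S \<Longrightarrow> lag_frame (G t)"
  shows "continuous_on S (\<lambda>t. Wtilde (F t) (G t))"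
  unfolding Wtilde_def
  by (intro continuous_intros continuous_on_matrix_inv lag_frame_invertible assms)

text \<open>
  With \<open>u = (z - Wtilde Z G)\<^sup>-\<^sup>1 v\<close> and \<open>u = frame_comb \<i> G g\<close>, the product \<open>gvec \<epsilon> G Z v\<close> is the vector \<open>c\<close> for which
  \<open>Z c\<close> and \<open>G g\<close> have the same image under \<open>x - i y\<close>; then \<open>- Wtilde Z G u\<close> is the image of \<open>Z c\<close> under \<open>x + i y\<close>.
\<close>
definition gvec :: "real \<Rightarrow> complex ^ 'n ^ ('n::finite + 'n) \<Rightarrow> complex ^ 'n ^ ('n + 'n) \<Rightarrow> complex ^ 'n ^ 'n" where
  "gvec \<epsilon> G Z = matrix_inv (frame_comb (-\<i>) Z) ** frame_comb (-\<i>) G ** matrix_inv (frame_comb \<i> G)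
     ** matrix_inv (mat (cis (pi + \<epsilon>)) - Wtilde Z G)"

text \<open>
  In \<open>gform_diff\<close> the term \<open>(u, u')\<close> can be computed with \<open>x - i y\<close> instead of \<open>x + i y\<close>, because
  \<open>G\<close> is isotropic, and in that form it involves only the plane \<open>Z\<close>.  The difference of the two inner products is
  then the symplectic product of the two positions of the moving plane, by \<open>cinner_comb\<close>.
\<close>
lemma gform_frames:
  assumes Z: "lag_frame Z" "lag_frame Z'" and G: "lag_frame G"
    and z: "cis (pi + \<epsilon>) \<notin> mspectrum (Wtilde Z G)" "cis (pi + \<epsilon>) \<notin> mspectrum (Wtilde Z' G)"
  shows "gform \<epsilon> (Wtilde Z' G) v - gform \<epsilon> (Wtilde Z G) v
    = 4 * ((Jmat *v (Z *v (gvec \<epsilon> G Z *v v))) \<bullet> (Z' *v (gvec \<epsilon> G Z' *v v)))"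
proof -
  define u where "u = matrix_inv (mat (cis (pi + \<epsilon>)) - Wtilde Z G) *v v"
  define u' where "u' = matrix_inv (mat (cis (pi + \<epsilon>)) - Wtilde Z' G) *v v"
  let ?B = "\<lambda>u. frame_comb (-\<i>) G *v (matrix_inv (frame_comb \<i> G) *v u)"
  let ?c = "gvec \<epsilon> G Z *v v" and ?c' = "gvec \<epsilon> G Z' *v v"
  note inv = lag_frame_invertible[OF Z(1)] lag_frame_invertible[OF Z(2)] lag_frame_invertible[OF G]
  have c: "?c = matrix_inv (frame_comb (-\<i>) Z) *v ?B u" "?c' = matrix_inv (frame_comb (-\<i>) Z') *v ?B u'"
    by (simp_all add: gvec_def u_def u'_def matrix_vector_mul_assoc matrix_mul_assoc)
  have W: "Wtilde Z G *v u = - (frame_comb \<i> Z *v ?c)" "Wtilde Z' G *v u' = - (frame_comb \<i> Z' *v ?c')"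
    by (simp_all add: Wtilde_vector c)
  have "cinner u u' = cinner (?B u) (?B u')"
    by (simp add: lag_frame_cinner[OF G, symmetric] inv_vector inv)
  also have "\<dots> = cinner (frame_comb (-\<i>) Z *v ?c) (frame_comb (-\<i>) Z' *v ?c')"
    by (simp add: c inv_vector inv)
  finally have uu: "cinner u u' = cinner (frame_comb (-\<i>) Z *v ?c) (frame_comb (-\<i>) Z' *v ?c')" .
  have "gform \<epsilon> (Wtilde Z' G) v - gform \<epsilon> (Wtilde Z G) v
    = Re (- 2 * \<i> * (cinner u u' - cinner (Wtilde Z G *v u) (Wtilde Z' G *v u')))"
    by (rule gform_diff[OF unitary_Wtilde[OF Z(1) G] unitary_Wtilde[OF Z(2) G] z u_def u'_def])
  also have "cinner u u' - cinner (Wtilde Z G *v u) (Wtilde Z' G *v u') = 2 * \<i> * cinner (Jmat *v (Z *v ?c)) (Z' *v ?c')"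
    using cinner_comb[of "Z *v ?c" "Z' *v ?c'"] unfolding uu W cinner_minus frame_comb_vector
    by (simp add: algebra_simps)
  also have "Re (- 2 * \<i> * (2 * \<i> * cinner (Jmat *v (Z *v ?c)) (Z' *v ?c'))) = 4 * Re (cinner (Jmat *v (Z *v ?c)) (Z' *v ?c'))"
    by simp
  finally show ?thesis by (simp add: Re_cinner)
qed

text \<open>
  All four factors of \<open>gvec\<close> are invertible.
\<close>
lemma gvec_nonzero:
  assumes Z: "lag_frame Z" and G: "lag_frame G" and z: "cis (pi + \<epsilon>) \<notin> mspectrum (Wtilde Z G)" and v: "v \<noteq> 0"
  shows "gvec \<epsilon> G Z *v v \<noteq> 0"
proof
  assume 0: "gvec \<epsilon> G Z *v v = 0"
  let ?R = "mat (cis (pi + \<epsilon>)) - Wtilde Z G"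
  note inv = lag_frame_invertible[OF Z] lag_frame_invertible[OF G]
  have R: "invertible ?R" using z by (simp add: mspectrum_iff_det invertible_det_nz)
  have "v = ?R *v (frame_comb \<i> G *v (matrix_inv (frame_comb (-\<i>) G) *v (frame_comb (-\<i>) Z *v (gvec \<epsilon> G Z *v v))))"
    by (simp add: gvec_def matrix_vector_mul_assoc[symmetric] inv_vector inv R)
  then show False using v by (simp add: 0)
qed

lemma continuous_on_gvec:
  assumes "continuous_on S Z" "\<And>t. t \<in> S \<Longrightarrow> lag_frame (Z t)" "lag_frame G"
    "\<And>t. t \<in> S \<Longrightarrow> cis (pi + \<epsilon>) \<notin> mspectrum (Wtilde (Z t) G)"
  shows "continuous_on S (\<lambda>t. gvec \<epsilon> G (Z t))"
  unfolding gvec_def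
  by (intro continuous_intros continuous_on_matrix_inv continuous_on_Wtilde lag_frame_invertible assms)
    (use assms(4) in \<open>simp_all add: mspectrum_iff_det invertible_det_nz\<close>)

text \<open>
  The condition \<open>\<alpha> J \<alpha>\<^sup>* = 0\<close> says that the columns of \<open>J \<alpha>\<^sup>*\<close> span an isotropic plane, and this plane is the kernel
  of \<open>\<alpha>\<close>; the second identity expresses the boundary condition by the symplectic product with that frame.
\<close>
lemma boundary_frame:
  fixes \<alpha> :: "complex ^ ('n::finite + 'n) ^ 'n"
  assumes r: "rank \<alpha> = CARD('n)" and s: "\<alpha> ** Jmat ** adj \<alpha> = 0"
  shows "lag_frame (Jmat ** adj \<alpha>)" and "\<alpha> = adj (Jmat ** adj \<alpha>) ** Jmat"
proof -
  show eq: "\<alpha> = adj (Jmat ** adj \<alpha>) ** Jmat"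
    by (simp add: adj_mult adj_Jmat matrix_mult_minus_left matrix_mult_minus_right matrix_mul_assoc[symmetric] Jmat_Jmat)
  have li: "\<exists>B. \<alpha> ** B = mat 1"
  proof -
    have rows: "rows \<alpha> = range (\<lambda>i. row i \<alpha>)" by (auto simp: rows_def)
    have dim: "vec.dim (rows \<alpha>) = CARD('n)" using r by (simp add: row_rank_def_gen)
    have "vec.dim (rows \<alpha>) \<le> card (rows \<alpha>)" by (rule vec.dim_le_card') (simp add: rows)
    moreover have "card (rows \<alpha>) \<le> CARD('n)" unfolding rows by (rule card_image_le) simp
    ultimately have card: "card (rows \<alpha>) = CARD('n)" using dim by simp
    then have inj: "inj (\<lambda>i. row i \<alpha>)" by (intro eq_card_imp_inj_on) (simp_all add: rows)
    have "vec.independent (rows \<alpha>)"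
      using vec.card_eq_dim[of "rows \<alpha>" "rows \<alpha>"] card dim by (simp add: vec.span_superset rows)
    then have "(\<Sum>i\<in>UNIV. c i *s row i \<alpha>) = 0 \<longrightarrow> (\<forall>i. c i = 0)" for c
    proof (intro impI allI)
      fix i
      assume ind: "vec.independent (rows \<alpha>)" and 0: "(\<Sum>i\<in>UNIV. c i *s row i \<alpha>) = 0"
      define d where "d x = c (inv (\<lambda>i. row i \<alpha>) x)" for x
      have d: "d (row j \<alpha>) = c j" for j using inv_f_f[OF inj, of j] by (simp add: d_def)
      have "(\<Sum>x\<in>rows \<alpha>. d x *s x) = 0"
        unfolding rows using 0 by (subst sum.reindex[OF inj]) (simp add: d)
      then have "d (row i \<alpha>) = 0"
        using vec.independentD[OF ind, of "rows \<alpha>" d "row i \<alpha>"] by (simp add: rows)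
      then show "c i = 0" by (simp add: d)
    qed
    then show ?thesis by (simp add: matrix_right_invertible_independent_rows)
  qed
  show "lag_frame (Jmat ** adj \<alpha>)"
    unfolding lag_frame_def
  proof (intro conjI allI impI)
    show "adj (Jmat ** adj \<alpha>) ** Jmat ** (Jmat ** adj \<alpha>) = 0"
      using s unfolding eq[symmetric] by (simp add: matrix_mul_assoc)
    fix v assume "(Jmat ** adj \<alpha>) *v v = 0"
    then have "Jmat *v (Jmat *v (adj \<alpha> *v v)) = 0" by (simp add: matrix_vector_mul_assoc[symmetric])
    then have 0: "adj \<alpha> *v v = 0" by simp
    obtain B where "\<alpha> ** B = mat 1" using li ..
    then have "adj B ** adj \<alpha> = mat 1" by (metis adj_mat adj_mult complex_cnj_one)
    then have "v = adj B *v (adj \<alpha> *v v)" by (simp add: matrix_vector_mul_assoc)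
    then show "v = 0" using 0 by simp
  qed
qed

section \<open>Submultiplicativity of the matrix norm\<close>

text \<open>
  The Euclidean norm of all entries, so the Cauchy-Schwarz inequality for rows and columns applies.
\<close>
lemma norm_matrix_sq: "norm A = L2_set (\<lambda>i. L2_set (\<lambda>j. norm (A $ i $ j)) UNIV) UNIV"
  for A :: "complex ^ 'k ^ 'm"
  by (simp add: norm_vec_def)

lemma norm_mm_le: "norm (A ** B) \<le> norm A * norm B"
  for A :: "complex ^ 'k ^ 'm" and B :: "complex ^ 'l ^ 'k"
proof -
  define r where "r i = L2_set (\<lambda>k. norm (A $ i $ k)) UNIV" for i
  define c where "c j = L2_set (\<lambda>k. norm (B $ k $ j)) UNIV" for j
  have entry: "norm ((A ** B) $ i $ j) \<le> r i * c j" for i j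
  proof -
    have "norm ((A ** B) $ i $ j) \<le> (\<Sum>k\<in>UNIV. norm (A $ i $ k) * norm (B $ k $ j))"
      unfolding matrix_matrix_mult_def vec_lambda_beta
      by (rule order_trans[OF norm_sum]) (simp add: norm_mult)
    also have "\<dots> \<le> r i * c j"
      unfolding r_def c_def using L2_set_mult_ineq[of "\<lambda>k. norm (A $ i $ k)" "\<lambda>k. norm (B $ k $ j)" UNIV] by simp
    finally show ?thesis .
  qed
  have c0: "0 \<le> c j" and r0: "0 \<le> r i" for i j by (simp_all add: c_def r_def L2_set_nonneg)
  have cB: "L2_set c UNIV = norm B"
  proof -
    have "(\<Sum>j\<in>UNIV. (c j)\<^sup>2) = (\<Sum>j\<in>UNIV. \<Sum>k\<in>UNIV. (norm (B $ k $ j))\<^sup>2)"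
      by (simp add: c_def L2_set_def sum_nonneg)
    also have "\<dots> = (\<Sum>k\<in>UNIV. \<Sum>j\<in>UNIV. (norm (B $ k $ j))\<^sup>2)" by (rule sum.swap)
    also have "\<dots> = (\<Sum>k\<in>UNIV. (L2_set (\<lambda>j. norm (B $ k $ j)) UNIV)\<^sup>2)"
      by (simp add: L2_set_def sum_nonneg)
    finally show ?thesis by (simp add: norm_matrix_sq L2_set_def[of c] L2_set_def[of "\<lambda>i. L2_set (\<lambda>j. norm (B $ i $ j)) UNIV"])
  qed
  have "norm (A ** B) \<le> L2_set (\<lambda>i. L2_set (\<lambda>j. r i * c j) UNIV) UNIV"
    unfolding norm_matrix_sq by (intro L2_set_mono entry) (auto simp: L2_set_nonneg)
  also have "\<dots> = L2_set (\<lambda>i. r i * norm B) UNIV"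
    by (simp add: L2_set_right_distrib[OF r0, symmetric] cB)
  also have "\<dots> = norm A * norm B"
    by (simp add: L2_set_left_distrib[symmetric] r_def norm_matrix_sq)
  finally show ?thesis .
qed

lemma norm_adj: "norm (adj A) = norm A" for A :: "complex ^ 'k ^ 'm"
proof -
  have "(\<Sum>j\<in>UNIV. \<Sum>i\<in>UNIV. (norm (A $ i $ j))\<^sup>2) = (\<Sum>i\<in>UNIV. \<Sum>j\<in>UNIV. (norm (A $ i $ j))\<^sup>2)"
    by (rule sum.swap)
  then show ?thesis by (simp add: norm_matrix_sq adj_def L2_set_def sum_nonneg)
qed

lemma norm_mv_le: "norm (A *v v) \<le> norm A * norm v" for A :: "complex ^ 'k ^ 'm"
proof -
  have "norm ((A *v v) $ i) \<le> L2_set (\<lambda>k. norm (A $ i $ k)) UNIV * norm v" for i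
  proof -
    have "norm ((A *v v) $ i) \<le> (\<Sum>k\<in>UNIV. norm (A $ i $ k) * norm (v $ k))"
      unfolding matrix_vector_mult_def vec_lambda_beta
      by (rule order_trans[OF norm_sum]) (simp add: norm_mult)
    also have "\<dots> \<le> L2_set (\<lambda>k. norm (A $ i $ k)) UNIV * L2_set (\<lambda>k. norm (v $ k)) UNIV"
      using L2_set_mult_ineq[of "\<lambda>k. norm (A $ i $ k)" "\<lambda>k. norm (v $ k)" UNIV] by simp
    finally show ?thesis by (simp add: norm_vec_def)
  qed
  then have "norm (A *v v) \<le> L2_set (\<lambda>i. L2_set (\<lambda>k. norm (A $ i $ k)) UNIV * norm v) UNIV"
    unfolding norm_vec_def[of "A *v v"] by (intro L2_set_mono) auto
  also have "\<dots> = norm A * norm v" by (simp add: L2_set_left_distrib[symmetric] norm_matrix_sq)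
  finally show ?thesis .
qed

section \<open>Absolutely continuous functions are integrals\<close>

lemma AE_leb01_iff: "(AE x in leb01. P x) \<longleftrightarrow> (\<exists>N. negligible N \<and> (\<forall>x\<in>{0<..<1} - N. P x))"
proof -
  have "(AE x in leb01. P x) \<longleftrightarrow> (AE x in lebesgue. x \<in> {0<..<1} \<longrightarrow> P x)"
    by (subst AE_restrict_space_iff) auto
  also have "\<dots> \<longleftrightarrow> (\<exists>N. negligible N \<and> (\<forall>x\<in>{0<..<1} - N. P x))"
  proof -
    have "{x \<in> space lebesgue. \<not> (x \<in> {0<..<1} \<longrightarrow> P x)} \<subseteq> M \<longleftrightarrow> (\<forall>x\<in>{0<..<1} - M. P x)" for M
      by auto
    then show ?thesis
      unfolding eventually_ae_filter negligible_iff_null_sets Bex_def by (simp only:)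
  qed
  finally show ?thesis .
qed

text \<open>
  Outer regularity of Lebesgue measure.
\<close>
lemma negligible_small_open:
  fixes N :: "real set"
  assumes N: "negligible N" and e: "e > 0"
  obtains U where "open U" "N \<subseteq> U" "U \<in> lmeasurable" "measure lebesgue U < e"
proof -
  have Ns: "N \<in> sets lebesgue" "emeasure lebesgue N = 0"
    using N by (auto simp: negligible_iff_null_sets)
  obtain U where U: "open U" "N \<subseteq> U" "(U - N) \<in> lmeasurable" "emeasure lebesgue (U - N) < ennreal e"
    using sets_lebesgue_outer_open[OF Ns(1) e] by blast
  have "U = (U - N) \<union> N" using U by auto
  then have "emeasure lebesgue U \<le> emeasure lebesgue (U - N) + emeasure lebesgue N"
    using emeasure_subadditive[of "U - N" lebesgue N] Ns U(3) by (metis fmeasurableD)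
  then have less: "emeasure lebesgue U < ennreal e" using U Ns by simp
  have Um: "U \<in> lmeasurable"
    using less U(1) by (intro fmeasurableI) (auto simp: less_top[symmetric])
  then have "measure lebesgue U < e"
    using less e by (simp add: emeasure_eq_measure2 ennreal_less_iff)
  then show ?thesis using that U Um by blast
qed

lemma AC_continuous:
  assumes "abs_continuous_on a b f" shows "continuous_on {a..b} f"
  unfolding continuous_on_iff
proof (intro ballI allI impI)
  fix x and e :: real assume x: "x \<in> {a..b}" and e: "e > 0"
  obtain \<delta> where \<delta>: "\<delta> > 0" and ac: "\<And>(N::nat) c d. (\<forall>i<N. a \<le> c i \<and> c i \<le> d i \<and> d i \<le> b) \<Longrightarrow>
       disjoint_family_on (\<lambda>i. {c i<..<d i}) {..<N} \<Longrightarrow> (\<Sum>i<N. d i - c i) < \<delta> \<Longrightarrow>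
       (\<Sum>i<N. norm (f (d i) - f (c i))) < e"
    using assms e unfolding abs_continuous_on_def by meson
  have "dist (f y) (f x) < e" if y: "y \<in> {a..b}" "dist y x < \<delta>" for y
    using ac[of 1 "\<lambda>_. min x y" "\<lambda>_. max x y"] x y
    by (cases "x \<le> y") (auto simp: dist_real_def dist_norm min_def max_def disjoint_family_on_def norm_minus_commute)
  then show "\<exists>d>0. \<forall>y\<in>{a..b}. dist y x < d \<longrightarrow> dist (f y) (f x) < e" using \<delta> by blast
qed

lemma AC_linear_image:
  assumes f: "abs_continuous_on a b f" and h: "bounded_linear h"
  shows "abs_continuous_on a b (\<lambda>x. h (f x))"
  unfolding abs_continuous_on_def
proof (intro allI impI)
  fix e :: real assume e: "e > 0"
  obtain K where K: "K > 0" "\<And>x. norm (h x) \<le> norm x * K" using bounded_linear.pos_bounded[OF h] by blast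
  obtain \<delta> where \<delta>: "\<delta> > 0" and ac: "\<And>(N::nat) c d. (\<forall>i<N. a \<le> c i \<and> c i \<le> d i \<and> d i \<le> b) \<Longrightarrow>
       disjoint_family_on (\<lambda>i. {c i<..<d i}) {..<N} \<Longrightarrow> (\<Sum>i<N. d i - c i) < \<delta> \<Longrightarrow>
       (\<Sum>i<N. norm (f (d i) - f (c i))) < e / K"
    using f divide_pos_pos[OF e K(1)] unfolding abs_continuous_on_def by meson
  show "\<exists>\<delta>>0. \<forall>(N::nat) c d. (\<forall>i<N. a \<le> c i \<and> c i \<le> d i \<and> d i \<le> b) \<longrightarrow>
       disjoint_family_on (\<lambda>i. {c i<..<d i}) {..<N} \<longrightarrow> (\<Sum>i<N. d i - c i) < \<delta> \<longrightarrow>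
       (\<Sum>i<N. norm (h (f (d i)) - h (f (c i)))) < e"
  proof (intro exI[of _ \<delta>] conjI \<delta> allI impI)
    fix N :: nat and c d
    assume A: "\<forall>i<N. a \<le> c i \<and> c i \<le> d i \<and> d i \<le> b" "disjoint_family_on (\<lambda>i. {c i<..<d i}) {..<N}" "(\<Sum>i<N. d i - c i) < \<delta>"
    have "(\<Sum>i<N. norm (h (f (d i)) - h (f (c i)))) \<le> (\<Sum>i<N. norm (f (d i) - f (c i)) * K)"
      by (intro sum_mono) (simp add: linear_diff[OF bounded_linear.linear[OF h], symmetric] K(2))
    also have "\<dots> < e" using ac[OF A] K(1) by (simp add: sum_distrib_right[symmetric] pos_less_divide_eq)
    finally show "(\<Sum>i<N. norm (h (f (d i)) - h (f (c i)))) < e" .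
  qed
qed

text \<open>
  The \<open>\<epsilon>\<close>-\<open>\<delta>\<close> condition of absolute continuity speaks of enumerated disjoint intervals; here it is transferred
  to the intervals of a tagged division.
\<close>
lemma tagged_intervals_sum:
  fixes f :: "real \<Rightarrow> 'a::real_normed_vector"
  assumes q: "q tagged_partial_division_of {s..t}" and st: "a \<le> s" "t \<le> b"
    and U: "U \<in> lmeasurable" "\<And>x K. (x, K) \<in> q \<Longrightarrow> K \<subseteq> U"
    and ac: "\<And>(N::nat) c d. (\<forall>i<N. a \<le> c i \<and> c i \<le> d i \<and> d i \<le> b) \<Longrightarrow>
       disjoint_family_on (\<lambda>i. {c i<..<d i}) {..<N} \<Longrightarrow> (\<Sum>i<N. d i - c i) < \<delta> \<Longrightarrow>
       (\<Sum>i<N. norm (f (d i) - f (c i))) < e"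
    and \<delta>: "measure lebesgue U < \<delta>"
  shows "(\<Sum>(x, K)\<in>q. norm (f (Sup K) - f (Inf K))) < e"
proof -
  have fin: "finite q" using tagged_partial_division_ofD(1)[OF q] .
  have I: "K \<noteq> {} \<and> K = {Inf K..Sup K} \<and> s \<le> Inf K \<and> Inf K \<le> Sup K \<and> Sup K \<le> t" if xK: "(x, K) \<in> q" for x K
  proof -
    obtain u v where K: "K = cbox u v" "x \<in> K" "K \<subseteq> {s..t}"
      using tagged_partial_division_ofD(2,3,4)[OF q xK] by metis
    then have "u \<le> v" by auto
    then show ?thesis using K by (auto simp: interval_bounds_real)
  qed
  obtain h where h: "bij_betw h {..<card q} q" using ex_bij_betw_nat_finite[OF fin] atLeast0LessThan by metis
  define c where "c i = Inf (snd (h i))" for i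
  define d where "d i = Sup (snd (h i))" for i
  have hq: "(fst (h i), snd (h i)) \<in> q" if "i < card q" for i
    using h that by (auto simp: bij_betw_def)
  have cd: "\<forall>i<card q. a \<le> c i \<and> c i \<le> d i \<and> d i \<le> b"
    using I[OF hq] st unfolding c_def d_def by force
  have int: "{c i<..<d i} = interior (snd (h i))" if "i < card q" for i
    using I[OF hq[OF that]] unfolding c_def d_def by (metis interior_atLeastAtMost_real)
  have dis: "disjoint_family_on (\<lambda>i. {c i<..<d i}) {..<card q}"
    unfolding disjoint_family_on_def
  proof (intro ballI impI)
    fix i j assume ij: "i \<in> {..<card q}" "j \<in> {..<card q}" "i \<noteq> j"
    then have "h i \<noteq> h j" using h by (auto simp: bij_betw_def inj_on_def)
    then have "(fst (h i), snd (h i)) \<noteq> (fst (h j), snd (h j))" by simp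
    from tagged_partial_division_ofD(5)[OF q hq hq this]
    show "{c i<..<d i} \<inter> {c j<..<d j} = {}" using int ij by auto
  qed
  have "(\<Sum>i<card q. d i - c i) = (\<Sum>i<card q. measure lebesgue {c i<..<d i})"
    using cd by (intro sum.cong) auto
  also have "\<dots> = measure lebesgue (\<Union>i\<in>{..<card q}. {c i<..<d i})"
    by (rule measure_finite_Union[symmetric, OF _ _ dis]) (use cd in auto)
  also have "\<dots> \<le> measure lebesgue U"
  proof (rule measure_mono_fmeasurable[OF _ _ U(1)])
    show "(\<Union>i\<in>{..<card q}. {c i<..<d i}) \<subseteq> U"
      using int U(2)[OF hq] interior_subset by fastforce
  qed auto
  finally have len: "(\<Sum>i<card q. d i - c i) < \<delta>" using \<delta> by simp
  have "(\<Sum>(x, K)\<in>q. norm (f (Sup K) - f (Inf K))) = (\<Sum>i<card q. norm (f (d i) - f (c i)))"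
    unfolding split_def c_def d_def by (rule sum.reindex_bij_betw[OF h, symmetric])
  also have "\<dots> < e" by (rule ac[OF cd dis len])
  finally show ?thesis .
qed

text \<open>
  Off the null set \<open>N\<close> a fine tagged interval obeys the straddle estimate; the intervals tagged in
  \<open>N\<close> lie in an open set of small measure, and absolute continuity controls their contribution.
\<close>
lemma AC_fundamental_theorem:
  fixes f :: "real \<Rightarrow> 'a::euclidean_space"
  assumes ac: "abs_continuous_on a b f" and N: "negligible N"
    and der: "\<And>x. x \<in> {a..b} - N \<Longrightarrow> (f has_vector_derivative g x) (at x)"
    and st: "a \<le> s" "s \<le> t" "t \<le> b"
  shows "(g has_integral (f t - f s)) {s..t}"
proof -
  \<comment> \<open>Tags in \<open>N\<close> then contribute only an increment of \<open>f\<close>.\<close>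
  define g0 where "g0 x = (if x \<in> N then 0 else g x)" for x
  have "(g0 has_integral (f t - f s)) {s..t}"
    unfolding has_integral_real
  proof (intro allI impI)
    fix e :: real assume e: "e > 0"
    define e1 where "e1 = e / 2 / (t - s + 1)"
    have e1: "e1 > 0" "e1 * (t - s) < e / 2" using e st by (auto simp: e1_def divide_simps)
    obtain \<delta> where \<delta>: "\<delta> > 0" and ac': "\<And>(N::nat) c d. (\<forall>i<N. a \<le> c i \<and> c i \<le> d i \<and> d i \<le> b) \<Longrightarrow>
       disjoint_family_on (\<lambda>i. {c i<..<d i}) {..<N} \<Longrightarrow> (\<Sum>i<N. d i - c i) < \<delta> \<Longrightarrow>
       (\<Sum>i<N. norm (f (d i) - f (c i))) < e / 2"
      using ac half_gt_zero[OF e] unfolding abs_continuous_on_def by meson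
    obtain U where U: "open U" "N \<subseteq> U" "U \<in> lmeasurable" "measure lebesgue U < \<delta>"
      using negligible_small_open[OF N \<delta>] by blast
    have "\<exists>r>0. (x \<in> N \<longrightarrow> ball x r \<subseteq> U) \<and> (x \<in> {s..t} - N \<longrightarrow>
        (\<forall>y\<in>{s..t}. norm (y - x) < r \<longrightarrow> norm (f y - f x - (y - x) *\<^sub>R g x) \<le> e1 * norm (y - x)))" for x
    proof (cases "x \<in> N")
      case True
      then have "x \<in> U" using U by auto
      then obtain r where "r > 0" "ball x r \<subseteq> U" using U(1) open_contains_ball by blast
      then show ?thesis using True by auto
    next
      case F: False
      show ?thesis
      proof (cases "x \<in> {s..t}")
        case True
        then have "(f has_vector_derivative g x) (at x)" using der[of x] F st by auto
        then have "(f has_vector_derivative g x) (at x within {s..t})"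
          by (rule has_vector_derivative_at_within)
        then show ?thesis
          using F e1(1) unfolding has_vector_derivative_def has_derivative_within_alt by auto
      qed (use F in \<open>auto intro: exI[of _ 1]\<close>)
    qed
    then obtain r where r: "\<And>x. r x > 0" "\<And>x. x \<in> N \<Longrightarrow> ball x (r x) \<subseteq> U"
      "\<And>x y. x \<in> {s..t} - N \<Longrightarrow> y \<in> {s..t} \<Longrightarrow> norm (y - x) < r x \<Longrightarrow> norm (f y - f x - (y - x) *\<^sub>R g x) \<le> e1 * norm (y - x)"
      by metis
    show "\<exists>\<gamma>. gauge \<gamma> \<and> (\<forall>\<D>. \<D> tagged_division_of {s..t} \<and> \<gamma> fine \<D> \<longrightarrow>
        norm ((\<Sum>(x, K)\<in>\<D>. measure lborel K *\<^sub>R g0 x) - (f t - f s)) < e)"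
    proof (intro exI[of _ "\<lambda>x. ball x (r x)"] conjI allI impI)
      show "gauge (\<lambda>x. ball x (r x))" using r(1) gauge_ball_dependent by blast
      fix p assume "p tagged_division_of {s..t} \<and> (\<lambda>x. ball x (r x)) fine p"
      then have p: "p tagged_division_of {s..t}" and fine: "\<And>x K. (x, K) \<in> p \<Longrightarrow> K \<subseteq> ball x (r x)"
        by (auto simp: fine_def)
      have pp: "p tagged_partial_division_of {s..t}" using p by (simp add: tagged_division_of_def)
      have fin: "finite p" using p by blast
      define S where "S = {xK \<in> p. fst xK \<in> N}"
      have S: "S \<subseteq> p" "finite S" "finite (p - S)" using fin by (auto simp: S_def)
      define D where "D = (\<lambda>(x, K). measure lborel K *\<^sub>R g0 x - (f (Sup K) - f (Inf K)))"
      have I: "\<exists>u v. K = {u..v} \<and> u \<le> v \<and> s \<le> u \<and> v \<le> t \<and> x \<in> K" if xK: "(x, K) \<in> p" for x K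
      proof -
        obtain u v where K: "K = cbox u v" "x \<in> K" "K \<subseteq> {s..t}"
          using tagged_partial_division_ofD(2,3,4)[OF pp xK] by metis
        then show ?thesis by auto
      qed
      have "norm (sum D S) < e / 2"
      proof -
        have "norm (sum D S) \<le> (\<Sum>(x, K)\<in>S. norm (f (Sup K) - f (Inf K)))"
          by (rule sum_norm_le) (auto simp: D_def S_def g0_def split_def norm_minus_commute)
        also have "\<dots> < e / 2"
        proof (rule tagged_intervals_sum[OF tagged_partial_division_subset[OF pp S(1)] st(1,3) U(3) _ ac' U(4)])
          show "K \<subseteq> U" if "(x, K) \<in> S" for x K
            using that fine[of x K] r(2)[of x] by (auto simp: S_def)
        qed
        finally show ?thesis .
      qed
      moreover have "norm (sum D (p - S)) \<le> e1 * (t - s)"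
      proof -
        have "norm (sum D (p - S)) \<le> (\<Sum>(x, K)\<in>p - S. e1 * measure lborel K)"
        proof (rule sum_norm_le)
          fix z assume "z \<in> p - S"
          moreover obtain x K where z: "z = (x, K)" by (cases z)
          ultimately have xK: "(x, K) \<in> p" "(x, K) \<notin> S" by auto
          obtain u v where K: "K = {u..v}" "u \<le> v" "s \<le> u" "v \<le> t" "x \<in> K" using I[OF xK(1)] by blast
          have xN: "x \<in> {s..t} - N" using xK K by (auto simp: S_def)
          have "u \<in> K" "v \<in> K" using K by auto
          then have b: "u \<in> ball x (r x)" "v \<in> ball x (r x)" using fine[OF xK(1)] by blast+
          have "D (x, K) = (f u - f x - (u - x) *\<^sub>R g x) - (f v - f x - (v - x) *\<^sub>R g x)"
            using K xN by (simp add: D_def g0_def interval_bounds_real algebra_simps)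
          also have "norm \<dots> \<le> norm (f u - f x - (u - x) *\<^sub>R g x) + norm (f v - f x - (v - x) *\<^sub>R g x)"
            by (rule norm_triangle_ineq4)
          also have "\<dots> \<le> e1 * norm (u - x) + e1 * norm (v - x)"
            using b K by (intro add_mono r(3)[OF xN]) (auto simp: dist_norm norm_minus_commute)
          also have "\<dots> = e1 * measure lborel K" using K by (simp add: algebra_simps)
          finally show "norm (D z) \<le> (case z of (x, K) \<Rightarrow> e1 * measure lborel K)" by (simp add: z)
        qed
        also have "\<dots> \<le> (\<Sum>(x, K)\<in>p. e1 * measure lborel K)"
          using fin e1(1) by (intro sum_mono2) auto
        also have "\<dots> = e1 * (\<Sum>(x, K)\<in>p. measure lborel K)" by (simp add: sum_distrib_left split_def)
        also have "(\<Sum>(x, K)\<in>p. measure lborel K) = t - s"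
          using additive_content_tagged_division[of p s t] p st by simp
        finally show ?thesis .
      qed
      moreover have "(\<Sum>(x, K)\<in>p. measure lborel K *\<^sub>R g0 x) - (f t - f s) = sum D p"
        using additive_tagged_division_1[OF st(2) p, of f] by (simp add: D_def split_def sum_subtractf)
      moreover have "sum D p = sum D S + sum D (p - S)"
        using sum.subset_diff[OF S(1) fin, of D] by simp
      ultimately show "norm ((\<Sum>(x, K)\<in>p. measure lborel K *\<^sub>R g0 x) - (f t - f s)) < e"
        using norm_triangle_ineq[of "sum D S" "sum D (p - S)"] e1(2) by (simp only:)
    qed
  qed
  then show ?thesis
    by (rule has_integral_spike[OF N, rotated]) (auto simp: g0_def)
qed

section \<open>Increments of interval functions\<close>

text \<open>An additive interval function that is at least \<open>-\<eta> \<integral>h\<close> on short intervals, for every \<open>\<eta> > 0\<close>,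
  is nonnegative: sum over a partition and let \<open>\<eta>\<close> tend to \<open>0\<close>.\<close>
lemma increment_nonneg:
  fixes D :: "real \<Rightarrow> real \<Rightarrow> real"
  assumes h: "h integrable_on {a..b}"
    and add: "\<And>s t u. a \<le> s \<Longrightarrow> s \<le> t \<Longrightarrow> t \<le> u \<Longrightarrow> u \<le> b \<Longrightarrow> D s u = D s t + D t u"
    and loc: "\<And>\<eta> x. \<eta> > 0 \<Longrightarrow> x \<in> {a..b} \<Longrightarrow> \<exists>\<delta>>0. \<forall>s t. a \<le> s \<longrightarrow> s \<le> x \<longrightarrow> x \<le> t \<longrightarrow> t \<le> b \<longrightarrow> t - s < \<delta> \<longrightarrow>
        - \<eta> * integral {s..t} h \<le> D s t"
    and ab: "a \<le> b"
  shows "0 \<le> D a b"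
proof -
  have key: "- \<eta> * integral {a..b} h \<le> D a b" if \<eta>: "\<eta> > 0" for \<eta>
  proof -
    define P where "P s t \<longleftrightarrow> (a \<le> s \<longrightarrow> s \<le> t \<longrightarrow> t \<le> b \<longrightarrow> - \<eta> * integral {s..t} h \<le> D s t)" for s t
    have "P a b" using ab
    proof (induction rule: Bolzano)
      case (trans x y z)
      show ?case unfolding P_def
      proof (intro impI)
        assume r: "a \<le> x" "x \<le> z" "z \<le> b"
        have "h integrable_on {x..z}" using h r by (auto intro: integrable_subinterval_real)
        then have I: "integral {x..y} h + integral {y..z} h = integral {x..z} h"
          using trans r by (intro Henstock_Kurzweil_Integration.integral_combine) auto
        moreover have "- \<eta> * integral {x..y} h \<le> D x y" "- \<eta> * integral {y..z} h \<le> D y z"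
          using trans r unfolding P_def by auto
        moreover have "D x z = D x y + D y z" using r trans by (intro add) auto
        ultimately show "- \<eta> * integral {x..z} h \<le> D x z"
          unfolding I[symmetric] distrib_left by linarith
      qed
    next
      case (local x)
      obtain \<delta> where \<delta>: "\<delta> > 0" "\<And>s t. a \<le> s \<Longrightarrow> s \<le> x \<Longrightarrow> x \<le> t \<Longrightarrow> t \<le> b \<Longrightarrow> t - s < \<delta> \<Longrightarrow> - \<eta> * integral {s..t} h \<le> D s t"
        using loc[OF \<eta>, of x] local by (metis atLeastAtMost_iff)
      show ?case
        using \<delta> unfolding P_def by blast
    qed
    then show ?thesis using ab by (simp add: P_def)
  qed
  show ?thesis
  proof (rule ccontr)
    assume "\<not> 0 \<le> D a b"
    then have neg: "D a b < 0" by simp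
    define c where "c = \<bar>integral {a..b} h\<bar> + 1"
    have c: "c > 0" by (simp add: c_def)
    define \<eta> where "\<eta> = - D a b / (2 * c)"
    have \<eta>: "\<eta> > 0" using neg c by (simp add: \<eta>_def divide_neg_pos)
    have "\<eta> * integral {a..b} h \<le> \<eta> * c" using \<eta> by (intro mult_left_mono) (auto simp: c_def)
    also have "\<dots> = - D a b / 2" using c by (simp add: \<eta>_def)
    finally show False using key[OF \<eta>] neg by simp
  qed
qed

text \<open>
  Each component and its negative satisfy the assumptions of \<open>increment_nonneg\<close>.
\<close>
lemma increment_zero:
  fixes D :: "real \<Rightarrow> real \<Rightarrow> 'a::euclidean_space"
  assumes h: "h integrable_on {a..b}"
    and add: "\<And>s t u. a \<le> s \<Longrightarrow> s \<le> t \<Longrightarrow> t \<le> u \<Longrightarrow> u \<le> b \<Longrightarrow> D s u = D s t + D t u"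
    and loc: "\<And>\<eta> x. \<eta> > 0 \<Longrightarrow> x \<in> {a..b} \<Longrightarrow> \<exists>\<delta>>0. \<forall>s t. a \<le> s \<longrightarrow> s \<le> x \<longrightarrow> x \<le> t \<longrightarrow> t \<le> b \<longrightarrow> t - s < \<delta> \<longrightarrow>
        norm (D s t) \<le> \<eta> * integral {s..t} h"
    and ab: "a \<le> b"
  shows "D a b = 0"
proof (rule euclidean_eqI)
  fix i :: 'a assume i: "i \<in> Basis"
  have le: "\<bar>D s t \<bullet> i\<bar> \<le> norm (D s t)" for s t using Basis_le_norm[OF i] .
  have "0 \<le> D a b \<bullet> i"
  proof (rule increment_nonneg[OF h _ _ ab])
    fix \<eta> :: real and x assume "\<eta> > 0" "x \<in> {a..b}"
    from loc[OF this] show "\<exists>\<delta>>0. \<forall>s t. a \<le> s \<longrightarrow> s \<le> x \<longrightarrow> x \<le> t \<longrightarrow> t \<le> b \<longrightarrow> t - s < \<delta> \<longrightarrow> - \<eta> * integral {s..t} h \<le> D s t \<bullet> i"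
      by (rule ex_forward) (use le in \<open>smt (verit, best) mult_minus_left\<close>)
  next
    fix s t u assume "a \<le> s" "s \<le> t" "t \<le> u" "u \<le> b"
    from add[OF this] show "D s u \<bullet> i = D s t \<bullet> i + D t u \<bullet> i" by (metis inner_add_left)
  qed
  moreover have "0 \<le> - (D a b \<bullet> i)"
  proof (rule increment_nonneg[OF h _ _ ab])
    fix \<eta> :: real and x assume "\<eta> > 0" "x \<in> {a..b}"
    from loc[OF this] show "\<exists>\<delta>>0. \<forall>s t. a \<le> s \<longrightarrow> s \<le> x \<longrightarrow> x \<le> t \<longrightarrow> t \<le> b \<longrightarrow> t - s < \<delta> \<longrightarrow> - \<eta> * integral {s..t} h \<le> - (D s t \<bullet> i)"
      by (rule ex_forward) (use le in \<open>smt (verit, best) mult_minus_left\<close>)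
  next
    fix s t u assume "a \<le> s" "s \<le> t" "t \<le> u" "u \<le> b"
    from add[OF this] show "- (D s u \<bullet> i) = - (D s t \<bullet> i) + - (D t u \<bullet> i)" by (metis inner_add_left minus_add_distrib)
  qed
  ultimately show "D a b \<bullet> i = 0 \<bullet> i" by simp
qed

section \<open>Linear systems with integrable coefficients\<close>

text \<open>
  The bound is required everywhere, not almost everywhere, so that products with continuous factors can be
  estimated without exceptional sets.
\<close>
definition l1_matrix :: "(real \<Rightarrow> complex ^ 'k ^ 'm) \<Rightarrow> (real \<Rightarrow> real) \<Rightarrow> bool" where
  "l1_matrix A b \<longleftrightarrow> A \<in> borel_measurable lebesgue \<and> (\<forall>x. norm (A x) \<le> b x) \<and> b integrable_on {0..1}"

lemma l1_matrixD:
  assumes "l1_matrix A b"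
  shows "A \<in> borel_measurable lebesgue" "norm (A x) \<le> b x" "0 \<le> b x" "b integrable_on {0..1}"
    and "0 \<le> s \<Longrightarrow> t \<le> 1 \<Longrightarrow> b integrable_on {s..t}" "0 \<le> s \<Longrightarrow> t \<le> 1 \<Longrightarrow> 0 \<le> integral {s..t} b"
proof -
  show "A \<in> borel_measurable lebesgue" "norm (A x) \<le> b x" and b: "b integrable_on {0..1}"
    using assms by (auto simp: l1_matrix_def)
  have pos: "0 \<le> b x" for x using assms unfolding l1_matrix_def by (meson norm_ge_zero order_trans)
  show "0 \<le> b x" by (rule pos)
  show "b integrable_on {s..t}" if "0 \<le> s" "t \<le> 1"
    using b that by (auto intro: integrable_on_subinterval)
  then show "0 \<le> integral {s..t} b" if "0 \<le> s" "t \<le> 1"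
    using that pos by (intro integral_nonneg) auto
qed

lemma continuous_measurable_01:
  fixes f :: "real \<Rightarrow> 'a::euclidean_space"
  assumes "continuous_on {0..1} f" shows "f \<in> borel_measurable (lebesgue_on {0..1})"
  using assms by (intro continuous_imp_measurable_on_sets_lebesgue) auto

lemma measurable_mm:
  fixes A :: "'a \<Rightarrow> complex ^ 'k ^ 'm" and B :: "'a \<Rightarrow> complex ^ 'l ^ 'k"
  assumes "A \<in> borel_measurable M" "B \<in> borel_measurable M"
  shows "(\<lambda>x. A x ** B x) \<in> borel_measurable M"
  by (rule borel_measurable_continuous_Pair[OF assms]) (intro continuous_intros)

lemma l1_factors:
  assumes A: "l1_matrix A b"
  shows "norm L * norm R \<le> c \<Longrightarrow> norm (L ** A x ** R) \<le> c * b x"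
    and "norm R \<le> c \<Longrightarrow> norm (A x ** R) \<le> c * b x"
proof -
  assume c: "norm L * norm R \<le> c"
  have "norm (L ** A x ** R) \<le> norm L * norm (A x) * norm R"
    by (meson mult_right_mono norm_ge_zero norm_mm_le order_trans)
  also have "\<dots> = (norm L * norm R) * norm (A x)" by simp
  also have "\<dots> \<le> c * b x"
    using c l1_matrixD(2)[OF A, of x] by (intro mult_mono) (auto intro: order_trans[OF _ c])
  finally show "norm (L ** A x ** R) \<le> c * b x" .
next
  assume c: "norm R \<le> c"
  have "norm (A x ** R) \<le> norm R * norm (A x)" using norm_mm_le[of "A x" R] by (simp add: mult.commute)
  also have "\<dots> \<le> c * b x"
    using c l1_matrixD(2)[OF A, of x] by (intro mult_mono) (auto intro: order_trans[OF _ c])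
  finally show "norm (A x ** R) \<le> c * b x" .
qed

lemma l1_product_integrable:
  fixes A :: "real \<Rightarrow> complex ^ 'k ^ 'm"
  assumes A: "l1_matrix A b" and L: "continuous_on {0..1} L" and R: "continuous_on {0..1} R"
    and st: "0 \<le> s" "t \<le> 1"
  shows "(\<lambda>x. L x ** A x ** R x) integrable_on {s..t}"
proof -
  have "bounded ((\<lambda>x. norm (L x) * norm (R x)) ` {0..1})"
    by (intro compact_imp_bounded compact_continuous_image continuous_intros L R) auto
  then obtain K where K: "\<And>x. x \<in> {0..1} \<Longrightarrow> norm (L x) * norm (R x) \<le> K"
    unfolding bounded_iff by fastforce
  have "(\<lambda>x. L x ** A x ** R x) absolutely_integrable_on {0..1}"
  proof (rule measurable_bounded_by_integrable_imp_absolutely_integrable)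
    show "(\<lambda>x. L x ** A x ** R x) \<in> borel_measurable (lebesgue_on {0..1})"
      by (intro measurable_mm continuous_measurable_01 L R measurable_restrict_space1 l1_matrixD(1)[OF A])
    show "(\<lambda>x. K * b x) integrable_on {0..1}"
      using l1_matrixD(4)[OF A] by (rule integrable_on_mult_right)
    show "norm (L x ** A x ** R x) \<le> K * b x" if "x \<in> {0..1}" for x
      by (rule l1_factors(1)[OF A K[OF that]])
  qed auto
  then have "(\<lambda>x. L x ** A x ** R x) integrable_on {0..1}"
    using absolutely_integrable_on_def by blast
  then show ?thesis using st by (auto intro: integrable_on_subinterval)
qed

lemma l1_product_bound:
  fixes A :: "real \<Rightarrow> complex ^ 'k ^ 'm"
  assumes A: "l1_matrix A b" and L: "continuous_on {0..1} L" and R: "continuous_on {0..1} R"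
    and st: "0 \<le> s" "t \<le> 1" and c: "\<And>x. x \<in> {s..t} \<Longrightarrow> norm (L x ** A x ** R x) \<le> c * b x"
  shows "norm (integral {s..t} (\<lambda>x. L x ** A x ** R x)) \<le> c * integral {s..t} b"
proof -
  have "norm (integral {s..t} (\<lambda>x. L x ** A x ** R x)) \<le> integral {s..t} (\<lambda>x. c * b x)"
  proof (rule integral_norm_bound_integral[OF _ _ c])
    show "(\<lambda>x. L x ** A x ** R x) integrable_on {s..t}" by (rule l1_product_integrable[OF A L R st])
    show "(\<lambda>x. c * b x) integrable_on {s..t}"
      using l1_matrixD(5)[OF A st] by (rule integrable_on_mult_right)
  qed
  then show ?thesis by simp
qed

lemma l1_integrable:
  assumes "l1_matrix A b" "continuous_on {0..1} R" "0 \<le> s" "t \<le> 1"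
  shows "(\<lambda>x. A x ** R x) integrable_on {s..t}"
  using l1_product_integrable[OF assms(1) continuous_on_const[of _ "mat 1"] assms(2-4)] by simp

lemma l1_bound:
  assumes "l1_matrix A b" "continuous_on {0..1} R" "0 \<le> s" "t \<le> 1" "\<And>x. x \<in> {s..t} \<Longrightarrow> norm (A x ** R x) \<le> c * b x"
  shows "norm (integral {s..t} (\<lambda>x. A x ** R x)) \<le> c * integral {s..t} b"
  using l1_product_bound[OF assms(1) continuous_on_const[of _ "mat 1"] assms(2-4)] assms(5) by simp

text \<open>
  The integrated form of \<open>J F' = A F\<close>.
\<close>
definition integral_solution ::
  "(real \<Rightarrow> complex ^ ('n::finite + 'n) ^ ('n + 'n)) \<Rightarrow> (real \<Rightarrow> complex ^ 'k ^ ('n + 'n)) \<Rightarrow> bool" where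
  "integral_solution A F \<longleftrightarrow> continuous_on {0..1} F \<and>
    (\<forall>s t. 0 \<le> s \<longrightarrow> s \<le> t \<longrightarrow> t \<le> 1 \<longrightarrow> ((\<lambda>x. A x ** F x) has_integral (Jmat ** (F t - F s))) {s..t})"

lemma integral_solutionD:
  assumes "integral_solution A F"
  shows "continuous_on {0..1} F"
    and "0 \<le> s \<Longrightarrow> s \<le> t \<Longrightarrow> t \<le> 1 \<Longrightarrow> ((\<lambda>x. A x ** F x) has_integral (Jmat ** (F t - F s))) {s..t}"
    and "0 \<le> s \<Longrightarrow> s \<le> t \<Longrightarrow> t \<le> 1 \<Longrightarrow> integral {s..t} (\<lambda>x. A x ** F x) = Jmat ** (F t - F s)"
  using assms by (auto simp: integral_solution_def intro!: integral_unique)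

lemma Jmat_cancel: "F = - (Jmat ** (Jmat ** F))"
  by (simp add: matrix_mul_assoc Jmat_Jmat matrix_mult_minus_left)

lemma norm_le_Jmat:
  fixes F :: "complex ^ 'k ^ ('n::finite + 'n)"
  shows "norm F \<le> norm (Jmat :: complex ^ ('n + 'n) ^ ('n + 'n)) * norm (Jmat ** F)"
  by (subst Jmat_cancel) (simp add: norm_mm_le)

text \<open>
  The indefinite integral is continuous.
\<close>
lemma short_intervals:
  assumes b: "b integrable_on {0..1}" and e: "e > 0" and x: "x \<in> {0..1::real}"
  shows "\<exists>\<delta>>0. \<forall>s t. 0 \<le> s \<longrightarrow> s \<le> x \<longrightarrow> x \<le> t \<longrightarrow> t \<le> 1 \<longrightarrow> t - s < \<delta> \<longrightarrow> integral {s..t} b < (e::real)"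
proof -
  have "continuous_on {0..1} (\<lambda>y. integral {0..y} b)" by (rule indefinite_integral_continuous_1[OF b])
  then obtain \<delta> where \<delta>: "\<delta> > 0" "\<And>y. y \<in> {0..1} \<Longrightarrow> dist y x < \<delta> \<Longrightarrow> dist (integral {0..y} b) (integral {0..x} b) < e / 2"
    using x e unfolding continuous_on_iff by (metis half_gt_zero)
  have "integral {s..t} b < e" if st: "0 \<le> s" "s \<le> x" "x \<le> t" "t \<le> 1" "t - s < \<delta>" for s t
  proof -
    have "b integrable_on {0..t}" using b st by (auto intro: integrable_on_subinterval)
    then have "integral {0..s} b + integral {s..t} b = integral {0..t} b"
      using st by (intro Henstock_Kurzweil_Integration.integral_combine) auto
    moreover have "dist (integral {0..s} b) (integral {0..x} b) < e / 2" "dist (integral {0..t} b) (integral {0..x} b) < e / 2"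
      using \<delta>(2)[of s] \<delta>(2)[of t] st x by (auto simp: dist_real_def)
    ultimately show ?thesis unfolding dist_real_def by linarith
  qed
  then show ?thesis using \<delta>(1) by blast
qed

text \<open>
  Gronwall's inequality in both directions of \<open>x\<close>: on an interval with \<open>\<integral>b \<le> 1/2\<close> the maximum \<open>M\<close> of
  \<open>|f|\<close> satisfies \<open>M \<le> |f v| + \<gamma> + M/2\<close> for each \<open>v\<close> in it, and finitely many such intervals
  cover \<open>[0,1]\<close>.
\<close>
lemma gronwall:
  assumes b: "b integrable_on {0..1}" and b0: "\<And>x. 0 \<le> b x"
  shows "\<exists>C\<ge>0. \<forall>(f :: real \<Rightarrow> 'a::euclidean_space) \<gamma>. 0 \<le> \<gamma> \<longrightarrow> continuous_on {0..1} f \<longrightarrow>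
    (\<forall>s t M. 0 \<le> s \<longrightarrow> s \<le> t \<longrightarrow> t \<le> 1 \<longrightarrow> (\<forall>x\<in>{s..t}. norm (f x) \<le> M) \<longrightarrow> norm (f t - f s) \<le> \<gamma> + M * integral {s..t} b) \<longrightarrow>
    (\<forall>u\<in>{0..1}. \<forall>v\<in>{0..1}. norm (f u) \<le> C * (norm (f v) + \<gamma>))"
proof -
  define H where "H f \<gamma> \<longleftrightarrow> 0 \<le> \<gamma> \<and> continuous_on {0..1} f \<and>
    (\<forall>s t M. 0 \<le> s \<longrightarrow> s \<le> t \<longrightarrow> t \<le> 1 \<longrightarrow> (\<forall>x\<in>{s..t}. norm (f x) \<le> M) \<longrightarrow> norm (f t - f s) \<le> \<gamma> + M * integral {s..t} b)"
    for f :: "real \<Rightarrow> 'a" and \<gamma>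
  define P where "P s t \<longleftrightarrow> (0 \<le> s \<longrightarrow> s \<le> t \<longrightarrow> t \<le> 1 \<longrightarrow>
     (\<exists>C\<ge>0. \<forall>f \<gamma>. H f \<gamma> \<longrightarrow> (\<forall>u\<in>{s..t}. \<forall>v\<in>{s..t}. norm (f u) \<le> C * (norm (f v) + \<gamma>))))" for s t
  have "P 0 1"
  proof (rule Bolzano[of 0 1 P])
    fix x y z assume P: "P x y" "P y z" and xyz: "x \<le> y" "y \<le> z"
    show "P x z" unfolding P_def
    proof (intro impI)
      assume r: "0 \<le> x" "x \<le> z" "z \<le> 1"
      obtain C1 where C1: "C1 \<ge> 0" "\<And>f \<gamma> u v. H f \<gamma> \<Longrightarrow> u \<in> {x..y} \<Longrightarrow> v \<in> {x..y} \<Longrightarrow> norm (f u) \<le> C1 * (norm (f v) + \<gamma>)"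
        using P(1) r xyz unfolding P_def by (metis order_trans)
      obtain C2 where C2: "C2 \<ge> 0" "\<And>f \<gamma> u v. H f \<gamma> \<Longrightarrow> u \<in> {y..z} \<Longrightarrow> v \<in> {y..z} \<Longrightarrow> norm (f u) \<le> C2 * (norm (f v) + \<gamma>)"
        using P(2) r xyz unfolding P_def by (metis order_trans)
      define C where "C = C1 * C2 + C1 + C2"
      have C0: "C \<ge> 0" "C1 \<le> C" "C2 \<le> C" using C1 C2 by (auto simp: C_def)
      have "norm (f u) \<le> C * (norm (f v) + \<gamma>)" if H: "H f \<gamma>" and u: "u \<in> {x..z}" and v: "v \<in> {x..z}" for f \<gamma> u v
      proof -
        have g0: "0 \<le> \<gamma>" using H by (simp add: H_def)
        have nn: "0 \<le> norm (f v) + \<gamma>" using g0 by simp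
        have mix: "C1 * (C2 * (norm (f v) + \<gamma>) + \<gamma>) \<le> C * (norm (f v) + \<gamma>)" "C2 * (C1 * (norm (f v) + \<gamma>) + \<gamma>) \<le> C * (norm (f v) + \<gamma>)"
          using C1(1) C2(1) g0 nn mult_nonneg_nonneg[of C1 "norm (f v)"] mult_nonneg_nonneg[of C2 "norm (f v)"]
            mult_nonneg_nonneg[of C1 \<gamma>] mult_nonneg_nonneg[of C2 \<gamma>]
          by (auto simp: C_def algebra_simps)
        consider "u \<le> y" "v \<le> y" | "u \<ge> y" "v \<ge> y" | "u \<le> y" "v \<ge> y" | "u \<ge> y" "v \<le> y" by linarith
        then show ?thesis
        proof cases
          case 1
          then have "norm (f u) \<le> C1 * (norm (f v) + \<gamma>)" using C1(2)[OF H] u v by auto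
          also have "\<dots> \<le> C * (norm (f v) + \<gamma>)" using C0 nn by (intro mult_right_mono)
          finally show ?thesis .
        next
          case 2
          then have "norm (f u) \<le> C2 * (norm (f v) + \<gamma>)" using C2(2)[OF H] u v by auto
          also have "\<dots> \<le> C * (norm (f v) + \<gamma>)" using C0 nn by (intro mult_right_mono)
          finally show ?thesis .
        next
          case 3
          have "norm (f u) \<le> C1 * (norm (f y) + \<gamma>)" using C1(2)[OF H, of u y] 3 u xyz by auto
          also have "\<dots> \<le> C1 * (C2 * (norm (f v) + \<gamma>) + \<gamma>)"
            using C2(2)[OF H, of y v] 3 v xyz C1(1) by (intro mult_left_mono add_right_mono) auto
          finally show ?thesis using mix(1) by linarith
        next
          case 4
          have "norm (f u) \<le> C2 * (norm (f y) + \<gamma>)" using C2(2)[OF H, of u y] 4 u xyz by auto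
          also have "\<dots> \<le> C2 * (C1 * (norm (f v) + \<gamma>) + \<gamma>)"
            using C1(2)[OF H, of y v] 4 v xyz C2(1) by (intro mult_left_mono add_right_mono) auto
          finally show ?thesis using mix(2) by linarith
        qed
      qed
      then show "\<exists>C\<ge>0. \<forall>f \<gamma>. H f \<gamma> \<longrightarrow> (\<forall>u\<in>{x..z}. \<forall>v\<in>{x..z}. norm (f u) \<le> C * (norm (f v) + \<gamma>))"
        using C0(1) by blast
    qed
  next
    fix x :: real assume x: "0 \<le> x" "x \<le> 1"
    obtain \<delta> where \<delta>: "\<delta> > 0" and sm: "\<And>s t. 0 \<le> s \<Longrightarrow> s \<le> x \<Longrightarrow> x \<le> t \<Longrightarrow> t \<le> 1 \<Longrightarrow> t - s < \<delta> \<Longrightarrow> integral {s..t} b < 1 / 2"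
      using short_intervals[OF b, of "1/2" x] x by force
    have "P s t" if st: "s \<le> x \<and> x \<le> t \<and> t - s < \<delta>" for s t
      unfolding P_def
    proof (intro impI exI[of _ 2] conjI allI ballI)
      fix f :: "real \<Rightarrow> 'a" and \<gamma> u v
      assume r: "0 \<le> s" "s \<le> t" "t \<le> 1" and H: "H f \<gamma>" and u: "u \<in> {s..t}" and v: "v \<in> {s..t}"
      have fc: "continuous_on {s..t} (\<lambda>x. norm (f x))"
        using H r unfolding H_def by (intro continuous_intros) (auto intro: continuous_on_subset)
      obtain w where w: "w \<in> {s..t}" "\<And>x. x \<in> {s..t} \<Longrightarrow> norm (f x) \<le> norm (f w)"
        using continuous_attains_sup[OF compact_Icc _ fc] r by auto
      have sub: "integral {p..q} b \<le> 1 / 2" if "p \<in> {s..t}" "q \<in> {s..t}" for p q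
      proof -
        have "b integrable_on {s..t}" "b integrable_on {p..q}"
          using b r that by (auto intro: integrable_on_subinterval)
        then have "integral {p..q} b \<le> integral {s..t} b"
          using that b0 by (intro integral_subset_le) auto
        then show ?thesis using sm st r by (smt (verit))
      qed
      have "norm (f w - f v) \<le> \<gamma> + norm (f w) * integral {min v w..max v w} b"
      proof (cases "v \<le> w")
        case True
        then show ?thesis using H r v w unfolding H_def by (auto simp: min_def max_def)
      next
        case False
        then have "norm (f v - f w) \<le> \<gamma> + norm (f w) * integral {w..v} b"
          using H r v w unfolding H_def by auto
        then show ?thesis using False by (simp add: min_def max_def norm_minus_commute)
      qed
      also have "\<dots> \<le> \<gamma> + norm (f w) * (1 / 2)"
        using sub[of "min v w" "max v w"] v w by (intro add_left_mono mult_left_mono) (auto simp: min_def max_def)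
      finally have "norm (f w - f v) \<le> \<gamma> + norm (f w) / 2" by simp
      then have "norm (f w) \<le> 2 * (norm (f v) + \<gamma>)"
        using norm_triangle_ineq2[of "f w" "f v"] by (simp add: algebra_simps)
      then show "norm (f u) \<le> 2 * (norm (f v) + \<gamma>)" using w(2)[OF u] by linarith
    qed simp
    then show "\<exists>d>0. \<forall>s t. s \<le> x \<and> x \<le> t \<and> t - s < d \<longrightarrow> P s t" using \<delta> by blast
  qed simp
  then obtain C where C: "C \<ge> 0" "\<And>f \<gamma>. H f \<gamma> \<Longrightarrow> \<forall>u\<in>{0..1}. \<forall>v\<in>{0..1}. norm (f u) \<le> C * (norm (f v) + \<gamma>)"
    unfolding P_def by auto
  show ?thesis
  proof (intro exI[of _ C] conjI C(1) allI impI)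
    fix f :: "real \<Rightarrow> 'a" and \<gamma>
    assume "0 \<le> \<gamma>" "continuous_on {0..1} f"
      "\<forall>s t M. 0 \<le> s \<longrightarrow> s \<le> t \<longrightarrow> t \<le> 1 \<longrightarrow> (\<forall>x\<in>{s..t}. norm (f x) \<le> M) \<longrightarrow> norm (f t - f s) \<le> \<gamma> + M * integral {s..t} b"
    then have "H f \<gamma>" unfolding H_def by blast
    then show "\<forall>u\<in>{0..1}. \<forall>v\<in>{0..1}. norm (f u) \<le> C * (norm (f v) + \<gamma>)" by (rule C(2))
  qed
qed

lemma integral_solution_increment:
  fixes A :: "real \<Rightarrow> complex ^ ('n::finite + 'n) ^ ('n + 'n)"
  assumes A: "l1_matrix A b" and F: "integral_solution A F" and st: "0 \<le> s" "s \<le> t" "t \<le> 1"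
    and M: "\<And>x. x \<in> {s..t} \<Longrightarrow> norm (F x) \<le> M"
  shows "norm (F t - F s) \<le> M * integral {s..t} (\<lambda>x. norm (Jmat :: complex ^ ('n + 'n) ^ ('n + 'n)) * b x)"
proof -
  let ?j = "norm (Jmat :: complex ^ ('n + 'n) ^ ('n + 'n))"
  have "norm (F t - F s) \<le> ?j * norm (Jmat ** (F t - F s))" by (rule norm_le_Jmat)
  also have "\<dots> \<le> ?j * (M * integral {s..t} b)"
    unfolding integral_solutionD(3)[OF F st, symmetric]
    by (intro mult_left_mono l1_bound[OF A integral_solutionD(1)[OF F] st(1,3)] l1_factors(2)[OF A] M) auto
  finally show ?thesis by (simp add: mult_ac)
qed

lemma integral_solution_unique:
  fixes A :: "real \<Rightarrow> complex ^ ('n::finite + 'n) ^ ('n + 'n)" and F :: "real \<Rightarrow> complex ^ 'k ^ ('n + 'n)"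
  assumes A: "l1_matrix A b" and F: "integral_solution A F" and x0: "x0 \<in> {0..1}" "F x0 = 0" and x: "x \<in> {0..1}"
  shows "F x = 0"
proof -
  let ?b = "\<lambda>x. norm (Jmat :: complex ^ ('n + 'n) ^ ('n + 'n)) * b x"
  have "?b integrable_on {0..1}" using l1_matrixD(4)[OF A] by (rule integrable_on_mult_right)
  moreover have "0 \<le> ?b x" for x using l1_matrixD(3)[OF A] by simp
  ultimately obtain C where C: "\<And>(f :: real \<Rightarrow> complex ^ 'k ^ ('n + 'n)) \<gamma>. 0 \<le> \<gamma> \<Longrightarrow> continuous_on {0..1} f \<Longrightarrow>
    (\<forall>s t M. 0 \<le> s \<longrightarrow> s \<le> t \<longrightarrow> t \<le> 1 \<longrightarrow> (\<forall>x\<in>{s..t}. norm (f x) \<le> M) \<longrightarrow> norm (f t - f s) \<le> \<gamma> + M * integral {s..t} ?b) \<Longrightarrow>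
    (\<forall>u\<in>{0..1}. \<forall>v\<in>{0..1}. norm (f u) \<le> C * (norm (f v) + \<gamma>))"
    using gronwall[of ?b] by metis
  have "\<forall>s t M. 0 \<le> s \<longrightarrow> s \<le> t \<longrightarrow> t \<le> 1 \<longrightarrow> (\<forall>x\<in>{s..t}. norm (F x) \<le> M) \<longrightarrow> norm (F t - F s) \<le> 0 + M * integral {s..t} ?b"
    using integral_solution_increment[OF A F] by simp
  from C[OF _ integral_solutionD(1)[OF F] this] have "norm (F x) \<le> C * (norm (F x0) + 0)"
    using x0(1) x by blast
  then show ?thesis using x0 by simp
qed

lemma integral_solution_mult:
  assumes F: "integral_solution A F" shows "integral_solution A (\<lambda>x. F x ** C)"
  unfolding integral_solution_def
proof (intro conjI allI impI)
  show "continuous_on {0..1} (\<lambda>x. F x ** C)" by (intro continuous_intros integral_solutionD(1)[OF F])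
  fix s t :: real assume st: "0 \<le> s" "s \<le> t" "t \<le> 1"
  from has_integral_linear[OF integral_solutionD(2)[OF F st] bounded_bilinear.bounded_linear_left[OF bounded_bilinear_mm, of C]]
  show "((\<lambda>x. A x ** (F x ** C)) has_integral Jmat ** (F t ** C - F s ** C)) {s..t}"
    by (simp add: o_def matrix_mul_assoc matrix_diff_rdistrib matrix_diff_ldistrib)
qed

text \<open>
  The Lagrange identity.  The two sides are interval functions of \<open>[s,t]\<close> which on a short interval
  differ by at most the oscillation of \<open>F\<close> and \<open>G\<close> times the integral of the coefficient bounds.
\<close>
lemma lagrange_identity:
  fixes A B :: "real \<Rightarrow> complex ^ ('n::finite + 'n) ^ ('n + 'n)"
    and F :: "real \<Rightarrow> complex ^ 'k ^ ('n + 'n)" and G :: "real \<Rightarrow> complex ^ 'l ^ ('n + 'n)"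
  assumes A: "l1_matrix A a" and B: "l1_matrix B b" and Asa: "\<And>x. adj (A x) = A x"
    and F: "integral_solution A F" and G: "integral_solution B G" and st: "0 \<le> s" "s \<le> t" "t \<le> 1"
  shows "adj (F t) ** Jmat ** G t - adj (F s) ** Jmat ** G s
     = integral {s..t} (\<lambda>x. adj (F x) ** B x ** G x) - integral {s..t} (\<lambda>x. adj (F x) ** A x ** G x)"
proof -
  note Fc = integral_solutionD(1)[OF F] and Gc = integral_solutionD(1)[OF G]
  have Fc': "continuous_on {0..1} (\<lambda>x. adj (F x))" by (intro continuous_intros Fc)
  define I where "I p q = integral {p..q} (\<lambda>x. adj (F x) ** B x ** G x) - integral {p..q} (\<lambda>x. adj (F x) ** A x ** G x)" for p q
  define D where "D p q = adj (F q) ** Jmat ** G q - adj (F p) ** Jmat ** G p - I p q" for p q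
  have "bounded ((\<lambda>x. norm (F x)) ` {0..1})" "bounded ((\<lambda>x. norm (G x)) ` {0..1})"
    by (intro compact_imp_bounded compact_continuous_image continuous_intros Fc Gc; simp)+
  then obtain M1 M2 where M1: "\<And>x. x \<in> {0..1} \<Longrightarrow> norm (F x) \<le> M1" and M2: "\<And>x. x \<in> {0..1} \<Longrightarrow> norm (G x) \<le> M2"
    unfolding bounded_iff by (metis imageI abs_norm_cancel real_norm_def)
  define M where "M = max M1 M2 + 1"
  have M: "norm (F x) \<le> M" "norm (G x) \<le> M" if "x \<in> {0..1}" for x
    using M1[OF that] M2[OF that] by (auto simp: M_def)
  have "0 \<le> M1" using order_trans[OF norm_ge_zero M1[of 0]] by simp
  then have M0: "M > 0" by (auto simp: M_def)
  define h where "h x = M * (a x + b x)" for x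
  have "D s t = 0"
  proof (rule increment_zero[of h s t D])
    have "a integrable_on {s..t}" "b integrable_on {s..t}"
      using l1_matrixD(5)[OF A] l1_matrixD(5)[OF B] st by auto
    then show "h integrable_on {s..t}"
      unfolding h_def by (intro integrable_on_mult_right integrable_add)
  next
    fix p q r assume pqr: "s \<le> p" "p \<le> q" "q \<le> r" "r \<le> t"
    have comb: "integral {p..q} f + integral {q..r} f = integral {p..r} f" if "f integrable_on {p..r}" for f :: "real \<Rightarrow> complex ^ 'l ^ 'k"
      using that pqr by (intro Henstock_Kurzweil_Integration.integral_combine) auto
    have "I p r = I p q + I q r"
      unfolding I_def
      using comb[OF l1_product_integrable[OF B Fc' Gc, of p r]] comb[OF l1_product_integrable[OF A Fc' Gc, of p r]] pqr st
      by (simp add: algebra_simps)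
    then show "D p r = D p q + D q r" by (simp add: D_def)
  next
    fix \<eta> :: real and x assume \<eta>: "\<eta> > 0" and x: "x \<in> {s..t}"
    have x01: "x \<in> {0..1}" using x st by auto
    obtain \<delta>1 where \<delta>1: "\<delta>1 > 0" "\<And>y. y \<in> {0..1} \<Longrightarrow> dist y x < \<delta>1 \<Longrightarrow> dist (F y) (F x) < \<eta> / 2"
      using Fc x01 half_gt_zero[OF \<eta>] unfolding continuous_on_iff by metis
    obtain \<delta>2 where \<delta>2: "\<delta>2 > 0" "\<And>y. y \<in> {0..1} \<Longrightarrow> dist y x < \<delta>2 \<Longrightarrow> dist (G y) (G x) < \<eta> / 2"
      using Gc x01 half_gt_zero[OF \<eta>] unfolding continuous_on_iff by metis
    show "\<exists>\<delta>>0. \<forall>p q. s \<le> p \<longrightarrow> p \<le> x \<longrightarrow> x \<le> q \<longrightarrow> q \<le> t \<longrightarrow> q - p < \<delta> \<longrightarrow> norm (D p q) \<le> \<eta> * integral {p..q} h"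
    proof (intro exI[of _ "min \<delta>1 \<delta>2"] conjI allI impI)
      show "min \<delta>1 \<delta>2 > 0" using \<delta>1 \<delta>2 by simp
      fix p q assume pq: "s \<le> p" "p \<le> x" "x \<le> q" "q \<le> t" "q - p < min \<delta>1 \<delta>2"
      have r: "0 \<le> p" "p \<le> q" "q \<le> 1" using pq st by auto
      have osc: "norm (F y - F z) \<le> \<eta>" "norm (G y - G z) \<le> \<eta>" if "y \<in> {p..q}" "z \<in> {p..q}" for y z
      proof -
        have "y \<in> {0..1}" "z \<in> {0..1}" "dist y x < min \<delta>1 \<delta>2" "dist z x < min \<delta>1 \<delta>2"
          using that pq r by (auto simp: dist_real_def)
        then have "dist (F y) (F x) < \<eta> / 2" "dist (F z) (F x) < \<eta> / 2" "dist (G y) (G x) < \<eta> / 2" "dist (G z) (G x) < \<eta> / 2"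
          using \<delta>1(2) \<delta>2(2) by auto
        then show "norm (F y - F z) \<le> \<eta>" "norm (G y - G z) \<le> \<eta>"
          by (metis dist_norm dist_triangle_half_l less_imp_le)+
      qed
      have p01: "p \<in> {p..q}" "q \<in> {p..q}" using r by auto
      have sub: "y \<in> {0..1}" if "y \<in> {p..q}" for y using that r by auto
      have E1: "adj (F p) ** (Jmat ** (G q - G p)) = integral {p..q} (\<lambda>x. adj (F p) ** B x ** G x)"
      proof -
        have "integral {p..q} (\<lambda>x. adj (F p) ** (B x ** G x)) = adj (F p) ** integral {p..q} (\<lambda>x. B x ** G x)"
          using integral_linear[OF _ bounded_bilinear.bounded_linear_right[OF bounded_bilinear_mm, of "adj (F p)"], of "\<lambda>x. B x ** G x" "{p..q}"]
            integral_solutionD(2)[OF G r] by (simp add: o_def has_integral_integrable)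
        then show ?thesis by (simp add: integral_solutionD(3)[OF G r] matrix_mul_assoc)
      qed
      have E2: "adj (F q - F p) ** Jmat ** G q = - integral {p..q} (\<lambda>x. adj (F x) ** A x ** G q)"
      proof -
        have bl: "bounded_linear (\<lambda>Z :: complex ^ 'k ^ ('n + 'n). adj Z ** G q)"
          by (intro bounded_linear_compose[OF bounded_bilinear.bounded_linear_left[OF bounded_bilinear_mm] bounded_linear_adj])
        have "integral {p..q} (\<lambda>x. adj (A x ** F x) ** G q) = adj (integral {p..q} (\<lambda>x. A x ** F x)) ** G q"
          using integral_linear[OF _ bl, of "\<lambda>x. A x ** F x" "{p..q}"]
            integral_solutionD(2)[OF F r] by (simp add: o_def has_integral_integrable)
        then show ?thesis
          by (simp add: integral_solutionD(3)[OF F r] adj_mult Asa adj_Jmat matrix_mult_minus_left matrix_mult_minus_right)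
      qed
      have int: "(\<lambda>x. adj (F p) ** B x ** G x) integrable_on {p..q}" "(\<lambda>x. adj (F x) ** B x ** G x) integrable_on {p..q}"
        "(\<lambda>x. adj (F x) ** A x ** G q) integrable_on {p..q}" "(\<lambda>x. adj (F x) ** A x ** G x) integrable_on {p..q}"
        by (intro l1_product_integrable[OF B] l1_product_integrable[OF A] Fc' Gc continuous_on_const r)+
      have "D p q = adj (F q - F p) ** Jmat ** G q + adj (F p) ** (Jmat ** (G q - G p)) - I p q"
        by (simp add: D_def adj_diff matrix_diff_ldistrib matrix_diff_rdistrib matrix_mul_assoc)
      also have "\<dots> = (integral {p..q} (\<lambda>x. adj (F p) ** B x ** G x) - integral {p..q} (\<lambda>x. adj (F x) ** B x ** G x))
          + (integral {p..q} (\<lambda>x. adj (F x) ** A x ** G x) - integral {p..q} (\<lambda>x. adj (F x) ** A x ** G q))"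
        unfolding E1 E2 I_def by simp
      also have "\<dots> = integral {p..q} (\<lambda>x. adj (F p - F x) ** B x ** G x) + integral {p..q} (\<lambda>x. adj (F x) ** A x ** (G x - G q))"
        by (simp add: integral_diff[OF int(1,2), symmetric] integral_diff[OF int(4,3), symmetric] adj_diff
            matrix_diff_ldistrib matrix_diff_rdistrib)
      also have "norm \<dots> \<le> (\<eta> * M) * integral {p..q} b + (\<eta> * M) * integral {p..q} a"
      proof (intro norm_triangle_mono l1_product_bound[OF B] l1_product_bound[OF A] l1_factors(1)[OF B] l1_factors(1)[OF A] continuous_intros Fc Gc r)
        fix y assume y: "y \<in> {p..q}"
        show "norm (adj (F p - F y)) * norm (G y) \<le> \<eta> * M"
          unfolding norm_adj using osc(1)[OF p01(1) y] M(2)[OF sub[OF y]] \<eta> by (intro mult_mono) auto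
        have "norm (F y) * norm (G y - G q) \<le> M * \<eta>"
          using osc(2)[OF y p01(2)] M(1)[OF sub[OF y]] M0 by (intro mult_mono) auto
        then show "norm (adj (F y)) * norm (G y - G q) \<le> \<eta> * M" unfolding norm_adj by (simp add: mult.commute)
      qed
      also have "\<dots> = \<eta> * integral {p..q} h"
      proof -
        have "a integrable_on {p..q}" "b integrable_on {p..q}" using l1_matrixD(5)[OF A] l1_matrixD(5)[OF B] r by auto
        then have "integral {p..q} h = M * (integral {p..q} a + integral {p..q} b)"
          unfolding h_def by (simp add: integral_add)
        then show ?thesis by (simp add: algebra_simps)
      qed
      finally show "norm (D p q) \<le> \<eta> * integral {p..q} h" .
    qed
  qed (use st in auto)
  then show ?thesis by (simp add: D_def I_def)
qed

text \<open>
  If \<open>|J| \<integral>b \<le> 1/2\<close>, the integral equation based at \<open>x0\<close> is a contraction of the space of bounded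
  continuous functions on the real line; the clamp \<open>cl\<close> extends functions from \<open>[0,1]\<close> by constants.
\<close>
lemma integral_solution_exists:
  fixes A :: "real \<Rightarrow> complex ^ ('n::finite + 'n) ^ ('n + 'n)" and C :: "complex ^ 'k ^ ('n + 'n)"
  assumes A: "l1_matrix A b" and x0: "x0 \<in> {0..1}"
    and small: "norm (Jmat :: complex ^ ('n + 'n) ^ ('n + 'n)) * integral {0..1} b \<le> 1 / 2"
  shows "\<exists>F. integral_solution A F \<and> F x0 = C"
proof -
  let ?j = "norm (Jmat :: complex ^ ('n + 'n) ^ ('n + 'n))"
  define cl where "cl x = max 0 (min 1 x)" for x :: real
  have cl: "cl x \<in> {0..1}" "x \<in> {0..1} \<Longrightarrow> cl x = x" for x by (auto simp: cl_def)
  define g where "g u y = integral {0..y} (\<lambda>x. A x ** apply_bcontfun u x)" for u :: "real \<Rightarrow>\<^sub>C (complex ^ 'k ^ ('n + 'n))" and y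
  have uc: "continuous_on S (apply_bcontfun u)" for u :: "real \<Rightarrow>\<^sub>C (complex ^ 'k ^ ('n + 'n))" and S
    using continuous_on_subset[OF continuous_on_apply_bcontfun] by blast
  have int: "(\<lambda>x. A x ** apply_bcontfun u x) integrable_on {s..t}" if "0 \<le> s" "t \<le> 1" for u :: "real \<Rightarrow>\<^sub>C (complex ^ 'k ^ ('n + 'n))" and s t
    by (rule l1_integrable[OF A uc that])
  have gdiff: "g u t - g u s = integral {s..t} (\<lambda>x. A x ** apply_bcontfun u x)" if "0 \<le> s" "s \<le> t" "t \<le> 1" for u s t
    using Henstock_Kurzweil_Integration.integral_combine[OF that(1,2) int[of 0 t u]] that by (simp add: g_def algebra_simps)
  have gc: "continuous_on {0..1} (g u)" for u
    unfolding g_def by (rule indefinite_integral_continuous_1[OF int]) auto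
  define T0 where "T0 u x = C - Jmat ** (g u (cl x) - g u x0)" for u x
  have T0: "T0 u \<in> bcontfun" for u
  proof -
    have "continuous_on UNIV (\<lambda>x. g u (cl x))"
      by (rule continuous_on_compose2[OF gc]) (auto simp: cl_def intro!: continuous_intros)
    then have c: "continuous_on UNIV (T0 u)" unfolding T0_def by (intro continuous_intros)
    have "range (T0 u) \<subseteq> T0 u ` {0..1}"
    proof
      fix y assume "y \<in> range (T0 u)"
      then obtain x where "y = T0 u x" by blast
      then have "y = T0 u (cl x)" using cl by (simp add: T0_def)
      then show "y \<in> T0 u ` {0..1}" using cl by blast
    qed
    moreover have "bounded (T0 u ` {0..1})"
      by (intro compact_imp_bounded compact_continuous_image continuous_on_subset[OF c]) auto
    ultimately show ?thesis using c by (auto simp: bcontfun_def intro: bounded_subset)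
  qed
  define T where "T u = Bcontfun (T0 u)" for u
  have T: "apply_bcontfun (T u) = T0 u" for u by (simp add: T_def Bcontfun_inverse T0)
  have "\<exists>!u. T u = u"
  proof (rule banach_fix_type[of "1/2" T])
    show "\<forall>u v. dist (T u) (T v) \<le> 1 / 2 * dist u v"
    proof (intro allI dist_bound)
      fix u v :: "real \<Rightarrow>\<^sub>C (complex ^ 'k ^ ('n + 'n))" and x
      have uv: "norm (apply_bcontfun u x - apply_bcontfun v x) \<le> dist u v" for x
        using dist_bounded[of u x v] by (simp add: dist_norm)
      have inc: "norm ((g u t - g v t) - (g u s - g v s)) \<le> dist u v * integral {0..1} b" if st: "0 \<le> s" "s \<le> t" "t \<le> 1" for s t
      proof -
        have "(g u t - g v t) - (g u s - g v s) = (g u t - g u s) - (g v t - g v s)" by simp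
        also have "\<dots> = integral {s..t} (\<lambda>x. A x ** apply_bcontfun u x) - integral {s..t} (\<lambda>x. A x ** apply_bcontfun v x)"
          by (simp only: gdiff[OF st])
        also have "\<dots> = integral {s..t} (\<lambda>x. A x ** (apply_bcontfun u x - apply_bcontfun v x))"
          using st by (simp add: integral_diff[OF int int, symmetric] matrix_diff_ldistrib)
        also have "norm \<dots> \<le> dist u v * integral {s..t} b"
          by (intro l1_bound[OF A _ st(1,3)] l1_factors(2)[OF A] uv continuous_intros uc)
        also have "\<dots> \<le> dist u v * integral {0..1} b"
          using l1_matrixD[OF A] st by (intro mult_left_mono integral_subset_le) auto
        finally show ?thesis .
      qed
      have "dist (apply_bcontfun (T u) x) (apply_bcontfun (T v) x) = norm (Jmat ** ((g u (cl x) - g v (cl x)) - (g u x0 - g v x0)))"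
      proof -
        have "T0 u x - T0 v x = - (Jmat ** ((g u (cl x) - g v (cl x)) - (g u x0 - g v x0)))"
          by (simp add: T0_def matrix_diff_ldistrib)
        then show ?thesis by (simp only: T dist_norm norm_minus_cancel)
      qed
      also have "\<dots> \<le> ?j * norm ((g u (cl x) - g v (cl x)) - (g u x0 - g v x0))" by (rule norm_mm_le)
      also have "\<dots> \<le> ?j * (dist u v * integral {0..1} b)"
      proof (intro mult_left_mono)
        show "norm ((g u (cl x) - g v (cl x)) - (g u x0 - g v x0)) \<le> dist u v * integral {0..1} b"
          using inc[of x0 "cl x"] inc[of "cl x" x0] x0 cl[of x]
          by (cases "x0 \<le> cl x") (auto simp: norm_minus_commute)
      qed simp
      also have "\<dots> \<le> 1 / 2 * dist u v"
        using mult_right_mono[OF small, of "dist u v"] by (simp add: mult_ac)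
      finally show "dist (apply_bcontfun (T u) x) (apply_bcontfun (T v) x) \<le> 1 / 2 * dist u v" .
    qed
  qed auto
  then obtain u where u: "T u = u" by blast
  have F: "apply_bcontfun u x = C - Jmat ** (g u x - g u x0)" if "x \<in> {0..1}" for x
    using T[of u] that by (simp add: u T0_def cl)
  have "integral_solution A (apply_bcontfun u)"
    unfolding integral_solution_def
  proof (intro conjI allI impI uc)
    fix s t :: real assume st: "0 \<le> s" "s \<le> t" "t \<le> 1"
    have "Jmat ** (apply_bcontfun u t - apply_bcontfun u s) = - (Jmat ** (Jmat ** (g u t - g u s)))"
      using st by (simp add: F matrix_diff_ldistrib matrix_mul_assoc)
    also have "\<dots> = integral {s..t} (\<lambda>x. A x ** apply_bcontfun u x)"
      by (simp only: Jmat_cancel[symmetric] gdiff[OF st])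
    finally show "((\<lambda>x. A x ** apply_bcontfun u x) has_integral Jmat ** (apply_bcontfun u t - apply_bcontfun u s)) {s..t}"
      using integrable_integral[OF int[of s t u]] st by simp
  qed
  moreover have "apply_bcontfun u x0 = C" using F[OF x0] by simp
  ultimately show ?thesis by blast
qed

section \<open>Dependence on the spectral parameter\<close>

lemma difference_quotient_limit:
  fixes f :: "real \<Rightarrow> 'a::real_normed_vector"
  assumes f: "(f has_vector_derivative L) (at x within S)"
    and y: "y \<longlonglongrightarrow> x" "\<And>n. y n \<in> S" "\<And>n. y n \<noteq> x"
  shows "(\<lambda>n. (1 / (y n - x)) *\<^sub>R (f (y n) - f x)) \<longlonglongrightarrow> L"
proof -
  have "((\<lambda>z. (1 / (z - x)) *\<^sub>R (f z - f x) - L) \<longlongrightarrow> 0) (at x within S)"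
  proof -
    have "((\<lambda>z. norm ((f z - f x - (z - x) *\<^sub>R L) /\<^sub>R norm (z - x))) \<longlongrightarrow> 0) (at x within S)"
      using f unfolding has_vector_derivative_def has_derivative_within
      by (intro tendsto_norm_zero) (simp add: divide_inverse_commute diff_diff_eq)
    then have "((\<lambda>z. norm ((1 / (z - x)) *\<^sub>R (f z - f x) - L)) \<longlongrightarrow> 0) (at x within S)"
    proof (rule Lim_transform_eventually)
      have eq: "norm ((f z - f x - (z - x) *\<^sub>R L) /\<^sub>R norm (z - x)) = norm ((1 / (z - x)) *\<^sub>R (f z - f x) - L)" if "z \<noteq> x" for z
      proof -
        have "(1 / (z - x)) *\<^sub>R (f z - f x) - L = (1 / (z - x)) *\<^sub>R (f z - f x - (z - x) *\<^sub>R L)"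
          using that by (simp add: scaleR_diff_right)
        then show ?thesis by (simp add: divide_inverse)
      qed
      show "\<forall>\<^sub>F z in at x within S. norm ((f z - f x - (z - x) *\<^sub>R L) /\<^sub>R norm (z - x)) = norm ((1 / (z - x)) *\<^sub>R (f z - f x) - L)"
        unfolding eventually_at_filter by (intro always_eventually allI impI eq)
    qed
    then show ?thesis by (rule tendsto_norm_zero_cancel)
  qed
  then have "((\<lambda>z. (1 / (z - x)) *\<^sub>R (f z - f x)) \<longlongrightarrow> L) (at x within S)"
    by (simp add: Lim_null[of _ L])
  then show ?thesis
    using y unfolding tendsto_at_iff_sequentially o_def by auto
qed

lemma onorm_entry:
  fixes A :: "complex ^ 'k ^ 'm"
  shows "norm (A $ i $ j) \<le> onorm ((*v) A)"
proof -
  have "norm (A $ i $ j) = norm ((A *v axis j 1) $ i)"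
    by (simp add: matrix_vector_mult_def axis_def if_distrib if_distribR cong: if_cong)
  also have "\<dots> \<le> norm (A *v axis j 1)" by (rule Finite_Cartesian_Product.norm_nth_le)
  also have "\<dots> \<le> onorm ((*v) A) * norm (axis j (1::complex))"
    by (rule onorm[OF bounded_bilinear.bounded_linear_right[OF bounded_bilinear_mv]])
  also have "norm (axis j (1::complex)) = 1" by simp
  finally show ?thesis by simp
qed

text \<open>
  Every entry is bounded by the operator norm.
\<close>
lemma norm_le_onorm:
  fixes A :: "complex ^ 'k ^ 'm"
  shows "norm A \<le> real (CARD('k) * CARD('m)) * onorm ((*v) A)"
proof -
  have "norm A \<le> (\<Sum>i\<in>UNIV. L2_set (\<lambda>j. norm (A $ i $ j)) UNIV)"
    unfolding norm_matrix_sq by (rule L2_set_le_sum) (simp add: L2_set_nonneg)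
  also have "\<dots> \<le> (\<Sum>i\<in>UNIV. \<Sum>j\<in>UNIV. norm (A $ i $ j))"
    by (intro sum_mono L2_set_le_sum) simp
  also have "\<dots> \<le> (\<Sum>i\<in>(UNIV :: 'm set). \<Sum>j\<in>(UNIV :: 'k set). onorm ((*v) A))"
    by (intro sum_mono onorm_entry)
  finally show ?thesis by (simp add: mult_ac)
qed

lemma AE_lborel_negligible:
  assumes "AE x in lborel. P x" obtains N :: "real set" where "negligible N" "\<And>x. x \<notin> N \<Longrightarrow> P x"
proof -
  obtain N where N: "N \<in> null_sets lborel" "{x \<in> space lborel. \<not> P x} \<subseteq> N"
    using assms unfolding eventually_ae_filter by blast
  have "negligible N" unfolding negligible_iff_null_sets using N(1) by (rule null_sets_completionI)
  then show ?thesis using that N(2) by auto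
qed

text \<open>A function that is measurable in the first and continuous in the second variable is jointly
  measurable: it is the limit of its step functions in the second variable.\<close>
lemma caratheodory_measurable:
  fixes C :: "'a \<Rightarrow> real \<Rightarrow> 'b::{second_countable_topology, metric_space}"
  assumes m: "\<And>\<mu>. (\<lambda>x. C x \<mu>) \<in> borel_measurable M" and c: "\<And>x. continuous_on UNIV (C x)"
  shows "(\<lambda>p. C (fst p) (snd p)) \<in> borel_measurable (M \<Otimes>\<^sub>M lborel)"
proof (rule borel_measurable_LIMSEQ_metric)
  fix n :: nat
  have "(\<lambda>p. C (fst p) (real_of_int i / real (Suc n))) \<in> borel_measurable (M \<Otimes>\<^sub>M lborel)" for i :: int
    by (rule measurable_compose[OF measurable_fst m])
  moreover have "(\<lambda>p. \<lfloor>real (Suc n) * snd p\<rfloor>) \<in> measurable (M \<Otimes>\<^sub>M lborel) (count_space UNIV)"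
    by measurable
  ultimately show "(\<lambda>p. C (fst p) (real_of_int \<lfloor>real (Suc n) * snd p\<rfloor> / real (Suc n))) \<in> borel_measurable (M \<Otimes>\<^sub>M lborel)"
    by (rule measurable_compose_countable)
next
  fix p :: "'a \<times> real"
  have "(\<lambda>n. real_of_int \<lfloor>real (Suc n) * snd p\<rfloor> / real (Suc n)) \<longlonglongrightarrow> snd p"
  proof (rule LIMSEQ_norm_0[THEN Lim_null[THEN iffD2]])
    fix n
    have "\<bar>real_of_int \<lfloor>real (Suc n) * snd p\<rfloor> - real (Suc n) * snd p\<bar> < 1" by linarith
    moreover have "real_of_int \<lfloor>real (Suc n) * snd p\<rfloor> / real (Suc n) - snd p
        = (real_of_int \<lfloor>real (Suc n) * snd p\<rfloor> - real (Suc n) * snd p) / real (Suc n)"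
      by (simp add: diff_divide_distrib)
    ultimately show "norm (real_of_int \<lfloor>real (Suc n) * snd p\<rfloor> / real (Suc n) - snd p) < 1 / real (Suc n)"
      by (simp add: abs_divide divide_strict_right_mono)
  qed
  then show "(\<lambda>n. C (fst p) (real_of_int \<lfloor>real (Suc n) * snd p\<rfloor> / real (Suc n))) \<longlonglongrightarrow> C (fst p) (snd p)"
    by (rule isCont_tendsto_compose[rotated]) (use c[of "fst p"] in \<open>simp add: continuous_on_eq_continuous_at\<close>)
qed

text \<open>
  The bound on the derivative holds for each parameter off a null set depending on it.  By Fubini's
  theorem, for almost every \<open>x\<close> it holds for almost every parameter.  The derivative exists at every parameter, so the
  Henstock-Kurzweil integral recovers \<open>B x\<close> from it, and changing the derivative on a null set of parameters does
  not affect that integral.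
\<close>
lemma parameter_lipschitz:
  fixes B :: "real \<Rightarrow> real \<Rightarrow> complex ^ 'm ^ 'm"
  assumes A: "assumptions_A I B" and I: "{a..b} \<subseteq> I" and ab: "a < b"
    and b1: "integrable leb01 b1" "\<And>\<mu>. \<mu> \<in> I \<Longrightarrow> AE x in leb01. onorm ((*v) (lam_deriv I B x \<mu>)) \<le> b1 x"
  shows "AE x in leb01. \<forall>\<mu>\<in>{a..b}. \<forall>\<nu>\<in>{a..b}.
    norm (B x \<mu> - B x \<nu>) \<le> real (CARD('m) * CARD('m)) * \<bar>b1 x\<bar> * \<bar>\<mu> - \<nu>\<bar>"
proof -
  let ?\<kappa> = "real (CARD('m) * CARD('m))"
  have meas: "\<And>\<mu>. \<mu> \<in> I \<Longrightarrow> (\<lambda>x. B x \<mu>) \<in> borel_measurable leb01"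
    and diff: "AE x in leb01. \<forall>\<mu>\<in>I. B x differentiable (at \<mu> within I)"
    using A unfolding assumptions_A_def by auto
  obtain N0 where N0: "negligible N0" "\<And>x \<mu>. x \<in> {0<..<1} - N0 \<Longrightarrow> \<mu> \<in> I \<Longrightarrow> B x differentiable (at \<mu> within I)"
    using diff unfolding AE_leb01_iff by blast
  have N0s: "{x \<in> space leb01. x \<in> N0} \<in> sets leb01"
    using N0(1) negligible_imp_sets by (auto simp: sets_restrict_space image_iff intro!: bexI[of _ N0])
  define cl where "cl \<mu> = max a (min b \<mu>)" for \<mu>
  have cl: "cl \<mu> \<in> {a..b}" "\<mu> \<in> {a..b} \<Longrightarrow> cl \<mu> = \<mu>" for \<mu> using ab by (auto simp: cl_def)
  \<comment> \<open>A version of \<open>B\<close> that is defined for all parameters and continuous in them for every \<open>x\<close>, so that its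
    difference quotients are jointly measurable.\<close>
  define C where "C x \<mu> = (if x \<in> N0 \<or> x \<notin> {0<..<1} then 0 else B x (cl \<mu>))" for x \<mu>
  have Cm: "(\<lambda>x. C x \<mu>) \<in> borel_measurable leb01" for \<mu>
  proof -
    have "(\<lambda>x. if x \<in> N0 then 0 else B x (cl \<mu>)) \<in> borel_measurable leb01"
      using cl[of \<mu>] I by (intro measurable_If meas N0s) auto
    also have "?this \<longleftrightarrow> ?thesis" by (intro measurable_cong) (auto simp: C_def)
    finally show ?thesis .
  qed
  have Bc: "continuous_on {a..b} (B x)" if "x \<in> {0<..<1} - N0" for x
  proof (rule continuous_on_subset[OF _ I])
    show "continuous_on I (B x)"
      using N0(2)[OF that] differentiable_imp_continuous_on by (auto simp: differentiable_on_def)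
  qed
  have Cc: "continuous_on UNIV (C x)" for x
  proof (cases "x \<in> N0 \<or> x \<notin> {0<..<1}")
    case True then show ?thesis by (simp add: C_def)
  next
    case False
    then have "continuous_on UNIV (\<lambda>\<mu>. B x (cl \<mu>))"
      by (intro continuous_on_compose2[OF Bc]) (auto simp: cl_def intro!: continuous_intros, use ab in auto)
    then show ?thesis using False by (simp add: C_def)
  qed
  have Cc': "continuous_on UNIV (\<lambda>\<mu>. C x (\<mu> + h))" for x h
    by (intro continuous_on_compose2[OF Cc] continuous_intros) auto
  define D where "D n p = real (Suc n) *\<^sub>R (C (fst p) (snd p + 1 / real (Suc n)) - C (fst p) (snd p))" for n and p :: "real \<times> real"
  have Dm: "D n \<in> borel_measurable (leb01 \<Otimes>\<^sub>M lborel)" for n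
    unfolding D_def
    using caratheodory_measurable[of C leb01, OF Cm Cc] caratheodory_measurable[of "\<lambda>x \<mu>. C x (\<mu> + 1 / real (Suc n))" leb01, OF Cm Cc']
    by (intro borel_measurable_scaleR borel_measurable_diff) auto
  define L where "L x \<mu> = lim (\<lambda>n. D n (x, \<mu>))" for x \<mu>
  have Lm: "(\<lambda>p. L (fst p) (snd p)) \<in> borel_measurable (leb01 \<Otimes>\<^sub>M lborel)"
    unfolding L_def using Dm by simp
  have L: "L x \<mu> = lam_deriv I B x \<mu>" if x: "x \<in> {0<..<1} - N0" and \<mu>: "\<mu> \<in> {a<..<b}" for x \<mu>
  proof -
    have "\<mu> \<in> I" using \<mu> I by auto
    have der: "(B x has_vector_derivative lam_deriv I B x \<mu>) (at \<mu> within {a..b})"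
      using N0(2)[OF x \<open>\<mu> \<in> I\<close>] I unfolding lam_deriv_def vector_derivative_works by (rule has_vector_derivative_within_subset)
    obtain n0 where n0: "1 / real (Suc n0) < b - \<mu>" using \<mu> nat_approx_posE[of "b - \<mu>"] by auto
    have small: "1 / real (Suc (n + n0)) < b - \<mu>" for n
    proof -
      have "1 / real (Suc (n + n0)) \<le> 1 / real (Suc n0)" by (intro divide_left_mono) auto
      then show ?thesis using n0 by linarith
    qed
    have inside: "\<mu> + h \<in> {a..b}" if "0 < h" "h < b - \<mu>" for h using that \<mu> by auto
    have "(\<lambda>n. (1 / ((\<mu> + 1 / real (Suc (n + n0))) - \<mu>)) *\<^sub>R (B x (\<mu> + 1 / real (Suc (n + n0))) - B x \<mu>)) \<longlonglongrightarrow> lam_deriv I B x \<mu>"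
    proof (rule difference_quotient_limit[OF der])
      have "(\<lambda>n. 1 / real (Suc (n + n0))) \<longlonglongrightarrow> 0"
        using LIMSEQ_ignore_initial_segment[OF lim_1_over_n[THEN LIMSEQ_Suc], of n0] by simp
      then show "(\<lambda>n. \<mu> + 1 / real (Suc (n + n0))) \<longlonglongrightarrow> \<mu>" using tendsto_add[OF tendsto_const] by fastforce
      show "\<mu> + 1 / real (Suc (n + n0)) \<in> {a..b}" for n
        by (rule inside[OF _ small]) simp
      show "\<mu> + 1 / real (Suc (n + n0)) \<noteq> \<mu>" for n by simp
    qed
    also have "(\<lambda>n. (1 / ((\<mu> + 1 / real (Suc (n + n0))) - \<mu>)) *\<^sub>R (B x (\<mu> + 1 / real (Suc (n + n0))) - B x \<mu>)) = (\<lambda>n. D (n + n0) (x, \<mu>))"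
    proof
      fix n
      have "\<mu> + 1 / real (Suc (n + n0)) \<in> {a..b}" by (rule inside[OF _ small]) simp
      then have "cl (\<mu> + 1 / real (Suc (n + n0))) = \<mu> + 1 / real (Suc (n + n0))" "cl \<mu> = \<mu>"
        using \<mu> by (simp_all only: cl(2)) (auto intro!: cl(2))
      then show "(1 / ((\<mu> + 1 / real (Suc (n + n0))) - \<mu>)) *\<^sub>R (B x (\<mu> + 1 / real (Suc (n + n0))) - B x \<mu>) = D (n + n0) (x, \<mu>)"
        using x by (simp add: D_def C_def)
    qed
    finally have "(\<lambda>n. D n (x, \<mu>)) \<longlonglongrightarrow> lam_deriv I B x \<mu>" by (rule LIMSEQ_offset)
    then show ?thesis unfolding L_def by (rule limI)
  qed
  have b1m: "(\<lambda>p. b1 (fst p)) \<in> borel_measurable (leb01 \<Otimes>\<^sub>M lborel)"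
    using b1(1) by (intro measurable_compose[OF measurable_fst]) auto
  define P where "P x \<mu> \<longleftrightarrow> (\<mu> \<in> {a<..<b} \<longrightarrow> norm (L x \<mu>) \<le> ?\<kappa> * \<bar>b1 x\<bar>)" for x \<mu>
  interpret pair_sigma_finite leb01 lborel
  proof
    show "\<exists>A::real set set. countable A \<and> A \<subseteq> sets leb01 \<and> \<Union> A = space leb01 \<and> (\<forall>a\<in>A. emeasure leb01 a \<noteq> \<infinity>)"
      by (intro exI[of _ "{{0<..<1}}"]) (auto simp: emeasure_restrict_space sets_restrict_space image_iff)
  qed
  have "AE x in leb01. AE \<mu> in lborel. P x \<mu>"
  proof (subst AE_commute)
    have "Measurable.pred (leb01 \<Otimes>\<^sub>M lborel) (\<lambda>p. P (fst p) (snd p))"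
      unfolding P_def using Lm b1m by measurable
    then show "{p \<in> space (leb01 \<Otimes>\<^sub>M lborel). P (fst p) (snd p)} \<in> sets (leb01 \<Otimes>\<^sub>M lborel)"
      by (rule predE)
    have "AE x in leb01. P x \<mu>" for \<mu>
    proof (cases "\<mu> \<in> {a<..<b}")
      case True
      then have "\<mu> \<in> I" using I by auto
      obtain N where N: "negligible N" "\<And>x. x \<in> {0<..<1} - N \<Longrightarrow> onorm ((*v) (lam_deriv I B x \<mu>)) \<le> b1 x"
        using b1(2)[OF \<open>\<mu> \<in> I\<close>] unfolding AE_leb01_iff by blast
      have "P x \<mu>" if x: "x \<in> {0<..<1} - (N \<union> N0)" for x
      proof -
        have "norm (L x \<mu>) \<le> ?\<kappa> * onorm ((*v) (lam_deriv I B x \<mu>))"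
          using L[of x \<mu>] x True norm_le_onorm[of "lam_deriv I B x \<mu>"] by simp
        also have "\<dots> \<le> ?\<kappa> * \<bar>b1 x\<bar>" using N(2)[of x] x by (intro mult_left_mono) auto
        finally show ?thesis by (simp add: P_def)
      qed
      then show ?thesis unfolding AE_leb01_iff using N(1) N0(1) negligible_Un by blast
    next
      case False
      then have "P x \<mu>" for x by (auto simp: P_def)
      then show ?thesis by simp
    qed
    then show "AE \<mu> in lborel. AE x in leb01. P x \<mu>" by simp
  qed
  then obtain N1 where N1: "negligible N1" "\<And>x. x \<in> {0<..<1} - N1 \<Longrightarrow> AE \<mu> in lborel. P x \<mu>"
    unfolding AE_leb01_iff by blast
  have main: "norm (B x \<mu> - B x \<nu>) \<le> ?\<kappa> * \<bar>b1 x\<bar> * (\<mu> - \<nu>)"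
    if x: "x \<in> {0<..<1} - (N0 \<union> N1)" and \<mu>\<nu>: "a \<le> \<nu>" "\<nu> \<le> \<mu>" "\<mu> \<le> b" for x \<mu> \<nu>
  proof -
    have x1: "AE \<mu> in lborel. P x \<mu>" using x by (intro N1(2)) auto
    obtain M where M: "negligible M" "\<And>\<mu>. \<mu> \<notin> M \<Longrightarrow> P x \<mu>" using AE_lborel_negligible[OF x1] by blast
    have sub: "{\<nu>..\<mu>} \<subseteq> I" using \<mu>\<nu> I by auto
    have "(lam_deriv I B x has_integral (B x \<mu> - B x \<nu>)) {\<nu>..\<mu>}"
    proof (rule fundamental_theorem_of_calculus[OF \<mu>\<nu>(2)])
      fix y assume "y \<in> {\<nu>..\<mu>}"
      then have "B x differentiable (at y within I)" using N0(2)[of x y] x sub by auto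
      then show "(B x has_vector_derivative lam_deriv I B x y) (at y within {\<nu>..\<mu>})"
        using sub unfolding lam_deriv_def vector_derivative_works by (rule has_vector_derivative_within_subset)
    qed
    then have int: "((\<lambda>y. if y \<in> M \<union> {a, b} then 0 else lam_deriv I B x y) has_integral (B x \<mu> - B x \<nu>)) {\<nu>..\<mu>}"
      by (rule has_integral_spike[of "M \<union> {a, b}", rotated 2]) (use M(1) in auto)
    have "norm (B x \<mu> - B x \<nu>) \<le> ?\<kappa> * \<bar>b1 x\<bar> * measure lborel {\<nu>..\<mu>}"
    proof (rule has_integral_bound_real[OF _ finite.emptyI int])
      fix y assume y: "y \<in> {\<nu>..\<mu>} - {}"
      show "norm (if y \<in> M \<union> {a, b} then 0 else lam_deriv I B x y) \<le> ?\<kappa> * \<bar>b1 x\<bar>"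
      proof (cases "y \<in> M \<union> {a, b}")
        case False
        then have yab: "y \<in> {a<..<b}" using y \<mu>\<nu> by auto
        have "norm (L x y) \<le> ?\<kappa> * \<bar>b1 x\<bar>" using M(2)[of y] False yab by (simp add: P_def)
        then show ?thesis using L[of x y] x yab False by simp
      qed simp
    qed simp
    then show ?thesis using \<mu>\<nu> by simp
  qed
  have "negligible (N0 \<union> N1)" using N0 N1 by auto
  moreover have "norm (B x \<mu> - B x \<nu>) \<le> ?\<kappa> * \<bar>b1 x\<bar> * \<bar>\<mu> - \<nu>\<bar>"
    if x: "x \<in> {0<..<1} - (N0 \<union> N1)" and \<mu>\<nu>: "\<mu> \<in> {a..b}" "\<nu> \<in> {a..b}" for x \<mu> \<nu>
    using main[OF x, of \<nu> \<mu>] main[OF x, of \<mu> \<nu>] \<mu>\<nu> by (cases "\<nu> \<le> \<mu>") (auto simp: norm_minus_commute)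
  ultimately show ?thesis unfolding AE_leb01_iff by blast
qed


lemma integrable_leb01:
  fixes f :: "real \<Rightarrow> 'a::euclidean_space"
  assumes "integrable leb01 f"
  shows "f integrable_on {0..1}" and "integral\<^sup>L leb01 f = integral {0..1} f"
proof -
  have S: "{0<..<1::real} \<in> sets lebesgue" by simp
  show "f integrable_on {0..1}"
    using integrable_on_lebesgue_on[OF assms S] integrable_on_open_interval_real by blast
  show "integral\<^sup>L leb01 f = integral {0..1} f"
    using lebesgue_integral_eq_integral[OF assms S] integral_open_interval_real[of 0 1 f] by simp
qed

text \<open>
  Off a null set that may depend on the parameter the coefficient is self-adjoint and bounded by \<open>b0\<close>; redefined as zero
  there, it has both properties everywhere, and the integrated equation is unaffected.
\<close>
lemma coefficient_version:
  fixes B :: "real \<Rightarrow> real \<Rightarrow> complex ^ 'm ^ 'm"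
  assumes A: "assumptions_A I B"
  shows "\<exists>A bnd. \<forall>\<mu>\<in>I. l1_matrix (A \<mu>) bnd \<and> (\<forall>x. adj (A \<mu> x) = A \<mu> x) \<and>
    (\<exists>N. negligible N \<and> (\<forall>x\<in>{0<..<1} - N. A \<mu> x = B x \<mu>))"
proof -
  let ?\<kappa> = "real (CARD('m) * CARD('m))"
  obtain b0 where b0: "integrable leb01 b0" "\<And>\<mu>. \<mu> \<in> I \<Longrightarrow> AE x in leb01. onorm ((*v) (B x \<mu>)) \<le> b0 x"
    and meas: "\<And>\<mu>. \<mu> \<in> I \<Longrightarrow> (\<lambda>x. B x \<mu>) \<in> borel_measurable leb01"
    and sa: "\<And>\<mu>. \<mu> \<in> I \<Longrightarrow> AE x in leb01. adj (B x \<mu>) = B x \<mu>"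
    using A unfolding assumptions_A_def by auto
  have "\<exists>N. negligible N \<and> (\<forall>x\<in>{0<..<1} - N. onorm ((*v) (B x \<mu>)) \<le> b0 x \<and> adj (B x \<mu>) = B x \<mu>)" if "\<mu> \<in> I" for \<mu>
    using AE_conjI[OF b0(2)[OF that] sa[OF that]] unfolding AE_leb01_iff by blast
  then obtain N where N: "\<And>\<mu>. \<mu> \<in> I \<Longrightarrow> negligible (N \<mu>)"
    "\<And>\<mu> x. \<mu> \<in> I \<Longrightarrow> x \<in> {0<..<1} - N \<mu> \<Longrightarrow> onorm ((*v) (B x \<mu>)) \<le> b0 x \<and> adj (B x \<mu>) = B x \<mu>"
    by metis
  define A where "A \<mu> x = (if x \<in> {0<..<1} - N \<mu> then B x \<mu> else 0)" for \<mu> x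
  have l1: "l1_matrix (A \<mu>) (\<lambda>x. ?\<kappa> * \<bar>b0 x\<bar>)" if \<mu>: "\<mu> \<in> I" for \<mu>
    unfolding l1_matrix_def
  proof (intro conjI allI)
    have S: "{0<..<1} - N \<mu> \<in> sets lebesgue" using negligible_imp_sets[OF N(1)[OF \<mu>]] by auto
    have "(\<lambda>x. B x \<mu>) \<in> borel_measurable (lebesgue_on ({0<..<1} - N \<mu>))"
      using meas[OF \<mu>] by (rule measurable_restrict_mono) auto
    then show "A \<mu> \<in> borel_measurable lebesgue"
      unfolding A_def by (rule borel_measurable_if_I[OF _ S])
    show "norm (A \<mu> x) \<le> ?\<kappa> * \<bar>b0 x\<bar>" for x
    proof (cases "x \<in> {0<..<1} - N \<mu>")
      case True
      have "norm (B x \<mu>) \<le> ?\<kappa> * onorm ((*v) (B x \<mu>))" by (rule norm_le_onorm)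
      also have "\<dots> \<le> ?\<kappa> * \<bar>b0 x\<bar>" using N(2)[OF \<mu> True] by (intro mult_left_mono) auto
      finally show ?thesis using True by (simp add: A_def)
    next
      case False
      then show ?thesis by (auto simp: A_def)
    qed
    show "(\<lambda>x. ?\<kappa> * \<bar>b0 x\<bar>) integrable_on {0..1}"
      by (intro integrable_on_mult_right integrable_leb01(1) integrable_abs b0(1))
  qed
  show ?thesis
  proof (intro exI[of _ A] exI[of _ "\<lambda>x. ?\<kappa> * \<bar>b0 x\<bar>"] ballI conjI)
    fix \<mu> assume \<mu>: "\<mu> \<in> I"
    show "l1_matrix (A \<mu>) (\<lambda>x. ?\<kappa> * \<bar>b0 x\<bar>)" by (rule l1[OF \<mu>])
    show "\<forall>x. adj (A \<mu> x) = A \<mu> x" using N(2)[OF \<mu>] by (simp add: A_def)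
    show "\<exists>N. negligible N \<and> (\<forall>x\<in>{0<..<1} - N. A \<mu> x = B x \<mu>)"
      by (intro exI[of _ "N \<mu>"] conjI N(1)[OF \<mu>]) (simp add: A_def)
  qed
qed

text \<open>
  The solution is absolutely continuous, hence the integral of its derivative \<open>- J A F\<close>, which exists off a null set.
\<close>
lemma solves_matrix_system_integral:
  fixes X :: "real \<Rightarrow> complex ^ 'n ^ ('n::finite + 'n)"
  assumes X: "solves_matrix_system C X" and N: "negligible N" and A: "\<And>x. x \<in> {0<..<1} - N \<Longrightarrow> A x = C x"
  shows "integral_solution A X"
proof -
  have ac: "abs_continuous_on 0 1 X" using X by (simp add: solves_matrix_system_def)
  obtain M where M: "negligible M" "\<And>x. x \<in> {0<..<1} - M \<Longrightarrow> \<exists>X'. (X has_vector_derivative X') (at x) \<and> Jmat ** X' = C x ** X x"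
    using X unfolding solves_matrix_system_def AE_leb01_iff by blast
  let ?N = "M \<union> N \<union> {0, 1}"
  have Nn: "negligible ?N" using M N by auto
  define g where "g x = - (Jmat ** (A x ** X x))" for x
  have der: "(X has_vector_derivative g x) (at x)" if x: "x \<in> {0..1} - ?N" for x
  proof -
    obtain X' where X': "(X has_vector_derivative X') (at x)" "Jmat ** X' = C x ** X x" using M(2)[of x] x by auto
    have "X' = - (Jmat ** (Jmat ** X'))" by (rule Jmat_cancel)
    also have "\<dots> = g x" using x A[of x] by (simp add: g_def X')
    finally show ?thesis using X' by simp
  qed
  show ?thesis
    unfolding integral_solution_def
  proof (intro conjI allI impI)
    show "continuous_on {0..1} X" by (rule AC_continuous[OF ac])
    fix s t :: real assume st: "0 \<le> s" "s \<le> t" "t \<le> 1"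
    have "(g has_integral (X t - X s)) {s..t}" by (rule AC_fundamental_theorem[OF ac Nn der st])
    from has_integral_linear[OF this bounded_bilinear.bounded_linear_right[OF bounded_bilinear_mm, of Jmat]]
    show "((\<lambda>x. A x ** X x) has_integral Jmat ** (X t - X s)) {s..t}"
      by (simp add: o_def g_def matrix_mult_minus_right Jmat_cancel[symmetric])
  qed
qed

text \<open>
  A vector as a matrix with equal columns, which makes results about matrix solutions available for
  vector solutions.
\<close>
definition repeat_column :: "complex ^ 'm \<Rightarrow> complex ^ 'k ^ 'm" where
  "repeat_column v = (\<chi> i j. v $ i)"

lemma repeat_column_mult: "A ** repeat_column v = repeat_column (A *v v)"
  by (simp add: repeat_column_def vec_eq_iff matrix_matrix_mult_def matrix_vector_mult_def)

lemma repeat_column_inj: "repeat_column u = (repeat_column v :: complex ^ 'k ^ 'm) \<Longrightarrow> u = v"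
  by (simp add: repeat_column_def vec_eq_iff)

lemma bounded_linear_repeat_column: "bounded_linear (repeat_column :: complex ^ 'm \<Rightarrow> complex ^ 'k ^ 'm)"
  unfolding linear_conv_bounded_linear[symmetric]
  by (rule linearI) (simp_all add: repeat_column_def vec_eq_iff)

text \<open>
  By the Lagrange identity \<open>F\<^sup>* J F\<close> is constant, and by uniqueness a combination of the columns that vanishes at
  one point vanishes everywhere.
\<close>
lemma lag_frame_propagates:
  fixes F :: "real \<Rightarrow> complex ^ 'n ^ ('n::finite + 'n)"
  assumes A: "l1_matrix A b" and sa: "\<And>x. adj (A x) = A x" and F: "integral_solution A F"
    and x0: "x0 \<in> {0..1}" "lag_frame (F x0)" and x: "x \<in> {0..1}"
  shows "lag_frame (F x)"
  unfolding lag_frame_def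
proof (intro conjI allI impI)
  have const: "adj (F x) ** Jmat ** F x = adj (F 0) ** Jmat ** F 0" if "x \<in> {0..1}" for x
    using lagrange_identity[OF A A sa F F, of 0 x] that by simp
  show "adj (F x) ** Jmat ** F x = 0"
    using x0(2) unfolding lag_frame_def const[OF x, folded const[OF x0(1)]] by blast
  fix v assume v: "F x *v v = 0"
  have "integral_solution A (\<lambda>x. F x ** (repeat_column v :: complex ^ 'n ^ 'n))" by (rule integral_solution_mult[OF F])
  from integral_solution_unique[OF A this x _ x0(1)]
  have "repeat_column (F x0 *v v) = (repeat_column 0 :: complex ^ 'n ^ ('n + 'n))"
    by (simp add: repeat_column_mult v) (simp add: repeat_column_def vec_eq_iff)
  then have "F x0 *v v = 0" by (rule repeat_column_inj)
  then show "v = 0" using x0(2) by (simp add: lag_frame_def)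
qed

text \<open>
  A family of solutions with common initial value \<open>Z0\<close>.  The coefficient occurs twice: \<open>A\<close> has the integrability
  properties everywhere, for each parameter, while \<open>B\<close> is the version that is differentiable in the parameter; for each
  parameter the two agree almost everywhere.
\<close>
locale parameter_family =
  fixes I :: "real set" and B :: "real \<Rightarrow> real \<Rightarrow> complex ^ ('n::finite + 'n) ^ ('n + 'n)"
    and a b :: real and A :: "real \<Rightarrow> real \<Rightarrow> complex ^ ('n + 'n) ^ ('n + 'n)" and bnd b1 :: "real \<Rightarrow> real"
    and F :: "real \<Rightarrow> real \<Rightarrow> complex ^ 'n ^ ('n + 'n)" and Z0 :: "complex ^ 'n ^ ('n + 'n)"
  assumes ab: "a < b" and abI: "{a..b} \<subseteq> I"
    and A: "\<And>\<mu>. \<mu> \<in> {a..b} \<Longrightarrow> l1_matrix (A \<mu>) bnd" and sa: "\<And>\<mu> x. \<mu> \<in> {a..b} \<Longrightarrow> adj (A \<mu> x) = A \<mu> x"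
    and AB: "\<And>\<mu>. \<mu> \<in> {a..b} \<Longrightarrow> \<exists>N. negligible N \<and> (\<forall>x\<in>{0<..<1} - N. A \<mu> x = B x \<mu>)"
    and meas: "\<And>\<mu>. \<mu> \<in> {a..b} \<Longrightarrow> (\<lambda>x. B x \<mu>) \<in> borel_measurable leb01"
    and diff: "AE x in leb01. \<forall>\<mu>\<in>I. B x differentiable (at \<mu> within I)"
    and b1: "integrable leb01 b1" "\<And>x. 0 \<le> b1 x"
    and lip: "AE x in leb01. \<forall>\<mu>\<in>{a..b}. \<forall>\<nu>\<in>{a..b}. norm (B x \<mu> - B x \<nu>) \<le> b1 x * \<bar>\<mu> - \<nu>\<bar>"
    and F: "\<And>\<mu>. \<mu> \<in> {a..b} \<Longrightarrow> integral_solution (A \<mu>) (F \<mu>)" and F0: "\<And>\<mu>. \<mu> \<in> {a..b} \<Longrightarrow> F \<mu> 0 = Z0"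
    and Z0: "lag_frame Z0"
begin

text \<open>
  The difference of two coefficients, set to zero on the null set where the Lipschitz bound fails.
\<close>
lemma coefficient_difference:
  assumes "\<mu> \<in> {a..b}" "\<nu> \<in> {a..b}"
  obtains E N where "l1_matrix E (\<lambda>x. \<bar>\<mu> - \<nu>\<bar> * b1 x)" "negligible N"
    "\<And>x. x \<in> {0..1} - N \<Longrightarrow> E x = A \<mu> x - A \<nu> x \<and> E x = B x \<mu> - B x \<nu>"
proof -
  obtain N where N: "negligible N" "\<And>x. x \<in> {0<..<1} - N \<Longrightarrow> norm (B x \<mu> - B x \<nu>) \<le> b1 x * \<bar>\<mu> - \<nu>\<bar>"
    using lip assms unfolding AE_leb01_iff by blast
  obtain N1 N2 where N1: "negligible N1" "\<And>x. x \<in> {0<..<1} - N1 \<Longrightarrow> A \<mu> x = B x \<mu>"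
    and N2: "negligible N2" "\<And>x. x \<in> {0<..<1} - N2 \<Longrightarrow> A \<nu> x = B x \<nu>" using AB assms by meson
  define M where "M = N \<union> N1 \<union> N2 \<union> {0, 1}"
  have M: "negligible M" using N N1 N2 by (simp add: M_def)
  define E where "E x = (if x \<in> {0..1} - M then A \<mu> x - A \<nu> x else 0)" for x
  have "l1_matrix E (\<lambda>x. \<bar>\<mu> - \<nu>\<bar> * b1 x)"
    unfolding l1_matrix_def
  proof (intro conjI allI)
    have "(\<lambda>x. A \<mu> x - A \<nu> x) \<in> borel_measurable lebesgue"
      using l1_matrixD(1)[OF A[OF assms(1)]] l1_matrixD(1)[OF A[OF assms(2)]] by (rule borel_measurable_diff)
    then show "E \<in> borel_measurable lebesgue"
      unfolding E_def using negligible_imp_sets[OF M] by (intro borel_measurable_if_I measurable_restrict_space1) auto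
    show "norm (E x) \<le> \<bar>\<mu> - \<nu>\<bar> * b1 x" for x
      using N(2)[of x] N1(2)[of x] N2(2)[of x] b1(2)[of x] by (auto simp: E_def M_def mult.commute)
    show "(\<lambda>x. \<bar>\<mu> - \<nu>\<bar> * b1 x) integrable_on {0..1}"
      by (intro integrable_on_mult_right integrable_leb01(1) b1)
  qed
  moreover have "E x = A \<mu> x - A \<nu> x \<and> E x = B x \<mu> - B x \<nu>" if "x \<in> {0..1} - M" for x
    using that N1(2)[of x] N2(2)[of x] by (auto simp: E_def M_def)
  ultimately show ?thesis using that M by blast
qed

lemma bound_integrable: "(\<lambda>x. norm (Jmat :: complex ^ ('n + 'n) ^ ('n + 'n)) * bnd x) integrable_on {0..1}"
  and bound_nonneg: "0 \<le> norm (Jmat :: complex ^ ('n + 'n) ^ ('n + 'n)) * bnd x"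
proof -
  have m: "a \<in> {a..b}" using ab by simp
  show "(\<lambda>x. norm (Jmat :: complex ^ ('n + 'n) ^ ('n + 'n)) * bnd x) integrable_on {0..1}"
    by (rule integrable_on_mult_right[OF l1_matrixD(4)[OF A[OF m]]])
  show "0 \<le> norm (Jmat :: complex ^ ('n + 'n) ^ ('n + 'n)) * bnd x"
    by (rule mult_nonneg_nonneg[OF norm_ge_zero l1_matrixD(3)[OF A[OF m]]])
qed

text \<open>
  Both are instances of Gronwall's inequality: the difference of two solutions vanishes at \<open>0\<close> and solves the
  equation up to a perturbation of size \<open>|\<mu> - \<nu>| \<integral>b1\<close>.
\<close>
lemma solution_bound: "\<exists>R\<ge>0. \<forall>\<mu>\<in>{a..b}. \<forall>x\<in>{0..1}. norm (F \<mu> x) \<le> R"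
  and solution_lipschitz: "\<exists>C\<ge>0. \<forall>\<mu>\<in>{a..b}. \<forall>\<nu>\<in>{a..b}. \<forall>x\<in>{0..1}. norm (F \<mu> x - F \<nu> x) \<le> C * \<bar>\<mu> - \<nu>\<bar>"
proof -
  let ?j = "norm (Jmat :: complex ^ ('n + 'n) ^ ('n + 'n))"
  let ?b = "\<lambda>x. ?j * bnd x"
  obtain C where C0: "C \<ge> 0" and C: "\<And>(f :: real \<Rightarrow> complex ^ 'n ^ ('n + 'n)) \<gamma>. 0 \<le> \<gamma> \<Longrightarrow> continuous_on {0..1} f \<Longrightarrow>
    \<forall>s t M. 0 \<le> s \<longrightarrow> s \<le> t \<longrightarrow> t \<le> 1 \<longrightarrow> (\<forall>x\<in>{s..t}. norm (f x) \<le> M) \<longrightarrow> norm (f t - f s) \<le> \<gamma> + M * integral {s..t} ?b \<Longrightarrow>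
    \<forall>u\<in>{0..1}. \<forall>v\<in>{0..1}. norm (f u) \<le> C * (norm (f v) + \<gamma>)"
    using gronwall[OF bound_integrable bound_nonneg] by metis
  define R where "R = C * norm Z0"
  have R0: "R \<ge> 0" using C0 by (simp add: R_def)
  have R: "norm (F \<mu> x) \<le> R" if \<mu>: "\<mu> \<in> {a..b}" and x: "x \<in> {0..1}" for \<mu> x
  proof -
    have "\<forall>s t M. 0 \<le> s \<longrightarrow> s \<le> t \<longrightarrow> t \<le> 1 \<longrightarrow> (\<forall>x\<in>{s..t}. norm (F \<mu> x) \<le> M) \<longrightarrow> norm (F \<mu> t - F \<mu> s) \<le> 0 + M * integral {s..t} ?b"
      using integral_solution_increment[OF A[OF \<mu>] F[OF \<mu>]] by simp
    from bspec[OF bspec[OF C[OF order_refl integral_solutionD(1)[OF F[OF \<mu>]] this] x], of 0]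
    have "norm (F \<mu> x) \<le> C * (norm (F \<mu> 0) + 0)" by simp
    then show ?thesis by (simp add: F0[OF \<mu>] R_def)
  qed
  then show "\<exists>R\<ge>0. \<forall>\<mu>\<in>{a..b}. \<forall>x\<in>{0..1}. norm (F \<mu> x) \<le> R" using R0 by blast
  define K where "K = ?j * R * integral {0..1} b1"
  have I1: "0 \<le> integral {0..1} b1" using b1 by (intro integral_nonneg integrable_leb01) auto
  have K0: "0 \<le> K" unfolding K_def using R0 I1 by simp
  have "norm (F \<mu> x - F \<nu> x) \<le> (C * K) * \<bar>\<mu> - \<nu>\<bar>" if \<mu>: "\<mu> \<in> {a..b}" and \<nu>: "\<nu> \<in> {a..b}" and x: "x \<in> {0..1}" for \<mu> \<nu> x
  proof -
    obtain E N where E: "l1_matrix E (\<lambda>x. \<bar>\<mu> - \<nu>\<bar> * b1 x)" "negligible N"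
      "\<And>x. x \<in> {0..1} - N \<Longrightarrow> E x = A \<mu> x - A \<nu> x" using coefficient_difference[OF \<mu> \<nu>] by metis
    note Fc = integral_solutionD(1)[OF F[OF \<mu>]] integral_solutionD(1)[OF F[OF \<nu>]]
    define f where "f x = F \<mu> x - F \<nu> x" for x
    have fc: "continuous_on {0..1} f" unfolding f_def by (intro continuous_intros Fc)
    have inc: "norm (f t - f s) \<le> K * \<bar>\<mu> - \<nu>\<bar> + M * integral {s..t} ?b"
      if st: "0 \<le> s" "s \<le> t" "t \<le> 1" and M: "\<forall>x\<in>{s..t}. norm (f x) \<le> M" for s t M
    proof -
      have "Jmat ** (f t - f s) = integral {s..t} (\<lambda>x. A \<mu> x ** F \<mu> x) - integral {s..t} (\<lambda>x. A \<nu> x ** F \<nu> x)"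
        unfolding integral_solutionD(3)[OF F[OF \<mu>] st] integral_solutionD(3)[OF F[OF \<nu>] st] f_def
        by (simp add: matrix_diff_ldistrib)
      also have "\<dots> = integral {s..t} (\<lambda>x. A \<mu> x ** F \<mu> x - A \<nu> x ** F \<nu> x)"
        using st by (intro integral_diff[symmetric] l1_integrable[OF A[OF \<mu>]] l1_integrable[OF A[OF \<nu>]] Fc) auto
      also have "\<dots> = integral {s..t} (\<lambda>x. A \<mu> x ** f x + E x ** F \<nu> x)"
        by (rule integral_spike[OF E(2)]) (use st in \<open>auto simp: E(3) f_def matrix_diff_ldistrib matrix_diff_rdistrib\<close>)
      also have "\<dots> = integral {s..t} (\<lambda>x. A \<mu> x ** f x) + integral {s..t} (\<lambda>x. E x ** F \<nu> x)"
        using st by (intro integral_add l1_integrable[OF A[OF \<mu>]] l1_integrable[OF E(1)] Fc fc) auto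
      finally have eq: "Jmat ** (f t - f s) = integral {s..t} (\<lambda>x. A \<mu> x ** f x) + integral {s..t} (\<lambda>x. E x ** F \<nu> x)" .
      have "norm (f t - f s) \<le> ?j * norm (Jmat ** (f t - f s))" by (rule norm_le_Jmat)
      also have "\<dots> \<le> ?j * (M * integral {s..t} bnd + R * integral {s..t} (\<lambda>x. \<bar>\<mu> - \<nu>\<bar> * b1 x))"
        unfolding eq
      proof (intro mult_left_mono norm_triangle_mono)
        show "norm (integral {s..t} (\<lambda>x. A \<mu> x ** f x)) \<le> M * integral {s..t} bnd"
          using M by (intro l1_bound[OF A[OF \<mu>] fc st(1,3)] l1_factors(2)[OF A[OF \<mu>]]) auto
        show "norm (integral {s..t} (\<lambda>x. E x ** F \<nu> x)) \<le> R * integral {s..t} (\<lambda>x. \<bar>\<mu> - \<nu>\<bar> * b1 x)"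
          using R[OF \<nu>] st by (intro l1_bound[OF E(1) Fc(2) st(1,3)] l1_factors(2)[OF E(1)]) auto
      qed simp
      also have "integral {s..t} (\<lambda>x. \<bar>\<mu> - \<nu>\<bar> * b1 x) \<le> \<bar>\<mu> - \<nu>\<bar> * integral {0..1} b1"
      proof -
        have "integral {s..t} b1 \<le> integral {0..1} b1"
          using st b1 integrable_leb01(1)[OF b1(1)] by (intro integral_subset_le) (auto intro: integrable_on_subinterval)
        then show ?thesis by (simp add: mult_left_mono)
      qed
      then have "?j * (M * integral {s..t} bnd + R * integral {s..t} (\<lambda>x. \<bar>\<mu> - \<nu>\<bar> * b1 x))
          \<le> ?j * (M * integral {s..t} bnd + R * (\<bar>\<mu> - \<nu>\<bar> * integral {0..1} b1))"
        using R0 by (intro mult_left_mono add_left_mono) auto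
      also have "\<dots> = K * \<bar>\<mu> - \<nu>\<bar> + M * integral {s..t} ?b"
        by (simp add: K_def algebra_simps)
      finally show ?thesis .
    qed
    have h1: "0 \<le> K * \<bar>\<mu> - \<nu>\<bar>" using K0 by simp
    have h2: "\<forall>s t M. 0 \<le> s \<longrightarrow> s \<le> t \<longrightarrow> t \<le> 1 \<longrightarrow> (\<forall>x\<in>{s..t}. norm (f x) \<le> M) \<longrightarrow> norm (f t - f s) \<le> K * \<bar>\<mu> - \<nu>\<bar> + M * integral {s..t} ?b"
      by (intro allI impI inc)
    from bspec[OF bspec[OF C[OF h1 fc h2] x], of 0]
    have "norm (f x) \<le> C * (norm (f 0) + K * \<bar>\<mu> - \<nu>\<bar>)" by simp
    then show ?thesis by (simp add: f_def F0[OF \<mu>] F0[OF \<nu>])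
  qed
  then show "\<exists>C\<ge>0. \<forall>\<mu>\<in>{a..b}. \<forall>\<nu>\<in>{a..b}. \<forall>x\<in>{0..1}. norm (F \<mu> x - F \<nu> x) \<le> C * \<bar>\<mu> - \<nu>\<bar>"
    using mult_nonneg_nonneg[OF C0 K0] by blast
qed

text \<open>
  Continuity in \<open>x\<close> for each parameter, together with the Lipschitz bound in the parameter that is uniform in \<open>x\<close>.
\<close>
lemma solution_continuous: "continuous_on ({0..1} \<times> {a..b}) (\<lambda>p. F (snd p) (fst p))"
  unfolding continuous_on_iff
proof (intro ballI allI impI)
  fix p :: "real \<times> real" and e assume p: "p \<in> {0..1} \<times> {a..b}" and e: "(e::real) > 0"
  obtain x \<mu> where px: "p = (x, \<mu>)" "x \<in> {0..1}" "\<mu> \<in> {a..b}" using p by auto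
  obtain C where C: "C \<ge> 0" "\<And>\<mu> \<nu> x. \<mu> \<in> {a..b} \<Longrightarrow> \<nu> \<in> {a..b} \<Longrightarrow> x \<in> {0..1} \<Longrightarrow> norm (F \<mu> x - F \<nu> x) \<le> C * \<bar>\<mu> - \<nu>\<bar>"
    using solution_lipschitz by blast
  obtain \<delta> where \<delta>: "\<delta> > 0" "\<And>y. y \<in> {0..1} \<Longrightarrow> dist y x < \<delta> \<Longrightarrow> dist (F \<mu> y) (F \<mu> x) < e / 2"
    using integral_solutionD(1)[OF F[OF px(3)]] px(2) half_gt_zero[OF e] unfolding continuous_on_iff by metis
  define \<eta> where "\<eta> = min \<delta> (e / (2 * (C + 1)))"
  have \<eta>: "\<eta> > 0" using \<delta> e C by (simp add: \<eta>_def)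
  have "dist (F (snd q) (fst q)) (F (snd p) (fst p)) < e" if q: "q \<in> {0..1} \<times> {a..b}" "dist q p < \<eta>" for q
  proof -
    obtain y \<nu> where qy: "q = (y, \<nu>)" "y \<in> {0..1}" "\<nu> \<in> {a..b}" using q by auto
    have d: "dist y x < \<eta>" "dist \<nu> \<mu> < \<eta>"
      using q(2) dist_fst_le[of q p] dist_snd_le[of q p] by (auto simp: qy px)
    have "norm (F \<nu> y - F \<mu> y) \<le> C * \<bar>\<nu> - \<mu>\<bar>" by (rule C(2)[OF qy(3) px(3) qy(2)])
    also have "\<dots> \<le> (C + 1) * \<bar>\<nu> - \<mu>\<bar>" using C by (intro mult_right_mono) auto
    also have "\<dots> \<le> (C + 1) * (e / (2 * (C + 1)))"
      using d(2) C by (intro mult_left_mono) (auto simp: dist_real_def \<eta>_def)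
    also have "\<dots> = e / 2"
    proof -
      have k: "k * (e / (2 * k)) = e / 2" if "k > 0" for k :: real using that by simp
      show ?thesis by (rule k) (use C(1) in simp)
    qed
    finally have "dist (F \<nu> y) (F \<mu> y) \<le> e / 2" by (simp add: dist_norm)
    moreover have "dist (F \<mu> y) (F \<mu> x) < e / 2" using \<delta>(2)[OF qy(2)] d(1) by (simp add: \<eta>_def)
    ultimately show ?thesis
      using dist_triangle[of "F \<nu> y" "F \<mu> x" "F \<mu> y"] by (simp add: qy px)
  qed
  then show "\<exists>d>0. \<forall>q\<in>{0..1} \<times> {a..b}. dist q p < d \<longrightarrow> dist (F (snd q) (fst q)) (F (snd p) (fst p)) < e"
    using \<eta> by blast
qed

lemma solution_lag_frame:
  assumes \<mu>: "\<mu> \<in> {a..b}" and x: "x \<in> {0..1}"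
  shows "lag_frame (F \<mu> x)"
  using lag_frame_propagates[OF A[OF \<mu>] sa[OF \<mu>] F[OF \<mu>], of 0 x] x Z0 by (simp add: F0[OF \<mu>])

text \<open>
  By the Lagrange identity the quotient is minus the integral of
  \<open>F(y)\<^sup>* ((B(y) - B(\<omega>)) / (y - \<omega>)) F(\<omega>)\<close>, the boundary term at \<open>0\<close> being zero because all frames start at \<open>Z0\<close>.
  The Lipschitz bound is an integrable majorant, so dominated convergence applies.
\<close>
lemma symplectic_derivative:
  assumes \<omega>: "\<omega> \<in> {a..b}" and y: "y \<longlonglongrightarrow> \<omega>" "\<And>n. y n \<in> {a..b}" "\<And>n. y n \<noteq> \<omega>"
  shows "(\<lambda>n. (1 / (y n - \<omega>)) *\<^sub>R (adj (F (y n) 1) ** Jmat ** F \<omega> 1))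
    \<longlonglongrightarrow> - (LINT x|leb01. adj (F \<omega> x) ** lam_deriv I B x \<omega> ** F \<omega> x)"
proof -
  obtain R where R: "R \<ge> 0" "\<And>\<mu> x. \<mu> \<in> {a..b} \<Longrightarrow> x \<in> {0..1} \<Longrightarrow> norm (F \<mu> x) \<le> R" using solution_bound by blast
  obtain C where C: "C \<ge> 0" "\<And>\<mu> \<nu> x. \<mu> \<in> {a..b} \<Longrightarrow> \<nu> \<in> {a..b} \<Longrightarrow> x \<in> {0..1} \<Longrightarrow> norm (F \<mu> x - F \<nu> x) \<le> C * \<bar>\<mu> - \<nu>\<bar>"
    using solution_lipschitz by blast
  define s where "s n x = (1 / (y n - \<omega>)) *\<^sub>R (adj (F (y n) x) ** (B x (y n) - B x \<omega>) ** F \<omega> x)" for n x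
  define f where "f x = adj (F \<omega> x) ** lam_deriv I B x \<omega> ** F \<omega> x" for x
  have Fm: "F \<mu> \<in> borel_measurable leb01" if "\<mu> \<in> {a..b}" for \<mu>
    using integral_solutionD(1)[OF F[OF that]]
    by (intro continuous_imp_measurable_on_sets_lebesgue) (auto intro: continuous_on_subset)
  have adjm: "(\<lambda>x. adj (G x)) \<in> borel_measurable leb01" if "G \<in> borel_measurable leb01" for G :: "real \<Rightarrow> complex ^ 'n ^ ('n + 'n)"
    using that by (rule borel_measurable_continuous_on[rotated]) (intro continuous_intros)
  have sm: "s n \<in> borel_measurable leb01" for n
    unfolding s_def
    by (intro borel_measurable_scaleR borel_measurable_const measurable_mm adjm Fm y \<omega> borel_measurable_diff meas)
  obtain N where N: "negligible N" "\<And>x. x \<in> {0<..<1} - N \<Longrightarrow> (\<forall>\<mu>\<in>{a..b}. \<forall>\<nu>\<in>{a..b}. norm (B x \<mu> - B x \<nu>) \<le> b1 x * \<bar>\<mu> - \<nu>\<bar>) \<and> (\<forall>\<mu>\<in>I. B x differentiable (at \<mu> within I))"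
    using AE_conjI[OF lip diff] unfolding AE_leb01_iff by blast
  have lim: "(\<lambda>n. s n x) \<longlonglongrightarrow> f x" if x: "x \<in> {0<..<1} - N" for x
  proof -
    have "(B x has_vector_derivative lam_deriv I B x \<omega>) (at \<omega> within I)"
      using N(2)[OF x] \<omega> abI unfolding lam_deriv_def vector_derivative_works[symmetric] by blast
    then have 1: "(\<lambda>n. (1 / (y n - \<omega>)) *\<^sub>R (B x (y n) - B x \<omega>)) \<longlonglongrightarrow> lam_deriv I B x \<omega>"
      using y abI by (intro difference_quotient_limit) auto
    have "(\<lambda>n. F (y n) x - F \<omega> x) \<longlonglongrightarrow> 0"
    proof (rule Lim_null_comparison)
      show "\<forall>\<^sub>F n in sequentially. norm (F (y n) x - F \<omega> x) \<le> C * \<bar>y n - \<omega>\<bar>"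
        using C(2)[OF y(2) \<omega>] x by (intro always_eventually) auto
      have "(\<lambda>n. C * \<bar>y n - \<omega>\<bar>) \<longlonglongrightarrow> C * \<bar>\<omega> - \<omega>\<bar>" by (intro tendsto_intros y)
      then show "(\<lambda>n. C * \<bar>y n - \<omega>\<bar>) \<longlonglongrightarrow> 0" by simp
    qed
    then have 2: "(\<lambda>n. F (y n) x) \<longlonglongrightarrow> F \<omega> x" by (simp add: Lim_null[symmetric])
    have "(\<lambda>n. adj (F (y n) x) ** ((1 / (y n - \<omega>)) *\<^sub>R (B x (y n) - B x \<omega>)) ** F \<omega> x) \<longlonglongrightarrow> f x"
      unfolding f_def by (intro tendsto_intros 1 2)
    moreover have "adj (F (y n) x) ** ((1 / (y n - \<omega>)) *\<^sub>R (B x (y n) - B x \<omega>)) ** F \<omega> x = s n x" for n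
      unfolding s_def
      by (simp only: bounded_bilinear.scaleR_right[OF bounded_bilinear_mm] bounded_bilinear.scaleR_left[OF bounded_bilinear_mm])
    ultimately show ?thesis by simp
  qed
  have bound: "norm (s n x) \<le> R * R * b1 x" if x: "x \<in> {0<..<1} - N" for n x
  proof -
    have "norm (adj (F (y n) x) ** (B x (y n) - B x \<omega>) ** F \<omega> x) \<le> norm (adj (F (y n) x)) * norm (B x (y n) - B x \<omega>) * norm (F \<omega> x)"
      by (meson mult_right_mono norm_ge_zero norm_mm_le order_trans)
    also have "\<dots> \<le> R * (b1 x * \<bar>y n - \<omega>\<bar>) * R"
      unfolding norm_adj using N(2)[OF x] R y \<omega> x b1(2)[of x] by (intro mult_mono) auto
    finally have "\<bar>1 / (y n - \<omega>)\<bar> * norm (adj (F (y n) x) ** (B x (y n) - B x \<omega>) ** F \<omega> x) \<le> \<bar>1 / (y n - \<omega>)\<bar> * (R * (b1 x * \<bar>y n - \<omega>\<bar>) * R)"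
      by (rule mult_left_mono) simp
    also have "\<bar>1 / (y n - \<omega>)\<bar> * (R * (b1 x * \<bar>y n - \<omega>\<bar>) * R) = R * R * b1 x"
      using y(3)[of n] by simp
    finally show ?thesis by (simp only: s_def norm_scaleR)
  qed
  have AElim: "AE x in leb01. (\<lambda>n. s n x) \<longlonglongrightarrow> f x" and AEb: "\<And>n. AE x in leb01. norm (s n x) \<le> R * R * b1 x"
    unfolding AE_leb01_iff using N(1) lim bound by blast+
  have fm: "(\<lambda>x. if x \<in> N then 0 else f x) \<in> borel_measurable leb01"
  proof (rule borel_measurable_LIMSEQ_metric)
    have Ns: "{x \<in> space leb01. x \<in> N} \<in> sets leb01"
      using N(1) negligible_imp_sets by (auto simp: sets_restrict_space image_iff intro!: bexI[of _ N])
    show "(\<lambda>x. if x \<in> N then 0 else s n x) \<in> borel_measurable leb01" for n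
      by (intro measurable_If sm Ns) auto
    show "(\<lambda>n. if x \<in> N then 0 else s n x) \<longlonglongrightarrow> (if x \<in> N then 0 else f x)" if "x \<in> space leb01" for x
      using lim[of x] that by auto
  qed
  let ?f = "\<lambda>x. if x \<in> N then 0 else f x"
  have AElim': "AE x in leb01. (\<lambda>n. s n x) \<longlonglongrightarrow> ?f x"
    unfolding AE_leb01_iff by (rule exI[of _ N]) (use N(1) lim in auto)
  have w: "integrable leb01 (\<lambda>x. R * R * b1 x)" using b1(1) by simp
  have conv: "(\<lambda>n. integral\<^sup>L leb01 (s n)) \<longlonglongrightarrow> integral\<^sup>L leb01 ?f"
    by (rule integral_dominated_convergence[OF fm sm w AElim' AEb])
  \<comment> \<open>The values of \<open>f\<close> on the null set \<open>N\<close> are arbitrary; \<open>f\<close> is measurable because Lebesgue measure is complete.\<close>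
  have f_eq: "integral\<^sup>L leb01 ?f = integral\<^sup>L leb01 f"
  proof (rule integral_cong_AE[OF fm])
    show "f \<in> borel_measurable leb01"
    proof (rule measurableI)
      fix Y :: "(complex ^ 'n ^ 'n) set" assume Y: "Y \<in> sets borel"
      have "negligible (f -` Y \<inter> {0<..<1} \<inter> N)" by (rule negligible_subset[OF N(1)]) auto
      then have "f -` Y \<inter> {0<..<1} \<inter> N \<in> sets leb01"
        by (auto simp: sets_restrict_space image_iff dest!: negligible_imp_sets intro!: bexI[of _ "f -` Y \<inter> {0<..<1} \<inter> N"])
      moreover have "N \<inter> {0<..<1} \<in> sets leb01"
        using negligible_imp_sets[OF N(1)] by (auto simp: sets_restrict_space image_iff intro!: bexI[of _ N])
      moreover have "?f -` Y \<inter> space leb01 \<in> sets leb01" by (rule measurable_sets[OF fm Y])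
      ultimately have "(?f -` Y \<inter> space leb01 - N \<inter> {0<..<1}) \<union> (f -` Y \<inter> {0<..<1} \<inter> N) \<in> sets leb01" by auto
      also have "(?f -` Y \<inter> space leb01 - N \<inter> {0<..<1}) \<union> (f -` Y \<inter> {0<..<1} \<inter> N) = f -` Y \<inter> space leb01"
        by auto
      finally show "f -` Y \<inter> space leb01 \<in> sets leb01" .
    qed simp
    show "AE x in leb01. ?f x = f x" unfolding AE_leb01_iff by (rule exI[of _ N]) (use N(1) in auto)
  qed
  have eq: "(1 / (y n - \<omega>)) *\<^sub>R (adj (F (y n) 1) ** Jmat ** F \<omega> 1) = - integral\<^sup>L leb01 (s n)" for n
  proof -
    note \<nu> = y(2)[of n]
    obtain E M where E: "l1_matrix E (\<lambda>x. \<bar>y n - \<omega>\<bar> * b1 x)" "negligible M"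
      "\<And>x. x \<in> {0..1} - M \<Longrightarrow> E x = A (y n) x - A \<omega> x \<and> E x = B x (y n) - B x \<omega>" using coefficient_difference[OF \<nu> \<omega>] by metis
    have c: "continuous_on {0..1} (\<lambda>x. adj (F (y n) x))" "continuous_on {0..1} (F \<omega>)"
      by (intro continuous_intros integral_solutionD(1)[OF F] \<nu> \<omega>)+
    have ints: "integrable leb01 (s n)"
      by (rule integrable_dominated_convergence2[OF fm sm w AElim' AEb])
    have "adj (F (y n) 1) ** Jmat ** F \<omega> 1 - adj (F (y n) 0) ** Jmat ** F \<omega> 0
        = integral {0..1} (\<lambda>x. adj (F (y n) x) ** A \<omega> x ** F \<omega> x) - integral {0..1} (\<lambda>x. adj (F (y n) x) ** A (y n) x ** F \<omega> x)"
      by (rule lagrange_identity[OF A[OF \<nu>] A[OF \<omega>] sa[OF \<nu>] F[OF \<nu>] F[OF \<omega>]]) auto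
    also have "\<dots> = integral {0..1} (\<lambda>x. adj (F (y n) x) ** A \<omega> x ** F \<omega> x - adj (F (y n) x) ** A (y n) x ** F \<omega> x)"
      by (intro integral_diff[symmetric] l1_product_integrable[OF A[OF \<nu>]] l1_product_integrable[OF A[OF \<omega>]] c) auto
    also have "\<dots> = integral {0..1} (\<lambda>x. - ((y n - \<omega>) *\<^sub>R s n x))"
    proof (rule integral_spike[OF E(2)])
      fix x assume x: "x \<in> {0..1} - M"
      have "(y n - \<omega>) *\<^sub>R s n x = adj (F (y n) x) ** (B x (y n) - B x \<omega>) ** F \<omega> x" using y(3)[of n] by (simp add: s_def)
      also have "\<dots> = adj (F (y n) x) ** (A (y n) x - A \<omega> x) ** F \<omega> x"
      proof -
        have "B x (y n) - B x \<omega> = A (y n) x - A \<omega> x" using E(3)[OF x] by metis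
        then show ?thesis by (simp only:)
      qed
      finally show "- ((y n - \<omega>) *\<^sub>R s n x) = adj (F (y n) x) ** A \<omega> x ** F \<omega> x - adj (F (y n) x) ** A (y n) x ** F \<omega> x"
        by (simp add: matrix_diff_ldistrib matrix_diff_rdistrib)
    qed
    also have "\<dots> = - ((y n - \<omega>) *\<^sub>R integral {0..1} (s n))" by simp
    also have "integral {0..1} (s n) = integral\<^sup>L leb01 (s n)" by (rule integrable_leb01(2)[OF ints, symmetric])
    finally have "adj (F (y n) 1) ** Jmat ** F \<omega> 1 = - ((y n - \<omega>) *\<^sub>R integral\<^sup>L leb01 (s n))"
      using Z0 by (simp add: F0[OF \<nu>] F0[OF \<omega>] lag_frame_def)
    then show ?thesis using y(3)[of n] by simp
  qed
  show ?thesis unfolding eq f_def[symmetric] by (rule tendsto_minus) (use conv in \<open>simp only: f_eq\<close>)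
qed

end

section \<open>Eigenfunctions\<close>

lemma abs_continuous_on_cong:
  assumes "\<And>x. a \<le> x \<Longrightarrow> x \<le> b \<Longrightarrow> f x = g x" "abs_continuous_on a b f"
  shows "abs_continuous_on a b g"
  unfolding abs_continuous_on_def
proof (intro allI impI)
  fix e :: real assume "e > 0"
  then obtain \<delta> where \<delta>: "\<delta> > 0" and ac: "\<And>(N::nat) c d. (\<forall>i<N. a \<le> c i \<and> c i \<le> d i \<and> d i \<le> b) \<Longrightarrow>
       disjoint_family_on (\<lambda>i. {c i<..<d i}) {..<N} \<Longrightarrow> (\<Sum>i<N. d i - c i) < \<delta> \<Longrightarrow>
       (\<Sum>i<N. norm (f (d i) - f (c i))) < e"
    using assms(2) unfolding abs_continuous_on_def by meson
  show "\<exists>\<delta>>0. \<forall>(N::nat) c d. (\<forall>i<N. a \<le> c i \<and> c i \<le> d i \<and> d i \<le> b) \<longrightarrow>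
       disjoint_family_on (\<lambda>i. {c i<..<d i}) {..<N} \<longrightarrow> (\<Sum>i<N. d i - c i) < \<delta> \<longrightarrow>
       (\<Sum>i<N. norm (g (d i) - g (c i))) < e"
  proof (intro exI[of _ \<delta>] conjI \<delta> allI impI)
    fix N :: nat and c d
    assume A: "\<forall>i<N. a \<le> c i \<and> c i \<le> d i \<and> d i \<le> b" "disjoint_family_on (\<lambda>i. {c i<..<d i}) {..<N}" "(\<Sum>i<N. d i - c i) < \<delta>"
    have "g (d i) = f (d i) \<and> g (c i) = f (c i)" if "i < N" for i
      using A(1) that assms(1)[of "c i"] assms(1)[of "d i"] by force
    then have "(\<Sum>i<N. norm (g (d i) - g (c i))) = (\<Sum>i<N. norm (f (d i) - f (c i)))"
      by (intro sum.cong) auto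
    then show "(\<Sum>i<N. norm (g (d i) - g (c i))) < e" using ac[OF A] by simp
  qed
qed

text \<open>
  Uniqueness for the initial value problem, applied to the difference of the two solutions.
\<close>
lemma solves_system_frame:
  fixes X :: "real \<Rightarrow> complex ^ 'n ^ ('n::finite + 'n)"
  assumes X: "solves_matrix_system C X" and N: "negligible N" and AC: "\<And>x. x \<in> {0<..<1} - N \<Longrightarrow> A x = C x"
    and A: "l1_matrix A b" and y: "solves_system C y" and y0: "y 0 = X 0 *v c" and x: "x \<in> {0..1}"
  shows "y x = X x *v c"
proof -
  define Y where "Y x = (repeat_column (y x) :: complex ^ 'n ^ ('n + 'n))" for x
  have ac: "abs_continuous_on 0 1 y" using y by (simp add: solves_system_def)
  obtain M where M: "negligible M" "\<And>x. x \<in> {0<..<1} - M \<Longrightarrow> \<exists>y'. (y has_vector_derivative y') (at x) \<and> Jmat *v y' = C x *v y x"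
    using y unfolding solves_system_def AE_leb01_iff by blast
  have "solves_matrix_system C Y"
    unfolding solves_matrix_system_def AE_leb01_iff
  proof (intro conjI exI[of _ M] ballI)
    show "abs_continuous_on 0 1 Y"
      unfolding Y_def by (rule AC_linear_image[OF ac bounded_linear_repeat_column])
    fix x assume "x \<in> {0<..<1} - M"
    then obtain y' where y': "(y has_vector_derivative y') (at x)" "Jmat *v y' = C x *v y x" using M(2) by blast
    show "\<exists>Y'. (Y has_vector_derivative Y') (at x) \<and> Jmat ** Y' = C x ** Y x"
      unfolding Y_def
      by (intro exI[of _ "repeat_column y'"] conjI bounded_linear.has_vector_derivative[OF bounded_linear_repeat_column] y'(1))
        (simp add: repeat_column_mult y'(2))
  qed (rule M)
  then have Yi: "integral_solution A Y" by (rule solves_matrix_system_integral[OF _ N AC])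
  have Xi: "integral_solution A (\<lambda>x. X x ** repeat_column c)"
    by (rule integral_solution_mult[OF solves_matrix_system_integral[OF X N AC]])
  have "integral_solution A (\<lambda>x. Y x - X x ** repeat_column c)"
    unfolding integral_solution_def
  proof (intro conjI allI impI)
    show "continuous_on {0..1} (\<lambda>x. Y x - X x ** repeat_column c)"
      by (intro continuous_intros integral_solutionD(1)[OF Yi] integral_solutionD(1)[OF Xi])
    fix s t :: real assume st: "0 \<le> s" "s \<le> t" "t \<le> 1"
    from has_integral_diff[OF integral_solutionD(2)[OF Yi st] integral_solutionD(2)[OF Xi st]]
    show "((\<lambda>x. A x ** (Y x - X x ** repeat_column c)) has_integral
        Jmat ** (Y t - X t ** repeat_column c - (Y s - X s ** repeat_column c))) {s..t}"
      by (simp add: matrix_diff_ldistrib matrix_add_ldistrib algebra_simps)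
  qed
  from integral_solution_unique[OF A this, of 0 x] x
  have "Y x - X x ** repeat_column c = 0"
    by (simp add: Y_def y0 repeat_column_mult)
  then have "Y x = repeat_column (X x *v c)" by (simp add: repeat_column_mult)
  then show ?thesis unfolding Y_def by (rule repeat_column_inj)
qed

text \<open>The boundary condition at \<open>0\<close> restricts an eigenfunction to the span of the columns of \<open>X\<close>;
  the condition at \<open>1\<close> then is a linear condition on the coefficients.\<close>
lemma eigenspace_image:
  fixes X :: "real \<Rightarrow> complex ^ 'n ^ ('n::finite + 'n)" and \<alpha> \<beta> :: "complex ^ ('n + 'n) ^ 'n"
  assumes \<alpha>: "rank \<alpha> = CARD('n)" "\<alpha> ** Jmat ** adj \<alpha> = 0"
    and X: "solves_matrix_system (\<lambda>x. B x \<mu>) X" "X 0 = Jmat ** adj \<alpha>"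
    and A: "l1_matrix A b" "negligible N" "\<And>x. x \<in> {0<..<1} - N \<Longrightarrow> A x = B x \<mu>"
    and inj: "\<And>v. X 0 *v v = 0 \<Longrightarrow> v = 0"
  shows "vector_space.dim fscale (eigenspace B \<alpha> \<beta> \<mu>) = vec.dim (mker (\<beta> ** X 1))"
    and "(\<exists>y\<in>eigenspace B \<alpha> \<beta> \<mu>. y \<noteq> 0) \<longleftrightarrow> vec.dim (mker (\<beta> ** X 1)) \<noteq> 0"
proof -
  define \<Phi> where "\<Phi> c = (\<lambda>x. if x \<in> {0..1} then X x *v c else 0)" for c
  have lin: "Vector_Spaces.linear (*s) fscale \<Phi>"
  proof -
    interpret fs: vector_space fscale by (rule vector_space_fscale)
    show ?thesis
      by unfold_locales (auto simp: \<Phi>_def fscale_def fun_eq_iff matrix_vector_right_distrib vec.scale)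
  qed
  have \<Phi>0: "\<Phi> c = 0 \<Longrightarrow> c = 0" for c
    using inj[of c] by (auto simp: \<Phi>_def fun_eq_iff dest: spec[of _ 0])
  have injS: "inj_on \<Phi> S" for S
  proof (rule inj_onI)
    fix c d assume "\<Phi> c = \<Phi> d"
    then have "\<Phi> c 0 = \<Phi> d 0" by simp
    then have "X 0 *v (c - d) = 0" by (simp add: \<Phi>_def matrix_vector_mult_diff_distrib)
    then show "c = d" using inj by force
  qed
  have \<alpha>0: "\<alpha> *v v = 0 \<longleftrightarrow> (\<exists>c. v = X 0 *v c)" for v
    using lag_frame_maximal[OF boundary_frame(1)[OF \<alpha>], of v] boundary_frame(2)[OF \<alpha>] X(2) by simp
  have eq: "eigenspace B \<alpha> \<beta> \<mu> = \<Phi> ` mker (\<beta> ** X 1)"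
  proof (intro equalityI subsetI)
    fix y assume "y \<in> eigenspace B \<alpha> \<beta> \<mu>"
    then have y: "\<And>x. x \<notin> {0..1} \<Longrightarrow> y x = 0" "solves_system (\<lambda>x. B x \<mu>) y" "\<alpha> *v y 0 = 0" "\<beta> *v y 1 = 0"
      by (auto simp: eigenspace_def)
    obtain c where c: "y 0 = X 0 *v c" using y(3) \<alpha>0 by blast
    have yx: "y x = X x *v c" if "x \<in> {0..1}" for x
      by (rule solves_system_frame[OF X(1) A(2) A(3) A(1) y(2) c that])
    have "y = \<Phi> c" using y(1) yx by (auto simp: \<Phi>_def fun_eq_iff)
    moreover have "c \<in> mker (\<beta> ** X 1)" using y(4) yx[of 1] by (simp add: mker_def matrix_vector_mul_assoc[symmetric])
    ultimately show "y \<in> \<Phi> ` mker (\<beta> ** X 1)" by blast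
  next
    fix y assume "y \<in> \<Phi> ` mker (\<beta> ** X 1)"
    then obtain c where c: "y = \<Phi> c" "(\<beta> ** X 1) *v c = 0" by (auto simp: mker_def)
    have bl: "bounded_linear (\<lambda>Z :: complex ^ 'n ^ ('n + 'n). Z *v c)"
      by (rule bounded_bilinear.bounded_linear_left[OF bounded_bilinear_mv])
    have "abs_continuous_on 0 1 (\<lambda>x. X x *v c)"
      using X(1) by (intro AC_linear_image[OF _ bl]) (simp add: solves_matrix_system_def)
    then have "abs_continuous_on 0 1 y" by (rule abs_continuous_on_cong[rotated]) (simp add: c \<Phi>_def)
    moreover obtain M where M: "negligible M" "\<And>x. x \<in> {0<..<1} - M \<Longrightarrow> \<exists>X'. (X has_vector_derivative X') (at x) \<and> Jmat ** X' = B x \<mu> ** X x"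
      using X(1) unfolding solves_matrix_system_def AE_leb01_iff by blast
    moreover have "\<exists>y'. (y has_vector_derivative y') (at x) \<and> Jmat *v y' = B x \<mu> *v y x" if x: "x \<in> {0<..<1} - M" for x
    proof -
      obtain X' where X': "(X has_vector_derivative X') (at x)" "Jmat ** X' = B x \<mu> ** X x" using M(2)[OF x] by blast
      have "((\<lambda>x. X x *v c) has_vector_derivative X' *v c) (at x)"
        by (rule bounded_linear.has_vector_derivative[OF bl X'(1)])
      then have "(y has_vector_derivative X' *v c) (at x)"
        by (rule has_vector_derivative_transform_within_open[of _ _ _ "{0<..<1}"]) (use x in \<open>auto simp: c \<Phi>_def\<close>)
      moreover have "Jmat *v (X' *v c) = B x \<mu> *v y x"
        using x by (simp add: c \<Phi>_def matrix_vector_mul_assoc X'(2))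
      ultimately show ?thesis by blast
    qed
    ultimately have "solves_system (\<lambda>x. B x \<mu>) y" unfolding solves_system_def AE_leb01_iff by blast
    moreover have "\<alpha> *v y 0 = 0" using \<alpha>0[of "y 0"] by (auto simp: c \<Phi>_def)
    moreover have "\<beta> *v y 1 = 0" using c(2) by (simp add: c(1) \<Phi>_def matrix_vector_mul_assoc)
    ultimately show "y \<in> eigenspace B \<alpha> \<beta> \<mu>" by (auto simp: eigenspace_def c(1) \<Phi>_def)
  qed
  interpret P: finite_dimensional_vector_space_pair_1 "(*s)" cart_basis "fscale :: complex \<Rightarrow> (real \<Rightarrow> complex ^ ('n + 'n)) \<Rightarrow> _"
  proof -
    interpret fs: vector_space "fscale :: complex \<Rightarrow> (real \<Rightarrow> complex ^ ('n + 'n)) \<Rightarrow> _" by (rule vector_space_fscale)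
    show "finite_dimensional_vector_space_pair_1 (*s) cart_basis (fscale :: complex \<Rightarrow> (real \<Rightarrow> complex ^ ('n + 'n)) \<Rightarrow> _)"
      by unfold_locales
  qed
  show "vector_space.dim fscale (eigenspace B \<alpha> \<beta> \<mu>) = vec.dim (mker (\<beta> ** X 1))"
    unfolding eq by (rule P.dim_image_eq[OF lin injS])
  have z: "\<Phi> 0 = 0" by (auto simp: \<Phi>_def fun_eq_iff)
  have "(\<exists>y\<in>eigenspace B \<alpha> \<beta> \<mu>. y \<noteq> 0) \<longleftrightarrow> (\<exists>c\<in>mker (\<beta> ** X 1). c \<noteq> 0)"
  proof (unfold eq, intro iffI)
    assume "\<exists>y\<in>\<Phi> ` mker (\<beta> ** X 1). y \<noteq> 0"
    then obtain c where c: "c \<in> mker (\<beta> ** X 1)" "\<Phi> c \<noteq> 0" by (elim bexE imageE) simp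
    then have "c \<noteq> 0" using z by auto
    then show "\<exists>c\<in>mker (\<beta> ** X 1). c \<noteq> 0" by (rule bexI) (rule c)
  next
    assume "\<exists>c\<in>mker (\<beta> ** X 1). c \<noteq> 0"
    then obtain c where c: "c \<in> mker (\<beta> ** X 1)" "c \<noteq> 0" by (elim bexE)
    then have "\<Phi> c \<noteq> 0" using \<Phi>0 by auto
    then show "\<exists>y\<in>\<Phi> ` mker (\<beta> ** X 1). y \<noteq> 0" by (intro bexI[of _ "\<Phi> c"] imageI c(1))
  qed
  also have "\<dots> \<longleftrightarrow> vec.dim (mker (\<beta> ** X 1)) \<noteq> 0" unfolding vec.dim_eq_0 by blast
  finally show "(\<exists>y\<in>eigenspace B \<alpha> \<beta> \<mu>. y \<noteq> 0) \<longleftrightarrow> vec.dim (mker (\<beta> ** X 1)) \<noteq> 0" .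
qed

section \<open>Monotonicity in the spectral parameter\<close>

text \<open>
  The form is continuous, and its derivative is \<open>- 4 (Q c, c)\<close> with \<open>Q\<close> the positive definite matrix
  of the hypothesis and \<open>c \<noteq> 0\<close>.
\<close>
lemma (in parameter_family) gform_decreasing:
  assumes pos: "\<And>\<mu>. \<mu> \<in> {a..b} \<Longrightarrow> posdef_mat (LINT x|leb01. adj (F \<mu> x) ** lam_deriv I B x \<mu> ** F \<mu> x)"
    and G: "lag_frame G" and st: "a \<le> s" "s < t" "t \<le> b" and v: "v \<noteq> 0"
    and z: "\<And>u. u \<in> {s..t} \<Longrightarrow> cis (pi + \<epsilon>) \<notin> mspectrum (Wtilde (F u 1) G)"
  shows "gform \<epsilon> (Wtilde (F t 1) G) v < gform \<epsilon> (Wtilde (F s 1) G) v"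
proof -
  define Z where "Z u = F u 1" for u
  define c where "c u = gvec \<epsilon> G (Z u) *v v" for u
  define \<phi> where "\<phi> u = gform \<epsilon> (Wtilde (Z u) G) v" for u
  have sub: "{s..t} \<subseteq> {a..b}" using st by auto
  have lag: "lag_frame (Z u)" if "u \<in> {s..t}" for u
    unfolding Z_def using sub that by (intro solution_lag_frame) auto
  have Zc: "continuous_on {s..t} Z"
    unfolding Z_def
    by (rule continuous_on_compose2[OF solution_continuous, of "{s..t}" "\<lambda>u. (1, u)", simplified])
      (use sub in \<open>auto intro!: continuous_intros\<close>)
  have cc: "continuous_on {s..t} c"
    unfolding c_def using z by (intro continuous_intros continuous_on_gvec Zc lag G) (auto simp: Z_def)
  have diff: "\<phi> u - \<phi> w = 4 * ((Jmat *v (Z w *v c w)) \<bullet> (Z u *v c u))" if "u \<in> {s..t}" "w \<in> {s..t}" for u w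
    unfolding \<phi>_def c_def using z that by (intro gform_frames lag G) (auto simp: Z_def)
  have \<phi>c: "continuous_on {s..t} \<phi>"
  proof -
    have "continuous_on {s..t} (\<lambda>u. \<phi> s + 4 * ((Jmat *v (Z s *v c s)) \<bullet> (Z u *v c u)))"
      by (intro continuous_intros Zc cc)
    then show ?thesis
    proof (rule continuous_on_eq)
      fix u assume "u \<in> {s..t}"
      from diff[OF this, of s] show "\<phi> s + 4 * ((Jmat *v (Z s *v c s)) \<bullet> (Z u *v c u)) = \<phi> u" using st by simp
    qed
  qed
  have der: "\<exists>D. DERIV \<phi> w :> D \<and> D < 0" if w: "s < w" "w < t" for w
  proof -
    define Q where "Q = (LINT x|leb01. adj (F w x) ** lam_deriv I B x w ** F w x)"
    have wI: "w \<in> {s..t}" "w \<in> {a..b}" using w sub by auto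
    have "((\<lambda>u. (\<phi> u - \<phi> w) / (u - w)) \<longlongrightarrow> 4 * ((- Q *v c w) \<bullet> c w)) (at w within {s..t})"
      unfolding tendsto_at_iff_sequentially o_def
    proof (intro allI impI)
      fix y assume y: "\<forall>n. y n \<in> {s..t} - {w}" "y \<longlonglongrightarrow> w"
      have 1: "(\<lambda>n. (1 / (y n - w)) *\<^sub>R (adj (F (y n) 1) ** Jmat ** F w 1)) \<longlonglongrightarrow> - Q"
      proof -
        have yn: "y n \<in> {a..b}" "y n \<noteq> w" for n using y(1)[rule_format, of n] sub by auto
        show ?thesis unfolding Q_def by (rule symplectic_derivative[OF wI(2) y(2) yn])
      qed
      have "(\<lambda>n. c (y n)) \<longlonglongrightarrow> c w"
        by (rule continuous_on_tendsto_compose[OF cc y(2) wI(1)]) (use y in auto)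
      then have "(\<lambda>n. 4 * ((((1 / (y n - w)) *\<^sub>R (adj (F (y n) 1) ** Jmat ** F w 1)) *v c w) \<bullet> c (y n))) \<longlonglongrightarrow> 4 * ((- Q *v c w) \<bullet> c w)"
        by (intro tendsto_intros 1)
      moreover have "4 * ((((1 / (y n - w)) *\<^sub>R (adj (F (y n) 1) ** Jmat ** F w 1)) *v c w) \<bullet> c (y n)) = (\<phi> (y n) - \<phi> w) / (y n - w)" for n
      proof -
        have "(((adj (F (y n) 1) ** Jmat ** F w 1)) *v c w) \<bullet> c (y n) = (Jmat *v (Z w *v c w)) \<bullet> (Z (y n) *v c (y n))"
          using inner_adj[of "adj (Z (y n))" "Jmat *v (Z w *v c w)" "c (y n)"]
          by (simp add: Z_def matrix_vector_mul_assoc matrix_mul_assoc)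
        moreover have "\<phi> (y n) - \<phi> w = 4 * ((Jmat *v (Z w *v c w)) \<bullet> (Z (y n) *v c (y n)))"
          using y(1) wI by (intro diff) auto
        ultimately show ?thesis
          by (simp add: bounded_bilinear.scaleR_left[OF bounded_bilinear_mv])
      qed
      ultimately show "(\<lambda>n. (\<phi> (y n) - \<phi> w) / (y n - w)) \<longlonglongrightarrow> 4 * ((- Q *v c w) \<bullet> c w)" by simp
    qed
    moreover have "at w within {s..t} = at w" using w by (intro at_within_interior) auto
    ultimately have "DERIV \<phi> w :> 4 * ((- Q *v c w) \<bullet> c w)"
      by (simp add: has_field_derivative_iff)
    moreover have "c w \<noteq> 0"
      unfolding c_def using z[OF wI(1)] by (intro gvec_nonzero lag G wI v) (simp add: Z_def)
    then have "0 < (Q *v c w) \<bullet> c w"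
      using pos[OF wI(2)] unfolding posdef_mat_def Q_def by (simp add: Re_cinner)
    ultimately show ?thesis
      by (intro exI[of _ "4 * ((- Q *v c w) \<bullet> c w)"]) (simp add: matrix_vector_mult_minus_left)
  qed
  have "\<phi> t < \<phi> s"
    by (rule DERIV_neg_imp_decreasing_open[OF st(2) der \<phi>c])
  then show ?thesis by (simp add: \<phi>_def Z_def)
qed

section \<open>Monotonicity in the space variable\<close>

text \<open>
  For symplectic \<open>P\<close>, that is \<open>P J P\<^sup>* = J\<close>, this is \<open>P\<^sup>-\<^sup>1 X\<close>; the formula makes continuity in \<open>P\<close>
  evident.
\<close>
definition transport :: "complex ^ ('n::finite + 'n) ^ ('n + 'n) \<Rightarrow> complex ^ 'k ^ ('n + 'n) \<Rightarrow> complex ^ 'k ^ ('n + 'n)" where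
  "transport P X = - (Jmat ** adj P ** Jmat ** X)"

lemma transport_id: "transport (mat 1) X = X"
  by (simp add: transport_def Jmat_Jmat matrix_mul_assoc matrix_mult_minus_left)

text \<open>
  The hypothesis exhibits a left inverse of \<open>P\<close>, which is then a right inverse.
\<close>
lemma symplectic_adj:
  fixes P :: "complex ^ ('n::finite + 'n) ^ ('n + 'n)"
  assumes "adj P ** Jmat ** P = Jmat" shows "P ** Jmat ** adj P = Jmat"
proof -
  have "- (Jmat ** adj P ** Jmat) ** P = mat 1"
  proof -
    have "Jmat ** adj P ** Jmat ** P = Jmat ** (adj P ** Jmat ** P)" by (simp add: matrix_mul_assoc)
    then show ?thesis by (simp add: assms Jmat_Jmat matrix_mult_minus_left)
  qed
  then have "P ** (- (Jmat ** adj P ** Jmat)) = mat 1" by (rule iffD1[OF matrix_left_right_inverse])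
  then have "P ** Jmat ** adj P ** Jmat = - mat 1"
    by (simp add: matrix_mult_minus_right matrix_mul_assoc) (metis minus_minus)
  then have "P ** Jmat ** adj P ** (Jmat ** Jmat) = - Jmat"
    by (metis matrix_mul_assoc matrix_mul_lid matrix_mult_minus_left)
  then show ?thesis by (simp add: Jmat_Jmat matrix_mult_minus_right)
qed

lemma transport_symplectic:
  fixes X :: "complex ^ 'k ^ ('n::finite + 'n)" and Y :: "complex ^ 'l ^ ('n + 'n)"
  assumes "P ** Jmat ** adj P = Jmat"
  shows "adj (transport P X) ** Jmat ** transport P Y = adj X ** Jmat ** Y" and "P ** transport P X = X"
proof -
  have JJ: "M ** Jmat ** Jmat = - M" for M :: "complex ^ ('n + 'n) ^ 'a::finite"
    by (simp add: matrix_mul_assoc[symmetric] Jmat_Jmat matrix_mult_minus_right)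
  have PP: "M ** P ** Jmat ** adj P = M ** Jmat" for M :: "complex ^ ('n + 'n) ^ 'a::finite"
    by (simp add: matrix_mul_assoc[symmetric] assms) (simp add: matrix_mul_assoc assms)
  show "adj (transport P X) ** Jmat ** transport P Y = adj X ** Jmat ** Y"
    by (simp add: transport_def adj_minus adj_mult adj_Jmat matrix_mult_minus_left matrix_mult_minus_right
        matrix_mul_assoc JJ PP)
  have "P ** transport P X = - ((P ** Jmat ** adj P) ** Jmat ** X)"
    by (simp add: transport_def matrix_mult_minus_right matrix_mul_assoc)
  then show "P ** transport P X = X"
    by (simp add: assms Jmat_Jmat matrix_mult_minus_left)
qed

lemma transport_lag_frame:
  assumes P: "P ** Jmat ** adj P = Jmat" and X: "lag_frame X" shows "lag_frame (transport P X)"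
  unfolding lag_frame_def
proof (intro conjI allI impI)
  show "adj (transport P X) ** Jmat ** transport P X = 0"
    using X by (simp add: transport_symplectic(1)[OF P] lag_frame_def)
  fix v assume "transport P X *v v = 0"
  then have "P *v (transport P X *v v) = 0" by simp
  then have "X *v v = 0" by (simp add: matrix_vector_mul_assoc transport_symplectic(2)[OF P])
  then show "v = 0" using X by (simp add: lag_frame_def)
qed

lemma continuous_on_transport:
  assumes "continuous_on S P" "continuous_on S X"
  shows "continuous_on S (\<lambda>t. transport (P t) (X t))"
  unfolding transport_def by (intro continuous_intros assms)

lemma l1_matrix_restrict:
  assumes A: "l1_matrix A b" and pq: "0 \<le> p" "q \<le> 1"
  shows "l1_matrix (\<lambda>x. if x \<in> {p..q} then A x else 0) (\<lambda>x. if x \<in> {p..q} then b x else 0)"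
    and "integral {0..1} (\<lambda>x. if x \<in> {p..q} then b x else 0) = integral {p..q} b"
proof -
  have "{p..q} \<subseteq> {0..1}" using pq by auto
  then show "integral {0..1} (\<lambda>x. if x \<in> {p..q} then b x else 0) = integral {p..q} b"
    using integral_restrict_Int[of "{0..1}" "{p..q}" b] pq
    by (cases "p \<le> q") (auto simp: max_def min_def)
  show "l1_matrix (\<lambda>x. if x \<in> {p..q} then A x else 0) (\<lambda>x. if x \<in> {p..q} then b x else 0)"
    unfolding l1_matrix_def
  proof (intro conjI allI)
    show "(\<lambda>x. if x \<in> {p..q} then A x else 0) \<in> borel_measurable lebesgue"
      by (intro borel_measurable_if_I measurable_restrict_space1 l1_matrixD(1)[OF A]) auto
    show "norm (if x \<in> {p..q} then A x else 0) \<le> (if x \<in> {p..q} then b x else 0)" for x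
      using l1_matrixD(2)[OF A] by simp
    show "(\<lambda>x. if x \<in> {p..q} then b x else 0) integrable_on {0..1}"
      using l1_matrixD(5)[OF A pq] integrable_restrict_Int[of "{p..q}" b "{0..1}"] pq
      by (cases "p \<le> q") (auto simp: max_def min_def)
  qed
qed

lemma l1_matrix_diff:
  assumes "l1_matrix A a" "l1_matrix B b" shows "l1_matrix (\<lambda>x. B x - A x) (\<lambda>x. a x + b x)"
  unfolding l1_matrix_def
proof (intro conjI allI)
  show "(\<lambda>x. B x - A x) \<in> borel_measurable lebesgue"
    using l1_matrixD(1)[OF assms(1)] l1_matrixD(1)[OF assms(2)] by (intro borel_measurable_diff)
  show "norm (B x - A x) \<le> a x + b x" for x
    using l1_matrixD(2)[OF assms(1), of x] l1_matrixD(2)[OF assms(2), of x] norm_triangle_ineq4[of "B x" "A x"] by linarith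
  show "(\<lambda>x. a x + b x) integrable_on {0..1}"
    using l1_matrixD(4)[OF assms(1)] l1_matrixD(4)[OF assms(2)] by (rule integrable_add)
qed

lemma continuous_norm_bound:
  fixes f :: "'a::topological_space \<Rightarrow> 'b::real_normed_vector"
  assumes "continuous_on S f" "compact S" shows "\<exists>M. \<forall>x\<in>S. norm (f x) \<le> M"
  using compact_imp_bounded[OF compact_continuous_image[OF assms]] unfolding bounded_iff by blast

text \<open>
  The increment of the form over \<open>[s,t]\<close> is \<open>4 \<integral>(E \<Psi> Y s c s, X c t)\<close>, where \<open>\<Psi> Y = X\<close>.  Over a short
  interval around \<open>x\<close> this is close to \<open>4 \<integral>(E X c x, X c x) \<ge> 0\<close>, with an error that is small compared
  to the integral of \<open>h\<close>.
\<close>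
lemma gform_increasing:
  fixes E \<Psi> :: "real \<Rightarrow> complex ^ ('n::finite + 'n) ^ ('n + 'n)"
    and X Y :: "real \<Rightarrow> complex ^ 'n ^ ('n + 'n)"
  assumes E: "l1_matrix E h" and N: "negligible N" and En: "\<And>x v. x \<in> {0..1} - N \<Longrightarrow> 0 \<le> (E x *v v) \<bullet> v"
    and X: "continuous_on {0..1} X" and \<Psi>: "continuous_on {0..1} \<Psi>" and Y: "continuous_on {0..1} Y"
    and \<Psi>Y: "\<And>x. x \<in> {0..1} \<Longrightarrow> \<Psi> x ** Y x = X x"
    and lagY: "\<And>x. x \<in> {0..1} \<Longrightarrow> lag_frame (Y x)" and G: "lag_frame G"
    and pq: "0 \<le> p" "q \<le> 1"
    and inc: "\<And>s t. p \<le> s \<Longrightarrow> s \<le> t \<Longrightarrow> t \<le> q \<Longrightarrow> adj (Y t) ** Jmat ** Y s = integral {s..t} (\<lambda>r. adj (X r) ** E r ** \<Psi> r) ** Y s"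
    and st: "p \<le> s" "s \<le> t" "t \<le> q"
    and z: "\<And>u. u \<in> {s..t} \<Longrightarrow> cis (pi + \<epsilon>) \<notin> mspectrum (Wtilde (Y u) G)"
  shows "gform \<epsilon> (Wtilde (Y s) G) v \<le> gform \<epsilon> (Wtilde (Y t) G) v"
proof -
  define c where "c u = gvec \<epsilon> G (Y u) *v v" for u
  define \<phi> where "\<phi> u = gform \<epsilon> (Wtilde (Y u) G) v" for u
  have sub: "u \<in> {0..1}" if "u \<in> {s..t}" for u using that st pq by auto
  have Xa: "continuous_on {0..1} (\<lambda>x. adj (X x))" by (intro continuous_intros X)
  have cc: "continuous_on {s..t} c"
    unfolding c_def
    by (intro continuous_intros continuous_on_gvec continuous_on_subset[OF Y] lagY G z) (use sub in auto)
  obtain M where M': "\<And>x. x \<in> {0..1} \<Longrightarrow> norm (X x) \<le> M" using continuous_norm_bound[OF X compact_Icc] by blast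
  obtain C where C': "\<And>x. x \<in> {s..t} \<Longrightarrow> norm (c x) \<le> C" using continuous_norm_bound[OF cc compact_Icc] by blast
  define K where "K = max (max M C) 1"
  have K: "1 \<le> K" "\<And>x. x \<in> {0..1} \<Longrightarrow> norm (X x) \<le> K" "\<And>x. x \<in> {s..t} \<Longrightarrow> norm (c x) \<le> K"
    using M' C' by (auto simp: K_def intro: order_trans[OF M'] order_trans[OF C'])
  have "0 \<le> \<phi> t - \<phi> s"
  proof (rule increment_nonneg[of h s t "\<lambda>s t. \<phi> t - \<phi> s", OF _ _ _ st(2)])
    show "h integrable_on {s..t}" using l1_matrixD(5)[OF E] st pq by auto
    fix \<eta> :: real and x assume \<eta>: "\<eta> > 0" and x: "x \<in> {s..t}"
    \<comment> \<open>Three error terms, each at most \<open>K\<^sup>3 \<eta>1 \<integral>h\<close>, and the factor \<open>4\<close> of the increment.\<close>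
    define \<eta>1 where "\<eta>1 = \<eta> / (12 * (K * K * K))"
    have K3: "K * K * K > 0" using K(1) by simp
    have \<eta>1: "\<eta>1 > 0" using \<eta> K3 by (simp add: \<eta>1_def)
    have pc: "continuous_on ({0..1} \<times> {0..1}) (\<lambda>p. \<Psi> (fst p) ** Y (snd p) - X (fst p))"
      by (intro continuous_intros continuous_on_compose2[OF \<Psi>] continuous_on_compose2[OF Y] continuous_on_compose2[OF X]) auto
    have xx: "(x, x) \<in> {0..1} \<times> {0..1}" using sub[OF x] by auto
    obtain \<delta>1 where \<delta>1: "\<delta>1 > 0" "\<And>p. p \<in> {0..1} \<times> {0..1} \<Longrightarrow> dist p (x, x) < \<delta>1 \<Longrightarrow> norm (\<Psi> (fst p) ** Y (snd p) - X (fst p)) < \<eta>1"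
    proof -
      have "\<exists>\<delta>>0. \<forall>p\<in>{0..1} \<times> {0..1}. dist p (x, x) < \<delta> \<longrightarrow>
          dist (\<Psi> (fst p) ** Y (snd p) - X (fst p)) (\<Psi> (fst (x, x)) ** Y (snd (x, x)) - X (fst (x, x))) < \<eta>1"
        using pc xx \<eta>1 unfolding continuous_on_iff by blast
      then show ?thesis using that \<Psi>Y[OF sub[OF x]] by (auto simp: dist_norm)
    qed
    obtain \<delta>2 where \<delta>2: "\<delta>2 > 0" "\<And>y. y \<in> {s..t} \<Longrightarrow> dist y x < \<delta>2 \<Longrightarrow> norm (c y - c x) < \<eta>1"
      using cc x \<eta>1 unfolding continuous_on_iff dist_norm[symmetric] by metis
    show "\<exists>\<delta>>0. \<forall>s' t'. s \<le> s' \<longrightarrow> s' \<le> x \<longrightarrow> x \<le> t' \<longrightarrow> t' \<le> t \<longrightarrow> t' - s' < \<delta> \<longrightarrow> - \<eta> * integral {s'..t'} h \<le> \<phi> t' - \<phi> s'"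
    proof (intro exI[of _ "min (\<delta>1 / 2) \<delta>2"] conjI allI impI)
      show "min (\<delta>1 / 2) \<delta>2 > 0" using \<delta>1 \<delta>2 by simp
      fix \<sigma> \<tau> assume r: "s \<le> \<sigma>" "\<sigma> \<le> x" "x \<le> \<tau>" "\<tau> \<le> t" "\<tau> - \<sigma> < min (\<delta>1 / 2) \<delta>2"
      have r01: "0 \<le> \<sigma>" "\<sigma> \<le> \<tau>" "\<tau> \<le> 1" and mem: "\<sigma> \<in> {s..t}" "\<tau> \<in> {s..t}" using r st pq by auto
      have H0: "0 \<le> integral {\<sigma>..\<tau>} h" using l1_matrixD(6)[OF E r01(1,3)] .
      define I2 where "I2 = integral {\<sigma>..\<tau>} (\<lambda>r. adj (X r) ** E r ** X r)"
      define D where "D = integral {\<sigma>..\<tau>} (\<lambda>r. adj (X r) ** E r ** (\<Psi> r ** Y \<sigma> - X r))"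
      have \<Psi>c: "continuous_on {0..1} (\<lambda>r. \<Psi> r ** Y \<sigma> - X r)" by (intro continuous_intros \<Psi> X)
      have split: "adj (Y \<tau>) ** Jmat ** Y \<sigma> = D + I2"
      proof -
        have "adj (Y \<tau>) ** Jmat ** Y \<sigma> = integral {\<sigma>..\<tau>} (\<lambda>r. adj (X r) ** E r ** \<Psi> r) ** Y \<sigma>"
          using r st by (intro inc) auto
        also have "\<dots> = integral {\<sigma>..\<tau>} (\<lambda>r. adj (X r) ** E r ** \<Psi> r ** Y \<sigma>)"
          using integral_linear[OF l1_product_integrable[OF E Xa \<Psi> r01(1,3)] bounded_bilinear.bounded_linear_left[OF bounded_bilinear_mm, of "Y \<sigma>"]]
          by (simp add: o_def)
        also have "\<dots> = integral {\<sigma>..\<tau>} (\<lambda>r. adj (X r) ** E r ** (\<Psi> r ** Y \<sigma> - X r) + adj (X r) ** E r ** X r)"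
          by (simp add: matrix_diff_ldistrib matrix_mul_assoc)
        also have "\<dots> = D + I2"
          unfolding D_def I2_def by (intro integral_add l1_product_integrable[OF E Xa \<Psi>c r01(1,3)] l1_product_integrable[OF E Xa X r01(1,3)])
        finally show ?thesis .
      qed
      have nD: "norm D \<le> (K * \<eta>1) * integral {\<sigma>..\<tau>} h"
        unfolding D_def
      proof (intro l1_product_bound[OF E Xa \<Psi>c r01(1,3)] l1_factors(1)[OF E])
        fix y assume y: "y \<in> {\<sigma>..\<tau>}"
        have "(y, \<sigma>) \<in> {0..1} \<times> {0..1}" using y r01 by auto
        moreover have "dist (y, \<sigma>) (x, x) < \<delta>1"
        proof -
          have "dist (y, \<sigma>) (x, x) \<le> dist y x + dist \<sigma> x"
            using dist_triangle[of "(y, \<sigma>)" "(x, x)" "(x, \<sigma>)"] by (simp add: dist_Pair_Pair)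
          also have "\<dots> < \<delta>1" using y r by (auto simp: dist_real_def)
          finally show ?thesis .
        qed
        ultimately have "norm (\<Psi> y ** Y \<sigma> - X y) < \<eta>1" using \<delta>1(2)[of "(y, \<sigma>)"] by simp
        then show "norm (adj (X y)) * norm (\<Psi> y ** Y \<sigma> - X y) \<le> K * \<eta>1"
          unfolding norm_adj using K(1) K(2)[of y] y r01 by (intro mult_mono) auto
      qed
      have nI: "norm I2 \<le> (K * K) * integral {\<sigma>..\<tau>} h"
        unfolding I2_def
      proof (intro l1_product_bound[OF E Xa X r01(1,3)] l1_factors(1)[OF E])
        fix y assume y: "y \<in> {\<sigma>..\<tau>}"
        then show "norm (adj (X y)) * norm (X y) \<le> K * K"
          unfolding norm_adj using K(1) K(2)[of y] y r01 by (intro mult_mono) auto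
      qed
      have I2pos: "0 \<le> (I2 *v w) \<bullet> w" for w
      proof -
        have bl: "bounded_linear (\<lambda>Z :: complex ^ 'n ^ 'n. (Z *v w) \<bullet> w)"
          by (intro bounded_linear_compose[OF bounded_linear_inner_left] bounded_bilinear.bounded_linear_left[OF bounded_bilinear_mv])
        have int: "(\<lambda>r. adj (X r) ** E r ** X r) integrable_on {\<sigma>..\<tau>}" by (rule l1_product_integrable[OF E Xa X r01(1,3)])
        have "(I2 *v w) \<bullet> w = integral {\<sigma>..\<tau>} (\<lambda>r. ((adj (X r) ** E r ** X r) *v w) \<bullet> w)"
          unfolding I2_def using integral_linear[OF int bl] by (simp add: o_def)
        also have "\<dots> = integral {\<sigma>..\<tau>} (\<lambda>r. max 0 (((adj (X r) ** E r ** X r) *v w) \<bullet> w))"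
        proof (rule integral_spike[OF N])
          fix y assume "y \<in> {\<sigma>..\<tau>} - N"
          then have "0 \<le> (E y *v (X y *v w)) \<bullet> (X y *v w)" using r01 by (intro En) auto
          also have "\<dots> = ((adj (X y) ** E y ** X y) *v w) \<bullet> w"
            using inner_adj[of "adj (X y)" "E y *v (X y *v w)" w] by (simp add: matrix_vector_mul_assoc matrix_mul_assoc)
          finally show "max 0 (((adj (X y) ** E y ** X y) *v w) \<bullet> w) = ((adj (X y) ** E y ** X y) *v w) \<bullet> w" by simp
        qed
        also have "0 \<le> \<dots>"
          by (cases "(\<lambda>r. max 0 (((adj (X r) ** E r ** X r) *v w) \<bullet> w)) integrable_on {\<sigma>..\<tau>}")
            (auto intro: integral_nonneg simp: not_integrable_integral)
        finally show ?thesis .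
      qed
      have "\<phi> \<tau> - \<phi> \<sigma> = 4 * ((Jmat *v (Y \<sigma> *v c \<sigma>)) \<bullet> (Y \<tau> *v c \<tau>))"
        unfolding \<phi>_def c_def by (intro gform_frames lagY sub mem G z)
      also have "(Jmat *v (Y \<sigma> *v c \<sigma>)) \<bullet> (Y \<tau> *v c \<tau>) = ((D + I2) *v c \<sigma>) \<bullet> c \<tau>"
        unfolding split[symmetric] using inner_adj[of "adj (Y \<tau>)" "Jmat *v (Y \<sigma> *v c \<sigma>)" "c \<tau>"]
        by (simp add: matrix_vector_mul_assoc matrix_mul_assoc)
      also have "\<dots> = (I2 *v c x) \<bullet> c x + ((D *v c \<sigma>) \<bullet> c \<tau> + (I2 *v (c \<sigma> - c x)) \<bullet> c \<tau> + (I2 *v c x) \<bullet> (c \<tau> - c x))"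
        by (simp add: matrix_vector_mult_add_rdistrib matrix_vector_mult_diff_distrib inner_diff_left inner_diff_right inner_add_left)
      finally have eq: "\<phi> \<tau> - \<phi> \<sigma> = 4 * ((I2 *v c x) \<bullet> c x + ((D *v c \<sigma>) \<bullet> c \<tau> + (I2 *v (c \<sigma> - c x)) \<bullet> c \<tau> + (I2 *v c x) \<bullet> (c \<tau> - c x)))" .
      have bil: "\<bar>(Z *v w) \<bullet> w'\<bar> \<le> norm Z * norm w * norm w'" for Z :: "complex ^ 'n ^ 'n" and w w'
      proof -
        have "\<bar>(Z *v w) \<bullet> w'\<bar> \<le> norm (Z *v w) * norm w'" by (rule Cauchy_Schwarz_ineq2)
        also have "\<dots> \<le> norm Z * norm w * norm w'" by (intro mult_right_mono norm_mv_le) simp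
        finally show ?thesis .
      qed
      have cK: "norm (c \<sigma>) \<le> K" "norm (c \<tau>) \<le> K" "norm (c x) \<le> K" using K(3) mem x by auto
      have cd: "norm (c \<sigma> - c x) \<le> \<eta>1" "norm (c \<tau> - c x) \<le> \<eta>1"
        using \<delta>2(2)[OF mem(1)] \<delta>2(2)[OF mem(2)] r by (auto simp: dist_real_def)
      have "\<bar>(D *v c \<sigma>) \<bullet> c \<tau>\<bar> \<le> (K * \<eta>1 * integral {\<sigma>..\<tau>} h) * K * K"
        using nD cK H0 K(1) \<eta>1 by (intro order_trans[OF bil] mult_mono) auto
      moreover have "\<bar>(I2 *v (c \<sigma> - c x)) \<bullet> c \<tau>\<bar> \<le> (K * K * integral {\<sigma>..\<tau>} h) * \<eta>1 * K"
        using nI cK cd H0 K(1) \<eta>1 by (intro order_trans[OF bil] mult_mono) auto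
      moreover have "\<bar>(I2 *v c x) \<bullet> (c \<tau> - c x)\<bar> \<le> (K * K * integral {\<sigma>..\<tau>} h) * K * \<eta>1"
        using nI cK cd H0 K(1) \<eta>1 by (intro order_trans[OF bil] mult_mono) auto
      ultimately have L: "- (3 * ((K * K * K * \<eta>1) * integral {\<sigma>..\<tau>} h)) \<le> (D *v c \<sigma>) \<bullet> c \<tau> + (I2 *v (c \<sigma> - c x)) \<bullet> c \<tau> + (I2 *v c x) \<bullet> (c \<tau> - c x)"
        by (simp add: mult_ac abs_le_iff)
      have E3: "K * K * K * \<eta>1 = \<eta> / 12" using K(1) by (simp add: \<eta>1_def)
      have "- \<eta> * integral {\<sigma>..\<tau>} h = 4 * (- (3 * ((\<eta> / 12) * integral {\<sigma>..\<tau>} h)))" by simp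
      then show "- \<eta> * integral {\<sigma>..\<tau>} h \<le> \<phi> \<tau> - \<phi> \<sigma>"
        using mult_left_mono[OF order_trans[OF L[unfolded E3] add_increasing[OF I2pos[of "c x"] order_refl]], of 4]
        unfolding eq by (simp only:)
    qed
  qed simp
  then show ?thesis by (simp add: \<phi>_def)
qed

text \<open>
  Near \<open>x0\<close> the fundamental solution \<open>\<Psi>\<close> of the second system, normalised at \<open>x0\<close>, transports the plane
  \<open>X2\<close> to a constant one.  Transporting by \<open>\<Psi> s\<close> for independent \<open>s\<close> and \<open>x\<close> gives a map on a square: in
  the direction of \<open>s\<close> the crossing number, hence the flow, is constant; the side \<open>s = x0\<close> is the given
  path, and along the diagonal only the first plane moves.
\<close>
lemma space_monotone:
  fixes A1 A2 :: "real \<Rightarrow> complex ^ ('n::finite + 'n) ^ ('n + 'n)" and X1 X2 :: "real \<Rightarrow> complex ^ 'n ^ ('n + 'n)"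
  assumes A1: "l1_matrix A1 b1" and A2: "l1_matrix A2 b2" and sa: "\<And>x. adj (A1 x) = A1 x" "\<And>x. adj (A2 x) = A2 x"
    and X1: "integral_solution A1 X1" and X2: "integral_solution A2 X2"
    and lag: "\<And>x. x \<in> {0..1} \<Longrightarrow> lag_frame (X1 x)" "\<And>x. x \<in> {0..1} \<Longrightarrow> lag_frame (X2 x)"
    and N: "negligible N" and En: "\<And>x v. x \<in> {0..1} - N \<Longrightarrow> 0 \<le> ((A2 x - A1 x) *v v) \<bullet> v"
    and m: "flow_function {0..1} (\<lambda>x. Wtilde (X1 x) (X2 x)) m"
    and st: "0 \<le> s" "s \<le> t" "t \<le> 1"
  shows "m s \<le> m t \<and> m s - int (crossing (Wtilde (X1 s) (X2 s))) \<le> m t - int (crossing (Wtilde (X1 t) (X2 t)))"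
proof -
  let ?j = "norm (Jmat :: complex ^ ('n + 'n) ^ ('n + 'n))"
  define W where "W x = Wtilde (X1 x) (X2 x)" for x
  note c1 = integral_solutionD(1)[OF X1] and c2 = integral_solutionD(1)[OF X2]
  define P where "P s t \<longleftrightarrow> (0 \<le> s \<longrightarrow> s \<le> t \<longrightarrow> t \<le> 1 \<longrightarrow> m s \<le> m t \<and> m s - int (crossing (W s)) \<le> m t - int (crossing (W t)))" for s t
  have "P s t" using st(2)
  proof (induction rule: Bolzano)
    case (trans x y z) then show ?case unfolding P_def by force
  next
    case (local x0)
    have x0: "x0 \<in> {0..1}" using local st by auto
    have "(\<lambda>x. ?j * b2 x) integrable_on {0..1}" using l1_matrixD(4)[OF A2] by (rule integrable_on_mult_right)
    from short_intervals[OF this _ x0, of "1/2"]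
    obtain \<delta> where \<delta>: "\<delta> > 0" "\<And>s t. 0 \<le> s \<Longrightarrow> s \<le> x0 \<Longrightarrow> x0 \<le> t \<Longrightarrow> t \<le> 1 \<Longrightarrow> t - s < \<delta> \<Longrightarrow> integral {s..t} (\<lambda>x. ?j * b2 x) < 1 / 2"
      by auto
    \<comment> \<open>The interval is so short that the fundamental solution of the second system exists on it.\<close>
    define p where "p = max 0 (x0 - \<delta> / 3)"
    define q where "q = min 1 (x0 + \<delta> / 3)"
    have pq: "0 \<le> p" "p \<le> x0" "x0 \<le> q" "q \<le> 1" "q - p < \<delta>" using x0 \<delta>(1) by (auto simp: p_def q_def)
    have pq01: "x \<in> {0..1}" if "x \<in> {p..q}" for x using that pq by auto
    \<comment> \<open>Cutting the coefficient off outside of this interval makes its integral over \<open>[0,1]\<close> small.\<close>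
    define A where "A x = (if x \<in> {p..q} then A2 x else 0)" for x
    have Al: "l1_matrix A (\<lambda>x. if x \<in> {p..q} then b2 x else 0)"
      unfolding A_def by (rule l1_matrix_restrict(1)[OF A2 pq(1,4)])
    have Asa: "adj (A x) = A x" for x by (simp add: A_def sa)
    have "?j * integral {0..1} (\<lambda>x. if x \<in> {p..q} then b2 x else 0) \<le> 1 / 2"
      unfolding l1_matrix_restrict(2)[OF A2 pq(1,4)] using \<delta>(2)[OF pq] by simp
    from integral_solution_exists[OF Al x0 this, of "mat 1"]
    obtain \<Psi> :: "real \<Rightarrow> complex ^ ('n + 'n) ^ ('n + 'n)" where \<Psi>: "integral_solution A \<Psi>" "\<Psi> x0 = mat 1" by blast
    note c\<Psi> = integral_solutionD(1)[OF \<Psi>(1)]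
    have const: "adj (\<Psi> x) ** Jmat ** \<Psi> x = adj (\<Psi> 0) ** Jmat ** \<Psi> 0" if "x \<in> {0..1}" for x
      using lagrange_identity[OF Al Al Asa \<Psi>(1) \<Psi>(1), of 0 x] that by simp
    have "adj (\<Psi> x) ** Jmat ** \<Psi> x = Jmat" if "x \<in> {0..1}" for x
      using const[OF that] const[OF x0] \<Psi>(2) by simp
    then have S: "\<Psi> x ** Jmat ** adj (\<Psi> x) = Jmat" if "x \<in> {0..1}" for x
      using that by (intro symplectic_adj) auto
    \<comment> \<open>The first coordinate is the position of the planes, the second one that of the transporting matrix.\<close>
    define Z1 where "Z1 z = transport (\<Psi> (snd z)) (X1 (fst z))" for z
    define Z2 where "Z2 z = transport (\<Psi> (snd z)) (X2 (fst z))" for z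
    let ?D = "{p..q} \<times> {p..q}"
    have Zlag: "lag_frame (Z1 z)" "lag_frame (Z2 z)" if "z \<in> ?D" for z
      unfolding Z1_def Z2_def using that pq01 by (auto intro!: transport_lag_frame S lag)
    have Zc: "continuous_on ?D Z1" "continuous_on ?D Z2"
      unfolding Z1_def Z2_def
      by (intro continuous_on_transport continuous_on_compose2[OF c\<Psi>] continuous_on_compose2[OF c1] continuous_on_compose2[OF c2] continuous_intros; use pq01 in auto)+
    define V where "V z = Wtilde (Z1 z) (Z2 z)" for z
    have Vc: "continuous_on ?D V" unfolding V_def by (intro continuous_on_Wtilde Zc Zlag)
    have Vu: "unitary (V z)" if "z \<in> ?D" for z unfolding V_def using that by (intro unitary_Wtilde Zlag)
    have Vcross: "crossing (V z) = crossing (W (fst z))" if "z \<in> ?D" for z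
    proof -
      have "fst z \<in> {0..1}" "snd z \<in> {0..1}" using that pq01 by auto
      note * = this
      have "crossing (V z) = vec.dim (mker (adj (Z1 z) ** Jmat ** Z2 z))"
        unfolding V_def by (rule crossing_Wtilde(1)[OF Zlag[OF that]])
      also have "\<dots> = vec.dim (mker (adj (X1 (fst z)) ** Jmat ** X2 (fst z)))"
        unfolding Z1_def Z2_def by (simp add: transport_symplectic(1)[OF S[OF *(2)]])
      also have "\<dots> = crossing (W (fst z))"
        unfolding W_def using * by (intro crossing_Wtilde(1)[symmetric] lag)
      finally show ?thesis .
    qed
    obtain n where n: "flow_function ?D V n"
      using flow_function_exists[OF _ Vc Vu] by (auto simp: convex_Times)
    have conv: "convex ((\<lambda>x. (x, x)) ` T)" "convex ((\<lambda>x. (x, c)) ` T)" "convex ((\<lambda>x. (c, x)) ` T)" if "convex T" for T :: "real set" and c :: real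
    proof -
      have "linear (\<lambda>x::real. (x, x))" by (rule linearI) auto
      then show "convex ((\<lambda>x. (x, x)) ` T)" using that by (rule convex_linear_image)
      have "(\<lambda>x. (x, c)) ` T = T \<times> {c}" "(\<lambda>x. (c, x)) ` T = {c} \<times> T" by auto
      then show "convex ((\<lambda>x. (x, c)) ` T)" "convex ((\<lambda>x. (c, x)) ` T)" using that by (simp_all add: convex_Times)
    qed
    have cI: "convex {p..q}" by simp
    have vertical: "n (x, s) = n (x, s')" if x: "x \<in> {p..q}" and s: "s \<in> {p..q}" "s' \<in> {p..q}" for x s s'
    proof (rule flow_constant[where m = "\<lambda>s. n (x, s)" and D = "{p..q}"])
      show "flow_function {p..q} (\<lambda>s. V (x, s)) (\<lambda>s. n (x, s))"
        by (rule flow_function_compose[OF n conv(3)]) (use x in auto)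
      show "continuous_on {p..q} (\<lambda>s. V (x, s))"
        by (rule continuous_on_compose2[OF Vc]) (use x in \<open>auto intro!: continuous_intros\<close>)
      show "unitary (V (x, s))" if "s \<in> {p..q}" for s using x that by (intro Vu) auto
      show "crossing (V (x, s)) = crossing (W x)" if "s \<in> {p..q}" for s using Vcross[of "(x, s)"] x that by simp
    qed (use s cI in auto)
    have Wc: "continuous_on {p..q} W"
      unfolding W_def using pq01 lag by (intro continuous_on_Wtilde continuous_on_subset[OF c1] continuous_on_subset[OF c2]) auto
    have horizontal: "m s - n (s, x0) = m t - n (t, x0)" if "s \<in> {p..q}" "t \<in> {p..q}" for s t
    proof (rule flow_function_unique[where m = m and m' = "\<lambda>x. n (x, x0)" and W = W and D = "{p..q}"])
      show "flow_function {p..q} W m"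
        using flow_function_compose[OF m, of "{p..q}" "\<lambda>x. x"] pq01 by (auto simp: W_def[abs_def])
      have "V (x, x0) = W x" for x by (simp add: V_def W_def Z1_def Z2_def \<Psi>(2) transport_id)
      then have VW: "(\<lambda>x. V (x, x0)) = W" by auto
      have "(\<lambda>x. (x, x0)) ` {p..q} \<subseteq> ?D" using pq by auto
      from flow_function_compose[OF n conv(2) this]
      show "flow_function {p..q} W (\<lambda>x. n (x, x0))" unfolding VW .
      show "unitary (W x)" if "x \<in> {p..q}" for x unfolding W_def using pq01[OF that] by (intro unitary_Wtilde lag)
    qed (use that Wc cI in auto)
    define E where "E x = A2 x - A1 x" for x
    have El: "l1_matrix E (\<lambda>x. b1 x + b2 x)" unfolding E_def by (rule l1_matrix_diff[OF A1 A2])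
    have EN: "0 \<le> (E x *v v) \<bullet> v" if "x \<in> {0..1} - N" for x v unfolding E_def by (rule En[OF that])
    define Y where "Y x = transport (\<Psi> x) (X1 x)" for x
    have Yc: "continuous_on {0..1} Y" unfolding Y_def by (intro continuous_on_transport c\<Psi> c1)
    have Ylag: "lag_frame (Y x)" if "x \<in> {0..1}" for x unfolding Y_def using that by (intro transport_lag_frame S lag)
    have ca: "continuous_on {0..1} (\<lambda>x. adj (\<Psi> x))" "continuous_on {0..1} (\<lambda>x. adj (X1 x))" by (intro continuous_intros c\<Psi> c1)+
    have Yinc: "adj (Y t) ** Jmat ** Y s = integral {s..t} (\<lambda>r. adj (X1 r) ** E r ** \<Psi> r) ** Y s"
      if r: "p \<le> s" "s \<le> t" "t \<le> q" for s t
    proof -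
      have st: "0 \<le> s" "s \<le> t" "t \<le> 1" using r pq by auto
      define K where "K = integral {s..t} (\<lambda>r. adj (\<Psi> r) ** E r ** X1 r)"
      have "adj (\<Psi> t) ** Jmat ** X1 t - adj (\<Psi> s) ** Jmat ** X1 s
          = integral {s..t} (\<lambda>x. adj (\<Psi> x) ** A1 x ** X1 x) - integral {s..t} (\<lambda>x. adj (\<Psi> x) ** A x ** X1 x)"
        by (rule lagrange_identity[OF Al A1 Asa \<Psi>(1) X1 st])
      also have "\<dots> = integral {s..t} (\<lambda>x. adj (\<Psi> x) ** A1 x ** X1 x - adj (\<Psi> x) ** A x ** X1 x)"
        by (intro integral_diff[symmetric] l1_product_integrable[OF A1 ca(1) c1 st(1,3)] l1_product_integrable[OF Al ca(1) c1 st(1,3)])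
      also have "\<dots> = integral {s..t} (\<lambda>x. - (adj (\<Psi> x) ** E x ** X1 x))"
        by (rule Henstock_Kurzweil_Integration.integral_cong) (use r in \<open>auto simp: A_def E_def matrix_diff_ldistrib matrix_diff_rdistrib\<close>)
      also have "\<dots> = - K" by (simp add: K_def)
      finally have "Jmat ** (adj (\<Psi> t) ** Jmat ** X1 t - adj (\<Psi> s) ** Jmat ** X1 s) = - (Jmat ** K)"
        by (simp add: matrix_mult_minus_right)
      then have Yd: "Y t - Y s = Jmat ** K"
        by (simp add: Y_def transport_def matrix_diff_ldistrib matrix_mul_assoc algebra_simps)
      have "adj (Y s) ** Jmat ** Y s = 0" using Ylag[of s] st by (simp add: lag_frame_def)
      then have "adj (Y t) ** Jmat ** Y s = adj (Y t - Y s) ** Jmat ** Y s"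
        by (simp add: adj_diff matrix_diff_rdistrib)
      also have "\<dots> = adj K ** Y s"
        unfolding Yd by (simp add: adj_mult adj_Jmat matrix_mult_minus_left matrix_mult_minus_right matrix_mul_assoc[symmetric])
          (simp add: matrix_mul_assoc Jmat_Jmat matrix_mult_minus_left matrix_mult_minus_right)
      also have "adj K = integral {s..t} (\<lambda>r. adj (adj (\<Psi> r) ** E r ** X1 r))"
        unfolding K_def
        using integral_linear[OF l1_product_integrable[OF El ca(1) c1 st(1,3)] bounded_linear_adj] by (simp add: o_def)
      also have "\<dots> = integral {s..t} (\<lambda>r. adj (X1 r) ** E r ** \<Psi> r)"
        by (simp add: adj_mult E_def adj_diff sa matrix_mul_assoc)
      finally show ?thesis .
    qed
    define G where "G = Z2 (x0, x0)"
    have Gconst: "Z2 (x, x) = G" if x: "x \<in> {p..q}" for x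
    proof -
      have eq: "adj (\<Psi> t) ** Jmat ** X2 t = adj (\<Psi> s) ** Jmat ** X2 s" if r: "p \<le> s" "s \<le> t" "t \<le> q" for s t
      proof -
        have st: "0 \<le> s" "s \<le> t" "t \<le> 1" using r pq by auto
        have "integral {s..t} (\<lambda>x. adj (\<Psi> x) ** A2 x ** X2 x) = integral {s..t} (\<lambda>x. adj (\<Psi> x) ** A x ** X2 x)"
          by (rule Henstock_Kurzweil_Integration.integral_cong) (use r in \<open>auto simp: A_def\<close>)
        then show ?thesis using lagrange_identity[OF Al A2 Asa \<Psi>(1) X2 st] by simp
      qed
      have "adj (\<Psi> x) ** Jmat ** X2 x = adj (\<Psi> x0) ** Jmat ** X2 x0"
        using eq[of x x0] eq[of x0 x] x pq by (cases "x \<le> x0") auto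
      then show ?thesis by (simp add: G_def Z2_def transport_def matrix_mul_assoc[symmetric])
    qed
    have Glag: "lag_frame G" unfolding G_def using pq by (intro Zlag) auto
    have diag: "V (x, x) = Wtilde (Y x) G" if "x \<in> {p..q}" for x
      by (simp add: V_def Gconst[OF that]) (simp add: Z1_def Y_def)
    have "n (s, s) \<le> n (t, t) \<and> n (s, s) - int (crossing (V (s, s))) \<le> n (t, t) - int (crossing (V (t, t)))"
      if r: "p \<le> s" "s \<le> t" "t \<le> q" for s t
    proof (rule flow_monotone[where m = "\<lambda>x. n (x, x)" and W = "\<lambda>x. V (x, x)", OF _ _ _ _ r])
      show "flow_function {p..q} (\<lambda>x. V (x, x)) (\<lambda>x. n (x, x))"
        by (rule flow_function_compose[OF n conv(1)]) auto
      show "continuous_on {p..q} (\<lambda>x. V (x, x))"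
        by (rule continuous_on_compose2[OF Vc]) (auto intro!: continuous_intros)
      show "unitary (V (x, x))" if "x \<in> {p..q}" for x using that by (intro Vu) auto
      fix \<epsilon> s t v
      assume st: "p \<le> s" "s \<le> t" "t \<le> q" and z: "\<And>u. u \<in> {s..t} \<Longrightarrow> cis (pi + \<epsilon>) \<notin> mspectrum (V (u, u))"
      have "cis (pi + \<epsilon>) \<notin> mspectrum (Wtilde (Y u) G)" if "u \<in> {s..t}" for u
        using z[OF that] diag[of u] that st by auto
      from gform_increasing[OF El N EN c1 c\<Psi> Yc _ Ylag Glag pq(1,4) Yinc st this]
      have "gform \<epsilon> (Wtilde (Y s) G) v \<le> gform \<epsilon> (Wtilde (Y t) G) v"
        by (simp add: Y_def transport_symplectic(2)[OF S])
      then show "gform \<epsilon> (V (s, s)) v \<le> gform \<epsilon> (V (t, t)) v" using diag[of s] diag[of t] st by simp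
    qed
    then have "P s t" if r: "s \<le> x0 \<and> x0 \<le> t \<and> t - s < \<delta> / 3" for s t
      unfolding P_def
    proof (intro impI)
      assume st: "0 \<le> s" "s \<le> t" "t \<le> 1"
      have mem: "p \<le> s" "t \<le> q" using r st by (auto simp: p_def q_def)
      have mem': "s \<in> {p..q}" "t \<in> {p..q}" "x0 \<in> {p..q}" using mem st r pq by auto
      have "n (s, s) \<le> n (t, t) \<and> n (s, s) - int (crossing (V (s, s))) \<le> n (t, t) - int (crossing (V (t, t)))"
        using \<open>\<And>t s. p \<le> s \<Longrightarrow> s \<le> t \<Longrightarrow> t \<le> q \<Longrightarrow> n (s, s) \<le> n (t, t) \<and> n (s, s) - int (crossing (V (s, s))) \<le> n (t, t) - int (crossing (V (t, t)))\<close> mem st by blast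
      moreover have "n (s, s) = n (s, x0)" "n (t, t) = n (t, x0)" using vertical mem' by blast+
      moreover have "m s - n (s, x0) = m t - n (t, x0)" using horizontal mem' by blast
      moreover have "crossing (V (s, s)) = crossing (W s)" "crossing (V (t, t)) = crossing (W t)"
        using Vcross[of "(s, s)"] Vcross[of "(t, t)"] mem' by auto
      ultimately show "m s \<le> m t \<and> m s - int (crossing (W s)) \<le> m t - int (crossing (W t))" by linarith
    qed
    then show ?case using \<delta>(1) by (intro exI[of _ "\<delta> / 3"]) simp
  qed
  then show ?thesis using st by (simp add: P_def W_def)
qed

section \<open>The spectral count and the Maslov index\<close>

theorem theorem1p1:
  fixes I :: "real set"
    and B :: "real \<Rightarrow> real \<Rightarrow> complex ^ ('n::finite + 'n) ^ ('n + 'n)"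
    and \<alpha> \<beta> :: "complex ^ ('n + 'n) ^ 'n"
    and \<mu>1 \<mu>2 :: real
    and X1 :: "real \<Rightarrow> real \<Rightarrow> complex ^ 'n ^ ('n + 'n)"
    and X2 :: "real \<Rightarrow> complex ^ 'n ^ ('n + 'n)"
  assumes "is_interval I"
    and "assumptions_A I B"
    and "rank \<alpha> = CARD('n)" and "rank \<beta> = CARD('n)"
    and "\<alpha> ** Jmat ** adj \<alpha> = 0" and "\<beta> ** Jmat ** adj \<beta> = 0"
    and "\<mu>1 \<in> I" and "\<mu>2 \<in> I" and "\<mu>1 < \<mu>2"
    and "\<And>\<mu>. \<mu> \<in> I \<Longrightarrow> solves_matrix_system (\<lambda>x. B x \<mu>) (\<lambda>x. X1 x \<mu>) \<and> X1 0 \<mu> = Jmat ** adj \<alpha>"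
    and "solves_matrix_system (\<lambda>x. B x \<mu>2) X2 \<and> X2 1 = Jmat ** adj \<beta>"
    and "\<And>\<mu>. \<mu> \<in> I \<Longrightarrow>
      posdef_mat (LINT x|leb01. adj (X1 x \<mu>) ** lam_deriv I B x \<mu> ** X1 x \<mu>)"
  shows "finite (eigenvalues_in {\<mu>1..<\<mu>2} B \<alpha> \<beta>) \<and>
      int (spectral_count \<mu>1 \<mu>2 B \<alpha> \<beta>) =
        Mas (\<lambda>x. colspace (X1 x \<mu>1)) (\<lambda>x. colspace (X2 x)) 0 1 \<and>
      ((AE x in leb01. nonneg_mat (B x \<mu>2 - B x \<mu>1)) \<and>
       \<not> (\<exists>a b. 0 \<le> a \<and> a < b \<and> b \<le> 1 \<and>
            (\<forall>x\<in>{a..b}. vec.dim (colspace (X1 x \<mu>1) \<inter> colspace (X2 x)) \<noteq> 0)) \<longrightarrow>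
       finite {x \<in> {0<..1}. vec.dim (mker (adj (X1 x \<mu>1) ** Jmat ** X2 x)) \<noteq> 0} \<and>
       spectral_count \<mu>1 \<mu>2 B \<alpha> \<beta> =
         (\<Sum>x\<in>{x \<in> {0<..1}. vec.dim (mker (adj (X1 x \<mu>1) ** Jmat ** X2 x)) \<noteq> 0}.
            vec.dim (mker (adj (X1 x \<mu>1) ** Jmat ** X2 x))))"
proof -
  have \<mu>s: "\<mu> \<in> I" if "\<mu> \<in> {\<mu>1..\<mu>2}" for \<mu>
    using mem_is_interval_1_I[OF assms(1,7,8), of \<mu>] that by auto
  have \<mu>12: "\<mu>1 \<in> {\<mu>1..\<mu>2}" "\<mu>2 \<in> {\<mu>1..\<mu>2}" using assms(9) by auto
  obtain A bnd where "\<forall>\<mu>\<in>I. l1_matrix (A \<mu>) bnd \<and> (\<forall>x. adj (A \<mu> x) = A \<mu> x) \<and>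
      (\<exists>N. negligible N \<and> (\<forall>x\<in>{0<..<1} - N. A \<mu> x = B x \<mu>))"
    using coefficient_version[OF assms(2)] by blast
  then have coef: "l1_matrix (A \<mu>) bnd" "adj (A \<mu> x) = A \<mu> x"
      "\<exists>N. negligible N \<and> (\<forall>x\<in>{0<..<1} - N. A \<mu> x = B x \<mu>)" if "\<mu> \<in> I" for \<mu> x
    using that by auto
  obtain b1 where b1: "integrable leb01 b1" "\<And>\<mu>. \<mu> \<in> I \<Longrightarrow> AE x in leb01. onorm ((*v) (lam_deriv I B x \<mu>)) \<le> b1 x"
    using assms(2) unfolding assumptions_A_def by auto
  have solution: "integral_solution (A \<mu>) Y" if Y: "\<mu> \<in> I" "solves_matrix_system (\<lambda>x. B x \<mu>) Y" for \<mu> Y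
  proof -
    obtain N where N: "negligible N" "\<And>x. x \<in> {0<..<1} - N \<Longrightarrow> A \<mu> x = B x \<mu>" using coef(3)[OF Y(1)] by blast
    show ?thesis by (rule solves_matrix_system_integral[OF Y(2) N])
  qed
  \<comment> \<open>The factor by which the norm of a matrix may exceed the operator norm.\<close>
  define \<kappa> where "\<kappa> = real (CARD('n + 'n) * CARD('n + 'n))"
  interpret parameter_family I B \<mu>1 \<mu>2 A bnd "\<lambda>x. \<kappa> * \<bar>b1 x\<bar>" "\<lambda>\<mu> x. X1 x \<mu>" "Jmat ** adj \<alpha>"
  proof (unfold_locales, goal_cases)
    case 10 show ?case unfolding \<kappa>_def by (rule parameter_lipschitz[OF assms(2) _ assms(9) b1]) (use \<mu>s in auto)
  next
    case 13 show ?case by (rule boundary_frame(1)[OF assms(3,5)])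
  qed (use \<mu>s coef b1 assms in \<open>auto simp: assumptions_A_def \<kappa>_def intro!: solution\<close>)
  have S2: "integral_solution (A \<mu>2) X2" using assms(8,11) by (intro solution) auto
  have G: "lag_frame (X2 x)" if "x \<in> {0..1}" for x
    using lag_frame_propagates[OF coef(1)[OF assms(8)] coef(2)[OF assms(8)] S2, of 1 x] boundary_frame(1)[OF assms(4,6)] assms(11) that
    by simp
  let ?D = "{0..1::real} \<times> {\<mu>1..\<mu>2}"
  define W where "W p = Wtilde (X1 (fst p) (snd p)) (X2 (fst p))" for p
  have lag1: "lag_frame (X1 x \<mu>)" if "x \<in> {0..1}" "\<mu> \<in> {\<mu>1..\<mu>2}" for x \<mu>
    using solution_lag_frame that by blast
  have Wc: "continuous_on ?D W"
    unfolding W_def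
    by (intro continuous_on_Wtilde solution_continuous continuous_on_compose2[OF integral_solutionD(1)[OF S2]] continuous_intros lag1 G) auto
  have Wu: "unitary (W p)" if "p \<in> ?D" for p
    unfolding W_def using that by (intro unitary_Wtilde lag1 G) auto
  have Dc: "convex ?D" by (intro convex_Times convex_real_interval)
  obtain m where m: "flow_function ?D W m" using flow_function_exists[OF Dc Wc Wu] by blast
  have horizontal: "flow_function {0..1} (\<lambda>x. W (x, \<mu>)) (\<lambda>x. m (x, \<mu>))"
      "continuous_on {0..1} (\<lambda>x. W (x, \<mu>))" if "\<mu> \<in> {\<mu>1..\<mu>2}" for \<mu>
  proof -
    have "convex ((\<lambda>x. (x, \<mu>)) ` T)" if "convex T" for T :: "real set"
    proof -
      have "(\<lambda>x. (x, \<mu>)) ` T = T \<times> {\<mu>}" by auto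
      then show ?thesis using that by (simp add: convex_Times)
    qed
    then show "flow_function {0..1} (\<lambda>x. W (x, \<mu>)) (\<lambda>x. m (x, \<mu>))"
      by (rule flow_function_compose[OF m]) (use that in auto)
    show "continuous_on {0..1} (\<lambda>x. W (x, \<mu>))"
      by (rule continuous_on_compose2[OF Wc]) (use that in \<open>auto intro!: continuous_intros\<close>)
  qed
  \<comment> \<open>The parameter is reversed, because the flow on this side increases as \<open>\<mu>\<close> decreases.\<close>
  have vertical: "flow_function {- \<mu>2..- \<mu>1} (\<lambda>r. W (x, - r)) (\<lambda>r. m (x, - r))"
      "continuous_on {- \<mu>2..- \<mu>1} (\<lambda>r. W (x, - r))" if "x \<in> {0..1}" for x
  proof -
    have "convex ((\<lambda>r. (x, - r)) ` T)" if "convex T" for T :: "real set"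
    proof -
      have "(\<lambda>r. (x, - r)) ` T = {x} \<times> uminus ` T" by auto
      then show ?thesis using that by (simp add: convex_Times convex_negations)
    qed
    then show "flow_function {- \<mu>2..- \<mu>1} (\<lambda>r. W (x, - r)) (\<lambda>r. m (x, - r))"
      by (rule flow_function_compose[OF m]) (use that in auto)
    show "continuous_on {- \<mu>2..- \<mu>1} (\<lambda>r. W (x, - r))"
      by (rule continuous_on_compose2[OF Wc]) (use that in \<open>auto intro!: continuous_intros\<close>)
  qed

  have maslov: "Mas (\<lambda>x. colspace (X1 x \<mu>1)) (\<lambda>x. colspace (X2 x)) 0 1 = m (1, \<mu>1) - m (0, \<mu>1)"
  proof (rule Mas_flow[where ?F1.0 = "\<lambda>x. X1 x \<mu>1" and ?F2.0 = X2 and m = "\<lambda>x. m (x, \<mu>1)" and W = "\<lambda>x. W (x, \<mu>1)"])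
    show "unitary (W (t, \<mu>1))" if "t \<in> {0..1}" for t using that \<mu>12 by (intro Wu) auto
    show "lagrangian_path 0 1 (\<lambda>x. colspace (X1 x \<mu>1))"
      by (rule lagrangian_path_frames[OF lag1 integral_solutionD(1)[OF F]]) (use \<mu>12 in auto)
    show "lagrangian_path 0 1 (\<lambda>x. colspace (X2 x))"
      by (rule lagrangian_path_frames[OF G integral_solutionD(1)[OF S2]])
    show "is_frame (X1 t \<mu>1) (colspace (X1 t \<mu>1)) \<and> is_frame (X2 t) (colspace (X2 t))" if "t \<in> {0..1}" for t
      using lag_frame_is_frame[OF lag1[OF that \<mu>12(1)]] lag_frame_is_frame[OF G[OF that]] by blast
    show "Wtilde G1 G2 = W (t, \<mu>1)"
      if "t \<in> {0..1}" "is_frame G1 (colspace (X1 t \<mu>1))" "is_frame G2 (colspace (X2 t))" for t G1 G2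
      using Wtilde_frame_change[OF lag1[OF that(1) \<mu>12(1)] G[OF that(1)] that(2,3)] by (simp add: W_def)
  qed (use horizontal[OF \<mu>12(1)] in auto)

  \<comment> \<open>On this side the frame of the first plane does not depend on the parameter.\<close>
  have left: "m (0, \<mu>1) = m (0, \<mu>2)"
  proof -
    have "m (0, - (- \<mu>1)) = m (0, - (- \<mu>2))"
    proof (rule flow_constant[where D = "{- \<mu>2..- \<mu>1}" and W = "\<lambda>r. W (0, - r)" and m = "\<lambda>r. m (0, - r)"])
      show "crossing (W (0, - r)) = crossing (Wtilde (Jmat ** adj \<alpha>) (X2 0))" if "r \<in> {- \<mu>2..- \<mu>1}" for r
        using F0[of "- r"] that by (simp add: W_def)
      show "unitary (W (0, - r))" if "r \<in> {- \<mu>2..- \<mu>1}" for r using that by (intro Wu) auto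
    qed (use vertical[of 0] assms(9) in auto)
    then show ?thesis by simp
  qed
  \<comment> \<open>On this side both frames solve the same equation.\<close>
  have top: "m (0, \<mu>2) = m (1, \<mu>2)"
  proof -
    have const: "adj (X1 x \<mu>2) ** Jmat ** X2 x = adj (X1 0 \<mu>2) ** Jmat ** X2 0" if "x \<in> {0..1}" for x
      using lagrange_identity[OF coef(1)[OF assms(8)] coef(1)[OF assms(8)] coef(2)[OF assms(8)] F[OF \<mu>12(2)] S2, of 0 x] that by simp
    have cross: "crossing (W (x, \<mu>2)) = vec.dim (mker (adj (X1 0 \<mu>2) ** Jmat ** X2 0))" if "x \<in> {0..1}" for x
      using crossing_Wtilde(1)[OF lag1[OF that \<mu>12(2)] G[OF that]] unfolding const[OF that] by (simp add: W_def)
    show ?thesis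
      by (rule flow_constant[OF horizontal(1)[OF \<mu>12(2)] _ horizontal(2)[OF \<mu>12(2)] _ cross])
        (use \<mu>12 in \<open>auto intro!: Wu\<close>)
  qed

  define k where "k \<mu> = crossing (W (1, \<mu>))" for \<mu>
  have right: "finite {r \<in> {- \<mu>2<..- \<mu>1}. k (- r) \<noteq> 0} \<and>
      m (1, - (- \<mu>1)) - m (1, - (- \<mu>2)) = int (\<Sum>r\<in>{r \<in> {- \<mu>2<..- \<mu>1}. k (- r) \<noteq> 0}. k (- r))"
  proof (rule jump_count)
    show "- \<mu>2 \<le> - \<mu>1" using assms(9) by simp
    have one: "1 \<in> {0..1::real}" by simp
    note path = vertical[OF one]
    have Wu': "unitary (W (1, - r))" if "r \<in> {- \<mu>2..- \<mu>1}" for r using that by (intro Wu) auto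
    have inc: "gform \<epsilon> (W (1, - s)) v < gform \<epsilon> (W (1, - t)) v"
      if "- \<mu>2 \<le> s" "s < t" "t \<le> - \<mu>1" "v \<noteq> 0" "\<And>u. u \<in> {s..t} \<Longrightarrow> cis (pi + \<epsilon>) \<notin> mspectrum (W (1, - u))" for \<epsilon> s t v
      unfolding W_def fst_conv snd_conv
    proof (rule gform_decreasing[OF _ G[OF one]])
      show "posdef_mat (LINT x|leb01. adj (X1 x \<mu>) ** lam_deriv I B x \<mu> ** X1 x \<mu>)" if "\<mu> \<in> {\<mu>1..\<mu>2}" for \<mu>
        using assms(12)[OF \<mu>s[OF that]] .
      show "cis (pi + \<epsilon>) \<notin> mspectrum (Wtilde (X1 1 u) (X2 1))" if "u \<in> {- t..- s}" for u
        using \<open>\<And>u. u \<in> {s..t} \<Longrightarrow> cis (pi + \<epsilon>) \<notin> mspectrum (W (1, - u))\<close>[of "- u"] that by (simp add: W_def)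
    qed (use that in auto)
    note strict = flow_strictly_monotone[OF path Wu' inc]
    show "m (1, - s) \<le> m (1, - t) \<and> m (1, - s) - int (k (- s)) \<le> m (1, - t) - int (k (- t))"
      if "- \<mu>2 \<le> s" "s \<le> t" "t \<le> - \<mu>1" for s t
      unfolding k_def using strict(1) that by blast
    show "\<exists>x\<in>{s..t}. k (- x) = 0" if "- \<mu>2 \<le> s" "s < t" "t \<le> - \<mu>1" for s t
      unfolding k_def using strict(2) that by blast
    show "\<exists>\<delta>>0. \<forall>s\<in>{- \<mu>2..- \<mu>1}. dist s t < \<delta> \<longrightarrow>
        m (1, - s) \<le> m (1, - t) \<and> m (1, - t) - int (k (- t)) \<le> m (1, - s) - int (k (- s))" if "t \<in> {- \<mu>2..- \<mu>1}" for t
      unfolding k_def by (rule flow_local[OF path(1) _ path(2) Wu' that]) auto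
  qed

  have k: "vector_space.dim fscale (eigenspace B \<alpha> \<beta> \<mu>) = k \<mu>"
      "(\<exists>y\<in>eigenspace B \<alpha> \<beta> \<mu>. y \<noteq> 0) \<longleftrightarrow> k \<mu> \<noteq> 0" if \<mu>: "\<mu> \<in> {\<mu>1..\<mu>2}" for \<mu>
  proof -
    have one: "1 \<in> {0..1::real}" by simp
    have "adj (X2 1) ** Jmat = \<beta>" using boundary_frame(2)[OF assms(4,6)] assms(11) by simp
    then have kd: "k \<mu> = vec.dim (mker (\<beta> ** X1 1 \<mu>))"
      using crossing_Wtilde(2)[OF lag1[OF one \<mu>] G[OF one]] by (simp add: k_def W_def)
    obtain N where N: "negligible N" "\<And>x. x \<in> {0<..<1} - N \<Longrightarrow> A \<mu> x = B x \<mu>" using coef(3)[OF \<mu>s[OF \<mu>]] by blast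
    have inj: "v = 0" if "X1 0 \<mu> *v v = 0" for v using lag1[of 0 \<mu>] \<mu> that by (simp add: lag_frame_def)
    have X: "solves_matrix_system (\<lambda>x. B x \<mu>) (\<lambda>x. X1 x \<mu>)" "X1 0 \<mu> = Jmat ** adj \<alpha>"
      using assms(10)[OF \<mu>s[OF \<mu>]] by auto
    note eigen = eigenspace_image[where B = B and \<mu> = \<mu> and X = "\<lambda>x. X1 x \<mu>" and A = "A \<mu>", OF assms(3,5) X coef(1)[OF \<mu>s[OF \<mu>]] N inj]
    show "vector_space.dim fscale (eigenspace B \<alpha> \<beta> \<mu>) = k \<mu>" unfolding kd by (rule eigen(1))
    show "(\<exists>y\<in>eigenspace B \<alpha> \<beta> \<mu>. y \<noteq> 0) \<longleftrightarrow> k \<mu> \<noteq> 0" unfolding kd by (rule eigen(2))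
  qed
  have ev: "eigenvalues_in {\<mu>1..<\<mu>2} B \<alpha> \<beta> = {\<mu> \<in> {\<mu>1..<\<mu>2}. k \<mu> \<noteq> 0}"
    unfolding eigenvalues_in_def by (rule Collect_cong) (use k(2) in \<open>simp cong: conj_cong\<close>)
  have ev': "eigenvalues_in {\<mu>1..<\<mu>2} B \<alpha> \<beta> = uminus ` {r \<in> {- \<mu>2<..- \<mu>1}. k (- r) \<noteq> 0}"
    unfolding ev
  proof (intro equalityI subsetI)
    fix \<mu> assume "\<mu> \<in> {\<mu> \<in> {\<mu>1..<\<mu>2}. k \<mu> \<noteq> 0}"
    then show "\<mu> \<in> uminus ` {r \<in> {- \<mu>2<..- \<mu>1}. k (- r) \<noteq> 0}" by (intro image_eqI[of _ _ "- \<mu>"]) auto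
  qed auto
  have fin: "finite (eigenvalues_in {\<mu>1..<\<mu>2} B \<alpha> \<beta>)" using right unfolding ev' by blast
  have "spectral_count \<mu>1 \<mu>2 B \<alpha> \<beta> = (\<Sum>\<mu>\<in>eigenvalues_in {\<mu>1..<\<mu>2} B \<alpha> \<beta>. k \<mu>)"
    unfolding spectral_count_def by (rule sum.cong) (auto simp: ev intro!: k(1))
  also have "\<dots> = (\<Sum>r\<in>{r \<in> {- \<mu>2<..- \<mu>1}. k (- r) \<noteq> 0}. k (- r))"
    unfolding ev' by (subst sum.reindex) auto
  finally have count: "int (spectral_count \<mu>1 \<mu>2 B \<alpha> \<beta>) = m (1, \<mu>1) - m (0, \<mu>1)"
    using right left top by simp

  have "finite {x \<in> {0<..1}. vec.dim (mker (adj (X1 x \<mu>1) ** Jmat ** X2 x)) \<noteq> 0} \<and>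
       spectral_count \<mu>1 \<mu>2 B \<alpha> \<beta> =
         (\<Sum>x\<in>{x \<in> {0<..1}. vec.dim (mker (adj (X1 x \<mu>1) ** Jmat ** X2 x)) \<noteq> 0}.
            vec.dim (mker (adj (X1 x \<mu>1) ** Jmat ** X2 x)))"
    if nonneg: "AE x in leb01. nonneg_mat (B x \<mu>2 - B x \<mu>1)"
      and free: "\<not> (\<exists>a b. 0 \<le> a \<and> a < b \<and> b \<le> 1 \<and>
            (\<forall>x\<in>{a..b}. vec.dim (colspace (X1 x \<mu>1) \<inter> colspace (X2 x)) \<noteq> 0))"
  proof -
    define c where "c x = crossing (W (x, \<mu>1))" for x
    obtain N0 N1 N2 where N: "negligible N0" "\<And>x. x \<in> {0<..<1} - N0 \<Longrightarrow> nonneg_mat (B x \<mu>2 - B x \<mu>1)"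
        "negligible N1" "\<And>x. x \<in> {0<..<1} - N1 \<Longrightarrow> A \<mu>1 x = B x \<mu>1"
        "negligible N2" "\<And>x. x \<in> {0<..<1} - N2 \<Longrightarrow> A \<mu>2 x = B x \<mu>2"
      using nonneg coef(3)[OF assms(7)] coef(3)[OF assms(8)] unfolding AE_leb01_iff by blast
    have Nn: "negligible (N0 \<union> N1 \<union> N2 \<union> {0, 1})" using N by auto
    have Nv: "0 \<le> ((A \<mu>2 x - A \<mu>1 x) *v v) \<bullet> v" if "x \<in> {0..1} - (N0 \<union> N1 \<union> N2 \<union> {0, 1})" for x v
      using N(2,4,6)[of x] that by (auto simp: nonneg_mat_def Re_cinner)
    have mono: "m (s, \<mu>1) \<le> m (t, \<mu>1) \<and> m (s, \<mu>1) - int (c s) \<le> m (t, \<mu>1) - int (c t)"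
      if "0 \<le> s" "s \<le> t" "t \<le> 1" for s t
      using space_monotone[OF coef(1)[OF assms(7)] coef(1)[OF assms(8)] coef(2)[OF assms(7)] coef(2)[OF assms(8)] F[OF \<mu>12(1)] S2
          lag1[OF _ \<mu>12(1)] G Nn Nv, of "\<lambda>x. m (x, \<mu>1)" s t] horizontal(1)[OF \<mu>12(1)] that
      by (simp add: c_def W_def)
    have cd: "c x = vec.dim (mker (adj (X1 x \<mu>1) ** Jmat ** X2 x))" if "x \<in> {0..1}" for x
      using crossing_Wtilde(1)[OF lag1[OF that \<mu>12(1)] G[OF that]] by (simp add: c_def W_def)
    have jumps: "finite {x \<in> {0<..1}. c x \<noteq> 0} \<and> m (1, \<mu>1) - m (0, \<mu>1) = int (\<Sum>x\<in>{x \<in> {0<..1}. c x \<noteq> 0}. c x)"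
    proof (rule jump_count[OF _ mono])
      have Wu': "unitary (W (x, \<mu>1))" if "x \<in> {0..1}" for x using that \<mu>12 by (intro Wu) auto
      show "\<exists>\<delta>>0. \<forall>s\<in>{0..1}. dist s t < \<delta> \<longrightarrow>
          m (s, \<mu>1) \<le> m (t, \<mu>1) \<and> m (t, \<mu>1) - int (c t) \<le> m (s, \<mu>1) - int (c s)" if "t \<in> {0..1}" for t
        unfolding c_def by (rule flow_local[OF horizontal(1)[OF \<mu>12(1)] _ horizontal(2)[OF \<mu>12(1)] Wu' that]) auto
      show "\<exists>x\<in>{s..t}. c x = 0" if st: "0 \<le> s" "s < t" "t \<le> 1" for s t
      proof -
        obtain x where x: "x \<in> {s..t}" "vec.dim (colspace (X1 x \<mu>1) \<inter> colspace (X2 x)) = 0"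
          using free st by blast
        have "x \<in> {0..1}" using x(1) st by auto
        then have "c x = 0"
          using crossing_intersection[OF lag1[of x \<mu>1] G[of x]] \<mu>12(1) x(2) unfolding c_def W_def by auto
        then show ?thesis using x(1) by blast
      qed
    qed auto
    have nonzero: "{x \<in> {0<..1}. c x \<noteq> 0} = {x \<in> {0<..1}. vec.dim (mker (adj (X1 x \<mu>1) ** Jmat ** X2 x)) \<noteq> 0}"
      by (rule Collect_cong) (use cd in \<open>simp cong: conj_cong del: vec.dim_eq_0\<close>)
    have sum: "(\<Sum>x\<in>{x \<in> {0<..1}. c x \<noteq> 0}. c x) = (\<Sum>x\<in>{x \<in> {0<..1}. c x \<noteq> 0}. vec.dim (mker (adj (X1 x \<mu>1) ** Jmat ** X2 x)))"
      by (rule sum.cong) (auto simp: cd)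
    have "spectral_count \<mu>1 \<mu>2 B \<alpha> \<beta> = (\<Sum>x\<in>{x \<in> {0<..1}. c x \<noteq> 0}. c x)"
      using count jumps by (metis of_nat_eq_iff)
    with jumps show ?thesis unfolding sum[unfolded nonzero] nonzero by blast
  qed
  then show ?thesis using fin count maslov by simp
qed

end
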